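(* Let $L>0$, and let $\epsilon_0,\beta>0$ and the global solutions $(f^1,\dots,f^N,E,B)$ of the relativistic Vlasov–Maxwell system be as follows: the data $f^\alpha_0\in C^2$ are non-negative and supported on $\overline\Gamma_L\times\overline\Gamma_L$, $E_0,B_0\in C^3$ are supported on $\overline\Gamma_L$ with $\nabla\cdot E_0=\rho(0,\cdot)$, $\nabla\cdot B_0=0$, $\int\rho(0,x)dx=0$, and $\sum_\alpha\|f^\alpha_0\|_{C^2}+\|E_0\|_{C^3}+\|B_0\|_{C^3}\le\epsilon_0$, where $\epsilon_0$ is small enough (depending on $L$) that there is a unique global classical solution with $f^\alpha(t,x,p)=0$ for $|p|\ge\beta$, $E=B=0$ for $|x|>t+L$, and $|E|+|B|\le C\epsilon_0(t+1)^{-1}(t-|x|+2L)^{-1}$, $|\nabla_x E|+|\nabla_xB|\le C\epsilon_0\ln(t+2)(t+1)^{-1}(t-|x|+2L)^{-2}$, $|\nabla_x^2E|+|\nabla_x^2B|\le C\epsilon_0\ln(t+2)(t+1)^{-1}(t-|x|+2L)^{-3}$. Let $F^\alpha_\infty=\lim_{t\to\infty}\int f^\alpha(t,x,\cdot)\,dx$ (uniform limit), and let $\rho_\infty(q)=\sum_\alpha e_\alpha\mathcal{D}_\alpha(v_\alpha^{-1}(q))F^\alpha_\infty(v_\alpha^{-1}(q))$ for $q\in\Gamma_1$, $\rho_\infty(q)=0$ otherwise. If $\rho_\infty\equiv0$, then: (a) for every $\alpha$, $\tau\ge0$ and $(x,p)\in\mathcal{S}_{f^\alpha}(\tau)$,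 $|\mathcal{P}^\alpha(t,\tau,x,p)-\mathcal{P}^\alpha_\infty(\tau,x,p)|\lesssim t^{-2}\ln^8(t)$, where $\mathcal{P}^\alpha_\infty(\tau,x,p)=\lim_{t\to\infty}\mathcal{P}^\alpha(t,\tau,x,p)$; (b) $\|\rho(t)\|_\infty+\|j(t)\|_\infty\lesssim t^{-4}\ln^6(t)$, $\|\nabla_x\rho(t)\|_\infty+\|\nabla_xj(t)\|_\infty+\|\partial_tj(t)\|_\infty\lesssim t^{-5}\ln^8(t)$, and $\sup_{|x|\lesssim\gamma t}(|E(t,x)|+|B(t,x)|)\lesssim t^{-3}\ln^8(t)$, where $\gamma=\max\{\frac12,\frac{2\beta}{\sqrt{1+4\beta^2}}\}$.
   Context: Relativistic Vlasov–Maxwell system with $c=1$: $N$ species with masses $m_\alpha>0$, charges $e_\alpha$; $\partial_tf^\alpha+v_\alpha(p)\cdot\nabla_xf^\alpha+e_\alpha(E+v_\alpha(p)\times B)\cdot\nabla_pf^\alpha=0$, $v_\alpha(p)=p/\sqrt{m_\alpha^2+|p|^2}$; $\rho=4\pi\sum_\alpha e_\alpha\int f^\alpha dp$, $j=4\pi\sum_\alpha e_\alpha\int v_\alpha f^\alpha dp$; $\partial_tE-\nabla\times B=-j$, $\nabla\cdot E=\rho$, $\partial_tB+\nabla\times E=0$, $\nabla\cdot B=0$. Characteristics $\frac{d}{ds}\mathcal{X}^\alpha(s,\tau,x,p)=v_\alpha(\mathcal{P}^\alpha)$, $\frac{d}{ds}\mathcal{P}^\alpha=e_\alpha(E(s,\mathcal{X}^\alpha)+v_\alpha(\mathcal{P}^\alpha)\times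 B(s,\mathcal{X}^\alpha))$, with value $(x,p)$ at $s=\tau$. $\mathcal{S}_{f^\alpha}(t)$ = closure of $\{f^\alpha(t)\ne0\}$. $\mathcal{D}_\alpha(p)=|\det\nabla v_\alpha(p)|^{-1}$, $v_\alpha^{-1}(q)=m_\alpha q/\sqrt{1-|q|^2}$. $\Gamma_r=\{|u|<r\}$. $A(t)\lesssim B(t)$ means $A(t)\le CB(t)$ for $t$ sufficiently large with $C$ independent of $t$; $|x|\lesssim\gamma t$ means $|x|\le\gamma t$ for $t$ sufficiently large. *)

theory Defs
  imports "HOL-Analysis.Analysis"
begin

type_synonym vec3 = "real^3"

definition vel :: "real \<Rightarrow> vec3 \<Rightarrow> vec3" where
  "vel m p = (1 / sqrt (m\<^sup>2 + (norm p)\<^sup>2)) *\<^sub>R p"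

text \<open>Inverse of the velocity map, defined on the open unit ball.\<close>
definition vel_inv :: "real \<Rightarrow> vec3 \<Rightarrow> vec3" where
  "vel_inv m q = (m / sqrt (1 - (norm q)\<^sup>2)) *\<^sub>R q"

definition Djac :: "real \<Rightarrow> vec3 \<Rightarrow> real" where
  "Djac m p = inverse \<bar>det (matrix (frechet_derivative (vel m) (at p)))\<bar>"

primrec pderivs :: "'a::real_normed_vector list \<Rightarrow> ('a \<Rightarrow> 'b::real_normed_vector) \<Rightarrow> 'a \<Rightarrow> 'b" where
  "pderivs [] g = g"
| "pderivs (u # us) g = (\<lambda>x. frechet_derivative (pderivs us g) (at x) u)"

definition multi_idx :: "nat \<Rightarrow> 'a::euclidean_space list set" where
  "multi_idx k = {us. set us \<subseteq> Basis \<and> length us = k}"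

definition multi_idx_le :: "nat \<Rightarrow> 'a::euclidean_space list set" where
  "multi_idx_le k = {us. set us \<subseteq> Basis \<and> length us \<le> k}"

definition Ck :: "nat \<Rightarrow> ('a::euclidean_space \<Rightarrow> 'b::real_normed_vector) \<Rightarrow> bool" where
  "Ck k g \<longleftrightarrow> (\<forall>us\<in>multi_idx_le k. continuous_on UNIV (pderivs us g)) \<and>
               (\<forall>us\<in>multi_idx_le k. length us < k \<longrightarrow> (\<forall>x. pderivs us g differentiable (at x)))"

definition Ck_norm :: "nat \<Rightarrow> ('a::euclidean_space \<Rightarrow> 'b::real_normed_vector) \<Rightarrow> real" where
  "Ck_norm k g = (\<Sum>us\<in>multi_idx_le k. (SUP x. norm (pderivs us g x)))"

definition Dk_abs :: "nat \<Rightarrow> ('a::euclidean_space \<Rightarrow> 'b::real_normed_vector) \<Rightarrow> 'a \<Rightarrow> real" where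
  "Dk_abs k g x = (\<Sum>us\<in>multi_idx k. norm (pderivs us g x))"

definition C1_on :: "'a::real_normed_vector set \<Rightarrow> ('a \<Rightarrow> 'b::real_normed_vector) \<Rightarrow> bool" where
  "C1_on S g \<longleftrightarrow> (\<exists>D. (\<forall>z\<in>S. (g has_derivative blinfun_apply (D z)) (at z within S)) \<and> continuous_on S D)"

definition dt :: "(real \<Rightarrow> vec3 \<Rightarrow> 'b::real_normed_vector) \<Rightarrow> real \<Rightarrow> vec3 \<Rightarrow> 'b" where
  "dt F t x = frechet_derivative (\<lambda>z. F (fst z) (snd z)) (at (t, x)) (1, 0)"

definition dx :: "3 \<Rightarrow> (real \<Rightarrow> vec3 \<Rightarrow> 'b::real_normed_vector) \<Rightarrow> real \<Rightarrow> vec3 \<Rightarrow> 'b" where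
  "dx i F t x = frechet_derivative (\<lambda>z. F (fst z) (snd z)) (at (t, x)) (0, axis i 1)"

definition curl :: "(real \<Rightarrow> vec3 \<Rightarrow> vec3) \<Rightarrow> real \<Rightarrow> vec3 \<Rightarrow> vec3" where
  "curl F t x = vector [dx 2 F t x $ 3 - dx 3 F t x $ 2,
                        dx 3 F t x $ 1 - dx 1 F t x $ 3,
                        dx 1 F t x $ 2 - dx 2 F t x $ 1]"

definition div3 :: "(real \<Rightarrow> vec3 \<Rightarrow> vec3) \<Rightarrow> real \<Rightarrow> vec3 \<Rightarrow> real" where
  "div3 F t x = dx 1 F t x $ 1 + dx 2 F t x $ 2 + dx 3 F t x $ 3"

definition div0 :: "(vec3 \<Rightarrow> vec3) \<Rightarrow> vec3 \<Rightarrow> real" where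
  "div0 G x = (\<Sum>i\<in>UNIV. frechet_derivative G (at x) (axis i 1) $ i)"

definition rho :: "nat \<Rightarrow> (nat \<Rightarrow> real) \<Rightarrow> (nat \<Rightarrow> real \<Rightarrow> vec3 \<Rightarrow> vec3 \<Rightarrow> real) \<Rightarrow> real \<Rightarrow> vec3 \<Rightarrow> real" where
  "rho N e f t x = 4 * pi * (\<Sum>\<alpha><N. e \<alpha> * integral UNIV (\<lambda>p. f \<alpha> t x p))"

definition cur :: "nat \<Rightarrow> (nat \<Rightarrow> real) \<Rightarrow> (nat \<Rightarrow> real) \<Rightarrow> (nat \<Rightarrow> real \<Rightarrow> vec3 \<Rightarrow> vec3 \<Rightarrow> real) \<Rightarrow> real \<Rightarrow> vec3 \<Rightarrow> vec3" where
  "cur N m e f t x = (4 * pi) *\<^sub>R (\<Sum>\<alpha><N. e \<alpha> *\<^sub>R integral UNIV (\<lambda>p. f \<alpha> t x p *\<^sub>R vel (m \<alpha>) p))"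

definition RVM_solution ::
  "nat \<Rightarrow> (nat \<Rightarrow> real) \<Rightarrow> (nat \<Rightarrow> real) \<Rightarrow> (nat \<Rightarrow> real \<Rightarrow> vec3 \<Rightarrow> vec3 \<Rightarrow> real) \<Rightarrow>
   (real \<Rightarrow> vec3 \<Rightarrow> vec3) \<Rightarrow> (real \<Rightarrow> vec3 \<Rightarrow> vec3) \<Rightarrow>
   (nat \<Rightarrow> vec3 \<Rightarrow> vec3 \<Rightarrow> real) \<Rightarrow> (vec3 \<Rightarrow> vec3) \<Rightarrow> (vec3 \<Rightarrow> vec3) \<Rightarrow> bool" where
  "RVM_solution N m e f E B f0 E0 B0 \<longleftrightarrow>
     (\<forall>\<alpha><N. C1_on {z. fst z \<ge> 0} (\<lambda>z::real \<times> vec3 \<times> vec3. f \<alpha> (fst z) (fst (snd z)) (snd (snd z)))) \<and>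
     C1_on {z. fst z \<ge> 0} (\<lambda>z::real \<times> vec3. E (fst z) (snd z)) \<and>
     C1_on {z. fst z \<ge> 0} (\<lambda>z::real \<times> vec3. B (fst z) (snd z)) \<and>
     (\<forall>\<alpha><N. \<forall>x p. f \<alpha> 0 x p = f0 \<alpha> x p) \<and>
     (\<forall>x. E 0 x = E0 x) \<and> (\<forall>x. B 0 x = B0 x) \<and>
     (\<forall>\<alpha><N. \<forall>t>0. \<forall>x p.
        frechet_derivative (\<lambda>z::real \<times> vec3 \<times> vec3. f \<alpha> (fst z) (fst (snd z)) (snd (snd z))) (at (t, x, p))
          (1, vel (m \<alpha>) p, e \<alpha> *\<^sub>R (E t x + cross3 (vel (m \<alpha>) p) (B t x))) = 0) \<and>
     (\<forall>t>0. \<forall>x. dt E t x - curl B t x = - cur N m e f t x) \<and>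
     (\<forall>t>0. \<forall>x. div3 E t x = rho N e f t x) \<and>
     (\<forall>t>0. \<forall>x. dt B t x + curl E t x = 0) \<and>
     (\<forall>t>0. \<forall>x. div3 B t x = 0)"

definition is_char ::
  "real \<Rightarrow> real \<Rightarrow> (real \<Rightarrow> vec3 \<Rightarrow> vec3) \<Rightarrow> (real \<Rightarrow> vec3 \<Rightarrow> vec3) \<Rightarrow> real \<Rightarrow> vec3 \<Rightarrow> vec3 \<Rightarrow>
   (real \<Rightarrow> vec3) \<Rightarrow> (real \<Rightarrow> vec3) \<Rightarrow> bool" where
  "is_char m q E B \<tau> x p X P \<longleftrightarrow>
     X \<tau> = x \<and> P \<tau> = p \<and>
     (\<forall>s\<ge>0. (X has_vector_derivative vel m (P s)) (at s within {0..}) \<and>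
             (P has_vector_derivative q *\<^sub>R (E s (X s) + cross3 (vel m (P s)) (B s (X s)))) (at s within {0..}))"

definition supp_f :: "(real \<Rightarrow> vec3 \<Rightarrow> vec3 \<Rightarrow> real) \<Rightarrow> real \<Rightarrow> (vec3 \<times> vec3) set" where
  "supp_f g t = closure {z. g t (fst z) (snd z) \<noteq> 0}"

definition rho_inf :: "nat \<Rightarrow> (nat \<Rightarrow> real) \<Rightarrow> (nat \<Rightarrow> real) \<Rightarrow> (nat \<Rightarrow> vec3 \<Rightarrow> real) \<Rightarrow> vec3 \<Rightarrow> real" where
  "rho_inf N m e F q = (if norm q < 1
      then (\<Sum>\<alpha><N. e \<alpha> * Djac (m \<alpha>) (vel_inv (m \<alpha>) q) * F \<alpha> (vel_inv (m \<alpha>) q)) else 0)"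

end

theory Submission
 imports Defs
begin

text \<open>
 In the coordinates \<open>(x - t v, v)\<close> with \<open>v = vel m p\<close>, particles drift only by \<open>O(ln t)\<close> under fields of size
 \<open>t\<^sup>-\<^sup>2\<close>, and a weighted Gronwall argument shows that the density in these coordinates has first and second
 differences growing like \<open>ln\<^sup>2 t\<close> and \<open>ln\<^sup>4 t\<close>. At \<open>x = t y\<close> the quantity \<open>t\<^sup>3 \<rho>\<close> has time derivative \<open>t\<^sup>2\<close> times
 the divergence of a centred first moment, hence \<open>O(t\<^sup>-\<^sup>2 ln\<^sup>6 t)\<close>, with Lipschitz constant \<open>O(t\<^sup>-\<^sup>2 ln\<^sup>8 t)\<close>.
 It tends to \<open>\<rho>\<^sub>\<infinity> = 0\<close>, so integrating from infinity gains a factor \<open>t\<close>; higher moments are centred moments plus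
 multiples of the charge.

 For the fields, the light cone is replaced by hyperboloids of radius \<open>\<epsilon>\<close>. Integrating Maxwell's equations by parts
 against two retarded kernels expresses the field at the apex through charge and current and their time differences
 alone, so no spatial derivatives of the sources are needed; then \<open>\<epsilon> \<rightarrow> 0\<close>. The resulting bound
 \<open>O(t\<^sup>-\<^sup>3 ln\<^sup>8 t)\<close> on the fields is integrated along the characteristics.
\<close>

section \<open>Differences of first and second order\<close>

text \<open>The densities are only of class C^1 and the flow is never differentiated, so all
  second-order regularity is carried by differences of orbits. The powers of the logarithm arise as
  follows. In the variable x / (s + 2) the acceleration along particle orbits has its size and its
  first and second differences bounded by ln s / s^2. A velocity difference therefore shifts x - s v
  at the rate s * ln s / s^2, whose integral is of order ln^2 t: one difference in velocity costs
  ln^2 t and two cost ln^4 t. Every velocity present at x = t y lies within r = O(ln t / t) of y, so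
  the centred first moment is O(r^4), its gradient in y is O(r^4 ln^2 t), and this gradient has
  Lipschitz constant O(r^4 ln^4 t). Multiplied by t^2 the last two are the ln^6 and ln^8 of the
  result. The field bound inherits ln^8 from the time differences of the sources, which enter
  multiplied by the square of the radius of the retarded region.\<close>

abbreviation (input) unc :: "('a \<Rightarrow> 'b \<Rightarrow> 'c) \<Rightarrow> 'a \<times> 'b \<Rightarrow> 'c" where "unc F \<equiv> \<lambda>z. F (fst z) (snd z)"

abbreviation (input) unc3 :: "('a \<Rightarrow> 'b \<Rightarrow> 'c \<Rightarrow> 'd) \<Rightarrow> 'a \<times> 'b \<times> 'c \<Rightarrow> 'd" where
 "unc3 F \<equiv> \<lambda>z. F (fst z) (fst (snd z)) (snd (snd z))"

section \<open>Continuously differentiable maps on arbitrary sets\<close>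

lemma C1_onI:
 fixes g :: "'a::euclidean_space \<Rightarrow> 'b::real_normed_vector"
 assumes d: "\<And>z. z \<in> S \<Longrightarrow> (g has_derivative g' z) (at z within S)"
  and c: "\<And>h. continuous_on S (\<lambda>z. g' z h)"
 shows "C1_on S g"
 unfolding C1_on_def
proof (intro exI conjI ballI)
 have bl: "bounded_linear (g' z)" if "z \<in> S" for z
  using d[OF that] by (rule has_derivative_bounded_linear)
 show "(g has_derivative blinfun_apply (Blinfun (g' z))) (at z within S)" if "z \<in> S" for z
  using d[OF that] bl[OF that] by (simp add: bounded_linear_Blinfun_apply)
 show "continuous_on S (\<lambda>z. Blinfun (g' z))"
 proof (rule continuous_on_blinfun_componentwise)
  fix i :: 'a
  show "continuous_on S (\<lambda>z. blinfun_apply (Blinfun (g' z)) i)"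
   using c[of i] by (rule continuous_on_eq) (simp add: bl bounded_linear_Blinfun_apply)
 qed
qed

text \<open>The derivative is continuous in operator norm, so base point and direction may vary
  together; this is the third conclusion. \<open>C1_onI\<close> asks only for continuity in each
  fixed direction, which is equivalent in a domain of finite dimension.\<close>

lemma C1_onE:
 assumes "C1_on S g"
 obtains g' where "\<And>z. z \<in> S \<Longrightarrow> (g has_derivative g' z) (at z within S)"
  and "\<And>h. continuous_on S (\<lambda>z. g' z h)"
  and "\<And>f k X. continuous_on X f \<Longrightarrow> continuous_on X k \<Longrightarrow> f ` X \<subseteq> S \<Longrightarrow> continuous_on X (\<lambda>x. g' (f x) (k x))"
proof -
 obtain D where D: "\<And>z. z \<in> S \<Longrightarrow> (g has_derivative blinfun_apply (D z)) (at z within S)"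
  and c: "continuous_on S D" using assms unfolding C1_on_def by blast
 show ?thesis
 proof
  show "(g has_derivative blinfun_apply (D z)) (at z within S)" if "z \<in> S" for z by (rule D[OF that])
  show "continuous_on S (\<lambda>z. blinfun_apply (D z) h)" for h using c by (intro continuous_intros)
  show "continuous_on X (\<lambda>x. blinfun_apply (D (f x)) (k x))"
   if "continuous_on X f" "continuous_on X k" "f ` X \<subseteq> S" for X :: "'c::topological_space set" and f k
   using that by (intro continuous_intros continuous_on_compose2[OF c])
 qed
qed

lemma C1_on_continuous_on: "C1_on S g \<Longrightarrow> continuous_on S g"
 unfolding C1_on_def continuous_on_eq_continuous_within by (blast intro: has_derivative_continuous)

lemma C1_on_subset: "C1_on S g \<Longrightarrow> T \<subseteq> S \<Longrightarrow> C1_on T g"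
 unfolding C1_on_def by (blast intro: has_derivative_subset continuous_on_subset)

lemma C1_on_cong: "C1_on S g \<Longrightarrow> (\<And>x. x \<in> S \<Longrightarrow> f x = g x) \<Longrightarrow> C1_on S f"
 unfolding C1_on_def by (blast intro: has_derivative_transform)

lemma C1_on_compose:
 fixes f :: "'a::euclidean_space \<Rightarrow> 'b::real_normed_vector"
 assumes g: "C1_on T g" and f: "C1_on S f" and sub: "f ` S \<subseteq> T"
 shows "C1_on S (\<lambda>x. g (f x))"
proof -
 obtain g' where g': "\<And>z. z \<in> T \<Longrightarrow> (g has_derivative g' z) (at z within T)"
  "\<And>f k (X :: 'a set). continuous_on X f \<Longrightarrow> continuous_on X k \<Longrightarrow> f ` X \<subseteq> T \<Longrightarrow> continuous_on X (\<lambda>x. g' (f x) (k x))"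
  by (rule C1_onE[OF g]) blast
 obtain f' where f': "\<And>z. z \<in> S \<Longrightarrow> (f has_derivative f' z) (at z within S)"
  "\<And>h. continuous_on S (\<lambda>z. f' z h)"
  by (rule C1_onE[OF f]) blast
 show ?thesis
 proof (rule C1_onI)
  show "((\<lambda>x. g (f x)) has_derivative (\<lambda>h. g' (f z) (f' z h))) (at z within S)" if "z \<in> S" for z
   by (rule has_derivative_in_compose2[OF g'(1) _ that f'(1)[OF that]]) (use sub in auto)
  show "continuous_on S (\<lambda>z. g' (f z) (f' z h))" for h
   by (rule g'(2)[OF C1_on_continuous_on[OF f] f'(2) sub])
 qed
qed

lemma C1_on_bilinear:
 fixes f :: "'a::euclidean_space \<Rightarrow> 'b::real_normed_vector"
 assumes "bounded_bilinear pr" and f: "C1_on S f" and g: "C1_on S g"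
 shows "C1_on S (\<lambda>x. pr (f x) (g x))"
proof -
 interpret bounded_bilinear pr by fact
 obtain g' where g': "\<And>z. z \<in> S \<Longrightarrow> (g has_derivative g' z) (at z within S)"
  "\<And>h. continuous_on S (\<lambda>z. g' z h)"
  by (rule C1_onE[OF g]) blast
 obtain f' where f': "\<And>z. z \<in> S \<Longrightarrow> (f has_derivative f' z) (at z within S)"
  "\<And>h. continuous_on S (\<lambda>z. f' z h)"
  by (rule C1_onE[OF f]) blast
 show ?thesis
  by (rule C1_onI[OF FDERIV[OF f'(1) g'(1)]])
   (auto intro!: continuous_on_add continuous_on f'(2) g'(2) C1_on_continuous_on[OF f] C1_on_continuous_on[OF g])
qed

lemma C1_on_linear:
 fixes f :: "'a::euclidean_space \<Rightarrow> 'b::real_normed_vector"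
 shows "bounded_linear f \<Longrightarrow> C1_on S f"
 by (rule C1_onI[of _ f "\<lambda>_. f"]) (auto intro: bounded_linear_imp_has_derivative)

lemma C1_on_const:
 fixes c :: "'b::real_normed_vector"
 shows "C1_on S (\<lambda>x::'a::euclidean_space. c)"
 by (rule C1_onI[of _ _ "\<lambda>_ _. 0"]) auto

lemma C1_on_add:
 fixes f :: "'a::euclidean_space \<Rightarrow> 'b::real_normed_vector"
 assumes f: "C1_on S f" and g: "C1_on S g"
 shows "C1_on S (\<lambda>x. f x + g x)"
proof -
 obtain g' where g': "\<And>z. z \<in> S \<Longrightarrow> (g has_derivative g' z) (at z within S)"
  "\<And>h. continuous_on S (\<lambda>z. g' z h)"
  by (rule C1_onE[OF g]) blast
 obtain f' where f': "\<And>z. z \<in> S \<Longrightarrow> (f has_derivative f' z) (at z within S)"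
  "\<And>h. continuous_on S (\<lambda>z. f' z h)"
  by (rule C1_onE[OF f]) blast
 show ?thesis
  by (rule C1_onI[OF has_derivative_add[OF f'(1) g'(1)]])
   (auto intro!: continuous_intros f'(2) g'(2))
qed

lemma C1_on_Pair:
 fixes f :: "'a::euclidean_space \<Rightarrow> 'b::real_normed_vector"
 assumes f: "C1_on S f" and g: "C1_on S g"
 shows "C1_on S (\<lambda>x. (f x, g x))"
proof -
 obtain g' where g': "\<And>z. z \<in> S \<Longrightarrow> (g has_derivative g' z) (at z within S)"
  "\<And>h. continuous_on S (\<lambda>z. g' z h)"
  by (rule C1_onE[OF g]) blast
 obtain f' where f': "\<And>z. z \<in> S \<Longrightarrow> (f has_derivative f' z) (at z within S)"
  "\<And>h. continuous_on S (\<lambda>z. f' z h)"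
  by (rule C1_onE[OF f]) blast
 show ?thesis
  by (rule C1_onI[OF has_derivative_Pair[OF f'(1) g'(1)]])
   (auto intro!: continuous_intros f'(2) g'(2))
qed

lemma C1_on_blinear_compose:
 fixes f :: "'a::euclidean_space \<Rightarrow> 'b::real_normed_vector"
 assumes "bounded_linear l" "C1_on S f"
 shows "C1_on S (\<lambda>x. l (f x))"
proof -
 obtain f' where f': "\<And>z. z \<in> S \<Longrightarrow> (f has_derivative f' z) (at z within S)"
  "\<And>h. continuous_on S (\<lambda>z. f' z h)"
  by (rule C1_onE[OF assms(2)]) blast
 show ?thesis
  by (rule C1_onI[OF bounded_linear.has_derivative[OF assms(1) f'(1)]])
   (auto intro!: bounded_linear.continuous_on[OF assms(1)] f'(2))
qed

lemma C1_on_minus: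
 fixes f :: "'a::euclidean_space \<Rightarrow> 'b::real_normed_vector"
 shows "C1_on S f \<Longrightarrow> C1_on S (\<lambda>x. - f x)"
 by (rule C1_on_blinear_compose[OF bounded_linear_minus[OF bounded_linear_ident]])

lemma C1_on_diff:
 fixes f :: "'a::euclidean_space \<Rightarrow> 'b::real_normed_vector"
 shows "C1_on S f \<Longrightarrow> C1_on S g \<Longrightarrow> C1_on S (\<lambda>x. f x - g x)"
 using C1_on_add[OF _ C1_on_minus, of S f g] by simp

lemma C1_on_real_fun:
 fixes f :: "'a::euclidean_space \<Rightarrow> real"
 assumes f: "C1_on S f" and r: "\<And>y. y \<in> I \<Longrightarrow> (r has_real_derivative r' y) (at y)"
  and c: "continuous_on I r'" and sub: "f ` S \<subseteq> I"
 shows "C1_on S (\<lambda>x. r (f x))"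
proof (rule C1_on_compose[OF _ f sub])
 show "C1_on I r"
  by (rule C1_onI[of _ _ "\<lambda>y h. r' y * h"])
   (use r c in \<open>auto intro!: continuous_intros simp: has_field_derivative_def has_derivative_at_withinI\<close>)
qed

text \<open>At a point of the overlap both sets are neighbourhoods, so the two derivatives coincide
  and the pieces glue. Made for densities given by a formula on the open unit ball of velocities and
  by zero beyond the maximal speed.\<close>

lemma C1_on_open_cover:
 fixes g :: "'a::euclidean_space \<Rightarrow> 'b::real_normed_vector"
 assumes "open S" "open T" "C1_on S g" "C1_on T g"
 shows "C1_on (S \<union> T) g"
proof -
 obtain a where a: "\<And>z. z \<in> S \<Longrightarrow> (g has_derivative a z) (at z within S)"
  "\<And>h. continuous_on S (\<lambda>z. a z h)" by (rule C1_onE[OF assms(3)]) blast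
 obtain b where b: "\<And>z. z \<in> T \<Longrightarrow> (g has_derivative b z) (at z within T)"
  "\<And>h. continuous_on T (\<lambda>z. b z h)" by (rule C1_onE[OF assms(4)]) blast
 have A: "(g has_derivative a z) (at z)" if "z \<in> S" for z using a(1)[OF that] at_within_open[OF that assms(1)] by simp
 have B: "(g has_derivative b z) (at z)" if "z \<in> T" for z using b(1)[OF that] at_within_open[OF that assms(2)] by simp
 have eq: "a z = b z" if "z \<in> S" "z \<in> T" for z using A B that has_derivative_unique by blast
 define c where "c z = (if z \<in> S then a z else b z)" for z
 show ?thesis
 proof (rule C1_onI[of _ _ c])
  show "(g has_derivative c z) (at z within S \<union> T)" if "z \<in> S \<union> T" for z
   using A B that by (auto simp: c_def intro: has_derivative_at_withinI)
  show "continuous_on (S \<union> T) (\<lambda>z. c z h)" for h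
  proof (rule continuous_on_open_Un[OF assms(1,2)])
   show "continuous_on S (\<lambda>z. c z h)" using a(2)[of h] by (rule continuous_on_eq) (simp add: c_def)
   show "continuous_on T (\<lambda>z. c z h)" using b(2)[of h] by (rule continuous_on_eq) (simp add: c_def eq)
  qed
 qed
qed

text \<open>Second differences are taken over arbitrary quadruples, not only parallelograms: this form is stable under
 composition with nonlinear maps.\<close>

abbreviation (input) mod4 :: "real \<Rightarrow> 'a::real_normed_vector \<Rightarrow> 'a \<Rightarrow> 'a \<Rightarrow> 'a \<Rightarrow> real" where
 "mod4 \<sigma> a b c d \<equiv> \<sigma> * norm (d - c - b + a) + \<sigma>^2 * (norm (b - a) + norm (d - c)) * (norm (c - a) + norm (d - b))"

text \<open>A scaled C^{1,1} norm: \<open>M\<close> is the size of \<phi> and 1 / \<sigma> its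
  length scale, so each order of differences costs one factor \<sigma>. With the size factored out,
  products and compositions change only \<open>M\<close>, and the growth of the densities in time
  shows in \<sigma> alone.\<close>

definition C11 :: "real \<Rightarrow> real \<Rightarrow> 'a::real_normed_vector set \<Rightarrow> ('a \<Rightarrow> 'b::real_normed_vector) \<Rightarrow> bool" where
 "C11 M \<sigma> S \<phi> \<longleftrightarrow> 0 \<le> M \<and> 0 \<le> \<sigma> \<and> (\<forall>x\<in>S. norm (\<phi> x) \<le> M) \<and>
  (\<forall>x\<in>S. \<forall>y\<in>S. norm (\<phi> x - \<phi> y) \<le> M * \<sigma> * norm (x - y)) \<and>
  (\<forall>a\<in>S. \<forall>b\<in>S. \<forall>c\<in>S. \<forall>d\<in>S. norm (\<phi> d - \<phi> c - \<phi> b + \<phi> a) \<le>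
    M * mod4 \<sigma> a b c d)"

lemma C11D:
 assumes "C11 M \<sigma> S \<phi>"
 shows "0 \<le> M" "0 \<le> \<sigma>" "x \<in> S \<Longrightarrow> norm (\<phi> x) \<le> M"
  "x \<in> S \<Longrightarrow> y \<in> S \<Longrightarrow> norm (\<phi> x - \<phi> y) \<le> M * \<sigma> * norm (x - y)"
  "a \<in> S \<Longrightarrow> b \<in> S \<Longrightarrow> c \<in> S \<Longrightarrow> d \<in> S \<Longrightarrow> norm (\<phi> d - \<phi> c - \<phi> b + \<phi> a) \<le>
    M * mod4 \<sigma> a b c d"
 using assms unfolding C11_def by blast+

lemma C11I:
 assumes "0 \<le> M" "0 \<le> \<sigma>" "\<And>x. x \<in> S \<Longrightarrow> norm (\<phi> x) \<le> M"
  "\<And>x y. x \<in> S \<Longrightarrow> y \<in> S \<Longrightarrow> norm (\<phi> x - \<phi> y) \<le> M * \<sigma> * norm (x - y)"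
  "\<And>a b c d. a \<in> S \<Longrightarrow> b \<in> S \<Longrightarrow> c \<in> S \<Longrightarrow> d \<in> S \<Longrightarrow> norm (\<phi> d - \<phi> c - \<phi> b + \<phi> a) \<le>
    M * mod4 \<sigma> a b c d"
 shows "C11 M \<sigma> S \<phi>"
 using assms unfolding C11_def by blast

lemma C11_mono:
 assumes "C11 M \<sigma> S \<phi>" "M \<le> M'" "\<sigma> \<le> \<sigma>'" "T \<subseteq> S"
 shows "C11 M' \<sigma>' T \<phi>"
proof -
 have p: "0 \<le> M" "0 \<le> \<sigma>" "0 \<le> M'" "0 \<le> \<sigma>'" "\<sigma>^2 \<le> \<sigma>'^2" using C11D(1,2)[OF assms(1)] assms by auto
 show ?thesis
 proof (rule C11I)
  show "norm (\<phi> x) \<le> M'" if "x \<in> T" for x using C11D(3)[OF assms(1), of x] assms that by auto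
  show "norm (\<phi> x - \<phi> y) \<le> M' * \<sigma>' * norm (x - y)" if "x \<in> T" "y \<in> T" for x y
   by (rule order_trans[OF C11D(4)[OF assms(1)]]) (use that assms p in \<open>auto intro!: mult_mono\<close>)
  show "norm (\<phi> d - \<phi> c - \<phi> b + \<phi> a) \<le>
    M' * mod4 \<sigma>' a b c d"
   if "a \<in> T" "b \<in> T" "c \<in> T" "d \<in> T" for a b c d
   by (rule order_trans[OF C11D(5)[OF assms(1)]]) (use that assms p in \<open>auto intro!: mult_mono add_mono\<close>)
 qed (use p in auto)
qed

lemma C11_add:
 assumes f: "C11 M1 \<sigma> S f" and g: "C11 M2 \<sigma> S g"
 shows "C11 (M1 + M2) \<sigma> S (\<lambda>x. f x + g x)"
proof (rule C11I)
 show "norm (f x + g x) \<le> M1 + M2" if "x \<in> S" for x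
  using norm_triangle_ineq[of "f x" "g x"] C11D(3)[OF f that] C11D(3)[OF g that] by linarith
 show "norm (f x + g x - (f y + g y)) \<le> (M1 + M2) * \<sigma> * norm (x - y)" if "x \<in> S" "y \<in> S" for x y
  using norm_triangle_ineq[of "f x - f y" "g x - g y"] C11D(4)[OF f that] C11D(4)[OF g that]
  by (simp add: algebra_simps)
 fix a b c d assume h: "a \<in> S" "b \<in> S" "c \<in> S" "d \<in> S"
 have "f d + g d - (f c + g c) - (f b + g b) + (f a + g a) = (f d - f c - f b + f a) + (g d - g c - g b + g a)" by simp
 then show "norm (f d + g d - (f c + g c) - (f b + g b) + (f a + g a)) \<le>
    (M1 + M2) * mod4 \<sigma> a b c d"
  using norm_triangle_ineq[of "f d - f c - f b + f a" "g d - g c - g b + g a"] C11D(5)[OF f h] C11D(5)[OF g h]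
  by (simp only: distrib_right)
qed (use C11D(1,2)[OF f] C11D(1,2)[OF g] in auto)

lemma C11_linear:
 assumes "bounded_linear l" "\<And>x. norm (l x) \<le> K * norm x" "K \<ge> 0" and f: "C11 M \<sigma> S f"
 shows "C11 (K * M) \<sigma> S (\<lambda>x. l (f x))"
proof -
 interpret bounded_linear l by fact
 show ?thesis
 proof (rule C11I)
  show "norm (l (f x)) \<le> K * M" if "x \<in> S" for x
   by (rule order_trans[OF assms(2) mult_left_mono[OF C11D(3)[OF f that] assms(3)]])
  show "norm (l (f x) - l (f y)) \<le> K * M * \<sigma> * norm (x - y)" if "x \<in> S" "y \<in> S" for x y
   using order_trans[OF assms(2)[of "f x - f y"] mult_left_mono[OF C11D(4)[OF f that] assms(3)]]
   by (simp add: diff mult.assoc)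
  fix a b c d assume h: "a \<in> S" "b \<in> S" "c \<in> S" "d \<in> S"
  show "norm (l (f d) - l (f c) - l (f b) + l (f a)) \<le>
    K * M * mod4 \<sigma> a b c d"
   using order_trans[OF assms(2)[of "f d - f c - f b + f a"] mult_left_mono[OF C11D(5)[OF f h] assms(3)]]
   by (simp add: diff add mult.assoc)
 qed (use C11D(1,2)[OF f] assms in auto)
qed

lemma C11_bilinear:
 assumes bb: "bounded_bilinear pr" and K: "\<And>x y. norm (pr x y) \<le> K * norm x * norm y" "K \<ge> 0"
  and f: "C11 M1 \<sigma> S f" and g: "C11 M2 \<sigma> S g"
 shows "C11 (4 * K * M1 * M2) \<sigma> S (\<lambda>x. pr (f x) (g x))"
proof -
 interpret bounded_bilinear pr by fact
 note f0 = C11D(1,2)[OF f] and g0 = C11D(1,2)[OF g]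
 have P: "norm (pr u v) \<le> K * A * B" if "norm u \<le> A" "norm v \<le> B" for u v A B
 proof -
  have "0 \<le> A" using norm_ge_zero[of u] that by linarith
  then have "K * norm u * norm v \<le> K * A * B"
   by (intro mult_mono) (use that K in \<open>auto intro: mult_left_mono\<close>)
  then show ?thesis using K(1)[of u v] by linarith
 qed
 show ?thesis
 proof (rule C11I)
  show "norm (pr (f x) (g x)) \<le> 4 * K * M1 * M2" if "x \<in> S" for x
  proof -
   have "norm (pr (f x) (g x)) \<le> K * M1 * M2" by (rule P[OF C11D(3)[OF f that] C11D(3)[OF g that]])
   moreover have "0 \<le> K * M1 * M2" using f0 g0 K by simp
   ultimately show ?thesis by simp
  qed
  show "norm (pr (f x) (g x) - pr (f y) (g y)) \<le> 4 * K * M1 * M2 * \<sigma> * norm (x - y)" if "x \<in> S" "y \<in> S" for x y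
  proof -
   have "pr (f x) (g x) - pr (f y) (g y) = pr (f x - f y) (g x) + pr (f y) (g x - g y)"
    by (simp add: diff_left diff_right)
   moreover have "norm (pr (f x - f y) (g x)) \<le> K * (M1 * \<sigma> * norm (x - y)) * M2"
    by (rule P[OF C11D(4)[OF f that] C11D(3)[OF g that(1)]])
   moreover have "norm (pr (f y) (g x - g y)) \<le> K * M1 * (M2 * \<sigma> * norm (x - y))"
    by (rule P[OF C11D(3)[OF f that(2)] C11D(4)[OF g that]])
   ultimately have "norm (pr (f x) (g x) - pr (f y) (g y)) \<le> 2 * (K * M1 * M2 * \<sigma> * norm (x - y))"
    using norm_triangle_ineq[of "pr (f x - f y) (g x)" "pr (f y) (g x - g y)"] by (simp add: algebra_simps)
   moreover have "0 \<le> K * M1 * M2 * \<sigma> * norm (x - y)" using f0 g0 K by simp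
   ultimately show ?thesis by (simp add: algebra_simps)
  qed
  fix a b c d assume h: "a \<in> S" "b \<in> S" "c \<in> S" "d \<in> S"
  define N where "N = norm (d - c - b + a)"
  define p where "p = norm (b - a) + norm (d - c)"
  define q where "q = norm (c - a) + norm (d - b)"
  define A where "A = \<sigma> * N + \<sigma>^2 * p * q"
  have A0: "0 \<le> \<sigma> * N" "0 \<le> \<sigma>^2 * p * q" using f0 by (auto simp: N_def p_def q_def)
  have f4: "norm (f d - f c - f b + f a) \<le> M1 * A" and g4: "norm (g d - g c - g b + g a) \<le> M2 * A"
   using C11D(5)[OF f h] C11D(5)[OF g h] by (auto simp: A_def N_def p_def q_def)
  \<comment> \<open>Discrete product rule. Each of the two mixed terms pairs a difference of
    \<open>f\<close> across one direction of the quadruple with a difference of \<open>g\<close>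
    across the other, so both are controlled by \<open>p * q\<close>. The four terms give the factor
    4.\<close>
  have e: "pr (f d) (g d) - pr (f c) (g c) - pr (f b) (g b) + pr (f a) (g a) =
   pr (f d - f c - f b + f a) (g d) + pr (f a) (g d - g c - g b + g a)
   + pr (f b - f a) (g d - g b) + pr (f c - f a) (g d - g c)"
   by (simp add: diff_left diff_right add_left add_right)
  have 1: "norm (pr (f d - f c - f b + f a) (g d)) \<le> K * (M1 * A) * M2"
   by (rule P[OF f4 C11D(3)[OF g h(4)]])
  have 2: "norm (pr (f a) (g d - g c - g b + g a)) \<le> K * M1 * (M2 * A)"
   by (rule P[OF C11D(3)[OF f h(1)] g4])
  have 3: "norm (pr (f b - f a) (g d - g b)) \<le> K * (M1 * \<sigma> * norm (b - a)) * (M2 * \<sigma> * norm (d - b))"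
   by (rule P[OF C11D(4)[OF f h(2,1)] C11D(4)[OF g h(4,2)]])
  have 4: "norm (pr (f c - f a) (g d - g c)) \<le> K * (M1 * \<sigma> * norm (c - a)) * (M2 * \<sigma> * norm (d - c))"
   by (rule P[OF C11D(4)[OF f h(3,1)] C11D(4)[OF g h(4,3)]])
  have c: "0 \<le> K * M1 * M2" using f0 g0 K by simp
  have "norm (b - a) * norm (d - b) \<le> p * q" "norm (c - a) * norm (d - c) \<le> q * p"
   unfolding p_def q_def by (rule mult_mono; simp)+
  then have "\<sigma>^2 * (norm (b - a) * norm (d - b)) \<le> \<sigma>^2 * (p * q)" "\<sigma>^2 * (norm (c - a) * norm (d - c)) \<le> \<sigma>^2 * (q * p)"
   by (auto intro: mult_left_mono)
  then have "\<sigma>^2 * (norm (b - a) * norm (d - b)) \<le> A" "\<sigma>^2 * (norm (c - a) * norm (d - c)) \<le> A"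
   using A0 unfolding A_def by (simp_all add: algebra_simps)
  then have 5: "(K * M1 * M2) * (\<sigma>^2 * (norm (b - a) * norm (d - b))) \<le> (K * M1 * M2) * A"
   "(K * M1 * M2) * (\<sigma>^2 * (norm (c - a) * norm (d - c))) \<le> (K * M1 * M2) * A"
   using c by (auto intro: mult_left_mono)
  have "norm (pr (f d) (g d) - pr (f c) (g c) - pr (f b) (g b) + pr (f a) (g a)) \<le>
   K * (M1 * A) * M2 + K * M1 * (M2 * A) + K * (M1 * \<sigma> * norm (b - a)) * (M2 * \<sigma> * norm (d - b))
   + K * (M1 * \<sigma> * norm (c - a)) * (M2 * \<sigma> * norm (d - c))"
   unfolding e by (intro norm_triangle_le add_mono 1 2 3 4)
  also have "\<dots> = (K * M1 * M2) * A + (K * M1 * M2) * A + (K * M1 * M2) * (\<sigma>^2 * (norm (b - a) * norm (d - b)))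
   + (K * M1 * M2) * (\<sigma>^2 * (norm (c - a) * norm (d - c)))"
   by (simp add: power2_eq_square)
  also have "\<dots> \<le> 4 * ((K * M1 * M2) * A)" using 5 by linarith
  also have "\<dots> = 4 * K * M1 * M2 * A" by simp
  finally show "norm (pr (f d) (g d) - pr (f c) (g c) - pr (f b) (g b) + pr (f a) (g a)) \<le>
    4 * K * M1 * M2 * mod4 \<sigma> a b c d"
   by (simp only: A_def N_def p_def q_def)
 qed (use f0 g0 K in auto)
qed

lemma C11_compose:
 assumes f: "C11 M1 \<sigma> S f" and g: "C11 M2 1 T g" and sub: "f ` S \<subseteq> T"
 shows "C11 (M2 * (1 + 2 * M1)^2) \<sigma> S (\<lambda>x. g (f x))"
proof -
 note f0 = C11D(1,2)[OF f] and g0 = C11D(1,2)[OF g]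
 have T: "f x \<in> T" if "x \<in> S" for x using sub that by auto
 \<comment> \<open>One factor has to dominate 1 for the size, \<open>M1\<close> for the first
   differences, and \<open>M1 + M1^2\<close> for the second ones, where a product of two first
   differences of \<open>f\<close> enters.\<close>
 have k: "1 \<le> (1 + 2 * M1)^2" "M1 + 4 * M1^2 \<le> (1 + 2 * M1)^2" "M1 \<le> (1 + 2 * M1)^2"
  using f0 by (auto simp: power2_eq_square algebra_simps)
 show ?thesis
 proof (rule C11I)
  show "norm (g (f x)) \<le> M2 * (1 + 2 * M1)^2" if "x \<in> S" for x
   using C11D(3)[OF g T[OF that]] mult_left_mono[OF k(1) g0(1)] by simp
  show "norm (g (f x) - g (f y)) \<le> M2 * (1 + 2 * M1)^2 * \<sigma> * norm (x - y)" if "x \<in> S" "y \<in> S" for x y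
  proof -
   have "norm (g (f x) - g (f y)) \<le> M2 * norm (f x - f y)" using C11D(4)[OF g T T, of x y] that by simp
   also have "\<dots> \<le> M2 * (M1 * (\<sigma> * norm (x - y)))" using C11D(4)[OF f that] g0 by (simp add: mult_left_mono mult.assoc)
   also have "\<dots> \<le> M2 * ((1 + 2 * M1)^2 * (\<sigma> * norm (x - y)))" using k f0 g0 by (intro mult_left_mono mult_right_mono) auto
   finally show ?thesis by (simp add: mult.assoc)
  qed
  fix a b c d assume h: "a \<in> S" "b \<in> S" "c \<in> S" "d \<in> S"
  define N where "N = norm (d - c - b + a)"
  define p where "p = norm (b - a) + norm (d - c)"
  define q where "q = norm (c - a) + norm (d - b)"
  have pq: "p \<ge> 0" "q \<ge> 0" "N \<ge> 0" by (auto simp: p_def q_def N_def)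
  have p': "norm (f b - f a) + norm (f d - f c) \<le> M1 * \<sigma> * p"
   using C11D(4)[OF f h(2,1)] C11D(4)[OF f h(4,3)] by (simp add: p_def algebra_simps)
  have q': "norm (f c - f a) + norm (f d - f b) \<le> M1 * \<sigma> * q"
   using C11D(4)[OF f h(3,1)] C11D(4)[OF f h(4,2)] by (simp add: q_def algebra_simps)
  have f4: "norm (f d - f c - f b + f a) \<le> M1 * (\<sigma> * N + \<sigma>^2 * p * q)"
   using C11D(5)[OF f h] by (auto simp: N_def p_def q_def)
  have "norm (g (f d) - g (f c) - g (f b) + g (f a)) \<le>
   M2 * (norm (f d - f c - f b + f a) + (norm (f b - f a) + norm (f d - f c)) * (norm (f c - f a) + norm (f d - f b)))"
   using C11D(5)[OF g T T T T, of a b c d] h by simp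
  also have "\<dots> \<le> M2 * (M1 * (\<sigma> * N + \<sigma>^2 * p * q) + (M1 * \<sigma> * p) * (M1 * \<sigma> * q))"
   using g0 f0 pq by (intro mult_left_mono add_mono mult_mono f4 p' q') auto
  also have "\<dots> = M2 * (M1 * (\<sigma> * N) + (M1 + M1^2) * (\<sigma>^2 * p * q))"
   by (simp add: algebra_simps power2_eq_square)
  also have "\<dots> \<le> M2 * ((1 + 2 * M1)^2 * (\<sigma> * N) + (1 + 2 * M1)^2 * (\<sigma>^2 * p * q))"
  proof -
   have "M1 + M1^2 \<le> (1 + 2 * M1)^2" using k(2) zero_le_power2[of M1] by linarith
   then show ?thesis using k(3) pq f0 g0 by (intro mult_left_mono add_mono mult_right_mono) auto
  qed
  finally show "norm (g (f d) - g (f c) - g (f b) + g (f a)) \<le> M2 * (1 + 2 * M1)^2 *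
   mod4 \<sigma> a b c d"
   by (simp add: N_def p_def q_def algebra_simps)
 qed (use f0 g0 in auto)
qed

lemma C11_const: "C11 (norm c) 0 S (\<lambda>_. c)"
 by (rule C11I) auto

lemma C11_bounded_linear:
 assumes "bounded_linear l" "\<And>x. norm (l x) \<le> norm x" "\<And>x. x \<in> S \<Longrightarrow> norm x \<le> R" "1 \<le> R"
 shows "C11 R 1 S l"
proof -
 interpret bounded_linear l by fact
 show ?thesis
 proof (rule C11I)
  show "norm (l x) \<le> R" if "x \<in> S" for x using assms(2)[of x] assms(3)[OF that] by linarith
  have k: "norm z \<le> R * norm z" for z :: 'a using mult_right_mono[OF assms(4), of "norm z"] by simp
  show "norm (l x - l y) \<le> R * 1 * norm (x - y)" for x y
   using assms(2)[of "x - y"] k[of "x-y"] by (simp add: diff)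
  fix a b c d
  have "norm (l d - l c - l b + l a) \<le> R * norm (d - c - b + a)"
   using assms(2)[of "d - c - b + a"] k[of "d-c-b+a"] by (simp add: diff add)
  also have "\<dots> \<le> R * mod4 1 a b c d"
   using assms(4) by (intro mult_left_mono) auto
  finally show "norm (l d - l c - l b + l a) \<le>
   R * mod4 1 a b c d" .
 qed (use assms in auto)
qed

lemma C11_derivative:
 fixes \<phi> :: "'a::real_normed_vector \<Rightarrow> 'b::real_normed_vector"
 assumes S: "convex S" and d: "\<And>x. x \<in> S \<Longrightarrow> (\<phi> has_derivative \<phi>' x) (at x within S)"
  and M: "0 \<le> M" "0 \<le> \<sigma>" "\<And>x. x \<in> S \<Longrightarrow> norm (\<phi> x) \<le> M"
  and d1: "\<And>x h. x \<in> S \<Longrightarrow> norm (\<phi>' x h) \<le> M * \<sigma> * norm h"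
  and d2: "\<And>x y h. x \<in> S \<Longrightarrow> y \<in> S \<Longrightarrow> norm (\<phi>' x h - \<phi>' y h) \<le> M * \<sigma>^2 * norm (x - y) * norm h"
 shows "C11 M \<sigma> S \<phi>"
proof (rule C11I)
 show "norm (\<phi> x - \<phi> y) \<le> M * \<sigma> * norm (x - y)" if "x \<in> S" "y \<in> S" for x y
  by (rule differentiable_bound[OF S d _ that]) (auto intro!: onorm_bound d1 mult_nonneg_nonneg M)
 fix a b c d' assume h: "a \<in> S" "b \<in> S" "c \<in> S" "d' \<in> S"
 define u where "u \<theta> = a + \<theta> *\<^sub>R (b - a)" for \<theta> :: real
 define v where "v \<theta> = c + \<theta> *\<^sub>R (d' - c)" for \<theta> :: real
 define B where "B = M * mod4 \<sigma> a b c d'"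
 have uS: "u \<theta> \<in> S" "v \<theta> \<in> S" if "\<theta> \<in> {0..1}" for \<theta>
  using convexD_alt[OF S h(1,2), of \<theta>] convexD_alt[OF S h(3,4), of \<theta>] that
  by (auto simp: u_def v_def algebra_simps)
 \<comment> \<open>The second difference is \<open>F 1 - F 0\<close>, with \<open>u\<close> running
   along the edge from \<open>a\<close> to \<open>b\<close> and \<open>v\<close> along the one from
   \<open>c\<close> to \<open>d'\<close>. In the derivative of \<open>F\<close>, \<phi>' at
   \<open>v\<close> acts on \<open>d' - c - b + a\<close>, and the difference of \<phi>' between
   \<open>v\<close> and \<open>u\<close> acts on \<open>b - a\<close>; the distance of
   \<open>v\<close> from \<open>u\<close> interpolates those of the end points.\<close>
 define F where "F \<theta> = \<phi> (v \<theta>) - \<phi> (u \<theta>)" for \<theta>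
 have "norm (F 1 - F 0) \<le> B * norm (1 - 0 :: real)"
 proof (rule differentiable_bound[where f = F and S = "{0..1}" and f' = "\<lambda>\<theta> k. \<phi>' (v \<theta>) (k *\<^sub>R (d' - c)) - \<phi>' (u \<theta>) (k *\<^sub>R (b - a))"])
  fix \<theta> :: real assume t: "\<theta> \<in> {0..1}"
  show "(F has_derivative (\<lambda>k. \<phi>' (v \<theta>) (k *\<^sub>R (d' - c)) - \<phi>' (u \<theta>) (k *\<^sub>R (b - a)))) (at \<theta> within {0..1})"
   unfolding F_def
  proof (intro has_derivative_diff)
   show "((\<lambda>\<theta>. \<phi> (v \<theta>)) has_derivative (\<lambda>k. \<phi>' (v \<theta>) (k *\<^sub>R (d' - c)))) (at \<theta> within {0..1})"
    by (rule has_derivative_in_compose2[where t=S, OF d _ t]) (use uS in \<open>auto intro!: derivative_eq_intros simp: v_def\<close>)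
   show "((\<lambda>\<theta>. \<phi> (u \<theta>)) has_derivative (\<lambda>k. \<phi>' (u \<theta>) (k *\<^sub>R (b - a)))) (at \<theta> within {0..1})"
    by (rule has_derivative_in_compose2[where t=S, OF d _ t]) (use uS in \<open>auto intro!: derivative_eq_intros simp: u_def\<close>)
  qed
  interpret v: bounded_linear "\<phi>' (v \<theta>)" using d[OF uS(2)[OF t]] by (rule has_derivative_bounded_linear)
  interpret u: bounded_linear "\<phi>' (u \<theta>)" using d[OF uS(1)[OF t]] by (rule has_derivative_bounded_linear)
  show "onorm (\<lambda>k. \<phi>' (v \<theta>) (k *\<^sub>R (d' - c)) - \<phi>' (u \<theta>) (k *\<^sub>R (b - a))) \<le> B"
  proof (rule onorm_bound)
   show B0: "0 \<le> B" using M by (auto simp: B_def)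
   fix k :: real
   have e: "\<phi>' (v \<theta>) (d' - c) - \<phi>' (u \<theta>) (b - a) =
     \<phi>' (v \<theta>) (d' - c - b + a) + (\<phi>' (v \<theta>) (b - a) - \<phi>' (u \<theta>) (b - a))"
    by (simp add: v.add v.diff)
   have "v \<theta> - u \<theta> = (1 - \<theta>) *\<^sub>R (c - a) + \<theta> *\<^sub>R (d' - b)" by (simp add: u_def v_def algebra_simps)
   then have "norm (v \<theta> - u \<theta>) \<le> (1 - \<theta>) * norm (c - a) + \<theta> * norm (d' - b)"
    using norm_triangle_ineq[of "(1 - \<theta>) *\<^sub>R (c - a)" "\<theta> *\<^sub>R (d' - b)"] t by simp
   also have "\<dots> \<le> 1 * norm (c - a) + 1 * norm (d' - b)" using t by (intro add_mono mult_right_mono) auto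
   finally have uv: "norm (v \<theta> - u \<theta>) \<le> norm (c - a) + norm (d' - b)" by simp
   have "norm (\<phi>' (v \<theta>) (b - a) - \<phi>' (u \<theta>) (b - a)) \<le> M * \<sigma>^2 * norm (v \<theta> - u \<theta>) * norm (b - a)"
    by (rule d2[OF uS(2)[OF t] uS(1)[OF t]])
   also have "\<dots> \<le> M * \<sigma>^2 * (norm (c - a) + norm (d' - b)) * (norm (b - a) + norm (d' - c))"
    using M by (intro mult_mono uv) auto
   finally have "norm (\<phi>' (v \<theta>) (d' - c) - \<phi>' (u \<theta>) (b - a)) \<le> B"
    unfolding e B_def using norm_triangle_ineq[of "\<phi>' (v \<theta>) (d' - c - b + a)" "\<phi>' (v \<theta>) (b - a) - \<phi>' (u \<theta>) (b - a)"]
     d1[OF uS(2)[OF t], of "d' - c - b + a"] by (simp add: algebra_simps)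
   then have "\<bar>k\<bar> * norm (\<phi>' (v \<theta>) (d' - c) - \<phi>' (u \<theta>) (b - a)) \<le> \<bar>k\<bar> * B" by (rule mult_left_mono) simp
   moreover have "\<phi>' (v \<theta>) (k *\<^sub>R (d' - c)) - \<phi>' (u \<theta>) (k *\<^sub>R (b - a)) = k *\<^sub>R (\<phi>' (v \<theta>) (d' - c) - \<phi>' (u \<theta>) (b - a))"
    by (subst v.scaleR, subst u.scaleR) (simp only: scaleR_diff_right)
   ultimately show "norm (\<phi>' (v \<theta>) (k *\<^sub>R (d' - c)) - \<phi>' (u \<theta>) (k *\<^sub>R (b - a))) \<le> B * norm k"
    by (simp add: mult.commute)
  qed
 qed auto
 then show "norm (\<phi> d' - \<phi> c - \<phi> b + \<phi> a) \<le>
  M * mod4 \<sigma> a b c d'"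
  by (simp add: F_def B_def u_def v_def algebra_simps)
qed (use M in auto)

lemma C11_real_C2:
 fixes f :: "real \<Rightarrow> real"
 assumes d1: "\<And>x. x \<in> {a..b} \<Longrightarrow> (f has_real_derivative f' x) (at x)"
  and d2: "\<And>x. x \<in> {a..b} \<Longrightarrow> (f' has_real_derivative f'' x) (at x)"
  and c: "continuous_on {a..b} f''"
 shows "\<exists>M. C11 M 1 {a..b} f"
proof -
 have bd: "\<exists>K. \<forall>x\<in>{a..b}. \<bar>h x\<bar> \<le> K" if "continuous_on {a..b} h" for h :: "real \<Rightarrow> real"
  using compact_imp_bounded[OF compact_continuous_image[OF that compact_Icc]]
  by (auto simp: bounded_iff)
 have c0: "continuous_on {a..b} f" "continuous_on {a..b} f'"
  using d1 d2 by (meson DERIV_isCont continuous_at_imp_continuous_on)+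
 obtain K0 where K0: "\<And>x. x \<in> {a..b} \<Longrightarrow> \<bar>f x\<bar> \<le> K0" using bd[OF c0(1)] by blast
 obtain K1 where K1: "\<And>x. x \<in> {a..b} \<Longrightarrow> \<bar>f' x\<bar> \<le> K1" using bd[OF c0(2)] by blast
 obtain K2 where K2: "\<And>x. x \<in> {a..b} \<Longrightarrow> \<bar>f'' x\<bar> \<le> K2" using bd[OF c] by blast
 define M where "M = \<bar>K0\<bar> + \<bar>K1\<bar> + \<bar>K2\<bar>"
 have "C11 M 1 {a..b} f"
 proof (rule C11_derivative)
  show "(f has_derivative (\<lambda>h. f' x * h)) (at x within {a..b})" if "x \<in> {a..b}" for x
   using d1[OF that] by (auto simp: has_field_derivative_def intro: has_derivative_at_withinI)
  show "norm (f x) \<le> M" if "x \<in> {a..b}" for x using K0[OF that] by (auto simp: M_def)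
  show "norm (f' x * h) \<le> M * 1 * norm h" if "x \<in> {a..b}" for x h
   using K1[OF that] by (auto simp: M_def abs_mult intro!: mult_right_mono)
  show "norm (f' x * h - f' y * h) \<le> M * 1^2 * norm (x - y) * norm h" if "x \<in> {a..b}" "y \<in> {a..b}" for x y h
  proof -
   have "norm (f' x - f' y) \<le> M * norm (x - y)"
   proof (rule differentiable_bound[where f = f' and f' = "\<lambda>x h. f'' x * h", OF _ _ _ that])
    show "(f' has_derivative (\<lambda>h. f'' x * h)) (at x within {a..b})" if "x \<in> {a..b}" for x
     using d2[OF that] by (auto simp: has_field_derivative_def intro: has_derivative_at_withinI)
    show "onorm (\<lambda>h. f'' x * h) \<le> M" if "x \<in> {a..b}" for x
     by (rule onorm_bound) (use K2[OF that] in \<open>auto simp: M_def abs_mult intro!: mult_right_mono\<close>)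
   qed auto
   then have "norm (f' x - f' y) * norm h \<le> M * norm (x - y) * norm h" by (rule mult_right_mono) simp
   then show ?thesis by (simp add: left_diff_distrib[symmetric] abs_mult)
  qed
 qed (auto simp: M_def)
 then show ?thesis ..
qed

section \<open>From bounds on coordinate derivatives to bounds on differences\<close>

lemma multi_idx_1: "multi_idx 1 = (\<lambda>i. [i]) ` (Basis :: 'a::euclidean_space set)"
 by (auto simp: multi_idx_def length_Suc_conv image_iff)

lemma multi_idx_2: "multi_idx 2 = (\<lambda>(j,i). [j,i]) ` ((Basis :: 'a::euclidean_space set) \<times> Basis)"
 by (auto simp: multi_idx_def length_Suc_conv image_iff numeral_2_eq_2)

lemma Dk_abs_1: "Dk_abs 1 g x = (\<Sum>i\<in>Basis. norm (frechet_derivative g (at x) i))"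
 unfolding Dk_abs_def multi_idx_1 by (subst sum.reindex) (auto simp: inj_on_def)

lemma Dk_abs_2: "Dk_abs 2 g x = (\<Sum>j\<in>Basis. \<Sum>i\<in>Basis. norm (frechet_derivative (\<lambda>x. frechet_derivative g (at x) i) (at x) j))"
 unfolding Dk_abs_def multi_idx_2 by (subst sum.reindex) (auto simp: inj_on_def sum.cartesian_product intro!: sum.cong)

lemma Ck2_D:
 assumes "Ck 2 g"
 shows "(g has_derivative frechet_derivative g (at x)) (at x)"
  "i \<in> Basis \<Longrightarrow> ((\<lambda>x. frechet_derivative g (at x) i) has_derivative frechet_derivative (\<lambda>x. frechet_derivative g (at x) i) (at x)) (at x)"
  "continuous_on UNIV g"
  "i \<in> Basis \<Longrightarrow> continuous_on UNIV (\<lambda>x. frechet_derivative g (at x) i)"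
  "i \<in> Basis \<Longrightarrow> j \<in> Basis \<Longrightarrow> continuous_on UNIV (\<lambda>x. frechet_derivative (\<lambda>x. frechet_derivative g (at x) i) (at x) j)"
proof -
 have d: "pderivs us g differentiable (at x)" if "set us \<subseteq> Basis" "length us < 2" for us x
  using assms that unfolding Ck_def multi_idx_le_def by auto
 have c: "continuous_on UNIV (pderivs us g)" if "set us \<subseteq> Basis" "length us \<le> 2" for us
  using assms that unfolding Ck_def multi_idx_le_def by auto
 show "(g has_derivative frechet_derivative g (at x)) (at x)"
  using d[of "[]"] by (simp add: frechet_derivative_works)
 show "continuous_on UNIV g" using c[of "[]"] by simp
 show "((\<lambda>x. frechet_derivative g (at x) i) has_derivative frechet_derivative (\<lambda>x. frechet_derivative g (at x) i) (at x)) (at x)" if "i \<in> Basis"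
  using d[of "[i]"] that by (simp add: frechet_derivative_works)
 show "continuous_on UNIV (\<lambda>x. frechet_derivative g (at x) i)" if "i \<in> Basis" using c[of "[i]"] that by simp
 show "continuous_on UNIV (\<lambda>x. frechet_derivative (\<lambda>x. frechet_derivative g (at x) i) (at x) j)" if "i \<in> Basis" "j \<in> Basis"
  using c[of "[j,i]"] that by simp
qed

lemma bounded_linear_basis_expansion:
 fixes l :: "'a::euclidean_space \<Rightarrow> 'b::real_normed_vector"
 assumes "bounded_linear l" shows "l h = (\<Sum>i\<in>Basis. (h \<bullet> i) *\<^sub>R l i)"
proof -
 interpret bounded_linear l by fact
 have "l (\<Sum>i\<in>Basis. (h \<bullet> i) *\<^sub>R i) = (\<Sum>i\<in>Basis. (h \<bullet> i) *\<^sub>R l i)" by (simp add: sum scaleR)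
 then show ?thesis by (simp add: euclidean_representation)
qed

lemma bounded_linear_basis_bound:
 fixes l :: "'a::euclidean_space \<Rightarrow> 'b::real_normed_vector"
 assumes "bounded_linear l" shows "norm (l h) \<le> (\<Sum>i\<in>Basis. norm (l i)) * norm h"
proof -
 have "norm (l h) \<le> (\<Sum>i\<in>Basis. norm ((h \<bullet> i) *\<^sub>R l i))"
  unfolding bounded_linear_basis_expansion[OF assms, of h] by (rule norm_sum)
 also have "\<dots> \<le> (\<Sum>i\<in>Basis. norm h * norm (l i))" by (intro sum_mono) (auto intro!: mult_right_mono Basis_le_norm)
 finally show ?thesis by (simp add: sum_distrib_left mult.commute)
qed

text \<open>A linear map is bounded by the sum of its values on the basis, so \<open>Dk_abs\<close>
  dominates the operator norms. On the convex set \<open>S\<close> the mean value inequality then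
  turns second derivatives into a Lipschitz bound for the first.\<close>

lemma C11_Ck2:
 fixes g :: "'a::euclidean_space \<Rightarrow> 'b::real_normed_vector"
 assumes g: "Ck 2 g" and S: "convex S" and M: "0 \<le> M" "0 \<le> \<sigma>"
  and 0: "\<And>x. x \<in> S \<Longrightarrow> norm (g x) \<le> M"
  and 1: "\<And>x. x \<in> S \<Longrightarrow> Dk_abs 1 g x \<le> M * \<sigma>"
  and 2: "\<And>x. x \<in> S \<Longrightarrow> Dk_abs 2 g x \<le> M * \<sigma>^2"
 shows "C11 M \<sigma> S g"
proof (rule C11_derivative[OF S _ M 0])
 note D = Ck2_D[OF g]
 show "(g has_derivative frechet_derivative g (at x)) (at x within S)" for x
  using D(1) by (rule has_derivative_at_withinI)
 show "norm (frechet_derivative g (at x) h) \<le> M * \<sigma> * norm h" if "x \<in> S" for x h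
 proof -
  have "norm (frechet_derivative g (at x) h) \<le> Dk_abs 1 g x * norm h"
   unfolding Dk_abs_1 by (rule bounded_linear_basis_bound[OF has_derivative_bounded_linear[OF D(1)]])
  also have "\<dots> \<le> M * \<sigma> * norm h" by (rule mult_right_mono[OF 1[OF that]]) simp
  finally show ?thesis .
 qed
 show "norm (frechet_derivative g (at x) h - frechet_derivative g (at y) h) \<le> M * \<sigma>^2 * norm (x - y) * norm h"
  if xy: "x \<in> S" "y \<in> S" for x y h
 proof -
  define \<psi> where "\<psi> x = (\<Sum>i\<in>Basis. (h \<bullet> i) *\<^sub>R frechet_derivative g (at x) i)" for x
  define \<psi>' where "\<psi>' x k = (\<Sum>i\<in>Basis. (h \<bullet> i) *\<^sub>R frechet_derivative (\<lambda>x. frechet_derivative g (at x) i) (at x) k)" for x k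
  have e: "frechet_derivative g (at x) h = \<psi> x" for x
   unfolding \<psi>_def by (rule bounded_linear_basis_expansion[OF has_derivative_bounded_linear[OF D(1)]])
  have "norm (\<psi> x - \<psi> y) \<le> (M * \<sigma>^2 * norm h) * norm (x - y)"
  proof (rule differentiable_bound[where f = \<psi> and f' = \<psi>', OF S _ _ xy])
   show "(\<psi> has_derivative \<psi>' z) (at z within S)" for z
    unfolding \<psi>_def \<psi>'_def
    by (rule has_derivative_at_withinI) (intro has_derivative_sum has_derivative_scaleR_right D(2))
   fix z assume z: "z \<in> S"
   show "onorm (\<psi>' z) \<le> M * \<sigma>^2 * norm h"
   proof (rule onorm_bound)
    fix k
    let ?d = "\<lambda>i k. frechet_derivative (\<lambda>x. frechet_derivative g (at x) i) (at z) k"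
    have "norm (\<psi>' z k) \<le> (\<Sum>i\<in>Basis. norm ((h \<bullet> i) *\<^sub>R ?d i k))" unfolding \<psi>'_def by (rule norm_sum)
    also have "\<dots> \<le> (\<Sum>i\<in>Basis. norm h * ((\<Sum>j\<in>Basis. norm (?d i j)) * norm k))"
    proof (intro sum_mono)
     fix i :: 'a assume i: "i \<in> Basis"
     show "norm ((h \<bullet> i) *\<^sub>R ?d i k) \<le> norm h * ((\<Sum>j\<in>Basis. norm (?d i j)) * norm k)"
      unfolding norm_scaleR
      by (rule mult_mono) (use i Basis_le_norm[OF i, of h] bounded_linear_basis_bound[OF has_derivative_bounded_linear[OF D(2)[OF i]]] in auto)
    qed
    also have "\<dots> = Dk_abs 2 g z * norm h * norm k"
     unfolding Dk_abs_2 by (subst sum.swap) (simp add: sum_distrib_left sum_distrib_right mult_ac)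
    also have "\<dots> \<le> M * \<sigma>^2 * norm h * norm k" using 2[OF z] by (intro mult_right_mono) auto
    finally show "norm (\<psi>' z k) \<le> M * \<sigma>^2 * norm h * norm k" .
   qed (use M in auto)
  qed
  then show ?thesis by (simp add: e mult_ac)
 qed
qed

lemma C11_Ck2_cball:
 fixes g :: "'a::euclidean_space \<Rightarrow> 'b::real_normed_vector"
 assumes g: "Ck 2 g"
 shows "\<exists>M. C11 M 1 (cball 0 R) g"
proof -
 note D = Ck2_D[OF g]
 have bd: "\<exists>K. \<forall>x\<in>cball 0 R. h x \<le> K" if "continuous_on UNIV h" for h :: "'a \<Rightarrow> real"
 proof -
  have "bounded (h ` cball 0 R)"
   by (intro compact_imp_bounded compact_continuous_image compact_cball continuous_on_subset[OF that]) simp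
  then obtain K where "\<forall>y\<in>h ` cball 0 R. norm y \<le> K" unfolding bounded_iff by blast
  then show ?thesis by (intro exI[of _ K]) (auto dest: abs_le_D1)
 qed
 obtain K0 where K0: "\<And>x. x \<in> cball 0 R \<Longrightarrow> norm (g x) \<le> K0" using bd[OF continuous_on_norm[OF D(3)]] by blast
 have "continuous_on UNIV (\<lambda>x. Dk_abs 1 g x)" unfolding Dk_abs_1 by (intro continuous_intros D(4))
 then obtain K1 where K1: "\<And>x. x \<in> cball 0 R \<Longrightarrow> Dk_abs 1 g x \<le> K1" using bd by blast
 have "continuous_on UNIV (\<lambda>x. Dk_abs 2 g x)" unfolding Dk_abs_2 by (intro continuous_intros D(5))
 then obtain K2 where K2: "\<And>x. x \<in> cball 0 R \<Longrightarrow> Dk_abs 2 g x \<le> K2" using bd by blast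
 have "C11 (\<bar>K0\<bar> + \<bar>K1\<bar> + \<bar>K2\<bar>) 1 (cball 0 R) g"
  by (rule C11_Ck2[OF g convex_cball]) (use K0 K1 K2 in \<open>fastforce+\<close>)
 then show ?thesis ..
qed

section \<open>Ordinary differential equations\<close>

text \<open>A single contraction covers the whole interval. The unknown is the solution multiplied
  by \<open>exp (- \<Lambda> * s)\<close>, which makes the integral operator contracting however
  large \<open>T\<close> and \<open>Lc\<close> are, so no local solutions have to be
  continued.\<close>

lemma picard_lindelof:
 fixes F :: "real \<Rightarrow> 'a::euclidean_space \<Rightarrow> 'a"
 assumes T: "0 \<le> T" and cont: "continuous_on ({0..T} \<times> UNIV) (unc F)"
  and lip: "\<And>s x y. s \<in> {0..T} \<Longrightarrow> norm (F s x - F s y) \<le> Lc * norm (x - y)"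
 shows "\<exists>z. z 0 = z0 \<and> (\<forall>s\<in>{0..T}. (z has_vector_derivative F s (z s)) (at s within {0..T}))"
proof -
 \<comment> \<open>Integrating \<open>exp (\<Lambda> * s)\<close> gains a factor 1 / \<Lambda>, so
   in the weighted norm the operator has Lipschitz constant at most 1/2.\<close>
 define \<Lambda> where "\<Lambda> = 2 * (\<bar>Lc\<bar> + 1)"
 have \<Lambda>: "\<Lambda> > 0" "\<bar>Lc\<bar> / \<Lambda> \<le> 1/2" by (auto simp: \<Lambda>_def field_simps)
 \<comment> \<open>Bounded continuous functions live on the whole real line; clamping time to the
   interval extends the integral operator to them.\<close>
 define c where "c s = max 0 (min T s)" for s :: real
 have c: "c s \<in> {0..T}" "continuous_on UNIV c" for s
  using T by (auto simp: c_def intro!: continuous_intros)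
 have c_id: "c s = s" if "s \<in> {0..T}" for s using that by (auto simp: c_def)
 define h where "h u \<sigma> = F \<sigma> (exp (\<Lambda> * \<sigma>) *\<^sub>R u \<sigma>)" for u :: "real \<Rightarrow> 'a" and \<sigma>
 have hc: "continuous_on {0..T} (h u)" if "continuous_on UNIV u" for u
 proof -
  have "continuous_on {0..T} (\<lambda>\<sigma>. (\<sigma>, exp (\<Lambda> * \<sigma>) *\<^sub>R u \<sigma>))"
   using continuous_on_subset[OF that] by (intro continuous_intros) auto
  from continuous_on_compose2[OF cont this] show ?thesis by (auto simp: h_def)
 qed
 define I where "I u s = z0 + integral {0..s} (h u)" for u s
 have Ic: "continuous_on {0..T} (I u)" if "continuous_on UNIV u" for u
  unfolding I_def by (intro continuous_intros indefinite_integral_continuous_1 integrable_continuous_interval hc that)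
 define G where "G u s = exp (- \<Lambda> * c s) *\<^sub>R I u (c s)" for u s
 have Gb: "G u \<in> bcontfun" if "continuous_on UNIV u" for u
 proof -
  have k: "continuous_on {0..T} (\<lambda>s. exp (- \<Lambda> * s) *\<^sub>R I u s)" by (intro continuous_intros Ic that)
  have "continuous_on UNIV (G u)"
   unfolding G_def by (rule continuous_on_compose2[OF k c(2)]) (use c in auto)
  moreover have "range (G u) \<subseteq> (\<lambda>s. exp (- \<Lambda> * s) *\<^sub>R I u s) ` {0..T}"
   using c by (auto simp: G_def)
  then have "bounded (range (G u))"
   using bounded_subset compact_imp_bounded compact_continuous_image[OF k compact_Icc] by blast
  ultimately show ?thesis by (simp add: bcontfun_def)
 qed
 define \<Phi> where "\<Phi> u = Bcontfun (G (apply_bcontfun u))" for u :: "real \<Rightarrow>\<^sub>C 'a"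
 have ap: "apply_bcontfun (\<Phi> u) = G (apply_bcontfun u)" for u
  unfolding \<Phi>_def by (intro Bcontfun_inverse Gb) (simp add: continuous_on_apply_bcontfun)
 have contr: "dist (\<Phi> u) (\<Phi> v) \<le> 1/2 * dist u v" for u v
 proof (rule dist_bound)
  fix s
  define r where "r = c s"
  have r: "r \<in> {0..T}" using c by (auto simp: r_def)
  note hcu = continuous_on_subset[OF hc[OF continuous_on_apply_bcontfun], of "{0..r}"]
  have int: "h (apply_bcontfun u) integrable_on {0..r}" for u
   using r by (intro integrable_continuous_interval hcu) auto
  have ei: "((\<lambda>\<sigma>. \<bar>Lc\<bar> * dist u v * exp (\<Lambda> * \<sigma>)) has_integral \<bar>Lc\<bar> * dist u v * (exp (\<Lambda> * r) / \<Lambda> - exp (\<Lambda> * 0) / \<Lambda>)) {0..r}"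
   using r \<Lambda> by (intro has_integral_mult_right fundamental_theorem_of_calculus)
    (auto intro!: derivative_eq_intros simp: has_real_derivative_iff_has_vector_derivative[symmetric])
  have "norm (integral {0..r} (\<lambda>\<sigma>. h (apply_bcontfun u) \<sigma> - h (apply_bcontfun v) \<sigma>)) \<le> integral {0..r} (\<lambda>\<sigma>. \<bar>Lc\<bar> * dist u v * exp (\<Lambda> * \<sigma>))"
  proof (rule integral_norm_bound_integral)
   fix \<sigma> assume s: "\<sigma> \<in> {0..r}"
   have "norm (h (apply_bcontfun u) \<sigma> - h (apply_bcontfun v) \<sigma>) \<le> Lc * norm (exp (\<Lambda> * \<sigma>) *\<^sub>R (apply_bcontfun u \<sigma> - apply_bcontfun v \<sigma>))"
    unfolding h_def scaleR_diff_right by (rule lip) (use s r in auto)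
   also have "\<dots> = Lc * (exp (\<Lambda> * \<sigma>) * dist (apply_bcontfun u \<sigma>) (apply_bcontfun v \<sigma>))" by (simp add: dist_norm)
   also have "\<dots> \<le> \<bar>Lc\<bar> * (exp (\<Lambda> * \<sigma>) * dist u v)"
    by (intro mult_mono mult_left_mono dist_fun_lt_imp_dist_val_lt dist_bounded) auto
   finally show "norm (h (apply_bcontfun u) \<sigma> - h (apply_bcontfun v) \<sigma>) \<le> \<bar>Lc\<bar> * dist u v * exp (\<Lambda> * \<sigma>)" by (simp add: mult_ac)
  qed (use int ei in \<open>auto intro: integrable_diff\<close>)
  also have "\<dots> = \<bar>Lc\<bar> * dist u v * (exp (\<Lambda> * r) / \<Lambda> - exp (\<Lambda> * 0) / \<Lambda>)" using ei by (rule integral_unique)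
  also have "\<dots> \<le> \<bar>Lc\<bar> * dist u v * (exp (\<Lambda> * r) / \<Lambda>)" using \<Lambda> by (intro mult_left_mono) auto
  finally have b: "norm (integral {0..r} (h (apply_bcontfun u)) - integral {0..r} (h (apply_bcontfun v))) \<le> \<bar>Lc\<bar> * dist u v * (exp (\<Lambda> * r) / \<Lambda>)"
   using int by (simp add: integral_diff)
  have "dist (apply_bcontfun (\<Phi> u) s) (apply_bcontfun (\<Phi> v) s) =
   exp (- \<Lambda> * r) * norm (integral {0..r} (h (apply_bcontfun u)) - integral {0..r} (h (apply_bcontfun v)))"
   unfolding ap G_def I_def r_def[symmetric] dist_norm scaleR_diff_right[symmetric] by simp
  also have "\<dots> \<le> exp (- \<Lambda> * r) * (\<bar>Lc\<bar> * dist u v * (exp (\<Lambda> * r) / \<Lambda>))" by (rule mult_left_mono[OF b]) simp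
  also have "\<dots> = \<bar>Lc\<bar> / \<Lambda> * dist u v" by (simp add: exp_minus field_simps)
  also have "\<dots> \<le> 1/2 * dist u v" using \<Lambda>(2) by (rule mult_right_mono) simp
  finally show "dist (apply_bcontfun (\<Phi> u) s) (apply_bcontfun (\<Phi> v) s) \<le> 1/2 * dist u v" .
 qed
 have "\<exists>!u. \<Phi> u = u"
  by (rule banach_fix_type[of "1/2"]) (use contr in auto)
 then obtain u where u: "\<Phi> u = u" by blast
 define z where "z s = I (apply_bcontfun u) s" for s
 have zu: "z s = exp (\<Lambda> * s) *\<^sub>R apply_bcontfun u s" if "s \<in> {0..T}" for s
 proof -
  have "apply_bcontfun u s = exp (- \<Lambda> * s) *\<^sub>R z s"
  proof -
   have "apply_bcontfun u s = G (apply_bcontfun u) s" using ap[of u] u by metis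
   then show ?thesis unfolding G_def z_def c_id[OF that] .
  qed
  then show ?thesis by (simp add: exp_minus)
 qed
 have "(z has_vector_derivative F s (z s)) (at s within {0..T})" if s: "s \<in> {0..T}" for s
 proof -
  have "(z has_vector_derivative 0 + h (apply_bcontfun u) s) (at s within {0..T})"
   unfolding z_def I_def
   by (intro has_vector_derivative_add has_vector_derivative_const integral_has_vector_derivative hc s)
    (simp add: continuous_on_apply_bcontfun)
  then show ?thesis by (simp add: h_def zu[OF s])
 qed
 moreover have "z 0 = z0" by (simp add: z_def I_def)
 ultimately show ?thesis by blast
qed

text \<open>\<open>exp (- 2 * Lc * s) * (u s \<bullet> u s)\<close> does not increase. Working with
  the square avoids differentiating the norm where \<open>u\<close> vanishes.\<close>

lemma norm_growth_bound:
 fixes u :: "real \<Rightarrow> 'a::real_inner"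
 assumes "a \<le> b" and d: "\<And>s. s \<in> {a..b} \<Longrightarrow> (u has_vector_derivative u' s) (at s within {a..b})"
  and b: "\<And>s. s \<in> {a..b} \<Longrightarrow> norm (u' s) \<le> Lc * norm (u s)"
 shows "norm (u b) \<le> exp (Lc * (b - a)) * norm (u a)"
proof -
 have cu: "continuous_on {a..b} u" using d by (meson continuous_on_vector_derivative)
 have D: "((\<lambda>s. exp (k * s) * (u s \<bullet> u s)) has_real_derivative exp (k * s) * (k * (u s \<bullet> u s) + 2 * (u s \<bullet> u' s))) (at s)"
  if "a < s" "s < b" for s k
 proof -
  have "(u has_vector_derivative u' s) (at s)"
   using d[of s] that by (simp add: at_within_Icc_at)
  then have "(u has_derivative (\<lambda>h. h *\<^sub>R u' s)) (at s)" by (simp add: has_vector_derivative_def)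
  from has_derivative_inner[OF this this]
  have "((\<lambda>s. u s \<bullet> u s) has_real_derivative 2 * (u s \<bullet> u' s)) (at s)"
   by (simp add: has_field_derivative_def inner_commute algebra_simps mult_commute_abs)
  moreover have "((\<lambda>s. exp (k * s)) has_real_derivative exp (k * s) * k) (at s)"
   by (auto intro!: derivative_eq_intros)
  ultimately have "((\<lambda>s. exp (k * s) * (u s \<bullet> u s)) has_real_derivative exp (k * s) * k * (u s \<bullet> u s) + 2 * (u s \<bullet> u' s) * exp (k * s)) (at s)"
   by (intro DERIV_mult)
  then show ?thesis by (simp add: algebra_simps)
 qed
 have cc: "continuous_on {a..b} (\<lambda>s. exp (k * s) * (u s \<bullet> u s))" for k by (intro continuous_intros cu)
 have ip: "\<bar>u s \<bullet> u' s\<bar> \<le> Lc * (u s \<bullet> u s)" if "s \<in> {a..b}" for s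
 proof -
  have "\<bar>u s \<bullet> u' s\<bar> \<le> norm (u s) * (Lc * norm (u s))"
   by (rule order_trans[OF Cauchy_Schwarz_ineq2 mult_left_mono[OF b[OF that]]]) simp
  then show ?thesis by (simp add: power2_norm_eq_inner[symmetric] power2_eq_square mult_ac)
 qed
 have e: "exp (2 * Lc * (b - a)) = (exp (Lc * (b - a)))^2" by (simp add: power2_eq_square exp_add[symmetric] algebra_simps)
 have "- (exp (- 2 * Lc * a) * (u a \<bullet> u a)) \<le> - (exp (- 2 * Lc * b) * (u b \<bullet> u b))"
 proof (rule DERIV_nonneg_imp_increasing_open[OF assms(1)])
  show "\<exists>y. ((\<lambda>s. - (exp (- 2 * Lc * s) * (u s \<bullet> u s))) has_real_derivative y) (at s) \<and> 0 \<le> y" if "a < s" "s < b" for s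
  proof -
   have "0 \<le> - (exp (- 2 * Lc * s) * (- 2 * Lc * (u s \<bullet> u s) + 2 * (u s \<bullet> u' s)))"
    using ip[of s] that by (simp add: mult_le_0_iff abs_le_iff)
   with DERIV_minus[OF D[OF that, of "- 2 * Lc"]] show ?thesis by blast
  qed
 qed (intro continuous_intros cc)
 then have "exp (- 2 * Lc * b) * (norm (u b))^2 \<le> exp (- 2 * Lc * a) * (norm (u a))^2" by (simp add: power2_norm_eq_inner)
 then have "exp (2 * Lc * b) * (exp (- 2 * Lc * b) * (norm (u b))^2) \<le> exp (2 * Lc * b) * (exp (- 2 * Lc * a) * (norm (u a))^2)"
  by (rule mult_left_mono) simp
 then have "(norm (u b))^2 \<le> exp (2 * Lc * (b - a)) * (norm (u a))^2"
  by (simp only: mult.assoc[symmetric] exp_add[symmetric]) (simp add: algebra_simps)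
 then have "(norm (u b))^2 \<le> (exp (Lc * (b - a)) * norm (u a))^2" unfolding e by (simp add: power_mult_distrib)
 then show "norm (u b) \<le> exp (Lc * (b - a)) * norm (u a)" by (rule power2_le_imp_le) simp
qed

text \<open>\<open>wlam a\<close> is chosen with derivative \<open>(s + 2) * cdec a s\<close>, so that \<open>norm u + wlam a s * norm v\<close> is controlled backwards in time
 when \<open>v\<close> is a velocity difference and \<open>u\<close> the difference of the positions with free streaming removed.\<close>

definition cdec :: "real \<Rightarrow> real \<Rightarrow> real" where "cdec a s = a * ln (s + 2) / (s + 2)^2"
definition wlam :: "real \<Rightarrow> real \<Rightarrow> real" where "wlam a s = 1 + a * (ln (s + 2))^2 / 2"

lemma ln_le_2sqrt: "x > 0 \<Longrightarrow> ln x \<le> 2 * sqrt (x::real)"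
 using ln_le_minus_one[of "sqrt x"] by (simp add: ln_sqrt)

text \<open>The term \<open>(s + 2) * cdec a s * norm (v s)\<close> in the bound for
  \<open>u\<close> has a coefficient of order ln s / s, which is not integrable. Weighting
  \<open>v\<close> by \<open>wlam a s\<close> lets it cancel against the derivative of the weight,
  and the remaining coefficients are O(s^(-3/2)). The inhomogeneity with \<open>R\<close> is what
  products of two first differences leave behind; it is harmless because
  \<open>(s + 2) * cdec a s / (wlam a s)^2\<close> is the derivative of
  \<open>- 1 / wlam a s\<close>.\<close>

lemma gronwall_system:
 fixes u v :: "real \<Rightarrow> 'a::euclidean_space"
 assumes a: "0 < a" and t: "0 \<le> t" and R: "0 \<le> R"
  and du: "\<And>s. s \<in> {0..t} \<Longrightarrow> (u has_vector_derivative u' s) (at s within {0..t})"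
  and dv: "\<And>s. s \<in> {0..t} \<Longrightarrow> (v has_vector_derivative v' s) (at s within {0..t})"
  and bu: "\<And>s. s \<in> {0..t} \<Longrightarrow> norm (u' s) \<le> (s + 2) * cdec a s * (norm (u s) / (s + 2) + norm (v s) + R / (wlam a s)^2)"
  and bv: "\<And>s. s \<in> {0..t} \<Longrightarrow> norm (v' s) \<le> cdec a s * (norm (u s) / (s + 2) + norm (v s) + R / (wlam a s)^2)"
  and s0: "s0 \<in> {0..t}"
 shows "norm (u s0) + wlam a s0 * norm (v s0) \<le> exp (8 * a + 8 * a^2) * (1 + 8 * a + 8 * a^2) * (norm (u t) + wlam a t * norm (v t) + R)"
proof -
 \<comment> \<open>With \<open>p = k / sqrt (s + 2)\<close>, the quantity - p' is (4 a + 4 a^2) / (s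
   + 2)^(3/2), which is exactly the bound that ln x <= 2 sqrt x yields for the leftover coefficient
   \<open>c + l * c / x\<close> below.\<close>
 define k where "k = 8 * a + 8 * a^2"
 have k: "0 < k" using a by (auto simp: k_def intro: add_pos_nonneg)
 define p where "p s = k / sqrt (s + 2)" for s
 have p01: "0 \<le> p s" "p s \<le> k" if "s \<ge> 0" for s
  using that k by (auto simp: p_def field_simps)
 have lam1: "1 \<le> wlam a s" for s using a by (auto simp: wlam_def)
 have cu: "continuous_on {0..t} u" and cv: "continuous_on {0..t} v"
  using du dv by (meson continuous_on_vector_derivative)+
 have clam: "continuous_on {0..t} (wlam a)" unfolding wlam_def[abs_def] by (intro continuous_intros) auto
 have ccd: "continuous_on {0..t} (cdec a)" unfolding cdec_def[abs_def] by (intro continuous_intros) auto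
 define r where "r s = R / (wlam a s)^2" for s
 have cr: "continuous_on {0..t} r" unfolding r_def using lam1 by (intro continuous_intros clam) (smt (verit) power_eq_0_iff)
 define h where "h s = cdec a s * (norm (u s) / (s + 2) + norm (v s) + r s)" for s
 have ch: "continuous_on {0..t} h" unfolding h_def by (intro continuous_intros ccd cu cv cr) auto
 have cd0: "0 \<le> cdec a s" if "s \<ge> 0" for s using that a by (auto simp: cdec_def)
 \<comment> \<open>\<open>A\<close> and \<open>B\<close> majorise the norms of \<open>u\<close> and
   \<open>v\<close> by integrating the derivative bounds backwards from \<open>t\<close>; unlike the
   norms they are differentiable.\<close>
 define A where "A s = norm (u t) + integral {s..t} (\<lambda>\<sigma>. (\<sigma> + 2) * h \<sigma>)" for s
 define B where "B s = norm (v t) + integral {s..t} h" for s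
 have dA: "(A has_real_derivative - ((s + 2) * h s)) (at s within {0..t})" if "s \<in> {0..t}" for s
  unfolding A_def has_real_derivative_iff_has_vector_derivative
  by (rule has_vector_derivative_eq_rhs[OF has_vector_derivative_add[OF has_vector_derivative_const integral_has_vector_derivative'[OF _ that]]])
   (auto intro!: continuous_intros ch)
 have dB: "(B has_real_derivative - h s) (at s within {0..t})" if "s \<in> {0..t}" for s
  unfolding B_def has_real_derivative_iff_has_vector_derivative
  by (rule has_vector_derivative_eq_rhs[OF has_vector_derivative_add[OF has_vector_derivative_const integral_has_vector_derivative'[OF _ that]]])
   (auto intro!: continuous_intros ch)
 have bnd: "norm (w s) \<le> norm (w t) + integral {s..t} g"
  if dw: "\<And>s. s \<in> {0..t} \<Longrightarrow> (w has_vector_derivative w' s) (at s within {0..t})"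
   and cg: "continuous_on {0..t} g" and bw: "\<And>s. s \<in> {0..t} \<Longrightarrow> norm (w' s) \<le> g s" and s: "s \<in> {0..t}"
  for w w' :: "real \<Rightarrow> 'a" and g s
 proof -
  have i: "(w' has_integral w t - w s) {s..t}"
   by (rule fundamental_theorem_of_calculus) (use s in \<open>auto intro: has_vector_derivative_within_subset[OF dw]\<close>)
  have "norm (integral {s..t} w') \<le> integral {s..t} g"
   by (rule integral_norm_bound_integral) (use has_integral_integrable[OF i] integrable_continuous_interval[OF continuous_on_subset[OF cg]] s bw in auto)
  then have "norm (w t - w s) \<le> integral {s..t} g" using integral_unique[OF i] by simp
  then show ?thesis using norm_triangle_ineq3[of "w t" "w s"] by linarith
 qed
 have uA: "norm (u s) \<le> A s" if "s \<in> {0..t}" for s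
  unfolding A_def
 proof (rule bnd[OF du _ _ that])
  show "continuous_on {0..t} (\<lambda>\<sigma>. (\<sigma> + 2) * h \<sigma>)" by (intro continuous_intros ch)
 qed (use bu in \<open>auto simp: h_def r_def mult.assoc\<close>)
 have vB: "norm (v s) \<le> B s" if "s \<in> {0..t}" for s
  unfolding B_def by (rule bnd[OF dv ch _ that]) (use bv in \<open>auto simp: h_def r_def\<close>)
 define M where "M s = A s + wlam a s * B s" for s
 have lam0: "wlam a s \<noteq> 0" for s using lam1[of s] by auto
 \<comment> \<open>The factor \<open>exp (- p s)\<close> absorbs the integrable coefficients, and
   the derivative of the subtracted part compensates the terms with \<open>R\<close>. Hence
   \<open>G\<close> does not decrease, and the value at \<open>t\<close> controls the value at
   \<open>s0\<close>.\<close>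
 define G where "G s = M s * exp (- p s) - R * (1 / wlam a s + p s)" for s
 have dlam: "(wlam a has_real_derivative (s + 2) * cdec a s) (at s)" if "s \<ge> 0" for s
 proof -
  define i where "i = inverse (s + 2)"
  have i: "(s + 2) * i = 1" using that by (simp add: i_def)
  have "((\<lambda>s. ln (s + 2)) has_real_derivative i) (at s)"
   using that by (auto intro!: derivative_eq_intros simp: i_def divide_inverse)
  from DERIV_add[OF DERIV_const[of 1] DERIV_cdivide[OF DERIV_cmult[OF DERIV_mult[OF this this], of a], of 2]]
  have "(wlam a has_real_derivative a * ln (s + 2) * i) (at s)"
   by (simp add: wlam_def[abs_def] power2_eq_square mult_ac)
  moreover have "(s + 2) * cdec a s = ((s + 2) * i) * (a * ln (s + 2) * i)"
   by (simp add: cdec_def i_def divide_inverse power2_eq_square mult_ac)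
  then have "(s + 2) * cdec a s = a * ln (s + 2) * i" unfolding i by simp
  ultimately show ?thesis by simp
 qed
 have dp: "(p has_real_derivative - (k / 2) / ((s + 2) * sqrt (s + 2))) (at s)" if "s \<ge> 0" for s
  unfolding p_def[abs_def] using that
  by (auto intro!: derivative_eq_intros simp: field_simps)
 have mono: "G s0 \<le> G t"
 proof (rule DERIV_nonneg_imp_increasing_open[where f = G])
  show "s0 \<le> t" using s0 by simp
  have sub: "{s0..t} \<subseteq> {0..t}" using s0 by auto
  have cA: "continuous_on {s0..t} A" "continuous_on {s0..t} B"
   using continuous_on_subset[OF DERIV_continuous_on[OF dA] sub] continuous_on_subset[OF DERIV_continuous_on[OF dB] sub] by auto
  show "continuous_on {s0..t} G"
   unfolding G_def M_def p_def
   by (intro continuous_intros cA continuous_on_subset[OF clam sub]) (use s0 in \<open>auto simp: lam0\<close>)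
  fix s assume s: "s0 < s" "s < t"
  then have s': "s \<ge> 0" "s \<in> {0..t}" "0 < s" using s0 by auto
  have at: "at s within {0..t} = at s" using s s' by (simp add: at_within_Icc_at)
  define q where "q = (k / 2) / ((s + 2) * sqrt (s + 2))"
  define c where "c = cdec a s"
  define l where "l = wlam a s"
  have DG: "(G has_real_derivative ((- ((s + 2) * h s) + (((s + 2) * c) * B s + l * (- h s))) * exp (- p s) + M s * (exp (- p s) * q))
   - R * (- ((s + 2) * c / l^2) - q)) (at s)"
  proof -
   have l0: "l \<noteq> 0" using lam0 by (simp add: l_def)
   have DM: "(M has_real_derivative - ((s + 2) * h s) + ((s + 2) * c * B s + (- h s) * l)) (at s)"
    unfolding M_def c_def l_def
    by (intro DERIV_add DERIV_mult dA[OF s'(2), unfolded at] dB[OF s'(2), unfolded at] dlam[OF s'(1)])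
   have p': "(p has_real_derivative - q) (at s)" using dp[OF s'(1)] by (simp add: q_def)
   have DE: "((\<lambda>s. exp (- p s)) has_real_derivative exp (- p s) * q) (at s)"
    using DERIV_chain2[OF DERIV_exp DERIV_minus[OF p']] by simp
   have DI: "((\<lambda>s. 1 / wlam a s) has_real_derivative - ((s + 2) * c) / l^2) (at s)"
    using DERIV_inverse_fun[OF dlam[OF s'(1)] lam0] l0
    by (simp add: c_def l_def divide_inverse power2_eq_square mult_ac)
   have "(G has_real_derivative (- ((s + 2) * h s) + ((s + 2) * c * B s + (- h s) * l)) * exp (- p s) + exp (- p s) * q * M s
    - R * (- ((s + 2) * c) / l^2 + - q)) (at s)"
    unfolding G_def by (intro DERIV_diff DERIV_mult DM DE DERIV_cmult DERIV_add DI p')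
   then show ?thesis by (simp add: mult_ac)
  qed
  define x where "x = s + 2"
  define y where "y = sqrt x"
  have xy: "x = y * y" "y > 0" "x \<ge> 2" using s' by (auto simp: x_def y_def)
  define L where "L = ln x"
  have L: "0 \<le> L" "L \<le> 2 * y" using ln_le_2sqrt[of x] xy(3) by (auto simp: L_def y_def)
  have c0: "0 \<le> c" using cd0[OF s'(1)] by (simp add: c_def)
  have l1: "1 \<le> l" using lam1 by (simp add: l_def)
  have c_eq: "c = a * L / (x * x)" by (simp add: c_def cdec_def x_def L_def power2_eq_square)
  have l_eq: "l = 1 + a * (L * L) / 2" by (simp add: l_def wlam_def x_def L_def power2_eq_square)
  have q_eq: "q = (4 * a + 4 * a * a) / (y * y * y)"
  proof -
   have "q = (k / 2) / (x * y)" by (simp add: q_def x_def y_def)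
   also have "k / 2 = 4 * a + 4 * a * a" by (simp add: k_def power2_eq_square)
   also have "x * y = y * y * y" by (simp add: xy(1))
   finally show ?thesis .
  qed
  have c1: "c \<le> 2 * a / (y * y * y)"
  proof -
   have "a * L \<le> a * (2 * y)" using a L by (intro mult_left_mono) auto
   then have "c \<le> a * (2 * y) / (x * x)" unfolding c_eq by (intro divide_right_mono) auto
   also have "\<dots> = 2 * a / (y * y * y)" using xy by (simp add: xy(1) mult_ac)
   finally show ?thesis .
  qed
  have c2: "c + l * c / x \<le> q"
  proof -
   have "L * L * L \<le> (2 * y) * (2 * y) * (2 * y)" using L by (intro mult_mono) auto
   then have "a * a * (L * L * L) \<le> a * a * (8 * (y * y * y))" using a by (intro mult_left_mono) auto
   then have "a * a * (L * L * L) / 2 / (x * x * x) \<le> a * a * (8 * (y * y * y)) / 2 / (x * x * x)" using xy by (intro divide_right_mono) auto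
   also have "\<dots> = 4 * a * a / (y * y * y)" using xy(2) by (simp add: xy(1))
   finally have i: "a * a * (L * L * L) / 2 / (x * x * x) \<le> 4 * a * a / (y * y * y)" .
   have "c / x \<le> c" using xy c0 by (simp add: field_simps mult_le_cancel_left1)
   moreover have "l * c / x = c / x + a * a * (L * L * L) / 2 / (x * x * x)"
   proof -
    have "a * (L * L) / 2 * (c / x) = a * a * (L * L * L) / 2 / (x * x * x)" unfolding c_eq by (simp add: mult_ac)
    moreover have "l * c / x = c / x + a * (L * L) / 2 * (c / x)" by (simp add: l_eq add_divide_distrib distrib_right)
    ultimately show ?thesis by simp
   qed
   ultimately have "c + l * c / x \<le> 2 * (2 * a / (y * y * y)) + 4 * a * a / (y * y * y)" using c1 i by linarith
   also have "\<dots> = q" unfolding q_eq by (simp add: add_divide_distrib)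
   finally show ?thesis .
  qed
  have q0: "0 \<le> q" "c \<le> q" using c2 c0 l1 xy by (auto intro: order_trans[of _ "c + l * c / x"])
  have A0: "0 \<le> A s" "0 \<le> B s" using uA[OF s'(2)] vB[OF s'(2)] norm_ge_zero order_trans by blast+
  have hs: "h s \<le> c * (A s / x + B s + r s)"
   unfolding h_def c_def[symmetric] x_def[symmetric] using uA[OF s'(2)] vB[OF s'(2)] xy c0
   by (intro mult_left_mono add_mono divide_right_mono) auto
  have "x * h s + l * h s \<le> x * (c * (A s / x + B s + r s)) + l * (c * (A s / x + B s + r s))"
   using hs xy l1 by (intro add_mono mult_left_mono) auto
  also have "\<dots> = (c + l * c / x) * A s + x * c * B s + c * (l * B s) + (x * c + l * c) * r s"
   using xy by (simp add: field_simps)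
  finally have 1: "x * h s + l * h s - x * c * B s \<le> (c + l * c / x) * A s + c * (l * B s) + (x * c + l * c) * r s" by simp
  have 2: "(c + l * c / x) * A s \<le> q * A s" "c * (l * B s) \<le> q * (l * B s)"
   using c2 q0 A0 l1 by (intro mult_right_mono; simp)+
  have 3: "(x * c + l * c) * r s = R * (x * c / l^2 + c / l)"
   using l1 by (simp add: r_def l_def[symmetric] power2_eq_square field_simps)
  have "c / l \<le> c" using l1 c0 by (simp add: field_simps mult_le_cancel_left1)
  then have 4: "(x * c + l * c) * r s \<le> R * (x * c / l^2 + q)" unfolding 3 using R q0 by (intro mult_left_mono) auto
  have Ms: "M s = A s + l * B s" by (simp add: M_def l_def)
  have 5: "- (R * (x * c / l^2 + q)) \<le> - (x * h s) + (x * c * B s - l * h s) + q * M s"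
   using 1 2 4 unfolding Ms by (simp add: algebra_simps)
  have R0: "0 \<le> R * (x * c / l^2 + q)" using R xy c0 q0 by (intro mult_nonneg_nonneg add_nonneg_nonneg) auto
  have "exp (- p s) * (- (R * (x * c / l^2 + q))) \<le> exp (- p s) * (- (x * h s) + (x * c * B s - l * h s) + q * M s)"
   using 5 by (rule mult_left_mono) simp
  moreover have "exp (- p s) * (R * (x * c / l^2 + q)) \<le> 1 * (R * (x * c / l^2 + q))"
   using R0 p01[OF s'(1)] by (intro mult_right_mono) auto
  ultimately have "0 \<le> exp (- p s) * (- (x * h s) + (x * c * B s - l * h s) + q * M s) + R * (x * c / l^2 + q)"
   by linarith
  then show "\<exists>y. (G has_real_derivative y) (at s) \<and> 0 \<le> y"
   by (intro exI[of _ "((- ((s + 2) * h s) + (((s + 2) * c) * B s + l * (- h s))) * exp (- p s) + M s * (exp (- p s) * q))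
   - R * (- ((s + 2) * c / l^2) - q)"] conjI DG) (simp add: x_def[symmetric] algebra_simps)
 qed
 have s0': "s0 \<ge> 0" "t \<ge> 0" using s0 by auto
 have il: "0 \<le> 1 / wlam a s" "1 / wlam a s \<le> 1" for s using lam1[of s] by (auto simp: field_simps)
 have Mt: "M t = norm (u t) + wlam a t * norm (v t)" by (simp add: M_def A_def B_def)
 have "M s0 * exp (- p s0) \<le> M t * exp (- p t) + R * (1 / wlam a s0 + p s0)"
  using mono R il[of t] p01[OF s0'(2)] unfolding G_def by (smt (verit) mult_nonneg_nonneg)
 also have "\<dots> \<le> M t * 1 + R * (1 + k)"
  using R il p01[OF s0'(1)] p01[OF s0'(2)] lam1[of t] unfolding Mt
  by (intro add_mono mult_left_mono add_mono) auto
 finally have "exp (p s0) * (M s0 * exp (- p s0)) \<le> exp (p s0) * (M t + R * (1 + k))" by (intro mult_left_mono) auto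
 then have "M s0 \<le> exp (p s0) * (M t + R * (1 + k))" by (simp add: exp_minus field_simps)
 also have "\<dots> \<le> exp k * ((1 + k) * (M t + R))"
 proof (rule mult_mono)
  show "exp (p s0) \<le> exp k" using p01[OF s0'(1)] by simp
  have "0 \<le> M t" unfolding Mt using lam1[of t] by auto
  then show "M t + R * (1 + k) \<le> (1 + k) * (M t + R)" using k by (simp add: algebra_simps)
  show "0 \<le> M t + R * (1 + k)" using \<open>0 \<le> M t\<close> R k by auto
 qed auto
 finally have "M s0 \<le> exp k * (1 + k) * (M t + R)" by (simp add: mult.assoc)
 moreover have "norm (u s0) + wlam a s0 * norm (v s0) \<le> M s0"
  unfolding M_def using uA[OF s0] vB[OF s0] lam1[of s0] by (intro add_mono mult_left_mono) auto
 ultimately show ?thesis by (simp add: k_def Mt add.assoc)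
qed

section \<open>Relativistic velocities\<close>

lemma norm_cross3_le: "norm (cross3 x y) \<le> norm x * norm (y::vec3)"
proof (rule power2_le_imp_le)
 have "0 \<le> (x \<bullet> y)^2" by simp
 then show "(norm (cross3 x y))^2 \<le> (norm x * norm y)^2" using norm_cross_dot[of x y] by linarith
qed simp

lemma bounded_bilinear_cross3: "bounded_bilinear (cross3 :: vec3 \<Rightarrow> vec3 \<Rightarrow> vec3)"
proof
 show "\<exists>K. \<forall>a b. norm (cross3 a b) \<le> norm (a::vec3) * norm b * K"
  by (intro exI[of _ 1]) (simp add: norm_cross3_le)
qed (simp_all add: cross_add_left cross_add_right cross_mult_left cross_mult_right)

text \<open>The Lorentz factor of the velocity \<open>w\<close>.\<close>

definition lor :: "vec3 \<Rightarrow> real" where "lor w = 1 / sqrt (1 - (norm w)^2)"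

text \<open>The relativistic energy at momentum \<open>p\<close>, that is, \<open>m\<close> times
  the Lorentz factor of the velocity.\<close>

definition vrad :: "real \<Rightarrow> vec3 \<Rightarrow> real" where "vrad m p = sqrt (m^2 + (norm p)^2)"

lemma vrad_pos: "0 < m \<Longrightarrow> 0 < vrad m p" "0 < m \<Longrightarrow> m \<le> vrad m p" "0 < m \<Longrightarrow> (vrad m p)^2 = m^2 + (norm p)^2"
 by (auto simp: vrad_def add_pos_nonneg real_le_rsqrt)

lemma vel_alt: "vel m p = (1 / vrad m p) *\<^sub>R p"
 by (simp add: vel_def vrad_def)

lemma norm_vel: "0 < m \<Longrightarrow> norm (vel m p) = norm p / vrad m p"
 using vrad_pos[of m p] by (simp add: vel_alt)

lemma one_minus_vel: "0 < m \<Longrightarrow> 1 - (norm (vel m p))^2 = (m / vrad m p)^2"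
 using vrad_pos[of m p] by (simp add: norm_vel power_divide field_simps)

lemma norm_vel_less_1: assumes "0 < m" shows "norm (vel m p) < 1"
proof -
 have "0 < 1 - (norm (vel m p))^2"
  unfolding one_minus_vel[OF assms] using assms vrad_pos[OF assms, of p] by simp
 then have "(norm (vel m p))^2 < 1^2" by simp
 then show ?thesis by (rule power_less_imp_less_base) simp
qed

lemma lor_vel: "0 < m \<Longrightarrow> lor (vel m p) = vrad m p / m"
 using vrad_pos[of m p] by (simp add: lor_def one_minus_vel real_sqrt_divide)

lemma vel_inv_alt: "vel_inv m w = (m * lor w) *\<^sub>R w"
 by (simp add: vel_inv_def lor_def)

lemma vel_inv_vel: "0 < m \<Longrightarrow> vel_inv m (vel m p) = p"
 using vrad_pos[of m p] by (simp add: vel_inv_alt lor_vel) (simp add: vel_alt)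

lemma vrad_vel_inv: assumes "0 < m" "norm w < 1" shows "vrad m (vel_inv m w) = m * lor w"
proof -
 have p: "0 < 1 - (norm w)^2" using assms by (simp add: power_less_one_iff abs_square_less_1)
 then have l: "lor w > 0" "(lor w)^2 = 1 / (1 - (norm w)^2)" by (auto simp: lor_def power_divide)
 have "m^2 + (norm (vel_inv m w))^2 = m^2 + m^2 * (lor w)^2 * (norm w)^2"
  by (simp add: vel_inv_alt power_mult_distrib)
 also have "\<dots> = m^2 * (lor w)^2" unfolding l(2) using p by (simp add: field_simps)
 finally have "vrad m (vel_inv m w) = sqrt ((m * lor w)^2)" by (simp add: vrad_def power_mult_distrib)
 then show ?thesis using assms l by simp
qed

lemma lor_pos: "norm w < 1 \<Longrightarrow> 0 < lor w"
 by (simp add: lor_def power_less_one_iff abs_square_less_1)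

lemma vel_vel_inv: "0 < m \<Longrightarrow> norm w < 1 \<Longrightarrow> vel m (vel_inv m w) = w"
 using lor_pos[of w] by (simp add: vel_alt vrad_vel_inv) (simp add: vel_inv_alt)

lemma range_vel: "0 < m \<Longrightarrow> range (vel m) = ball 0 1"
 using norm_vel_less_1 vel_vel_inv by (auto simp: image_iff) metis

lemma inj_vel: "0 < m \<Longrightarrow> inj (vel m)"
 by (metis injI vel_inv_vel)

lemma norm_vel_mono: assumes "0 < m" "norm p \<le> b" shows "norm (vel m p) \<le> b / sqrt (m^2 + b^2)"
proof -
 have b: "0 \<le> b" using assms norm_ge_zero[of p] by linarith
 have s: "0 < m^2 + b^2" "0 < m^2 + (norm p)^2" using assms by (auto intro: add_pos_nonneg)
 have "norm p * sqrt (m^2 + b^2) \<le> b * sqrt (m^2 + (norm p)^2)"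
 proof (rule power2_le_imp_le)
  have "(norm p)^2 \<le> b^2" using assms(2) by (simp add: power_mono)
  then have "m^2 * (norm p)^2 \<le> m^2 * b^2" by (rule mult_left_mono) simp
  then show "(norm p * sqrt (m^2 + b^2))^2 \<le> (b * sqrt (m^2 + (norm p)^2))^2"
   using s by (simp add: power_mult_distrib algebra_simps)
 qed (use b s in auto)
 then show ?thesis using s by (simp add: norm_vel[OF assms(1)] vrad_def field_simps)
qed

lemma has_derivative_add_norm_sq:
 "((\<lambda>p::vec3. c + (norm p)^2) has_derivative (\<lambda>h. 2 * (p \<bullet> h))) (at p within S)"
 unfolding power2_norm_eq_inner by (auto intro!: derivative_eq_intros simp: inner_commute)

definition dvel :: "real \<Rightarrow> vec3 \<Rightarrow> vec3 \<Rightarrow> vec3" where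
 "dvel m p h = (1 / vrad m p) *\<^sub>R (h - (vel m p \<bullet> h) *\<^sub>R vel m p)"

lemma vel_has_derivative: assumes "0 < m" shows "(vel m has_derivative dvel m p) (at p within S)"
proof -
 define y where "y = m^2 + (norm p)^2"
 have y: "0 < y" using assms by (simp add: y_def add_pos_nonneg)
 have r: "vrad m p = sqrt y" by (simp add: vrad_def y_def)
 have "((\<lambda>y. 1 / sqrt y) has_real_derivative - 1 / (2 * y * sqrt y)) (at y)"
  using y by (auto intro!: derivative_eq_intros simp: field_simps)
 then have "((\<lambda>p. 1 / sqrt (m^2 + (norm p)^2)) has_derivative (\<lambda>h. (2 * (p \<bullet> h)) * (- 1 / (2 * y * sqrt y)))) (at p within S)"
  unfolding y_def by (rule DERIV_compose_FDERIV[OF _ has_derivative_add_norm_sq])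
 from has_derivative_scaleR[OF this has_derivative_ident]
 have "(vel m has_derivative (\<lambda>h. (1 / sqrt y) *\<^sub>R h + ((2 * (p \<bullet> h)) * (- 1 / (2 * y * sqrt y))) *\<^sub>R p)) (at p within S)"
  by (simp add: vel_def[abs_def] y_def)
 moreover have "(1 / sqrt y) *\<^sub>R h + ((2 * (p \<bullet> h)) * (- 1 / (2 * y * sqrt y))) *\<^sub>R p = dvel m p h" for h
  using y by (simp add: dvel_def vel_alt r algebra_simps inner_commute real_sqrt_mult[symmetric])
 ultimately show ?thesis by simp
qed

lemma norm_dvel: assumes "0 < m" shows "norm (dvel m p h) \<le> 2 / m * norm h"
proof -
 have "norm (h - (vel m p \<bullet> h) *\<^sub>R vel m p) \<le> norm h + norm ((vel m p \<bullet> h) *\<^sub>R vel m p)" by (rule norm_triangle_ineq4)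
 also have "norm ((vel m p \<bullet> h) *\<^sub>R vel m p) \<le> (1 * norm h) * 1"
  unfolding norm_scaleR using norm_vel_less_1[OF assms, of p]
  by (intro mult_mono) (auto intro!: order_trans[OF Cauchy_Schwarz_ineq2] mult_left_le_one_le)
 finally have "norm (h - (vel m p \<bullet> h) *\<^sub>R vel m p) \<le> 2 * norm h" by simp
 moreover have "0 \<le> 1 / vrad m p" "1 / vrad m p \<le> 1 / m" using vrad_pos[OF assms, of p] assms by (auto simp: field_simps)
 ultimately have "(1 / vrad m p) * norm (h - (vel m p \<bullet> h) *\<^sub>R vel m p) \<le> (1 / m) * (2 * norm h)" by (intro mult_mono) (use assms in auto)
 then show ?thesis using vrad_pos[OF assms, of p] by (simp add: dvel_def)
qed

lemma vel_lipschitz: assumes "0 < m" shows "norm (vel m p - vel m p') \<le> 2 / m * norm (p - p')"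
 by (rule differentiable_bound[OF convex_UNIV vel_has_derivative[OF assms]])
  (use norm_dvel[OF assms] assms in \<open>auto intro!: onorm_bound\<close>)

text \<open>With v the velocity and r the energy, the derivative of the velocity map is (I - v v^T)
  / r. Its determinant is (1 - |v|^2) / r^3 = m^2 / r^5, and r is m times the Lorentz factor. In
  this form the Jacobian is a function of velocity, smooth on balls strictly inside the unit
  ball.\<close>

lemma Djac_eq: assumes "0 < m" shows "Djac m p = m ^ 3 * lor (vel m p) ^ 5"
proof -
 define r where "r = vrad m p"
 define v where "v = vel m p"
 have r: "0 < r" using vrad_pos(1)[OF assms] by (simp add: r_def)
 have f: "frechet_derivative (vel m) (at p) = dvel m p"
  using vel_has_derivative[OF assms] by (rule frechet_derivative_at[symmetric])
 have e: "matrix (dvel m p) $ i $ j = (1 / r) * ((if i = j then 1 else 0) - v $ j * v $ i)" for i j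
  by (simp add: matrix_def dvel_def r_def v_def inner_axis) (simp add: axis_def)
 define a where "a = 1 / r"
 have "det (matrix (dvel m p)) = a ^ 3 * (1 - (v $ 1 * v $ 1 + v $ 2 * v $ 2 + v $ 3 * v $ 3))"
  unfolding det_3 e a_def[symmetric] by (simp add: power3_eq_cube algebra_simps)
 also have "a = 1 / r" by (rule a_def)
 also have "v $ 1 * v $ 1 + v $ 2 * v $ 2 + v $ 3 * v $ 3 = (norm v)^2"
  by (simp add: power2_norm_eq_inner inner_vec_def sum_3)
 also have "1 - (norm v)^2 = (m / r)^2" unfolding v_def r_def by (rule one_minus_vel[OF assms])
 finally have "det (matrix (dvel m p)) = (1 / r) ^ 3 * (m / r)^2" .
 moreover have "0 \<le> (1 / r) ^ 3 * (m / r)^2" using r assms by simp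
 ultimately have d: "\<bar>det (matrix (dvel m p))\<bar> = (1 / r) ^ 3 * (m / r)^2" by simp
 show ?thesis
  unfolding Djac_def f lor_vel[OF assms] r_def[symmetric] d using r assms
  by (simp add: field_simps eval_nat_numeral)
qed

section \<open>Regularity of the Lorentz factor and of the inverse velocity map\<close>

lemma C1_on_norm_sq: "C1_on S (\<lambda>p::vec3. c + d * (norm p)^2)"
proof (rule C1_onI[of _ _ "\<lambda>p h. d * (2 * (p \<bullet> h))"])
 show "((\<lambda>p. c + d * (norm p)^2) has_derivative (\<lambda>h. d * (2 * (p \<bullet> h)))) (at p within S)" for p :: vec3
  using has_derivative_add[OF has_derivative_const[of c] has_derivative_mult_right[OF has_derivative_add_norm_sq[of 0 p S], of d]]
  by simp
qed (auto intro!: continuous_intros)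

lemma C1_on_vel: assumes "0 < m" shows "C1_on S (vel m)"
proof -
 have "C1_on S (\<lambda>p. 1 / sqrt (m^2 + 1 * (norm p)^2))"
 proof (rule C1_on_real_fun[OF C1_on_norm_sq, of "{0<..}" _ "\<lambda>y. - 1 / (2 * y * sqrt y)"])
  show "((\<lambda>y. 1 / sqrt y) has_real_derivative - 1 / (2 * y * sqrt y)) (at y)" if "y \<in> {0<..}" for y
   using that by (auto intro!: derivative_eq_intros simp: field_simps)
 qed (use assms in \<open>auto intro!: continuous_intros add_pos_nonneg\<close>)
 from C1_on_bilinear[OF bounded_bilinear_scaleR this C1_on_linear[OF bounded_linear_ident]]
 show ?thesis by (simp add: vel_def[abs_def])
qed

lemma C1_on_lor: "C1_on (ball 0 1) lor"
proof -
 have "C1_on (ball 0 1) (\<lambda>p::vec3. 1 / sqrt (1 + (-1) * (norm p)^2))"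
 proof (rule C1_on_real_fun[OF C1_on_norm_sq, of "{0<..}" _ "\<lambda>y. - 1 / (2 * y * sqrt y)"])
  show "((\<lambda>y. 1 / sqrt y) has_real_derivative - 1 / (2 * y * sqrt y)) (at y)" if "y \<in> {0<..}" for y
   using that by (auto intro!: derivative_eq_intros simp: field_simps)
 qed (auto intro!: continuous_intros simp: power_less_one_iff abs_square_less_1)
 then show ?thesis by (simp add: lor_def[abs_def])
qed

lemma C1_on_vel_inv: "C1_on (ball 0 1) (vel_inv m)"
proof -
 have "C1_on (ball 0 1) (\<lambda>w. (m * lor w) *\<^sub>R w)"
  by (intro C1_on_bilinear[OF bounded_bilinear_scaleR] C1_on_linear bounded_linear_ident
    C1_on_blinear_compose[OF bounded_linear_mult_right] C1_on_lor)
 then show ?thesis by (simp add: vel_inv_alt[abs_def])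
qed

lemma C1_on_lor_power: "C1_on (ball 0 1) (\<lambda>w. lor w ^ n)"
 by (induction n) (auto intro!: C1_on_const C1_on_bilinear[OF bounded_bilinear_mult] C1_on_lor)

lemma C11_precompose:
 assumes f: "C11 M \<sigma> S f" and l: "bounded_linear l" "\<And>x. norm (l x) \<le> norm x" and sub: "l ` T \<subseteq> S"
 shows "C11 M \<sigma> T (\<lambda>x. f (l x))"
proof -
 interpret bounded_linear l by fact
 note f0 = C11D(1,2)[OF f]
 have T: "l x \<in> S" if "x \<in> T" for x using that sub by auto
 have dl: "norm (l x - l y) \<le> norm (x - y)" for x y using l(2)[of "x - y"] by (simp add: diff)
 show ?thesis
 proof (rule C11I)
  show "norm (f (l x)) \<le> M" if "x \<in> T" for x by (rule C11D(3)[OF f T[OF that]])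
  show "norm (f (l x) - f (l y)) \<le> M * \<sigma> * norm (x - y)" if "x \<in> T" "y \<in> T" for x y
   by (rule order_trans[OF C11D(4)[OF f T T]]) (use that f0 dl in \<open>auto intro!: mult_left_mono\<close>)
  fix a b c d assume h: "a \<in> T" "b \<in> T" "c \<in> T" "d \<in> T"
  have e: "norm (l d - l c - l b + l a) \<le> norm (d - c - b + a)" using l(2)[of "d - c - b + a"] by (simp add: diff add)
  show "norm (f (l d) - f (l c) - f (l b) + f (l a)) \<le>
   M * mod4 \<sigma> a b c d"
   by (rule order_trans[OF C11D(5)[OF f T T T T]])
    (use h f0 in \<open>auto intro!: mult_left_mono mult_mono add_mono dl e\<close>)
 qed (use f0 in auto)
qed

lemma C11_id_cball: assumes "\<gamma> \<le> 1" shows "C11 1 1 (cball 0 \<gamma>) (\<lambda>w::'a::real_normed_vector. w)"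
 by (rule C11_bounded_linear) (use assms in \<open>auto intro: bounded_linear_ident\<close>)

lemma one_minus_norm_sq_bounds:
 assumes "0 \<le> \<gamma>" "\<gamma> < 1" "w \<in> cball 0 \<gamma>"
 shows "1 - (norm (w::vec3))^2 \<in> {1 - \<gamma>^2..1}" "0 < 1 - \<gamma>^2"
 using assms by (auto simp: power_mono abs_square_less_1 power_less_one_iff)

text \<open>On a ball of radius \<gamma> < 1 the argument 1 - |w|^2 stays in a compact interval of
  positive numbers, where functions singular at 0, such as the square root and its reciprocal, have
  bounded derivatives.\<close>

lemma C11_fun_norm_sq:
 assumes g: "0 \<le> \<gamma>" "\<gamma> < 1"
  and d1: "\<And>x. x > 0 \<Longrightarrow> (f has_real_derivative f' x) (at x)"
  and d2: "\<And>x. x > 0 \<Longrightarrow> (f' has_real_derivative f'' x) (at x)"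
  and c: "continuous_on {0<..} f''"
 shows "\<exists>M. C11 M 1 (cball 0 \<gamma>) (\<lambda>w::vec3. f (1 - (norm w)^2))"
proof -
 have pos: "x > 0" if "x \<in> {1 - \<gamma>^2..1}" for x
  using one_minus_norm_sq_bounds(2)[OF g, of 0] g that by auto
 obtain M where M: "C11 M 1 {1 - \<gamma>^2..1} f"
  using C11_real_C2[of "1 - \<gamma>^2" 1 f f' f''] d1 d2 pos continuous_on_subset[OF c, of "{1 - \<gamma>^2..1}"] by blast
 have i: "C11 1 1 (cball 0 \<gamma>) (\<lambda>w::vec3. w)" using g by (intro C11_id_cball) auto
 have "C11 (4 * 1 * 1 * 1) 1 (cball 0 \<gamma>) (\<lambda>w::vec3. w \<bullet> w)"
  by (rule C11_bilinear[OF bounded_bilinear_inner _ _ i i]) (auto simp: Cauchy_Schwarz_ineq2)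
 then have a: "C11 (norm (1::real) + 1 * 4) 1 (cball 0 \<gamma>) (\<lambda>w::vec3. 1 + - (w \<bullet> w))"
  by (intro C11_add C11_linear[OF bounded_linear_minus[OF bounded_linear_ident]]) (auto intro: C11_mono[OF C11_const])
 have "\<exists>M. C11 M 1 (cball 0 \<gamma>) (\<lambda>w::vec3. f (1 + - (w \<bullet> w)))"
  by (intro exI, rule C11_compose[OF a M])
   (use one_minus_norm_sq_bounds(1)[OF g] in \<open>auto simp: power2_norm_eq_inner\<close>)
 then show ?thesis by (simp add: power2_norm_eq_inner)
qed

lemma C11_lor: assumes g: "0 \<le> \<gamma>" "\<gamma> < 1" shows "\<exists>M. C11 M 1 (cball 0 \<gamma>) lor"
 unfolding lor_def[abs_def]
proof (rule C11_fun_norm_sq[OF g])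
 show "((\<lambda>y. 1 / sqrt y) has_real_derivative - 1 / (2 * y * sqrt y)) (at y)" if "y > 0" for y
  using that by (auto intro!: derivative_eq_intros simp: field_simps)
 show "((\<lambda>y. - 1 / (2 * y * sqrt y)) has_real_derivative 3 / (4 * y^2 * sqrt y)) (at y)" if "y > 0" for y
  using that by (auto intro!: derivative_eq_intros simp: field_simps power2_eq_square)
qed (auto intro!: continuous_intros)

lemma C11_sqrt_one_minus: assumes g: "0 \<le> \<gamma>" "\<gamma> < 1" shows "\<exists>M. C11 M 1 (cball 0 \<gamma>) (\<lambda>w::vec3. sqrt (1 - (norm w)^2))"
proof (rule C11_fun_norm_sq[OF g])
 show "(sqrt has_real_derivative 1 / (2 * sqrt y)) (at y)" if "y > 0" for y
  using that by (auto intro!: derivative_eq_intros simp: field_simps)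
 show "((\<lambda>y. 1 / (2 * sqrt y)) has_real_derivative - 1 / (4 * y * sqrt y)) (at y)" if "y > 0" for y
  using that by (auto intro!: derivative_eq_intros simp: field_simps power2_eq_square)
qed (auto intro!: continuous_intros)

lemma C11_lor_power: assumes g: "0 \<le> \<gamma>" "\<gamma> < 1" shows "\<exists>M. C11 M 1 (cball 0 \<gamma>) (\<lambda>w. lor w ^ n)"
proof (induction n)
 case 0
 have "C11 (norm (1::real)) 1 (cball 0 \<gamma>) (\<lambda>w::vec3. 1::real)" by (rule C11_mono[OF C11_const]) auto
 then show ?case by auto
next
 case (Suc n)
 then obtain M where M: "C11 M 1 (cball 0 \<gamma>) (\<lambda>w. lor w ^ n)" ..
 obtain M' where "C11 M' 1 (cball 0 \<gamma>) lor" using C11_lor[OF g] ..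
 from C11_bilinear[OF bounded_bilinear_mult _ _ this M, of 1] show ?case by (auto simp: abs_mult)
qed

lemma C11_vel_inv: assumes g: "0 \<le> \<gamma>" "\<gamma> < 1" shows "\<exists>M. C11 M 1 (cball 0 \<gamma>) (vel_inv m)"
proof -
 obtain M' where "C11 M' 1 (cball 0 \<gamma>) lor" using C11_lor[OF g] ..
 from C11_linear[OF bounded_linear_mult_right[of m] _ _ this, of "\<bar>m\<bar>"]
 have "C11 (\<bar>m\<bar> * M') 1 (cball 0 \<gamma>) (\<lambda>w. m * lor w)" by (auto simp: abs_mult)
 from C11_bilinear[OF bounded_bilinear_scaleR _ _ this C11_id_cball, of 1]
 show ?thesis unfolding vel_inv_alt[abs_def] using g by auto
qed

text \<open>The acceleration of a particle with velocity \<open>w\<close>: the Lorentz force as seen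
  through the derivative of the velocity map (\<open>dvel_force\<close>). Velocity replaces momentum
  as the unknown because free streaming is linear in it.\<close>

definition acc :: "real \<Rightarrow> real \<Rightarrow> vec3 \<Rightarrow> vec3 \<Rightarrow> vec3 \<Rightarrow> vec3" where
 "acc m q E B w = (q / m) *\<^sub>R sqrt (1 - (norm w)^2) *\<^sub>R (E + cross3 w B + - ((w \<bullet> E) *\<^sub>R w))"

lemma dvel_force: assumes "0 < m"
 shows "dvel m p (q *\<^sub>R (E + cross3 (vel m p) B)) = acc m q E B (vel m p)"
proof -
 have "sqrt (1 - (norm (vel m p))^2) = m / vrad m p"
  unfolding one_minus_vel[OF assms] using assms vrad_pos(1)[OF assms, of p] by simp
 moreover have "vel m p \<bullet> cross3 (vel m p) B = 0" by (simp add: dot_cross_self)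
 ultimately show ?thesis
  using assms by (simp add: dvel_def acc_def inner_add_right algebra_simps)
qed

text \<open>The acceleration is linear in the fields, so its bound is linear in theirs.
  \<open>K\<close> is chosen before \<open>A\<close> and the fields, hence it is the same for all
  times.\<close>

lemma acc_C11:
 assumes g: "0 \<le> \<gamma>" "\<gamma> < 1"
 shows "\<exists>K\<ge>0. \<forall>A S E B. C11 A 1 S E \<and> C11 A 1 S B \<longrightarrow>
  C11 (K * A) 1 (S \<times> cball 0 \<gamma>) (\<lambda>z::vec3 \<times> vec3. acc m q (E (fst z)) (B (fst z)) (snd z))"
proof -
 obtain Ms where Ms: "C11 Ms 1 (cball 0 \<gamma>) (\<lambda>w::vec3. sqrt (1 - (norm w)^2))"
  using C11_sqrt_one_minus[OF g] by blast
 have Ms0: "0 \<le> Ms" using C11D(1)[OF Ms] .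
 show ?thesis
 proof (intro exI[of _ "\<bar>q / m\<bar> * (4 * 1 * Ms * 21)"] conjI allI impI)
  fix A and S :: "vec3 set" and E B :: "vec3 \<Rightarrow> vec3"
  assume EB: "C11 A 1 S E \<and> C11 A 1 S B"
  let ?S = "S \<times> cball (0::vec3) \<gamma>"
  have nf: "norm (fst z) \<le> norm z" "norm (snd z) \<le> norm z" for z :: "vec3 \<times> vec3"
   by (auto simp: norm_prod_def real_le_rsqrt)
  have E': "C11 A 1 ?S (\<lambda>z. E (fst z))" and B': "C11 A 1 ?S (\<lambda>z. B (fst z))"
   by (rule C11_precompose[OF _ bounded_linear_fst nf(1)], use EB in auto)+
  have i: "C11 1 1 (cball 0 \<gamma>) (\<lambda>w::vec3. w)" using g by (intro C11_id_cball) auto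
  have w: "C11 1 1 ?S (\<lambda>z. snd z)" and s: "C11 Ms 1 ?S (\<lambda>z. sqrt (1 - (norm (snd z))^2))"
   by (rule C11_precompose[OF _ bounded_linear_snd nf(2)], use i Ms in auto)+
  \<comment> \<open>The summands are E, w x B and (w.E) w. Each bilinear operation contributes a
    factor 4, hence 1 + 4 + 16 = 21; the product with the square root brings the further factor
    \<open>4 * Ms\<close>.\<close>
  have "C11 (A + 4 * 1 * 1 * A + 1 * (4 * 1 * (4 * 1 * 1 * A) * 1)) 1 ?S
   (\<lambda>z. E (fst z) + cross3 (snd z) (B (fst z)) + - ((snd z \<bullet> E (fst z)) *\<^sub>R snd z))"
   by (intro C11_add E' C11_linear[OF bounded_linear_minus[OF bounded_linear_ident]]
     C11_bilinear[OF bounded_bilinear_cross3 _ _ w B'] C11_bilinear[OF bounded_bilinear_scaleR _ _ _ w]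
     C11_bilinear[OF bounded_bilinear_inner _ _ w E'])
    (auto simp: norm_cross3_le Cauchy_Schwarz_ineq2)
  then have "C11 (21 * A) 1 ?S (\<lambda>z. E (fst z) + cross3 (snd z) (B (fst z)) + - ((snd z \<bullet> E (fst z)) *\<^sub>R snd z))"
   by simp
  from C11_linear[OF bounded_linear_scaleR_right[of "q / m"] _ _ C11_bilinear[OF bounded_bilinear_scaleR _ _ s this, of 1], of "\<bar>q / m\<bar>"]
  show "C11 (\<bar>q / m\<bar> * (4 * 1 * Ms * 21) * A) 1 ?S (\<lambda>z. acc m q (E (fst z)) (B (fst z)) (snd z))"
   by (simp add: acc_def mult.assoc)
 qed (use Ms0 in simp)
qed

section \<open>Characteristics\<close>

lemma norm_fst_snd_le: "norm (fst z) \<le> norm z" "norm (snd z) \<le> norm z"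
 "norm z \<le> norm (fst z) + norm (snd z)" for z :: "'a::real_normed_vector \<times> 'b::real_normed_vector"
 using norm_Pair_le[of "fst z" "snd z"] by (auto simp: norm_prod_def real_le_rsqrt)

text \<open>One species in prescribed fields; the coupling through Maxwell's equations enters only
  after the species are summed. \<open>K0\<close> stands for the product of the constants in the
  assumed field bounds.\<close>

locale species =
 fixes m q L \<beta> K0 :: real and E B :: "real \<Rightarrow> vec3 \<Rightarrow> vec3"
  and g :: "real \<Rightarrow> vec3 \<Rightarrow> vec3 \<Rightarrow> real" and g0 :: "vec3 \<Rightarrow> vec3 \<Rightarrow> real"
 assumes m: "0 < m" and L: "0 < L" and \<beta>: "0 < \<beta>"
  and C1g: "C1_on {z. fst z \<ge> 0} (\<lambda>z::real \<times> vec3 \<times> vec3. g (fst z) (fst (snd z)) (snd (snd z)))"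
  and C1E: "C1_on {z. fst z \<ge> 0} (\<lambda>z::real \<times> vec3. E (fst z) (snd z))"
  and C1B: "C1_on {z. fst z \<ge> 0} (\<lambda>z::real \<times> vec3. B (fst z) (snd z))"
  and CkE: "\<And>t. 0 \<le> t \<Longrightarrow> Ck 2 (E t)" and CkB: "\<And>t. 0 \<le> t \<Longrightarrow> Ck 2 (B t)"
  and g_init: "\<And>x p. g 0 x p = g0 x p"
  and Ck0: "Ck 2 (\<lambda>z. g0 (fst z) (snd z))"
  and g0_nonneg: "\<And>x p. 0 \<le> g0 x p"
  and g0_supp: "\<And>x p. g0 x p \<noteq> 0 \<Longrightarrow> norm x \<le> L \<and> norm p \<le> L"
  and vlasov: "\<And>t x p. 0 < t \<Longrightarrow>
    frechet_derivative (\<lambda>z::real \<times> vec3 \<times> vec3. g (fst z) (fst (snd z)) (snd (snd z))) (at (t, x, p))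
     (1, vel m p, q *\<^sub>R (E t x + cross3 (vel m p) (B t x))) = 0"
  and g_supp: "\<And>t x p. 0 \<le> t \<Longrightarrow> \<beta> \<le> norm p \<Longrightarrow> g t x p = 0"
  and vanish: "\<And>t x. 0 \<le> t \<Longrightarrow> t + L < norm x \<Longrightarrow> E t x = 0 \<and> B t x = 0"
  and bound0: "\<And>t x. 0 \<le> t \<Longrightarrow> norm x \<le> t + L \<Longrightarrow> norm (E t x) + norm (B t x) \<le> K0 / ((t + 1) * (t - norm x + 2 * L))"
  and bound1: "\<And>t x. 0 \<le> t \<Longrightarrow> norm x \<le> t + L \<Longrightarrow> Dk_abs 1 (E t) x + Dk_abs 1 (B t) x \<le> K0 * ln (t + 2) / ((t + 1) * (t - norm x + 2 * L) ^ 2)"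
  and bound2: "\<And>t x. 0 \<le> t \<Longrightarrow> norm x \<le> t + L \<Longrightarrow> Dk_abs 2 (E t) x + Dk_abs 2 (B t) x \<le> K0 * ln (t + 2) / ((t + 1) * (t - norm x + 2 * L) ^ 3)"
begin

text \<open>The speed at momentum \<beta>. It bounds all speeds in the support and is strictly less
  than 1, so particles separate linearly from the light cone.\<close>

definition \<gamma> :: real where "\<gamma> = \<beta> / sqrt (m^2 + \<beta>^2)"

lemma \<gamma>: "0 \<le> \<gamma>" "\<gamma> < 1"
proof -
 have "sqrt (\<beta>^2) < sqrt (m^2 + \<beta>^2)" using m by (intro real_sqrt_less_mono) simp
 then have "\<beta> < sqrt (m^2 + \<beta>^2)" using \<beta> by simp
 then show "0 \<le> \<gamma>" "\<gamma> < 1" using \<beta> by (auto simp: \<gamma>_def intro!: divide_nonneg_pos iffD2[OF divide_less_eq_1_pos] order.strict_trans[of 0 \<beta>])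
qed

lemma vel_le_\<gamma>: "norm p \<le> \<beta> \<Longrightarrow> norm (vel m p) \<le> \<gamma>"
 unfolding \<gamma>_def by (rule norm_vel_mono[OF m])

lemma K0: "0 \<le> K0"
proof -
 have "0 \<le> K0 / ((0 + 1) * (0 - norm (0::vec3) + 2 * L))"
  using bound0[of 0 0] L norm_ge_zero[of "E 0 0"] norm_ge_zero[of "B 0 0"] by (smt (verit) norm_zero)
 then show ?thesis using L by (simp add: zero_le_divide_iff)
qed

lemma Dk_abs_nonneg: "0 \<le> Dk_abs k h x"
 unfolding Dk_abs_def by (intro sum_nonneg) auto

lemma field_sup: assumes "0 \<le> t" shows "norm (E t x) \<le> K0 / L" "norm (B t x) \<le> K0 / L"
proof -
 have "norm (E t x) + norm (B t x) \<le> K0 / L"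
 proof (cases "norm x \<le> t + L")
  case True
  have "L * 1 \<le> (t - norm x + 2 * L) * (t + 1)" using assms True L by (intro mult_mono) auto
  then have "K0 / ((t + 1) * (t - norm x + 2 * L)) \<le> K0 / L" using K0 L by (intro divide_left_mono) (auto simp: mult.commute intro: mult_pos_pos)
  then show ?thesis using bound0[OF assms True] by linarith
 next
  case False then show ?thesis using vanish[OF assms, of x] K0 L by simp
 qed
 then show "norm (E t x) \<le> K0 / L" "norm (B t x) \<le> K0 / L"
  using norm_ge_zero[of "E t x"] norm_ge_zero[of "B t x"] by linarith+
qed

text \<open>Inside the support cone \<open>t - norm x + 2 * L\<close> is at least \<open>L\<close>;
  outside, the field is zero in a neighbourhood and so is its derivative. This crude global bound,
  growing with time, serves existence and stability of characteristics on bounded intervals.\<close>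

lemma field_lipschitz_aux:
 fixes H :: "vec3 \<Rightarrow> vec3"
 assumes t: "0 \<le> t" and ck: "Ck 2 H" and z: "\<And>x. t + L < norm x \<Longrightarrow> H x = (0::vec3)"
  and b: "\<And>x. norm x \<le> t + L \<Longrightarrow> Dk_abs 1 H x \<le> K0 * ln (t + 2) / ((t + 1) * (t - norm x + 2 * L) ^ 2)"
 shows "norm (H x - H y) \<le> (K0 * ln (t + 2) / L^2) * norm (x - y)"
proof (rule differentiable_bound[where f = H and f' = "\<lambda>x. frechet_derivative H (at x)", OF convex_UNIV])
 show "(H has_derivative frechet_derivative H (at x)) (at x within UNIV)" for x using Ck2_D(1)[OF ck] by simp
 have k: "0 \<le> K0 * ln (t + 2) / L^2" using K0 t by (simp add: )
 show "onorm (frechet_derivative H (at x)) \<le> K0 * ln (t + 2) / L^2" for x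
 proof (rule onorm_bound[OF k])
  fix h
  show "norm (frechet_derivative H (at x) h) \<le> K0 * ln (t + 2) / L^2 * norm h"
  proof (cases "norm x \<le> t + L")
   case True
   have "norm (frechet_derivative H (at x) h) \<le> Dk_abs 1 H x * norm h"
    unfolding Dk_abs_1 by (rule bounded_linear_basis_bound[OF has_derivative_bounded_linear[OF Ck2_D(1)[OF ck]]])
   moreover have "Dk_abs 1 H x \<le> K0 * ln (t + 2) / L^2"
   proof -
    have "1 * L^2 \<le> (t + 1) * (t - norm x + 2 * L)^2" using t True L by (intro mult_mono power_mono) auto
    then have "K0 * ln (t + 2) / ((t + 1) * (t - norm x + 2 * L)^2) \<le> K0 * ln (t + 2) / L^2"
     using K0 L t True by (intro divide_left_mono) (auto intro!: mult_pos_pos)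
    then show ?thesis using b[OF True] by linarith
   qed
   ultimately show ?thesis by (meson mult_right_mono norm_ge_zero order_trans)
  next
   case False
   have "open {x::vec3. t + L < norm x}" by (intro open_Collect_less continuous_intros)
   from has_derivative_transform_within_open[OF has_derivative_const this, of x 0 H UNIV]
   have "(H has_derivative (\<lambda>_. 0)) (at x)" using z False by auto
   then have "frechet_derivative H (at x) = (\<lambda>_. 0)" by (rule frechet_derivative_at[symmetric])
   then show ?thesis using mult_nonneg_nonneg[OF k norm_ge_zero[of h]] by simp
  qed
 qed
qed auto

lemma field_lipschitz:
 assumes "0 \<le> t" "t \<le> T"
 shows "norm (E t x - E t y) \<le> (K0 * ln (T + 2) / L^2) * norm (x - y)"
  "norm (B t x - B t y) \<le> (K0 * ln (T + 2) / L^2) * norm (x - y)"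
proof -
 have "(K0 * ln (t + 2) / L^2) * norm (x - y) \<le> (K0 * ln (T + 2) / L^2) * norm (x - y)"
  using assms K0 by (intro mult_right_mono divide_right_mono mult_left_mono) auto
 moreover have "norm (E t x - E t y) \<le> (K0 * ln (t + 2) / L^2) * norm (x - y)"
 proof (rule field_lipschitz_aux[OF assms(1) CkE[OF assms(1)]])
  show "Dk_abs 1 (E t) x \<le> K0 * ln (t + 2) / ((t + 1) * (t - norm x + 2 * L)^2)" if "norm x \<le> t + L" for x
   using bound1[OF assms(1) that] Dk_abs_nonneg[of 1 "E t" x] Dk_abs_nonneg[of 1 "B t" x] by linarith
 qed (use vanish[OF assms(1)] in auto)
 moreover have "norm (B t x - B t y) \<le> (K0 * ln (t + 2) / L^2) * norm (x - y)"
 proof (rule field_lipschitz_aux[OF assms(1) CkB[OF assms(1)]])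
  show "Dk_abs 1 (B t) x \<le> K0 * ln (t + 2) / ((t + 1) * (t - norm x + 2 * L)^2)" if "norm x \<le> t + L" for x
   using bound1[OF assms(1) that] Dk_abs_nonneg[of 1 "E t" x] Dk_abs_nonneg[of 1 "B t" x] by linarith
 qed (use vanish[OF assms(1)] in auto)
 ultimately show "norm (E t x - E t y) \<le> (K0 * ln (T + 2) / L^2) * norm (x - y)"
  "norm (B t x - B t y) \<le> (K0 * ln (T + 2) / L^2) * norm (x - y)" by linarith+
qed

section \<open>Characteristics on bounded time intervals\<close>

definition force :: "real \<Rightarrow> vec3 \<Rightarrow> vec3 \<Rightarrow> vec3" where
 "force t x p = q *\<^sub>R (E t x + cross3 (vel m p) (B t x))"

definition vf :: "real \<Rightarrow> vec3 \<times> vec3 \<Rightarrow> vec3 \<times> vec3" where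
 "vf t z = (vel m (snd z), force t (fst z) (snd z))"

lemma vf_lipschitz: "\<exists>Lc\<ge>0. \<forall>t\<in>{0..T}. \<forall>z z'. norm (vf t z - vf t z') \<le> Lc * norm (z - z')"
proof -
 define Le where "Le = K0 * ln (T + 2) / L^2"
 define Lc where "Lc = 2 / m + \<bar>q\<bar> * (2 * \<bar>Le\<bar> + 2 / m * (K0 / L))"
 have "norm (vf t z - vf t z') \<le> Lc * norm (z - z')" if t: "t \<in> {0..T}" for t z z'
 proof -
  define x where "x = fst z" define p where "p = snd z"
  define x' where "x' = fst z'" define p' where "p' = snd z'"
  define n where "n = norm (z - z')"
  have n: "norm (x - x') \<le> n" "norm (p - p') \<le> n" "0 \<le> n"
   using norm_fst_snd_le[of "z - z'"] by (auto simp: x_def x'_def p_def p'_def n_def)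
  have t': "0 \<le> t" "t \<le> T" using t by auto
  have v: "norm (vel m p - vel m p') \<le> 2 / m * n"
   using vel_lipschitz[OF m, of p p'] n m by (smt (verit) divide_nonneg_pos mult_left_mono)
  have e: "norm (E t x - E t x') \<le> \<bar>Le\<bar> * n" "norm (B t x - B t x') \<le> \<bar>Le\<bar> * n"
   using field_lipschitz[OF t', of x x'] n unfolding Le_def[symmetric]
   by (smt (verit) mult_mono norm_ge_zero)+
  have "cross3 (vel m p) (B t x) - cross3 (vel m p') (B t x') =
   cross3 (vel m p - vel m p') (B t x) + cross3 (vel m p') (B t x - B t x')"
   by (simp add: Cross3.left_diff_distrib Cross3.right_diff_distrib)
  moreover have "norm (cross3 (vel m p - vel m p') (B t x)) \<le> (2 / m * n) * (K0 / L)"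
   by (rule order_trans[OF norm_cross3_le mult_mono[OF v field_sup(2)[OF t'(1)]]]) (use m n in auto)
  moreover have "norm (cross3 (vel m p') (B t x - B t x')) \<le> 1 * (\<bar>Le\<bar> * n)"
   by (rule order_trans[OF norm_cross3_le mult_mono[OF _ e(2)]]) (use norm_vel_less_1[OF m, of p'] in auto)
  ultimately have c: "norm (cross3 (vel m p) (B t x) - cross3 (vel m p') (B t x')) \<le> (2 / m * n) * (K0 / L) + \<bar>Le\<bar> * n"
   by (metis add_mono norm_triangle_le mult_1)
  have "force t x p - force t x' p' = q *\<^sub>R ((E t x - E t x') + (cross3 (vel m p) (B t x) - cross3 (vel m p') (B t x')))"
   by (simp add: force_def algebra_simps)
  then have "norm (force t x p - force t x' p') \<le> \<bar>q\<bar> * (\<bar>Le\<bar> * n + ((2 / m * n) * (K0 / L) + \<bar>Le\<bar> * n))"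
   using norm_triangle_le[OF add_mono[OF e(1) c]] by (simp add: mult_left_mono)
  moreover have "norm (vf t z - vf t z') \<le> norm (vel m p - vel m p') + norm (force t x p - force t x' p')"
   using norm_fst_snd_le(3)[of "vf t z - vf t z'"] by (simp add: vf_def x_def p_def x'_def p'_def)
  ultimately have "norm (vf t z - vf t z') \<le> 2 / m * n + \<bar>q\<bar> * (\<bar>Le\<bar> * n + ((2 / m * n) * (K0 / L) + \<bar>Le\<bar> * n))"
   using v by linarith
  also have "\<dots> = Lc * n" by (simp add: Lc_def algebra_simps)
  finally show ?thesis by (simp add: n_def)
 qed
 moreover have "0 \<le> Lc" using m K0 L by (simp add: Lc_def)
 ultimately show ?thesis by blast
qed

lemma continuous_field:
 assumes "continuous_on S a" "continuous_on S b" "\<And>z. z \<in> S \<Longrightarrow> 0 \<le> a z"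
 shows "continuous_on S (\<lambda>z. E (a z) (b z))" "continuous_on S (\<lambda>z. B (a z) (b z))"
proof -
 have "(\<lambda>z. (a z, b z)) ` S \<subseteq> {z. 0 \<le> fst z}" using assms(3) by auto
 from continuous_on_compose2[OF C1_on_continuous_on[OF C1E] continuous_on_Pair[OF assms(1,2)] this]
  continuous_on_compose2[OF C1_on_continuous_on[OF C1B] continuous_on_Pair[OF assms(1,2)] this]
 show "continuous_on S (\<lambda>z. E (a z) (b z))" "continuous_on S (\<lambda>z. B (a z) (b z))" by simp_all
qed

lemma continuous_vel: "continuous_on S b \<Longrightarrow> continuous_on S (\<lambda>z. vel m (b z))"
 by (rule continuous_on_compose2[OF C1_on_continuous_on[OF C1_on_vel[OF m, of UNIV]]]) auto

lemma continuous_vf: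
 assumes "continuous_on S a" "continuous_on S b" "\<And>z. z \<in> S \<Longrightarrow> 0 \<le> a z"
 shows "continuous_on S (\<lambda>z. vf (a z) (b z))"
 unfolding vf_def force_def
 by (intro continuous_intros continuous_field continuous_vel bounded_bilinear.continuous_on[OF bounded_bilinear_cross3] assms)

definition sol :: "real \<Rightarrow> real \<Rightarrow> (real \<Rightarrow> vec3) \<Rightarrow> (real \<Rightarrow> vec3) \<Rightarrow> bool" where
 "sol a b X P \<longleftrightarrow> (\<forall>s\<in>{a..b}. (X has_vector_derivative vel m (P s)) (at s within {a..b}) \<and>
   (P has_vector_derivative force s (X s) (P s)) (at s within {a..b}))"

lemma sol_pair: assumes "sol a b X P" "s \<in> {a..b}"
 shows "((\<lambda>s. (X s, P s)) has_vector_derivative vf s (X s, P s)) (at s within {a..b})"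
 using has_vector_derivative_Pair[of X "vel m (P s)" s "{a..b}" P "force s (X s) (P s)"] assms
 unfolding sol_def by (simp add: vf_def)

lemma sol_of_pair:
 assumes "\<And>s. s \<in> {a..b} \<Longrightarrow> (Z has_vector_derivative vf s (Z s)) (at s within {a..b})"
 shows "sol a b (\<lambda>s. fst (Z s)) (\<lambda>s. snd (Z s))"
 using bounded_linear.has_vector_derivative[OF bounded_linear_fst assms]
  bounded_linear.has_vector_derivative[OF bounded_linear_snd assms]
 unfolding sol_def by (simp add: vf_def)

lemma sol_subset: "sol a b X P \<Longrightarrow> a \<le> a' \<Longrightarrow> b' \<le> b \<Longrightarrow> sol a' b' X P"
 unfolding sol_def by (auto intro: has_vector_derivative_within_subset[where S = "{a..b}"])

lemma sol_continuous: assumes "sol a b X P" shows "continuous_on {a..b} X" "continuous_on {a..b} P"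
proof -
 have "\<And>s. s \<in> {a..b} \<Longrightarrow> (X has_vector_derivative vel m (P s)) (at s within {a..b})"
  "\<And>s. s \<in> {a..b} \<Longrightarrow> (P has_vector_derivative force s (X s) (P s)) (at s within {a..b})"
  using assms unfolding sol_def by auto
 from this[THEN continuous_on_vector_derivative] show "continuous_on {a..b} X" "continuous_on {a..b} P" by auto
qed

lemma sol_forward: assumes "0 \<le> \<tau>" "\<tau> \<le> T"
 shows "\<exists>X P. sol \<tau> T X P \<and> X \<tau> = x \<and> P \<tau> = p"
proof -
 obtain Lc where Lc: "\<And>t z z'. t \<in> {0..T} \<Longrightarrow> norm (vf t z - vf t z') \<le> Lc * norm (z - z')"
  using vf_lipschitz[of T] by blast
 have "\<exists>z. z 0 = (x, p) \<and> (\<forall>s\<in>{0..T - \<tau>}. (z has_vector_derivative vf (\<tau> + s) (z s)) (at s within {0..T - \<tau>}))"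
 proof (rule picard_lindelof)
  show "continuous_on ({0..T - \<tau>} \<times> UNIV) (\<lambda>z. vf (\<tau> + fst z) (snd z))"
   by (intro continuous_vf continuous_intros) (use assms in auto)
 qed (use assms in \<open>auto intro!: Lc\<close>)
 then obtain z where z: "z 0 = (x, p)" "\<And>s. s \<in> {0..T - \<tau>} \<Longrightarrow> (z has_vector_derivative vf (\<tau> + s) (z s)) (at s within {0..T - \<tau>})" by blast
 define Z where "Z s = z (s - \<tau>)" for s
 have dZ: "(Z has_vector_derivative vf s (Z s)) (at s within {\<tau>..T})" if s: "s \<in> {\<tau>..T}" for s
 proof -
  have im: "(\<lambda>s. s - \<tau>) ` {\<tau>..T} = {0..T - \<tau>}" by (auto simp: image_iff intro!: bexI[of _ "_ + \<tau>"])
  have "((\<lambda>s. s - \<tau>) has_vector_derivative 1) (at s within {\<tau>..T})" by (auto intro!: derivative_eq_intros)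
  from vector_diff_chain_within[OF this, of z "vf s (Z s)"] z(2)[of "s - \<tau>"] s
  show ?thesis unfolding im by (simp add: Z_def[abs_def] o_def)
 qed
 have "sol \<tau> T (\<lambda>s. fst (Z s)) (\<lambda>s. snd (Z s))"
  by (rule sol_of_pair[OF dZ])
 then show ?thesis using z(1) by (intro exI[of _ "\<lambda>s. fst (Z s)"] exI[of _ "\<lambda>s. snd (Z s)"]) (simp add: Z_def)
qed

text \<open>The density at time \<open>t\<close> is read off from the initial data at the foot of
  the characteristic, so the equation is solved in reversed time starting from
  \<open>t\<close>.\<close>

lemma sol_backward: assumes "0 \<le> t"
 shows "\<exists>X P. sol 0 t X P \<and> X t = x \<and> P t = p"
proof -
 obtain Lc where Lc: "\<And>s z z'. s \<in> {0..t} \<Longrightarrow> norm (vf s z - vf s z') \<le> Lc * norm (z - z')"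
  using vf_lipschitz[of t] by blast
 have "\<exists>z. z 0 = (x, p) \<and> (\<forall>s\<in>{0..t}. (z has_vector_derivative - vf (t - s) (z s)) (at s within {0..t}))"
 proof (rule picard_lindelof)
  show "continuous_on ({0..t} \<times> UNIV) (\<lambda>z. - vf (t - fst z) (snd z))"
   by (intro continuous_vf continuous_intros) (use assms in auto)
  show "norm (- vf (t - s) x - - vf (t - s) y) \<le> Lc * norm (x - y)" if "s \<in> {0..t}" for s x y
   using Lc[of "t - s" y x] that by (simp add: norm_minus_commute)
 qed (use assms in auto)
 then obtain z where z: "z 0 = (x, p)" "\<And>s. s \<in> {0..t} \<Longrightarrow> (z has_vector_derivative - vf (t - s) (z s)) (at s within {0..t})" by blast
 define Z where "Z s = z (t - s)" for s
 have dZ: "(Z has_vector_derivative vf s (Z s)) (at s within {0..t})" if s: "s \<in> {0..t}" for s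
 proof -
  have im: "(\<lambda>s. t - s) ` {0..t} = {0..t}" by (auto simp: image_iff intro!: bexI[of _ "t - _"])
  have "((\<lambda>s. t - s) has_vector_derivative -1) (at s within {0..t})" by (auto intro!: derivative_eq_intros)
  from vector_diff_chain_within[OF this, of z "- vf s (Z s)"] z(2)[of "t - s"] s
  show ?thesis unfolding im by (simp add: Z_def[abs_def] o_def)
 qed
 have "sol 0 t (\<lambda>s. fst (Z s)) (\<lambda>s. snd (Z s))"
  by (rule sol_of_pair[OF dZ])
 then show ?thesis using z(1) by (intro exI[of _ "\<lambda>s. fst (Z s)"] exI[of _ "\<lambda>s. snd (Z s)"]) (simp add: Z_def)
qed

lemma sol_close:
 "\<exists>C\<ge>0. \<forall>X P X' P' s. sol \<tau> T X P \<and> sol \<tau> T X' P' \<and> s \<in> {\<tau>..T} \<and> 0 \<le> \<tau> \<longrightarrow>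
  norm ((X s, P s) - (X' s, P' s)) \<le> C * norm ((X \<tau>, P \<tau>) - (X' \<tau>, P' \<tau>))"
proof -
 obtain Lc where Lc: "Lc \<ge> 0" "\<And>t z z'. t \<in> {0..T} \<Longrightarrow> norm (vf t z - vf t z') \<le> Lc * norm (z - z')"
  using vf_lipschitz[of T] by blast
 show ?thesis
 proof (intro exI[of _ "exp (Lc * (T - \<tau>))"] conjI allI impI)
  fix X P X' P' s assume h: "sol \<tau> T X P \<and> sol \<tau> T X' P' \<and> s \<in> {\<tau>..T} \<and> 0 \<le> \<tau>"
  have "norm ((\<lambda>s. (X s, P s) - (X' s, P' s)) s) \<le> exp (Lc * (s - \<tau>)) * norm ((\<lambda>s. (X s, P s) - (X' s, P' s)) \<tau>)"
  proof (rule norm_growth_bound[where u' = "\<lambda>s. vf s (X s, P s) - vf s (X' s, P' s)"])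
   show "((\<lambda>s. (X s, P s) - (X' s, P' s)) has_vector_derivative vf r (X r, P r) - vf r (X' r, P' r)) (at r within {\<tau>..s})"
    if "r \<in> {\<tau>..s}" for r
   proof -
    have "sol \<tau> s X P" "sol \<tau> s X' P'" using h sol_subset[of \<tau> T _ _ \<tau> s] by auto
    then show ?thesis using that by (intro has_vector_derivative_diff sol_pair)
   qed
   show "norm (vf r (X r, P r) - vf r (X' r, P' r)) \<le> Lc * norm ((X r, P r) - (X' r, P' r))" if "r \<in> {\<tau>..s}" for r
    by (rule Lc(2)) (use h that in auto)
  qed (use h in auto)
  also have "\<dots> \<le> exp (Lc * (T - \<tau>)) * norm ((X \<tau>, P \<tau>) - (X' \<tau>, P' \<tau>))"
   using h Lc by (intro mult_right_mono) (auto intro: mult_left_mono)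
  finally show "norm ((X s, P s) - (X' s, P' s)) \<le> exp (Lc * (T - \<tau>)) * norm ((X \<tau>, P \<tau>) - (X' \<tau>, P' \<tau>))" .
 qed simp
qed

text \<open>Vlasov's equation says that the derivative of \<open>g\<close> in the direction
  \<open>(1, vf)\<close> vanishes. It holds at positive times; the initial time is reached by
  continuity along the curve.\<close>

lemma g_const: assumes S: "sol a b X P" and ab: "0 \<le> a" "s \<in> {a..b}"
 shows "g s (X s) (P s) = g a (X a) (P a)"
proof (cases "a = s")
 case False
 then have as: "a < s" using ab by auto
 define h where "h s = g s (X s) (P s)" for s
 define G where "G z = g (fst z) (fst (snd z)) (snd (snd z))" for z :: "real \<times> vec3 \<times> vec3"
 have hG: "h = (\<lambda>s. G (s, X s, P s))" by (simp add: h_def G_def fun_eq_iff)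
 have C1G: "C1_on {z. fst z \<ge> 0} G" using C1g by (simp add: G_def[abs_def])
 have "h s = h a"
 proof (rule DERIV_isconst_end[OF as])
  have "continuous_on {a..s} (\<lambda>s. (s, X s, P s))"
   using sol_continuous[OF sol_subset[OF S, of a s]] ab by (intro continuous_intros) auto
  moreover have "(\<lambda>s. (s, X s, P s)) ` {a..s} \<subseteq> {z. 0 \<le> fst z}" using ab by auto
  ultimately show "continuous_on {a..s} h" unfolding hG
   by (rule continuous_on_compose2[OF C1_on_continuous_on[OF C1G]])
  fix r assume r: "a < r" "r < s"
  have rab: "r \<in> {a..b}" "a < r" "r < b" using r ab by auto
  have "((\<lambda>s. (X s, P s)) has_vector_derivative vf r (X r, P r)) (at r)"
   using sol_pair[OF S rab(1)] rab by (simp add: at_within_Icc_at)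
  from has_vector_derivative_Pair[OF has_vector_derivative_id this]
  have d1: "((\<lambda>s. (s, X s, P s)) has_derivative (\<lambda>k. k *\<^sub>R (1, vf r (X r, P r)))) (at r)"
   by (simp add: has_vector_derivative_def id_def)
  obtain G' where G': "\<And>z. z \<in> {z. fst z \<ge> 0} \<Longrightarrow> (G has_derivative G' z) (at z within {z. fst z \<ge> 0})"
   by (rule C1_onE[OF C1G]) blast
  have "(r, X r, P r) \<in> interior {z :: real \<times> vec3 \<times> vec3. fst z \<ge> 0}"
   by (rule interiorI[of "{z. fst z > 0}"]) (use rab ab in \<open>auto intro!: open_Collect_less continuous_intros\<close>)
  then have "(G has_derivative G' (r, X r, P r)) (at (r, X r, P r))"
   using G'[of "(r, X r, P r)"] rab ab at_within_interior[of "(r, X r, P r)" "{z :: real \<times> vec3 \<times> vec3. fst z \<ge> 0}"]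
   by simp
  then have d2: "(G has_derivative frechet_derivative G (at (r, X r, P r))) (at (r, X r, P r))"
   by (simp only: frechet_derivative_at[symmetric])
  have "(h has_derivative (\<lambda>k. frechet_derivative G (at (r, X r, P r)) (k *\<^sub>R (1, vf r (X r, P r))))) (at r)"
   unfolding hG by (rule has_derivative_compose[OF d1 d2])
  moreover have "frechet_derivative G (at (r, X r, P r)) (1, vf r (X r, P r)) = 0"
   using vlasov[of r "X r" "P r"] rab ab by (simp add: vf_def force_def G_def[abs_def])
  then have "frechet_derivative G (at (r, X r, P r)) (k *\<^sub>R (1, vf r (X r, P r))) = 0" for k
   unfolding linear_cmul[OF has_derivative_linear[OF d2]] by simp
  ultimately show "(h has_real_derivative 0) (at r)" by (simp add: has_field_derivative_def lambda_zero)
 qed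
 then show ?thesis by (simp add: h_def)
qed simp

lemma g_nonneg: assumes "0 \<le> t" shows "0 \<le> g t x p"
proof -
 obtain X P where "sol 0 t X P" "X t = x" "P t = p" using sol_backward[OF assms] by blast
 then have "g t x p = g0 (X 0) (P 0)" using g_const[of 0 t X P t] assms g_init by auto
 then show ?thesis using g0_nonneg by simp
qed

definition orb :: "real \<Rightarrow> vec3 \<Rightarrow> vec3 \<Rightarrow> (real \<Rightarrow> vec3) \<Rightarrow> (real \<Rightarrow> vec3) \<Rightarrow> bool" where
 "orb t x p X P \<longleftrightarrow> sol 0 t X P \<and> X t = x \<and> P t = p \<and> g t x p = g0 (X 0) (P 0) \<and>
  (\<forall>s\<in>{0..t}. norm (vel m (P s)) \<le> \<gamma> \<and> norm (P s) \<le> \<beta> \<and> norm (X s) \<le> L + \<gamma> * s)"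

lemma sol_travel:
 assumes S: "sol a b X P" and v: "\<And>s. s \<in> {a..b} \<Longrightarrow> norm (vel m (P s)) \<le> \<gamma>" and s: "s \<in> {a..b}"
 shows "norm (X s - X a) \<le> \<gamma> * (s - a)"
proof -
 have "norm (X s - X a) \<le> \<gamma> * norm (s - a)"
 proof (rule differentiable_bound[where f = X and S = "{a..b}" and f' = "\<lambda>s k. k *\<^sub>R vel m (P s)"])
  show "(X has_derivative (\<lambda>k. k *\<^sub>R vel m (P r))) (at r within {a..b})" if "r \<in> {a..b}" for r
   using S that by (auto simp: sol_def has_vector_derivative_def)
  show "onorm (\<lambda>k. k *\<^sub>R vel m (P r)) \<le> \<gamma>" if "r \<in> {a..b}" for r
   by (rule onorm_bound) (use v[OF that] \<gamma> in \<open>auto simp: mult.commute intro!: mult_left_mono\<close>)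
 qed (use s in auto)
 then show ?thesis using s by simp
qed

text \<open>The density is constant along the characteristic, hence nonzero at all earlier times.
  The momentum bound on the support therefore holds all the way back, and with it the bounds on
  speed and position.\<close>

lemma orb_exists: assumes "0 \<le> t" "g t x p \<noteq> 0" shows "\<exists>X P. orb t x p X P"
proof -
 obtain X P where S: "sol 0 t X P" "X t = x" "P t = p" using sol_backward[OF assms(1)] by blast
 have c: "g s (X s) (P s) = g t x p" if "s \<in> {0..t}" for s
  using g_const[OF S(1), of s] g_const[OF S(1), of t] that assms S by auto
 have P: "norm (P s) \<le> \<beta>" if "s \<in> {0..t}" for s
  using c[OF that] assms(2) g_supp[of s "P s" "X s"] that by (cases "\<beta> \<le> norm (P s)") auto
 have v: "norm (vel m (P s)) \<le> \<gamma>" if "s \<in> {0..t}" for s using vel_le_\<gamma>[OF P[OF that]] .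
 have g: "g t x p = g0 (X 0) (P 0)" using c[of 0] assms g_init by simp
 then have "norm (X 0) \<le> L" using g0_supp assms by metis
 then have X: "norm (X s) \<le> L + \<gamma> * s" if "s \<in> {0..t}" for s
  using sol_travel[OF S(1) v that] norm_triangle_sub[of "X s" "X 0"] by (smt (verit) diff_zero)
 show ?thesis unfolding orb_def using S g v X P by blast
qed

end

section \<open>Rescaling, and extension beyond the set of positivity\<close>

lemma C11_scale:
 assumes f: "C11 M \<sigma> S f" and k: "0 \<le> k" "\<sigma> * k \<le> 1" and sub: "\<And>x. x \<in> T \<Longrightarrow> k *\<^sub>R x \<in> S"
 shows "C11 M 1 T (\<lambda>x. f (k *\<^sub>R x))"
proof (rule C11I)
 note f0 = C11D(1,2)[OF f]
 have s: "0 \<le> \<sigma> * k" using f0 k by simp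
 have mm: "M * (\<sigma> * k * x) \<le> M * x" if "0 \<le> x" for x
  using mult_right_mono[OF k(2) that] f0 by (intro mult_left_mono) auto
 show "0 \<le> M" by (rule f0)
 show "norm (f (k *\<^sub>R x)) \<le> M" if "x \<in> T" for x by (rule C11D(3)[OF f sub[OF that]])
 show "norm (f (k *\<^sub>R x) - f (k *\<^sub>R y)) \<le> M * 1 * norm (x - y)" if "x \<in> T" "y \<in> T" for x y
  using C11D(4)[OF f sub sub, OF that] mm[of "norm (x - y)"] k
  by (simp add: scaleR_diff_right[symmetric] mult_ac)
 fix a b c d assume h: "a \<in> T" "b \<in> T" "c \<in> T" "d \<in> T"
 have e: "norm (k *\<^sub>R d - k *\<^sub>R c - k *\<^sub>R b + k *\<^sub>R a) = k * norm (d - c - b + a)"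
  "norm (k *\<^sub>R x - k *\<^sub>R y) = k * norm (x - y)" for x y
  using k by (simp_all only: scaleR_diff_right[symmetric] scaleR_add_right[symmetric] norm_scaleR abs_of_nonneg)
 have "(\<sigma> * k) * (\<sigma> * k) \<le> 1 * 1" using s k by (intro mult_mono) auto
 then have "\<sigma>^2 * k^2 \<le> 1" by (simp add: power2_eq_square mult_ac)
 then have "\<sigma>^2 * k^2 * ((norm (b - a) + norm (d - c)) * (norm (c - a) + norm (d - b))) \<le> 1 * ((norm (b - a) + norm (d - c)) * (norm (c - a) + norm (d - b)))"
  by (intro mult_right_mono) auto
 moreover have "\<sigma> * k * norm (d - c - b + a) \<le> 1 * norm (d - c - b + a)" using k by (intro mult_right_mono) auto
 ultimately have "\<sigma> * (k * norm (d - c - b + a)) + \<sigma>^2 * (k * norm (b - a) + k * norm (d - c)) * (k * norm (c - a) + k * norm (d - b))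
  \<le> mod4 1 a b c d"
  by (simp add: power2_eq_square algebra_simps)
 with f0 have "M * (\<sigma> * (k * norm (d - c - b + a)) + \<sigma>^2 * (k * norm (b - a) + k * norm (d - c)) * (k * norm (c - a) + k * norm (d - b)))
  \<le> M * mod4 1 a b c d"
  by (intro mult_left_mono)
 with C11D(5)[OF f sub sub sub sub, OF h]
 show "norm (f (k *\<^sub>R d) - f (k *\<^sub>R c) - f (k *\<^sub>R b) + f (k *\<^sub>R a)) \<le>
  M * mod4 1 a b c d"
  unfolding e by linarith
qed auto

lemma C11_Pair:
 assumes f: "C11 M1 \<sigma> S f" and g: "C11 M2 \<sigma> S g"
 shows "C11 (M1 + M2) \<sigma> S (\<lambda>x. (f x, g x))"
proof (rule C11I)
 note f0 = C11D(1,2)[OF f] and g0 = C11D(1,2)[OF g]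
 show "norm (f x, g x) \<le> M1 + M2" if "x \<in> S" for x
  using norm_Pair_le[of "f x" "g x"] C11D(3)[OF f that] C11D(3)[OF g that] by linarith
 show "norm ((f x, g x) - (f y, g y)) \<le> (M1 + M2) * \<sigma> * norm (x - y)" if "x \<in> S" "y \<in> S" for x y
  using norm_Pair_le[of "f x - f y" "g x - g y"] C11D(4)[OF f that] C11D(4)[OF g that]
  by (simp add: algebra_simps)
 fix a b c d assume h: "a \<in> S" "b \<in> S" "c \<in> S" "d \<in> S"
 show "norm ((f d, g d) - (f c, g c) - (f b, g b) + (f a, g a)) \<le>
    (M1 + M2) * mod4 \<sigma> a b c d"
  using norm_Pair_le[of "f d - f c - f b + f a" "g d - g c - g b + g a"] C11D(5)[OF f h] C11D(5)[OF g h]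
  by (simp add: distrib_right[of M1 M2])
qed (use C11D(1,2)[OF f] C11D(1,2)[OF g] in auto)

lemma C11_cong: "C11 M \<sigma> S f \<Longrightarrow> (\<And>x. x \<in> S \<Longrightarrow> g x = f x) \<Longrightarrow> C11 M \<sigma> S g"
 unfolding C11_def by (auto simp: )

text \<open>A segment from \<open>U\<close> to its complement meets the frontier of
  \<open>U\<close>, where \<open>c\<close> is zero. The bound on \<open>U\<close> extends by
  continuity to the closure, and the frontier point is no farther away than the end of the
  segment.\<close>

lemma lipschitz_off_zero_set:
 fixes c :: "'a::euclidean_space \<Rightarrow> real"
 assumes c: "continuous_on UNIV c" and U: "open U" and z: "\<And>w. w \<notin> U \<Longrightarrow> c w = 0"
  and lip: "\<And>w w'. w \<in> U \<Longrightarrow> w' \<in> U \<Longrightarrow> \<bar>c w - c w'\<bar> \<le> K * norm (w - w')" and K: "0 \<le> K"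
 shows "\<bar>c w - c w'\<bar> \<le> K * norm (w - w')"
proof -
 have one: "\<bar>c w - c w'\<bar> \<le> K * norm (w - w')" if w: "w \<in> U" "w' \<notin> U" for w w'
 proof -
  have "connected (closed_segment w w')" by (rule connected_segment)
  moreover have "closed_segment w w' \<inter> U \<noteq> {}" "closed_segment w w' - U \<noteq> {}" using w by auto
  ultimately have "closed_segment w w' \<inter> frontier U \<noteq> {}" by (rule connected_Int_frontier)
  then obtain v where v: "v \<in> closed_segment w w'" "v \<in> frontier U" by blast
  then have vU: "v \<notin> U" "v \<in> closure U" using U by (auto simp: frontier_def interior_open)
  have "closed {v. \<bar>c w - c v\<bar> \<le> K * norm (w - v)}"
   by (intro closed_Collect_le continuous_intros c)
  moreover have "U \<subseteq> {v. \<bar>c w - c v\<bar> \<le> K * norm (w - v)}" using lip w by auto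
  ultimately have "\<bar>c w - c v\<bar> \<le> K * norm (w - v)" using vU(2) closure_minimal by blast
  moreover have "norm (w - v) \<le> norm (w - w')" using segment_bound1[OF v(1)] by (simp add: norm_minus_commute)
  ultimately have "\<bar>c w\<bar> \<le> K * norm (w - w')" using z[OF vU(1)] K mult_left_mono by fastforce
  then show ?thesis using z[OF w(2)] by simp
 qed
 show ?thesis
 proof (cases "w \<in> U")
  case True then show ?thesis using one lip by (cases "w' \<in> U") auto
 next
  case False
  then show ?thesis using one[of w' w] z K by (cases "w' \<in> U") (auto simp: norm_minus_commute abs_minus_commute)
 qed
qed

text \<open>A nonnegative \<open>C\<^sup>1\<close> function has zero gradient where it vanishes, so bounds on the set where it is positive carry over
 to the whole space.\<close>

lemma C11_globalize:
 fixes \<psi> :: "vec3 \<Rightarrow> real"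
 assumes C1: "C1_on UNIV \<psi>" and nn: "\<And>w. 0 \<le> \<psi> w" and C: "C11 M \<sigma> {w. \<psi> w \<noteq> 0} \<psi>"
 shows "\<bar>\<psi> w - \<psi> w'\<bar> \<le> M * \<sigma> * norm (w - w')"
  "\<bar>\<psi> (w + a + b) - \<psi> (w + a) - \<psi> (w + b) + \<psi> w\<bar> \<le> 4 * M * \<sigma>^2 * norm a * norm b"
proof -
 obtain D where D: "\<And>z. (\<psi> has_derivative D z) (at z)" "\<And>h. continuous_on UNIV (\<lambda>z. D z h)"
  by (rule C1_onE[OF C1]) (auto simp: )
 define U where "U = {w. \<psi> w \<noteq> 0}"
 have cpsi: "continuous_on UNIV \<psi>" by (rule C1_on_continuous_on[OF C1])
 have U: "open U" unfolding U_def using cpsi by (intro open_Collect_neq) auto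
 note CU = C[folded U_def]
 note M0 = C11D(1,2)[OF CU]
 show "\<bar>\<psi> w - \<psi> w'\<bar> \<le> M * \<sigma> * norm (w - w')" for w w'
  by (rule lipschitz_off_zero_set[OF cpsi U]) (use C11D(4)[OF CU] M0 in \<open>auto simp: U_def\<close>)
 have D0: "D w a = 0" if "w \<notin> U" for w a
 proof -
  have "\<psi> w = 0" using that by (simp add: U_def)
  then have "D w = (\<lambda>_. 0)" by (intro has_derivative_local_min[OF D(1)]) (use nn in simp)
  then show ?thesis by simp
 qed
 \<comment> \<open>The second-difference bound for the points w, w + h a, w', w' + h a, divided by
   h, becomes a Lipschitz bound for the directional derivative as h tends to 0. For small h all four
   points lie in the open set \<open>U\<close>, which takes the place of convexity.\<close>
 have Dl: "\<bar>D w a - D w' a\<bar> \<le> (4 * M * \<sigma>^2 * norm a) * norm (w - w')" if w: "w \<in> U" "w' \<in> U" for w w' a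
 proof -
  have lim: "((\<lambda>h. (\<psi> (w + h *\<^sub>R a) - \<psi> w) / h) \<longlongrightarrow> D w a) (at_right 0)" for w
  proof -
   have "((\<lambda>h. w + h *\<^sub>R a) has_derivative (\<lambda>h. h *\<^sub>R a)) (at 0)" by (auto intro!: derivative_eq_intros)
   moreover have "(\<psi> has_derivative D w) (at (w + 0 *\<^sub>R a))" using D(1) by simp
   ultimately have "((\<lambda>h. \<psi> (w + h *\<^sub>R a)) has_derivative (\<lambda>h. D w (h *\<^sub>R a))) (at 0)"
    by (rule has_derivative_compose)
   moreover have "D w (h *\<^sub>R a) = D w a * h" for h
    using linear_cmul[OF has_derivative_linear[OF D(1)]] by simp
   ultimately have "((\<lambda>h. \<psi> (w + h *\<^sub>R a)) has_real_derivative D w a) (at 0)" by (simp add: has_field_derivative_def)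
   then have "((\<lambda>h. (\<psi> (w + h *\<^sub>R a) - \<psi> w) / h) \<longlongrightarrow> D w a) (at 0)" by (simp add: DERIV_def)
   then show ?thesis by (rule tendsto_within_subset) simp
  qed
  have ev: "\<forall>\<^sub>F h in at_right 0. w + h *\<^sub>R a \<in> U" if "w \<in> U" for w
  proof -
   have "((\<lambda>h. w + h *\<^sub>R a) \<longlongrightarrow> w + 0 *\<^sub>R a) (at_right 0)" by (intro tendsto_intros)
   then show ?thesis by (rule topological_tendstoD[OF _ U]) (use that in simp)
  qed
  have "((\<lambda>h. \<bar>(\<psi> (w + h *\<^sub>R a) - \<psi> w) / h - (\<psi> (w' + h *\<^sub>R a) - \<psi> w') / h\<bar>) \<longlongrightarrow> \<bar>D w a - D w' a\<bar>) (at_right 0)"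
   by (intro tendsto_intros lim)
  moreover have "\<forall>\<^sub>F h in at_right 0. \<bar>(\<psi> (w + h *\<^sub>R a) - \<psi> w) / h - (\<psi> (w' + h *\<^sub>R a) - \<psi> w') / h\<bar> \<le> (4 * M * \<sigma>^2 * norm a) * norm (w - w')"
   using ev[OF w(1)] ev[OF w(2)] eventually_at_right_less[of "0::real"]
  proof eventually_elim
   case (elim h)
   have "norm (\<psi> (w' + h *\<^sub>R a) - \<psi> w' - \<psi> (w + h *\<^sub>R a) + \<psi> w) \<le> M * (\<sigma> * norm (w' + h *\<^sub>R a - w' - (w + h *\<^sub>R a) + w)
    + \<sigma>^2 * (norm (w + h *\<^sub>R a - w) + norm (w' + h *\<^sub>R a - w')) * (norm (w' - w) + norm (w' + h *\<^sub>R a - (w + h *\<^sub>R a))))"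
    by (rule C11D(5)[OF CU]) (use w elim in auto)
   also have "\<dots> = h * ((4 * M * \<sigma>^2 * norm a) * norm (w - w'))" using elim(3) by (simp add: norm_minus_commute algebra_simps)
   finally have "\<bar>\<psi> (w' + h *\<^sub>R a) - \<psi> w' - \<psi> (w + h *\<^sub>R a) + \<psi> w\<bar> \<le> h * ((4 * M * \<sigma>^2 * norm a) * norm (w - w'))" by simp
   moreover have "(\<psi> (w + h *\<^sub>R a) - \<psi> w) / h - (\<psi> (w' + h *\<^sub>R a) - \<psi> w') / h = - (\<psi> (w' + h *\<^sub>R a) - \<psi> w' - \<psi> (w + h *\<^sub>R a) + \<psi> w) / h"
    by (simp add: diff_divide_distrib[symmetric])
   ultimately show ?case using elim(3) by (simp add: abs_divide divide_le_eq mult.commute)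
  qed
  ultimately show ?thesis by (rule tendsto_upperbound) simp
 qed
 have Dg: "\<bar>D w a - D w' a\<bar> \<le> (4 * M * \<sigma>^2 * norm a) * norm (w - w')" for w w' a
  by (rule lipschitz_off_zero_set[OF D(2) U D0 Dl]) (use M0 in auto)
 \<comment> \<open>The Lipschitz bound for the derivative now holds everywhere and is integrated
   back over a parallelogram whose corners may lie outside \<open>U\<close>.\<close>
 define F where "F \<theta> = \<psi> (w + \<theta> *\<^sub>R a + b) - \<psi> (w + \<theta> *\<^sub>R a)" for \<theta> :: real
 have "norm (F 1 - F 0) \<le> (4 * M * \<sigma>^2 * norm a * norm b) * norm (1 - 0 :: real)"
 proof (rule differentiable_bound[where f = F and S = UNIV and f' = "\<lambda>\<theta> k. D (w + \<theta> *\<^sub>R a + b) (k *\<^sub>R a) - D (w + \<theta> *\<^sub>R a) (k *\<^sub>R a)"])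
  fix \<theta> :: real
  show "(F has_derivative (\<lambda>k. D (w + \<theta> *\<^sub>R a + b) (k *\<^sub>R a) - D (w + \<theta> *\<^sub>R a) (k *\<^sub>R a))) (at \<theta> within UNIV)"
   unfolding F_def
   by (intro has_derivative_diff has_derivative_compose[OF _ D(1)]) (auto intro!: derivative_eq_intros)
  show "onorm (\<lambda>k. D (w + \<theta> *\<^sub>R a + b) (k *\<^sub>R a) - D (w + \<theta> *\<^sub>R a) (k *\<^sub>R a)) \<le> 4 * M * \<sigma>^2 * norm a * norm b"
  proof (rule onorm_bound)
   fix k :: real
   have lc: "D z (k *\<^sub>R a) = k * D z a" for z using linear_cmul[OF has_derivative_linear[OF D(1)]] by simp
   have "\<bar>k\<bar> * \<bar>D (w + \<theta> *\<^sub>R a + b) a - D (w + \<theta> *\<^sub>R a) a\<bar> \<le> \<bar>k\<bar> * (4 * M * \<sigma>^2 * norm a * norm b)"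
    using Dg[of "w + \<theta> *\<^sub>R a + b" a "w + \<theta> *\<^sub>R a"] by (intro mult_left_mono) auto
   then show "norm (D (w + \<theta> *\<^sub>R a + b) (k *\<^sub>R a) - D (w + \<theta> *\<^sub>R a) (k *\<^sub>R a)) \<le> 4 * M * \<sigma>^2 * norm a * norm b * norm k"
    unfolding lc by (simp add: right_diff_distrib[symmetric] abs_mult mult.commute)
  qed (use M0 in auto)
 qed auto
 then show "\<bar>\<psi> (w + a + b) - \<psi> (w + a) - \<psi> (w + b) + \<psi> w\<bar> \<le> 4 * M * \<sigma>^2 * norm a * norm b"
  by (simp add: F_def algebra_simps)
qed

lemma wlam_ge_1: "0 \<le> a \<Longrightarrow> 1 \<le> wlam a s" by (simp add: wlam_def)

text \<open>Allows a factor 1 / (s + 2) to be traded for 1 / \<open>wlam a s\<close>, so that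
  position and velocity differences can be given the same gain.\<close>

lemma wlam_le_linear: assumes "0 \<le> a" "0 \<le> s" shows "wlam a s \<le> (1 + 2 * a) * (s + 2)"
proof -
 have "0 \<le> ln (s + 2)" "ln (s + 2) \<le> 2 * sqrt (s + 2)" using assms ln_le_2sqrt[of "s + 2"] by auto
 then have "(ln (s + 2))^2 \<le> (2 * sqrt (s + 2))^2" by (intro power_mono)
 also have "\<dots> = 4 * (s + 2)" using assms by (simp add: power_mult_distrib)
 finally have "a * (ln (s + 2))^2 \<le> a * (4 * (s + 2))" using assms by (intro mult_left_mono)
 then show ?thesis using assms by (simp add: wlam_def algebra_simps)
qed

section \<open>Differences of orbits and regularity of the density in velocity\<close>

context species
begin

text \<open>The aperture between the particles and the light cone: where |x| <= L + \<gamma> s, the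
  quantity s - |x| + 2 L is at least (1 - \<gamma>) s + L. The first entry of the minimum serves the
  multiple of s in \<open>aper * (s + 2)\<close>, the second its constant part.\<close>

definition aper :: real where "aper = min (1 - \<gamma>) (L / 2)"

lemma aper: "0 < aper" "0 \<le> s \<Longrightarrow> norm x \<le> L + \<gamma> * s \<Longrightarrow> aper * (s + 2) \<le> s - norm x + 2 * L"
proof -
 show "0 < aper" using \<gamma> L by (simp add: aper_def)
 assume s: "0 \<le> s" "norm x \<le> L + \<gamma> * s"
 have "aper \<le> 1 - \<gamma>" "aper \<le> L / 2" by (simp_all only: aper_def min.cobounded1 min.cobounded2)
 then have "aper * s \<le> (1 - \<gamma>) * s" "aper * 2 \<le> L" using s by (auto intro: mult_right_mono)
 then show "aper * (s + 2) \<le> s - norm x + 2 * L" using s by (simp add: algebra_simps)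
qed

lemma in_aper: assumes "0 \<le> s" "norm x \<le> L + \<gamma> * s" shows "norm x \<le> s + L"
 using mult_right_mono[of \<gamma> 1 s] \<gamma> assms by simp

lemma aper_div: assumes s: "0 \<le> s" "norm x \<le> L + \<gamma> * s" and c: "0 \<le> c"
 shows "c / ((s + 1) * (s - norm x + 2 * L) ^ k) \<le> 2 * c / aper ^ k / (s + 2) ^ (Suc k)"
proof -
 have p: "0 < aper * (s + 2)" using aper(1) s by simp
 \<comment> \<open>Half of \<open>s + 2\<close> is at most \<open>s + 1\<close>; this is the factor
   2 in the statement.\<close>
 have "(s + 2) / 2 * (aper * (s + 2)) ^ k \<le> (s + 1) * (s - norm x + 2 * L) ^ k"
  using s p aper(2)[OF s] by (intro mult_mono power_mono) auto
 then have "c / ((s + 1) * (s - norm x + 2 * L) ^ k) \<le> c / ((s + 2) / 2 * (aper * (s + 2)) ^ k)"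
  using c p s order.strict_trans2[OF p aper(2)[OF s]] aper(1) by (intro divide_left_mono mult_pos_pos zero_less_power) auto
 also have "\<dots> = 2 * c / aper ^ k / (s + 2) ^ (Suc k)" by (simp add: power_mult_distrib mult_ac)
 finally show ?thesis .
qed

lemma field_decay: assumes s: "0 \<le> s" "norm x \<le> L + \<gamma> * s"
 shows "norm (E s x) + norm (B s x) \<le> (2 * K0 / aper) / (s + 2)^2"
 using bound0[OF s(1) in_aper[OF s]] aper_div[OF s K0, of 1] by (simp add: power2_eq_square)

text \<open>Where the particles are, each spatial derivative of a field gains a factor 1 / (s + 2).
  The change of variable to \<xi> = x / (s + 2) turns this into unit length scale, and size and
  differences share one bound.\<close>

lemma field_C11:
 "\<exists>K1\<ge>0. \<forall>s\<ge>0. C11 (K1 * (ln (s + 2) / (s + 2)^2)) 1 (cball 0 ((L + \<gamma> * s) / (s + 2))) (\<lambda>\<xi>. E s ((s + 2) *\<^sub>R \<xi>))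
  \<and> C11 (K1 * (ln (s + 2) / (s + 2)^2)) 1 (cball 0 ((L + \<gamma> * s) / (s + 2))) (\<lambda>\<xi>. B s ((s + 2) *\<^sub>R \<xi>))"
proof -
 \<comment> \<open>The field itself is bounded without a logarithm. Since \<open>ln (s + 2)\<close>
   is at least 1/2, doubling its constant 2 K0 / aper puts it under the common logarithmic
   bound.\<close>
 define K1 where "K1 = 4 * K0 / aper + 2 * K0 / aper ^ 2 + 2 * K0 / aper ^ 3"
 have n: "0 \<le> K0 / aper" "0 \<le> K0 / aper ^ 2" "0 \<le> K0 / aper ^ 3" using K0 aper(1) by auto
 then have K1: "0 \<le> K1" by (simp add: K1_def)
 have C: "C11 (K1 * (ln (s + 2) / (s + 2)^2)) 1 (cball 0 ((L + \<gamma> * s) / (s + 2))) (\<lambda>\<xi>. H ((s + 2) *\<^sub>R \<xi>))"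
  if s: "0 \<le> s" and ck: "Ck 2 H"
  and b0: "\<And>x. norm x \<le> s + L \<Longrightarrow> norm (H x) \<le> norm (E s x) + norm (B s x)"
  and b1: "\<And>x. norm x \<le> s + L \<Longrightarrow> Dk_abs 1 H x \<le> K0 * ln (s + 2) / ((s + 1) * (s - norm x + 2 * L) ^ 2)"
  and b2: "\<And>x. norm x \<le> s + L \<Longrightarrow> Dk_abs 2 H x \<le> K0 * ln (s + 2) / ((s + 1) * (s - norm x + 2 * L) ^ 3)"
  for s and H :: "vec3 \<Rightarrow> vec3"
 proof (rule C11_scale)
  define l where "l = ln (s + 2)"
  have l2: "1 / 2 \<le> l" using s ln2_ge_two_thirds ln_mono[of 2 "s + 2"] unfolding l_def by linarith
  define x2 where "x2 = s + 2"
  have x2: "0 < x2" using s by (simp add: x2_def)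
  show "C11 (K1 * (ln (s + 2) / (s + 2)^2)) (1 / (s + 2)) (cball 0 (L + \<gamma> * s)) H"
   unfolding l_def[symmetric]
  proof (rule C11_Ck2[OF ck convex_cball])
   fix x :: vec3 assume "x \<in> cball 0 (L + \<gamma> * s)"
   then have x: "norm x \<le> L + \<gamma> * s" by simp
   note i = in_aper[OF s x]
   have "norm (H x) \<le> (2 * K0 / aper) / x2^2" using b0[OF i] field_decay[OF s x] by (simp add: x2_def)
   also have "2 * K0 / aper \<le> K1 * l"
   proof -
    have "4 * K0 / aper * (1 / 2) \<le> K1 * l" using n l2 K1 by (intro mult_mono) (auto simp: K1_def)
    then show ?thesis by simp
   qed
   then have "(2 * K0 / aper) / x2^2 \<le> (K1 * l) / x2^2" by (rule divide_right_mono) simp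
   finally show "norm (H x) \<le> K1 * (l / (s + 2)^2)" by (simp add: x2_def)
   have kl: "0 \<le> K0 * l" using K0 l2 by simp
   have "Dk_abs 1 H x \<le> 2 * (K0 * l) / aper ^ 2 / x2 ^ Suc 2"
    using b1[OF i] aper_div[OF s x kl, of 2] by (simp only: l_def x2_def)
   also have "2 * (K0 * l) / aper ^ 2 \<le> K1 * l"
   proof -
    have "2 * K0 / aper ^ 2 * l \<le> K1 * l" using n l2 by (intro mult_right_mono) (auto simp: K1_def)
    then show ?thesis by (simp add: mult_ac)
   qed
   then have "2 * (K0 * l) / aper ^ 2 / x2 ^ Suc 2 \<le> K1 * l / x2 ^ Suc 2" using x2 by (intro divide_right_mono) auto
   also have "\<dots> = K1 * (l / x2^2) * (1 / x2)" by (simp add: power2_eq_square power3_eq_cube)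
   finally show "Dk_abs 1 H x \<le> K1 * (l / (s + 2)^2) * (1 / (s + 2))" by (simp add: x2_def)
   have "Dk_abs 2 H x \<le> 2 * (K0 * l) / aper ^ 3 / x2 ^ Suc 3"
    using b2[OF i] aper_div[OF s x kl, of 3] by (simp only: l_def x2_def)
   also have "2 * (K0 * l) / aper ^ 3 \<le> K1 * l"
   proof -
    have "2 * K0 / aper ^ 3 * l \<le> K1 * l" using n l2 by (intro mult_right_mono) (auto simp: K1_def)
    then show ?thesis by (simp add: mult_ac)
   qed
   then have "2 * (K0 * l) / aper ^ 3 / x2 ^ Suc 3 \<le> K1 * l / x2 ^ Suc 3" using x2 by (intro divide_right_mono) auto
   also have "\<dots> = K1 * (l / x2^2) * (1 / x2)^2" by (simp add: power2_eq_square eval_nat_numeral)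
   finally show "Dk_abs 2 H x \<le> K1 * (l / (s + 2)^2) * (1 / (s + 2))^2" by (simp add: x2_def)
  qed (use K1 l2 s in auto)
  show "(s + 2) *\<^sub>R \<xi> \<in> cball 0 (L + \<gamma> * s)" if "\<xi> \<in> cball 0 ((L + \<gamma> * s) / (s + 2))" for \<xi> :: vec3
   using that x2 by (simp add: x2_def[symmetric] pos_le_divide_eq mult.commute)
 qed (use s in auto)
 show ?thesis
 proof (intro exI[of _ K1] conjI K1 allI impI)
  fix s :: real assume s: "0 \<le> s"
  have b1E: "Dk_abs 1 (E s) x \<le> K0 * ln (s + 2) / ((s + 1) * (s - norm x + 2 * L) ^ 2)"
   and b1B: "Dk_abs 1 (B s) x \<le> K0 * ln (s + 2) / ((s + 1) * (s - norm x + 2 * L) ^ 2)"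
   and b2E: "Dk_abs 2 (E s) x \<le> K0 * ln (s + 2) / ((s + 1) * (s - norm x + 2 * L) ^ 3)"
   and b2B: "Dk_abs 2 (B s) x \<le> K0 * ln (s + 2) / ((s + 1) * (s - norm x + 2 * L) ^ 3)"
   if "norm x \<le> s + L" for x
   using bound1[OF s that] bound2[OF s that] Dk_abs_nonneg[of 1 "E s" x] Dk_abs_nonneg[of 1 "B s" x]
    Dk_abs_nonneg[of 2 "E s" x] Dk_abs_nonneg[of 2 "B s" x] by linarith+
  show "C11 (K1 * (ln (s + 2) / (s + 2)^2)) 1 (cball 0 ((L + \<gamma> * s) / (s + 2))) (\<lambda>\<xi>. E s ((s + 2) *\<^sub>R \<xi>))"
   by (rule C[OF s CkE[OF s] _ b1E b2E]) auto
  show "C11 (K1 * (ln (s + 2) / (s + 2)^2)) 1 (cball 0 ((L + \<gamma> * s) / (s + 2))) (\<lambda>\<xi>. B s ((s + 2) *\<^sub>R \<xi>))"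
   by (rule C[OF s CkB[OF s] _ b1B b2B]) auto
 qed
qed

definition accf :: "real \<Rightarrow> vec3 \<Rightarrow> vec3 \<Rightarrow> vec3" where
 "accf s x w = acc m q (E s x) (B s x) w"

lemma accf_C11_ex: "\<exists>a>0. \<forall>s\<ge>0. C11 (cdec a s) 1 (cball 0 ((L + \<gamma> * s) / (s + 2)) \<times> cball 0 \<gamma>)
  (\<lambda>z. accf s ((s + 2) *\<^sub>R fst z) (snd z))"
proof -
 obtain K1 where K1: "0 \<le> K1" "\<And>s. 0 \<le> s \<Longrightarrow> C11 (K1 * (ln (s + 2) / (s + 2)^2)) 1 (cball 0 ((L + \<gamma> * s) / (s + 2))) (\<lambda>\<xi>. E s ((s + 2) *\<^sub>R \<xi>))
  \<and> C11 (K1 * (ln (s + 2) / (s + 2)^2)) 1 (cball 0 ((L + \<gamma> * s) / (s + 2))) (\<lambda>\<xi>. B s ((s + 2) *\<^sub>R \<xi>))"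
  using field_C11 by blast
 obtain K where K: "0 \<le> K" "\<And>A S E B. C11 A 1 S E \<and> C11 A 1 S B \<Longrightarrow>
  C11 (K * A) 1 (S \<times> cball 0 \<gamma>) (\<lambda>z::vec3 \<times> vec3. acc m q (E (fst z)) (B (fst z)) (snd z))"
  using acc_C11[OF \<gamma>, of m q] by blast
 show ?thesis
 \<comment> \<open>Adding 1 keeps the constant positive, as \<open>gronwall_system\<close>
   requires.\<close>
 proof (intro exI[of _ "K * K1 + 1"] conjI allI impI)
  show "0 < K * K1 + 1" using K(1) K1(1) by (simp add: add_nonneg_pos)
  fix s :: real assume s: "0 \<le> s"
  have le: "K * (K1 * (ln (s + 2) / (s + 2)^2)) \<le> cdec (K * K1 + 1) s"
  proof -
   have "0 \<le> ln (s + 2) / (s + 2)^2" using s by simp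
   then have "(K * K1) * (ln (s + 2) / (s + 2)^2) \<le> (K * K1 + 1) * (ln (s + 2) / (s + 2)^2)" by (intro mult_right_mono) auto
   then show ?thesis by (simp add: cdec_def mult_ac)
  qed
  show "C11 (cdec (K * K1 + 1) s) 1 (cball 0 ((L + \<gamma> * s) / (s + 2)) \<times> cball 0 \<gamma>) (\<lambda>z. accf s ((s + 2) *\<^sub>R fst z) (snd z))"
   unfolding accf_def by (rule C11_mono[OF K(2)[OF K1(2)[OF s]] le]) auto
 qed
qed

definition a1 :: real where "a1 = (SOME a. a > 0 \<and> (\<forall>s\<ge>0. C11 (cdec a s) 1 (cball 0 ((L + \<gamma> * s) / (s + 2)) \<times> cball 0 \<gamma>)
  (\<lambda>z. accf s ((s + 2) *\<^sub>R fst z) (snd z))))"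

lemma a1: "0 < a1" "0 \<le> s \<Longrightarrow> C11 (cdec a1 s) 1 (cball 0 ((L + \<gamma> * s) / (s + 2)) \<times> cball 0 \<gamma>)
  (\<lambda>z. accf s ((s + 2) *\<^sub>R fst z) (snd z))"
 using someI_ex[OF accf_C11_ex] unfolding a1_def[symmetric] by auto

definition Wc :: "(real \<Rightarrow> vec3) \<Rightarrow> real \<Rightarrow> vec3" where "Wc P s = vel m (P s)"
definition Yc :: "(real \<Rightarrow> vec3) \<Rightarrow> (real \<Rightarrow> vec3) \<Rightarrow> real \<Rightarrow> vec3" where "Yc X P s = X s - s *\<^sub>R Wc P s"
text \<open>The point of rescaled phase space at which the acceleration has the bound
  \<open>cdec a1 s\<close> at unit scale.\<close>

definition Zc :: "(real \<Rightarrow> vec3) \<Rightarrow> (real \<Rightarrow> vec3) \<Rightarrow> real \<Rightarrow> vec3 \<times> vec3" where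
 "Zc X P s = ((1 / (s + 2)) *\<^sub>R X s, Wc P s)"

lemma sol_W: assumes "sol a b X P" "s \<in> {a..b}"
 shows "(Wc P has_vector_derivative accf s (X s) (Wc P s)) (at s within {a..b})"
proof -
 have "(P has_derivative (\<lambda>k. k *\<^sub>R force s (X s) (P s))) (at s within {a..b})"
  using assms by (auto simp: sol_def has_vector_derivative_def)
 from has_derivative_compose[OF this vel_has_derivative[OF m]]
 have "((\<lambda>s. vel m (P s)) has_derivative (\<lambda>k. dvel m (P s) (k *\<^sub>R force s (X s) (P s)))) (at s within {a..b})" .
 moreover have "dvel m (P s) (k *\<^sub>R h) = k *\<^sub>R dvel m (P s) h" for k h
  by (rule linear_cmul[OF has_derivative_linear[OF vel_has_derivative[OF m, of _ UNIV]]])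
 moreover have "dvel m (P s) (force s (X s) (P s)) = accf s (X s) (Wc P s)"
  by (simp add: force_def dvel_force[OF m] accf_def Wc_def)
 ultimately show ?thesis
  by (simp add: has_vector_derivative_def Wc_def[abs_def])
qed

lemma sol_Y: assumes S: "sol a b X P" and s: "s \<in> {a..b}"
 shows "(Yc X P has_vector_derivative - (s *\<^sub>R accf s (X s) (Wc P s))) (at s within {a..b})"
proof -
 have "(X has_vector_derivative Wc P s) (at s within {a..b})" using S s by (auto simp: sol_def Wc_def)
 moreover have "((\<lambda>s. s *\<^sub>R Wc P s) has_vector_derivative s *\<^sub>R accf s (X s) (Wc P s) + 1 *\<^sub>R Wc P s) (at s within {a..b})"
  by (intro has_vector_derivative_scaleR sol_W[OF S s]) (auto intro!: derivative_eq_intros)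
 ultimately have "(Yc X P has_vector_derivative Wc P s - (s *\<^sub>R accf s (X s) (Wc P s) + 1 *\<^sub>R Wc P s)) (at s within {a..b})"
  unfolding Yc_def[abs_def] by (rule has_vector_derivative_diff)
 then show ?thesis by simp
qed

lemma orbD: assumes "orb t x p X P"
 shows "sol 0 t X P" "s \<in> {0..t} \<Longrightarrow> norm (Wc P s) \<le> \<gamma>" "s \<in> {0..t} \<Longrightarrow> norm (X s) \<le> L + \<gamma> * s"
  "s \<in> {0..t} \<Longrightarrow> Zc X P s \<in> cball 0 ((L + \<gamma> * s) / (s + 2)) \<times> cball 0 \<gamma>"
  "s \<in> {0..t} \<Longrightarrow> accf s (X s) (Wc P s) = (\<lambda>z. accf s ((s + 2) *\<^sub>R fst z) (snd z)) (Zc X P s)"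
  "X t = x" "P t = p" "g t x p = g0 (X 0) (P 0)"
 using assms unfolding orb_def Wc_def Zc_def by (auto simp: divide_right_mono)

text \<open>As X = Y + s W, the rescaled positions differ by at most |dY| / (s + 2) + |dW|, and the
  second component adds |dW| once more. The resulting factor 2 is moved by
  \<open>cdec_double\<close> into the constant, which is why \<open>2 * a1\<close> appears in the
  weights.\<close>

lemma Zc_diff: assumes "0 \<le> s"
 shows "norm (Zc X P s - Zc X' P' s) \<le> 2 * (norm (Yc X P s - Yc X' P' s) / (s + 2) + norm (Wc P s - Wc P' s))"
proof -
 have X: "X s - X' s = (Yc X P s - Yc X' P' s) + s *\<^sub>R (Wc P s - Wc P' s)" by (simp add: Yc_def algebra_simps)
 have "norm (X s - X' s) \<le> norm (Yc X P s - Yc X' P' s) + s * norm (Wc P s - Wc P' s)"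
  unfolding X using assms norm_triangle_ineq[of "Yc X P s - Yc X' P' s" "s *\<^sub>R (Wc P s - Wc P' s)"] by simp
 also have "\<dots> \<le> norm (Yc X P s - Yc X' P' s) + (s + 2) * norm (Wc P s - Wc P' s)" using assms by (intro add_left_mono mult_right_mono) auto
 finally have "norm (X s - X' s) / (s + 2) \<le> (norm (Yc X P s - Yc X' P' s) + (s + 2) * norm (Wc P s - Wc P' s)) / (s + 2)"
  using assms by (intro divide_right_mono) auto
 then have b: "norm (X s - X' s) / (s + 2) \<le> norm (Yc X P s - Yc X' P' s) / (s + 2) + norm (Wc P s - Wc P' s)"
  using assms by (simp add: add_divide_distrib)
 have "norm (Zc X P s - Zc X' P' s) \<le> norm ((1 / (s + 2)) *\<^sub>R (X s - X' s)) + norm (Wc P s - Wc P' s)"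
  unfolding Zc_def using norm_Pair_le[of "(1 / (s + 2)) *\<^sub>R (X s - X' s)" "Wc P s - Wc P' s"] by (simp add: scaleR_diff_right)
 also have "\<dots> = norm (X s - X' s) / (s + 2) + norm (Wc P s - Wc P' s)" using assms by simp
 finally show ?thesis using b assms norm_ge_zero[of "Yc X P s - Yc X' P' s"] by (smt (verit) divide_nonneg_nonneg)
qed

lemma Zc_diff4: assumes "0 \<le> s"
 shows "norm (Zc Xd Pd s - Zc Xc Pc s - Zc Xb Pb s + Zc Xa Pa s) \<le>
  2 * (norm (Yc Xd Pd s - Yc Xc Pc s - Yc Xb Pb s + Yc Xa Pa s) / (s + 2) + norm (Wc Pd s - Wc Pc s - Wc Pb s + Wc Pa s))"
proof -
 define y where "y = Yc Xd Pd s - Yc Xc Pc s - Yc Xb Pb s + Yc Xa Pa s"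
 define w where "w = Wc Pd s - Wc Pc s - Wc Pb s + Wc Pa s"
 define x where "x = Xd s - Xc s - Xb s + Xa s"
 have X: "x = y + s *\<^sub>R w" by (simp add: x_def y_def w_def Yc_def algebra_simps)
 have "norm x \<le> norm y + s * norm w"
  unfolding X using assms norm_triangle_ineq[of y "s *\<^sub>R w"] by simp
 also have "\<dots> \<le> norm y + (s + 2) * norm w" using assms by (intro add_left_mono mult_right_mono) auto
 finally have "norm x / (s + 2) \<le> (norm y + (s + 2) * norm w) / (s + 2)"
  using assms by (intro divide_right_mono) auto
 then have b: "norm x / (s + 2) \<le> norm y / (s + 2) + norm w"
  using assms by (simp add: add_divide_distrib)
 have "Zc Xd Pd s - Zc Xc Pc s - Zc Xb Pb s + Zc Xa Pa s = ((1 / (s + 2)) *\<^sub>R x, w)"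
  by (simp add: Zc_def x_def w_def algebra_simps)
 then have "norm (Zc Xd Pd s - Zc Xc Pc s - Zc Xb Pb s + Zc Xa Pa s) \<le> norm ((1 / (s + 2)) *\<^sub>R x) + norm w"
  using norm_Pair_le by metis
 also have "\<dots> = norm x / (s + 2) + norm w" using assms by simp
 finally show ?thesis unfolding y_def[symmetric] w_def[symmetric] using b assms norm_ge_zero[of y] by (smt (verit) divide_nonneg_nonneg)
qed

lemma cdec_double: "cdec a1 s * (2 * x) = cdec (2 * a1) s * x" by (simp add: cdec_def)

lemma norm_scaleR_le_shift: "0 \<le> s \<Longrightarrow> norm v \<le> c * x \<Longrightarrow> norm (- (s *\<^sub>R v)) \<le> (s + 2) * c * x" for v :: vec3
proof -
 assume s: "0 \<le> s" "norm v \<le> c * x"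
 then have "s * norm v \<le> (s + 2) * (c * x)" using norm_ge_zero[of v] by (intro mult_mono) auto
 then show ?thesis using s by (simp add: mult.assoc)
qed

definition gK :: real where "gK = exp (8 * (2 * a1) + 8 * (2 * a1)^2) * (1 + 8 * (2 * a1) + 8 * (2 * a1)^2)"

lemma gK: "1 \<le> gK"
proof -
 have "1 * 1 \<le> exp (8 * (2 * a1) + 8 * (2 * a1)^2) * (1 + 8 * (2 * a1) + 8 * (2 * a1)^2)"
  using a1(1) by (intro mult_mono) (auto simp: add_nonneg_nonneg)
 then show ?thesis by (simp add: gK_def)
qed

text \<open>The homogeneous case of the Gronwall estimate. For two orbits that end at the same
  \<open>Yc\<close> it bounds the distance of their feet by a multiple of
  \<open>wlam (2 * a1) t\<close> times the difference of final velocities: the cost, of order ln^2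
  t, of one difference of the density.\<close>

lemma orb_diff:
 assumes o: "orb t x p X P" and o': "orb t x' p' X' P'" and s: "s \<in> {0..t}"
 shows "norm (Yc X P s - Yc X' P' s) + wlam (2 * a1) s * norm (Wc P s - Wc P' s)
  \<le> gK * (norm (Yc X P t - Yc X' P' t) + wlam (2 * a1) t * norm (Wc P t - Wc P' t))"
proof -
 have acc: "norm (accf r (X r) (Wc P r) - accf r (X' r) (Wc P' r)) \<le> cdec (2 * a1) r * (norm (Yc X P r - Yc X' P' r) / (r + 2) + norm (Wc P r - Wc P' r))"
  if r: "r \<in> {0..t}" for r
 proof -
  have r0: "0 \<le> r" using r by simp
  have "norm (accf r (X r) (Wc P r) - accf r (X' r) (Wc P' r)) \<le> cdec a1 r * 1 * norm (Zc X P r - Zc X' P' r)"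
   unfolding orbD(5)[OF o r] orbD(5)[OF o' r] by (rule C11D(4)[OF a1(2)[OF r0] orbD(4)[OF o r] orbD(4)[OF o' r]])
  also have "\<dots> \<le> cdec a1 r * (2 * (norm (Yc X P r - Yc X' P' r) / (r + 2) + norm (Wc P r - Wc P' r)))"
   using Zc_diff[OF r0, of X P X' P'] C11D(1)[OF a1(2)[OF r0]] by (simp add: mult_left_mono)
  finally show ?thesis unfolding cdec_double .
 qed
 have "norm ((\<lambda>s. Yc X P s - Yc X' P' s) s) + wlam (2 * a1) s * norm ((\<lambda>s. Wc P s - Wc P' s) s) \<le>
  exp (8 * (2 * a1) + 8 * (2 * a1)^2) * (1 + 8 * (2 * a1) + 8 * (2 * a1)^2) *
  (norm ((\<lambda>s. Yc X P s - Yc X' P' s) t) + wlam (2 * a1) t * norm ((\<lambda>s. Wc P s - Wc P' s) t) + 0)"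
 proof (rule gronwall_system[where u' = "\<lambda>s. - (s *\<^sub>R accf s (X s) (Wc P s)) - - (s *\<^sub>R accf s (X' s) (Wc P' s))"
    and v' = "\<lambda>s. accf s (X s) (Wc P s) - accf s (X' s) (Wc P' s)"])
  fix r assume r: "r \<in> {0..t}"
  then have r0: "0 \<le> r" by simp
  show "((\<lambda>s. Yc X P s - Yc X' P' s) has_vector_derivative - (r *\<^sub>R accf r (X r) (Wc P r)) - - (r *\<^sub>R accf r (X' r) (Wc P' r))) (at r within {0..t})"
   by (intro has_vector_derivative_diff sol_Y orbD(1)[OF o] orbD(1)[OF o'] r)
  show "((\<lambda>s. Wc P s - Wc P' s) has_vector_derivative accf r (X r) (Wc P r) - accf r (X' r) (Wc P' r)) (at r within {0..t})"
   by (intro has_vector_derivative_diff sol_W orbD(1)[OF o] orbD(1)[OF o'] r)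
  show "norm (accf r (X r) (Wc P r) - accf r (X' r) (Wc P' r)) \<le> cdec (2 * a1) r * (norm (Yc X P r - Yc X' P' r) / (r + 2) + norm (Wc P r - Wc P' r) + 0 / (wlam (2 * a1) r)^2)"
   using acc[OF r] by simp
  show "norm (- (r *\<^sub>R accf r (X r) (Wc P r)) - - (r *\<^sub>R accf r (X' r) (Wc P' r))) \<le> (r + 2) * cdec (2 * a1) r * (norm (Yc X P r - Yc X' P' r) / (r + 2) + norm (Wc P r - Wc P' r) + 0 / (wlam (2 * a1) r)^2)"
   using norm_scaleR_le_shift[OF r0 acc[OF r]] by (simp add: scaleR_diff_right norm_minus_commute)
 qed (use a1(1) s in auto)
 then show ?thesis by (simp add: gK_def)
qed

definition gN :: "real \<Rightarrow> vec3 \<Rightarrow> vec3 \<Rightarrow> vec3 \<Rightarrow> vec3 \<Rightarrow> real" where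
 "gN t y w y' w' = norm (y - y') + wlam (2 * a1) t * norm (w - w')"

lemma gN_nonneg: "0 \<le> gN t y w y' w'"
 using wlam_ge_1[of "2 * a1" t] a1(1) by (simp add: gN_def)

text \<open>The same estimate at an intermediate time, with the weight kept: differences at time
  \<open>s\<close> are smaller by a factor 1 / \<open>wlam (2 * a1) s\<close>. This gain makes
  products of two such differences integrable in \<open>orb_diff4\<close>.\<close>

lemma orb_diff_Z:
 assumes o: "orb t x p X P" and o': "orb t x' p' X' P'" and s: "s \<in> {0..t}"
 shows "norm (Zc X P s - Zc X' P' s) \<le> 4 * gK * (1 + 2 * a1) * gN t (Yc X P t) (Wc P t) (Yc X' P' t) (Wc P' t) / wlam (2 * a1) s"
proof -
 define N where "N = gN t (Yc X P t) (Wc P t) (Yc X' P' t) (Wc P' t)"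
 define l where "l = wlam (2 * a1) s"
 have s0: "0 \<le> s" using s by simp
 have l: "1 \<le> l" "l \<le> (1 + 4 * a1) * (s + 2)" using wlam_ge_1[of "2 * a1" s] wlam_le_linear[of "2 * a1" s] a1(1) s0 by (auto simp: l_def)
 have b: "norm (Yc X P s - Yc X' P' s) + l * norm (Wc P s - Wc P' s) \<le> gK * N"
  using orb_diff[OF o o' s] by (simp add: N_def gN_def l_def)
 have "0 \<le> l * norm (Wc P s - Wc P' s)" using l by simp
 then have "norm (Yc X P s - Yc X' P' s) \<le> gK * N" using b by linarith
 moreover have gN: "0 \<le> gK * N" using gK gN_nonneg by (simp add: N_def)
 moreover have "1 / (s + 2) \<le> (1 + 4 * a1) / l" using l s0 by (simp add: field_simps)
 ultimately have "norm (Yc X P s - Yc X' P' s) * (1 / (s + 2)) \<le> (gK * N) * ((1 + 4 * a1) / l)"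
  using s0 by (intro mult_mono) auto
 moreover have "norm (Wc P s - Wc P' s) \<le> gK * N / l"
 proof -
  have "l * norm (Wc P s - Wc P' s) \<le> gK * N" using b norm_ge_zero[of "Yc X P s - Yc X' P' s"] by linarith
  then show ?thesis using l by (simp add: pos_le_divide_eq mult.commute)
 qed
 ultimately have "norm (Zc X P s - Zc X' P' s) \<le> 2 * ((gK * N) * ((1 + 4 * a1) / l) + gK * N / l)"
  using Zc_diff[OF s0, of X P X' P'] by simp
 also have "\<dots> = 4 * gK * (1 + 2 * a1) * N / l" using l by (simp add: field_simps)
 finally show ?thesis by (simp add: N_def l_def)
qed

text \<open>A product of two first differences carries the square of the constant in
  \<open>orb_diff_Z\<close>; the division by 2 compensates the factor 2 that
  \<open>cdec_double\<close> takes out in front.\<close>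

definition gR :: real where "gR = (4 * gK * (1 + 2 * a1))^2 / 2"

lemma orb_diff4:
 assumes oa: "orb t xa pa Xa Pa" and ob: "orb t xb pb Xb Pb" and oc: "orb t xc pc Xc Pc" and od: "orb t xd pd Xd Pd"
  and s: "s \<in> {0..t}"
 defines "N \<equiv> \<lambda>X P X' P'. gN t (Yc X P t) (Wc P t) (Yc X' P' t) (Wc P' t)"
 shows "norm (Yc Xd Pd s - Yc Xc Pc s - Yc Xb Pb s + Yc Xa Pa s) + wlam (2 * a1) s * norm (Wc Pd s - Wc Pc s - Wc Pb s + Wc Pa s)
  \<le> gK * (norm (Yc Xd Pd t - Yc Xc Pc t - Yc Xb Pb t + Yc Xa Pa t) + wlam (2 * a1) t * norm (Wc Pd t - Wc Pc t - Wc Pb t + Wc Pa t)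
    + gR * ((N Xb Pb Xa Pa + N Xd Pd Xc Pc) * (N Xc Pc Xa Pa + N Xd Pd Xb Pb)))"
proof -
 define Q where "Q = (N Xb Pb Xa Pa + N Xd Pd Xc Pc) * (N Xc Pc Xa Pa + N Xd Pd Xb Pb)"
 have Q0: "0 \<le> Q" unfolding Q_def N_def by (intro mult_nonneg_nonneg add_nonneg_nonneg gN_nonneg)
 define k where "k = 4 * gK * (1 + 2 * a1)"
 have k0: "0 \<le> k" using gK a1(1) by (simp add: k_def)
 have acc: "norm (accf r (Xd r) (Wc Pd r) - accf r (Xc r) (Wc Pc r) - accf r (Xb r) (Wc Pb r) + accf r (Xa r) (Wc Pa r)) \<le>
  cdec (2 * a1) r * (norm (Yc Xd Pd r - Yc Xc Pc r - Yc Xb Pb r + Yc Xa Pa r) / (r + 2) + norm (Wc Pd r - Wc Pc r - Wc Pb r + Wc Pa r)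
   + (gR * Q) / (wlam (2 * a1) r)^2)"
  if r: "r \<in> {0..t}" for r
 proof -
  have r0: "0 \<le> r" using r by simp
  define l where "l = wlam (2 * a1) r"
  have l: "1 \<le> l" using wlam_ge_1[of "2 * a1" r] a1(1) by (auto simp: l_def)
  have Zd: "norm (Zc X P r - Zc X' P' r) \<le> k * N X P X' P' / l" if "orb t x p X P" "orb t x' p' X' P'" for x p X P x' p' X' P'
   using orb_diff_Z[OF that r] by (simp add: k_def N_def l_def)
  have "norm (accf r (Xd r) (Wc Pd r) - accf r (Xc r) (Wc Pc r) - accf r (Xb r) (Wc Pb r) + accf r (Xa r) (Wc Pa r)) \<le>
   cdec a1 r * (1 * norm (Zc Xd Pd r - Zc Xc Pc r - Zc Xb Pb r + Zc Xa Pa r) + 1^2 * (norm (Zc Xb Pb r - Zc Xa Pa r) + norm (Zc Xd Pd r - Zc Xc Pc r))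
     * (norm (Zc Xc Pc r - Zc Xa Pa r) + norm (Zc Xd Pd r - Zc Xb Pb r)))"
   unfolding orbD(5)[OF oa r] orbD(5)[OF ob r] orbD(5)[OF oc r] orbD(5)[OF od r]
   by (rule C11D(5)[OF a1(2)[OF r0] orbD(4)[OF oa r] orbD(4)[OF ob r] orbD(4)[OF oc r] orbD(4)[OF od r]])
  also have "\<dots> \<le> cdec a1 r * (1 * (2 * (norm (Yc Xd Pd r - Yc Xc Pc r - Yc Xb Pb r + Yc Xa Pa r) / (r + 2) + norm (Wc Pd r - Wc Pc r - Wc Pb r + Wc Pa r)))
    + 1^2 * (k * N Xb Pb Xa Pa / l + k * N Xd Pd Xc Pc / l) * (k * N Xc Pc Xa Pa / l + k * N Xd Pd Xb Pb / l))"
   using C11D(1)[OF a1(2)[OF r0]] k0 l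
   by (intro mult_left_mono add_mono mult_mono Zc_diff4[OF r0] Zd[OF ob oa] Zd[OF od oc] Zd[OF oc oa] Zd[OF od ob] )
    (auto intro!: add_nonneg_nonneg divide_nonneg_nonneg mult_nonneg_nonneg simp: N_def gN_nonneg)
  also have "\<dots> = cdec a1 r * (2 * (norm (Yc Xd Pd r - Yc Xc Pc r - Yc Xb Pb r + Yc Xa Pa r) / (r + 2) + norm (Wc Pd r - Wc Pc r - Wc Pb r + Wc Pa r) + gR * Q / l^2))"
  proof -
   have "1^2 * (k * N Xb Pb Xa Pa / l + k * N Xd Pd Xc Pc / l) * (k * N Xc Pc Xa Pa / l + k * N Xd Pd Xb Pb / l) = k^2 * Q / l^2"
    by (simp add: Q_def add_divide_distrib[symmetric] distrib_left[symmetric] power2_eq_square)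
   moreover have "k^2 * Q / l^2 = 2 * (gR * Q / l^2)" by (simp add: gR_def k_def)
   ultimately show ?thesis by (simp only: distrib_left mult_1)
  qed
  finally show ?thesis unfolding cdec_double l_def .
 qed
 let ?u' = "\<lambda>s. - (s *\<^sub>R accf s (Xd s) (Wc Pd s)) - - (s *\<^sub>R accf s (Xc s) (Wc Pc s)) - - (s *\<^sub>R accf s (Xb s) (Wc Pb s)) + - (s *\<^sub>R accf s (Xa s) (Wc Pa s))"
 have "norm ((\<lambda>s. Yc Xd Pd s - Yc Xc Pc s - Yc Xb Pb s + Yc Xa Pa s) s) + wlam (2 * a1) s * norm ((\<lambda>s. Wc Pd s - Wc Pc s - Wc Pb s + Wc Pa s) s) \<le>
  exp (8 * (2 * a1) + 8 * (2 * a1)^2) * (1 + 8 * (2 * a1) + 8 * (2 * a1)^2) *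
  (norm ((\<lambda>s. Yc Xd Pd s - Yc Xc Pc s - Yc Xb Pb s + Yc Xa Pa s) t) + wlam (2 * a1) t * norm ((\<lambda>s. Wc Pd s - Wc Pc s - Wc Pb s + Wc Pa s) t) + gR * Q)"
 proof (rule gronwall_system[where u' = ?u'
    and v' = "\<lambda>s. accf s (Xd s) (Wc Pd s) - accf s (Xc s) (Wc Pc s) - accf s (Xb s) (Wc Pb s) + accf s (Xa s) (Wc Pa s)"])
  fix r assume r: "r \<in> {0..t}"
  then have r0: "0 \<le> r" by simp
  show "((\<lambda>s. Yc Xd Pd s - Yc Xc Pc s - Yc Xb Pb s + Yc Xa Pa s) has_vector_derivative ?u' r) (at r within {0..t})"
   by (intro has_vector_derivative_diff has_vector_derivative_add sol_Y orbD(1)[OF oa] orbD(1)[OF ob] orbD(1)[OF oc] orbD(1)[OF od] r)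
  show "((\<lambda>s. Wc Pd s - Wc Pc s - Wc Pb s + Wc Pa s) has_vector_derivative accf r (Xd r) (Wc Pd r) - accf r (Xc r) (Wc Pc r) - accf r (Xb r) (Wc Pb r) + accf r (Xa r) (Wc Pa r)) (at r within {0..t})"
   by (intro has_vector_derivative_diff has_vector_derivative_add sol_W orbD(1)[OF oa] orbD(1)[OF ob] orbD(1)[OF oc] orbD(1)[OF od] r)
  show "norm (accf r (Xd r) (Wc Pd r) - accf r (Xc r) (Wc Pc r) - accf r (Xb r) (Wc Pb r) + accf r (Xa r) (Wc Pa r)) \<le>
  cdec (2 * a1) r * (norm (Yc Xd Pd r - Yc Xc Pc r - Yc Xb Pb r + Yc Xa Pa r) / (r + 2) + norm (Wc Pd r - Wc Pc r - Wc Pb r + Wc Pa r)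
   + (gR * Q) / (wlam (2 * a1) r)^2)"
   by (rule acc[OF r])
  have "?u' r = - (r *\<^sub>R (accf r (Xd r) (Wc Pd r) - accf r (Xc r) (Wc Pc r) - accf r (Xb r) (Wc Pb r) + accf r (Xa r) (Wc Pa r)))"
   by (simp add: algebra_simps)
  then show "norm (?u' r) \<le> (r + 2) * cdec (2 * a1) r * (norm (Yc Xd Pd r - Yc Xc Pc r - Yc Xb Pb r + Yc Xa Pa r) / (r + 2) + norm (Wc Pd r - Wc Pc r - Wc Pb r + Wc Pa r)
   + (gR * Q) / (wlam (2 * a1) r)^2)"
   using norm_scaleR_le_shift[OF r0 acc[OF r]] by simp
 qed (use a1(1) s Q0 in \<open>auto simp: gR_def\<close>)
 then show ?thesis by (simp add: gK_def Q_def)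
qed

lemma orb_support:
 "\<exists>C\<ge>0. \<forall>t\<ge>0. \<forall>x p. g t x p \<noteq> 0 \<longrightarrow> norm (x - t *\<^sub>R vel m p) \<le> L + C * ln (t + 2)"
proof -
 \<comment> \<open>The factor 3 counts E, w x B and (w.E) w, each of which is at most the sum of the
   two field strengths.\<close>
 define C where "C = \<bar>q / m\<bar> * (3 * (2 * K0 / aper))"
 have C0: "0 \<le> C" using K0 aper(1) by (simp add: C_def)
 have "norm (x - t *\<^sub>R vel m p) \<le> L + C * ln (t + 2)" if t: "0 \<le> t" and nz: "g t x p \<noteq> 0" for t x p
 proof -
  obtain X P where o: "orb t x p X P" using orb_exists[OF t nz] by blast
  have "norm (Yc X P t - Yc X P 0) \<le> C * ln (t + 2) - C * ln (0 + 2)"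
  proof (cases "t = 0")
   case False
   show ?thesis
   proof (rule differentiable_bound_general[where f' = "\<lambda>s. - (s *\<^sub>R accf s (X s) (Wc P s))" and \<phi>' = "\<lambda>s. C / (s + 2)" and \<phi> = "\<lambda>s. C * ln (s + 2)"])
    show "continuous_on {0..t} (Yc X P)"
     by (rule continuous_on_vector_derivative[OF sol_Y[OF orbD(1)[OF o]]])
    show "continuous_on {0..t} (\<lambda>s. C * ln (s + 2))" by (intro continuous_intros) auto
    fix s assume s: "0 < s" "s < t"
    then have sI: "s \<in> {0..t}" by simp
    show "(Yc X P has_vector_derivative - (s *\<^sub>R accf s (X s) (Wc P s))) (at s)"
     using sol_Y[OF orbD(1)[OF o] sI] s by (simp add: at_within_Icc_at)
    show "((\<lambda>s. C * ln (s + 2)) has_vector_derivative C / (s + 2)) (at s)"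
     unfolding has_real_derivative_iff_has_vector_derivative[symmetric]
     using s by (auto intro!: derivative_eq_intros)
    have W: "norm (Wc P s) \<le> 1" using orbD(2)[OF o sI] \<gamma> by simp
    have fd: "norm (E s (X s)) + norm (B s (X s)) \<le> (2 * K0 / aper) / (s + 2)^2"
     using field_decay[OF _ orbD(3)[OF o sI]] s by simp
    have sq: "\<bar>sqrt (1 - (norm (Wc P s))^2)\<bar> \<le> 1"
     using W by (simp add: power_le_one)
    have "norm (cross3 (Wc P s) (B s (X s))) \<le> 1 * norm (B s (X s))"
     by (rule order_trans[OF norm_cross3_le mult_right_mono[OF W]]) simp
    moreover have "norm ((Wc P s \<bullet> E s (X s)) *\<^sub>R Wc P s) \<le> (1 * norm (E s (X s))) * 1"
     unfolding norm_scaleR using W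
     by (intro mult_mono) (auto intro!: order_trans[OF Cauchy_Schwarz_ineq2] mult_left_le_one_le)
    moreover have "norm (u + v + - w) \<le> norm u + norm v + norm w" for u v w :: vec3
     using norm_triangle_ineq4[of "u + v" w] norm_triangle_ineq[of u v] by simp
    ultimately have "norm (E s (X s) + cross3 (Wc P s) (B s (X s)) + - ((Wc P s \<bullet> E s (X s)) *\<^sub>R Wc P s))
     \<le> norm (E s (X s)) + norm (B s (X s)) + norm (E s (X s))"
     by (smt (verit))
    also have "\<dots> \<le> 3 * ((2 * K0 / aper) / (s + 2)^2)"
     using fd norm_ge_zero[of "E s (X s)"] norm_ge_zero[of "B s (X s)"] by linarith
    finally have e: "norm (E s (X s) + cross3 (Wc P s) (B s (X s)) + - ((Wc P s \<bullet> E s (X s)) *\<^sub>R Wc P s)) \<le> 3 * ((2 * K0 / aper) / (s + 2)^2)" .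
    have "norm (accf s (X s) (Wc P s)) \<le> \<bar>q / m\<bar> * (1 * (3 * ((2 * K0 / aper) / (s + 2)^2)))"
     unfolding accf_def acc_def norm_scaleR
     by (intro mult_left_mono mult_mono e) (use sq in auto)
    also have "\<dots> = C / (s + 2)^2" by (simp add: C_def)
    finally have "s * norm (accf s (X s) (Wc P s)) \<le> (s + 2) * (C / (s + 2)^2)" using s by (intro mult_mono) auto
    then show "norm (- (s *\<^sub>R accf s (X s) (Wc P s))) \<le> C / (s + 2)" using s by (simp add: power2_eq_square)
   qed (use False t in auto)
  qed simp
  moreover have Yt: "Yc X P t = x - t *\<^sub>R vel m p" using orbD(6,7)[OF o] by (simp add: Yc_def Wc_def)
  moreover have "norm (Yc X P 0) \<le> L" using orbD(3)[OF o, of 0] t by (simp add: Yc_def)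
  moreover have "0 \<le> C * ln (0 + 2)" using C0 by simp
  ultimately show ?thesis unfolding Yt[symmetric] using norm_triangle_sub[of "Yc X P t" "Yc X P 0"] by linarith
 qed
 then show ?thesis using C0 by blast
qed

definition gv :: "real \<Rightarrow> vec3 \<Rightarrow> vec3 \<Rightarrow> real" where
 "gv t y w = g t (y + t *\<^sub>R w) (vel_inv m w)"

text \<open>The density as a function of velocity along \<open>y + t w\<close>; the factor \<open>m\<^sup>3 * lor w ^ 5\<close> is the Jacobian of \<open>vel_inv m\<close>.\<close>

definition psi :: "real \<Rightarrow> vec3 \<Rightarrow> vec3 \<Rightarrow> real" where
 "psi t y w = (if norm w < 1 then m ^ 3 * lor w ^ 5 * gv t y w else 0)"

lemma gv_support: assumes "0 \<le> t" "norm w < 1" "gv t y w \<noteq> 0" shows "norm w \<le> \<gamma>"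
proof -
 have "norm (vel_inv m w) \<le> \<beta>" using g_supp[OF assms(1), of "vel_inv m w" "y + t *\<^sub>R w"] assms(3)
  by (cases "\<beta> \<le> norm (vel_inv m w)") (auto simp: gv_def)
 from vel_le_\<gamma>[OF this] show ?thesis by (simp add: vel_vel_inv[OF m assms(2)])
qed

text \<open>The density is the initial datum at the foot of the characteristic. At fixed
  \<open>y\<close> the foot depends on the final velocity with scale \<open>wlam (2 * a1) t\<close>,
  and composition with the fixed datum keeps that scale. Only velocities with nonzero density are
  compared, since their orbits obey the support bounds.\<close>

lemma gv_C11: "\<exists>M. \<forall>t\<ge>0. \<forall>y. C11 M (wlam (2 * a1) t) {w. norm w < 1 \<and> gv t y w \<noteq> 0} (gv t y)"
proof -
 define M1 where "M1 = L + 1 + gK * (1 + gR)"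
 have gR0: "0 \<le> gR" by (simp add: gR_def)
 have gKR: "0 \<le> gK * gR" "0 \<le> gK" using gK gR0 by auto
 have gKR2: "gK * (1 + gR) = gK + gK * gR" by (simp add: distrib_left)
 have M1: "gK \<le> M1" "gK * gR \<le> M1" "L + 1 \<le> M1" "0 \<le> M1" using gKR L unfolding M1_def gKR2 by linarith+
 obtain Mv where Mv: "C11 Mv 1 (cball 0 \<gamma>) (vel_inv m)" using C11_vel_inv[OF \<gamma>] by blast
 obtain Mg where Mg: "C11 Mg 1 (cball 0 (L + Mv)) (\<lambda>z. g0 (fst z) (snd z))" using C11_Ck2_cball[OF Ck0] by blast
 let ?S = "cball (0::vec3) L \<times> cball (0::vec3) \<gamma>"
 have "C11 (L + 1) 1 ?S (\<lambda>z. fst z)"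
 proof (rule C11_bounded_linear[OF bounded_linear_fst norm_fst_snd_le(1)])
  show "norm z \<le> L + 1" if "z \<in> ?S" for z :: "vec3 \<times> vec3"
   using that norm_fst_snd_le(3)[of z] \<gamma> by auto
 qed (use L in auto)
 moreover have "C11 Mv 1 ?S (\<lambda>z. vel_inv m (snd z))"
  by (rule C11_precompose[OF Mv bounded_linear_snd norm_fst_snd_le(2)]) auto
 ultimately have P: "C11 (L + 1 + Mv) 1 ?S (\<lambda>z. (fst z, vel_inv m (snd z)))" by (rule C11_Pair)
 have "C11 (Mg * (1 + 2 * (L + 1 + Mv))^2) 1 ?S (\<lambda>z. (\<lambda>z. g0 (fst z) (snd z)) (fst z, vel_inv m (snd z)))"
 proof (rule C11_compose[OF P Mg], safe)
  fix x w :: vec3 assume xw: "x \<in> cball 0 L" "w \<in> cball 0 \<gamma>"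
  have "norm (x, vel_inv m w) \<le> norm x + norm (vel_inv m w)" by (rule norm_Pair_le)
  also have "\<dots> \<le> L + Mv" using xw C11D(3)[OF Mv xw(2)] by (intro add_mono) auto
  finally show "(fst (x, w), vel_inv m (snd (x, w))) \<in> cball 0 (L + Mv)" by simp
 qed
 then obtain M2 where M2: "C11 M2 1 ?S (\<lambda>z. g0 (fst z) (vel_inv m (snd z)))" by auto
 have "C11 (M2 * (1 + 2 * M1)^2) (wlam (2 * a1) t) {w. norm w < 1 \<and> gv t y w \<noteq> 0} (gv t y)" if t: "0 \<le> t" for t y
 proof -
  define U where "U = {w. norm w < 1 \<and> gv t y w \<noteq> 0}"
  define l where "l = wlam (2 * a1) t"
  have l1: "1 \<le> l" using wlam_ge_1[of "2 * a1" t] a1(1) by (auto simp: l_def)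
  have l0: "1 \<le> wlam (2 * a1) 0" using wlam_ge_1[of "2 * a1" 0] a1(1) by auto
  have "\<forall>w\<in>U. \<exists>X P. orb t (y + t *\<^sub>R w) (vel_inv m w) X P"
   using orb_exists[OF t] by (auto simp: U_def gv_def)
  then obtain X P where o: "\<And>w. w \<in> U \<Longrightarrow> orb t (y + t *\<^sub>R w) (vel_inv m w) (X w) (P w)" by metis
  have Wt: "Wc (P w) t = w" if "w \<in> U" for w
   using orbD(7)[OF o[OF that]] that vel_vel_inv[OF m, of w] by (simp add: Wc_def U_def)
  have Yt: "Yc (X w) (P w) t = y" if "w \<in> U" for w
   using orbD(6)[OF o[OF that]] Wt[OF that] by (simp add: Yc_def)
  \<comment> \<open>The foot of the orbit: at time 0 there is no free streaming to remove, so
    \<open>Yc\<close> is the initial position.\<close>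
  define I where "I w = (Yc (X w) (P w) 0, Wc (P w) 0)" for w
  have z: "0 \<in> {0..t}" using t by simp
  have I: "I w \<in> ?S" if "w \<in> U" for w
   using orbD(2,3)[OF o[OF that] z] by (auto simp: I_def Yc_def)
  have g: "gv t y w = g0 (fst (I w)) (vel_inv m (snd (I w)))" if "w \<in> U" for w
   using orbD(8)[OF o[OF that]] vel_inv_vel[OF m] by (simp add: gv_def I_def Yc_def Wc_def)
  have N: "gN t (Yc (X w) (P w) t) (Wc (P w) t) (Yc (X w') (P w') t) (Wc (P w') t) = l * norm (w - w')"
   if "w \<in> U" "w' \<in> U" for w w' using that by (simp add: gN_def Yt Wt l_def)
  have le: "norm u + norm v \<le> norm u + wlam (2 * a1) 0 * norm v" for u v :: vec3
   using mult_right_mono[OF l0, of "norm v"] by simp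
  have eq1: "gK * (l * n + gR * ((l * p1 + l * p2) * (l * q1 + l * q2))) = gK * (l * n) + (gK * gR) * (l^2 * ((p1 + p2) * (q1 + q2)))"
   for n p1 p2 q1 q2 :: real by (simp add: power2_eq_square algebra_simps)
  have eq2: "M1 * (l * n + l^2 * p * q) = M1 * (l * n) + M1 * (l^2 * (p * q))" for n p q :: real
   by (simp add: algebra_simps)
  have CI: "C11 M1 l U I"
  proof (rule C11I)
   show "0 \<le> M1" "0 \<le> l" using M1 l1 by auto
   show "norm (I w) \<le> M1" if "w \<in> U" for w
   proof -
    have "norm (fst (I w)) \<le> L" "norm (snd (I w)) \<le> \<gamma>" using I[OF that] by (simp_all add: mem_Times_iff)
    then show ?thesis using norm_fst_snd_le(3)[of "I w"] \<gamma> M1(3) by linarith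
   qed
   show "norm (I w - I w') \<le> M1 * l * norm (w - w')" if w: "w \<in> U" "w' \<in> U" for w w'
   proof -
    have "norm (I w - I w') \<le> norm (Yc (X w) (P w) 0 - Yc (X w') (P w') 0) + norm (Wc (P w) 0 - Wc (P w') 0)"
     by (simp add: I_def norm_Pair_le)
    also note le
    also have "norm (Yc (X w) (P w) 0 - Yc (X w') (P w') 0) + wlam (2 * a1) 0 * norm (Wc (P w) 0 - Wc (P w') 0)
     \<le> gK * (l * norm (w - w'))"
     using orb_diff[OF o[OF w(1)] o[OF w(2)] z] w by (simp add: Yt Wt l_def)
    also have "\<dots> \<le> M1 * (l * norm (w - w'))" by (rule mult_right_mono[OF M1(1)]) (use l1 in simp)
    finally show ?thesis by (simp add: mult.assoc)
   qed
   fix a b c d assume h: "a \<in> U" "b \<in> U" "c \<in> U" "d \<in> U"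
   have "I d - I c - I b + I a = (Yc (X d) (P d) 0 - Yc (X c) (P c) 0 - Yc (X b) (P b) 0 + Yc (X a) (P a) 0, Wc (P d) 0 - Wc (P c) 0 - Wc (P b) 0 + Wc (P a) 0)"
    by (simp add: I_def)
   then have "norm (I d - I c - I b + I a) \<le> norm (Yc (X d) (P d) 0 - Yc (X c) (P c) 0 - Yc (X b) (P b) 0 + Yc (X a) (P a) 0) + norm (Wc (P d) 0 - Wc (P c) 0 - Wc (P b) 0 + Wc (P a) 0)"
    by (simp only: norm_Pair_le)
   also note le
   also have "norm (Yc (X d) (P d) 0 - Yc (X c) (P c) 0 - Yc (X b) (P b) 0 + Yc (X a) (P a) 0) + wlam (2 * a1) 0 * norm (Wc (P d) 0 - Wc (P c) 0 - Wc (P b) 0 + Wc (P a) 0)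
    \<le> gK * (l * norm (d - c - b + a) + gR * ((l * norm (b - a) + l * norm (d - c)) * (l * norm (c - a) + l * norm (d - b))))"
    using orb_diff4[OF o[OF h(1)] o[OF h(2)] o[OF h(3)] o[OF h(4)] z] h N by (simp add: Yt Wt l_def[symmetric])
   also have "\<dots> = gK * (l * norm (d - c - b + a)) + (gK * gR) * (l^2 * ((norm (b - a) + norm (d - c)) * (norm (c - a) + norm (d - b))))"
    by (rule eq1)
   also have "\<dots> \<le> M1 * (l * norm (d - c - b + a)) + M1 * (l^2 * ((norm (b - a) + norm (d - c)) * (norm (c - a) + norm (d - b))))"
    by (intro add_mono mult_right_mono M1(1,2) mult_nonneg_nonneg add_nonneg_nonneg) (use l1 in simp_all)
   finally show "norm (I d - I c - I b + I a) \<le> M1 * mod4 l a b c d"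
    by (simp only: eq2)
  qed
  have "C11 (M2 * (1 + 2 * M1)^2) l U (\<lambda>w. (\<lambda>z. g0 (fst z) (vel_inv m (snd z))) (I w))"
   by (rule C11_compose[OF CI M2 image_subsetI[OF I]])
  then have "C11 (M2 * (1 + 2 * M1)^2) l U (gv t y)" by (rule C11_cong) (rule g)
  then show ?thesis unfolding U_def l_def .
 qed
 then show ?thesis by blast
qed

lemma psi_C11: "\<exists>M. \<forall>t\<ge>0. \<forall>y. C11 M (wlam (2 * a1) t) {w. psi t y w \<noteq> 0} (psi t y)"
proof -
 obtain M where M: "\<And>t y. 0 \<le> t \<Longrightarrow> C11 M (wlam (2 * a1) t) {w. norm w < 1 \<and> gv t y w \<noteq> 0} (gv t y)" using gv_C11 by blast
 obtain M' where M': "C11 M' 1 (cball 0 \<gamma>) (\<lambda>w. lor w ^ 5)" using C11_lor_power[OF \<gamma>] by blast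
 from C11_linear[OF bounded_linear_mult_right[of "m ^ 3"] _ _ this, of "\<bar>m ^ 3\<bar>"]
 have D: "C11 (\<bar>m ^ 3\<bar> * M') 1 (cball 0 \<gamma>) (\<lambda>w. m ^ 3 * lor w ^ 5)" by (auto simp: abs_mult)
 have "C11 (4 * 1 * (\<bar>m ^ 3\<bar> * M') * M) (wlam (2 * a1) t) {w. psi t y w \<noteq> 0} (psi t y)" if t: "0 \<le> t" for t y
 proof -
  have sub: "{w. psi t y w \<noteq> 0} \<subseteq> {w. norm w < 1 \<and> gv t y w \<noteq> 0}" by (auto simp: psi_def split: if_splits)
  have sub2: "{w. psi t y w \<noteq> 0} \<subseteq> cball 0 \<gamma>" using gv_support[OF t] by (auto simp: psi_def split: if_splits)
  have "C11 (4 * 1 * (\<bar>m ^ 3\<bar> * M') * M) (wlam (2 * a1) t) {w. psi t y w \<noteq> 0} (\<lambda>w. (m ^ 3 * lor w ^ 5) * gv t y w)"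
   by (rule C11_bilinear[OF bounded_bilinear_mult _ _ C11_mono[OF D _ _ sub2] C11_mono[OF M[OF t] _ _ sub]])
    (use wlam_ge_1[of "2 * a1" t] a1(1) in \<open>auto simp: abs_mult\<close>)
  then show ?thesis by (rule C11_cong) (auto simp: psi_def)
 qed
 then show ?thesis by blast
qed

lemma psi_zero: assumes "0 \<le> t" "\<gamma> < norm w" shows "psi t y w = 0"
 using gv_support[OF assms(1), of w y] assms(2) by (force simp: psi_def)

lemma psi_nonneg: assumes "0 \<le> t" shows "0 \<le> psi t y w"
 using g_nonneg[OF assms] m lor_pos[of w] by (auto simp: psi_def gv_def intro!: mult_nonneg_nonneg zero_le_power)

lemma C1_on_g_compose:
 fixes a :: "'a::euclidean_space \<Rightarrow> real"
 assumes "C1_on S a" "C1_on S b" "C1_on S c" "\<And>z. z \<in> S \<Longrightarrow> 0 \<le> a z"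
 shows "C1_on S (\<lambda>z. g (a z) (b z) (c z))"
proof -
 have "(\<lambda>x. (a x, b x, c x)) ` S \<subseteq> {z. 0 \<le> fst z}" using assms(4) by auto
 from C1_on_compose[OF C1g C1_on_Pair[OF assms(1) C1_on_Pair[OF assms(2,3)]] this] show ?thesis by simp
qed

text \<open>The Jacobian is singular at the unit sphere, but the density vanishes already for speeds
  above \<gamma>. The ball and the region beyond \<gamma> are open, overlap and cover the
  space.\<close>

lemma psi_C1: assumes t: "0 \<le> t" shows "C1_on UNIV (psi t y)"
proof -
 have "C1_on (ball 0 1) (\<lambda>w. (m ^ 3 * lor w ^ 5) * gv t y w)"
  unfolding gv_def
  by (intro C1_on_bilinear[OF bounded_bilinear_mult] C1_on_g_compose C1_on_const C1_on_add C1_on_vel_inv C1_on_lor_power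
    C1_on_linear bounded_linear_scaleR_right) (use t in auto)
 then have 1: "C1_on (ball 0 1) (psi t y)" by (rule C1_on_cong) (auto simp: psi_def)
 have "C1_on {w. \<gamma> < norm w} (\<lambda>w::vec3. 0::real)" by (rule C1_on_const)
 then have 2: "C1_on {w. \<gamma> < norm w} (psi t y)" by (rule C1_on_cong) (auto simp: psi_zero[OF t])
 have "open {w::vec3. \<gamma> < norm w}" by (intro open_Collect_less continuous_intros)
 from C1_on_open_cover[OF open_ball this 1 2] have "C1_on (ball 0 1 \<union> {w. \<gamma> < norm w}) (psi t y)" .
 moreover have "ball 0 1 \<union> {w. \<gamma> < norm w} = (UNIV :: vec3 set)" using \<gamma>(2) by force
 ultimately show ?thesis by simp
qed

lemma psi_regularity:
 "\<exists>M\<ge>0. \<forall>t\<ge>0. \<forall>y w w' a b. \<bar>psi t y w\<bar> \<le> M \<and> \<bar>psi t y w - psi t y w'\<bar> \<le> M * wlam (2 * a1) t * norm (w - w') \<and>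
  \<bar>psi t y (w + a + b) - psi t y (w + a) - psi t y (w + b) + psi t y w\<bar> \<le> 4 * M * (wlam (2 * a1) t)^2 * norm a * norm b"
proof -
 obtain M where M: "\<And>t y. 0 \<le> t \<Longrightarrow> C11 M (wlam (2 * a1) t) {w. psi t y w \<noteq> 0} (psi t y)" using psi_C11 by blast
 have M0: "0 \<le> M" using C11D(1)[OF M[of 0]] by simp
 show ?thesis
 proof (intro exI[of _ M] conjI allI impI M0)
  fix t :: real and y w w' a b assume t: "0 \<le> t"
  show "\<bar>psi t y w\<bar> \<le> M"
   using C11D(3)[OF M[OF t, of y], of w] M0 by (cases "psi t y w = 0") auto
  show "\<bar>psi t y w - psi t y w'\<bar> \<le> M * wlam (2 * a1) t * norm (w - w')"
   by (rule C11_globalize(1)[OF psi_C1[OF t] psi_nonneg[OF t] M[OF t]])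
  show "\<bar>psi t y (w + a + b) - psi t y (w + a) - psi t y (w + b) + psi t y w\<bar> \<le> 4 * M * (wlam (2 * a1) t)^2 * norm a * norm b"
   by (rule C11_globalize(2)[OF psi_C1[OF t] psi_nonneg[OF t] M[OF t]])
 qed
qed

end

section \<open>Velocity moments\<close>

text \<open>A cube rather than a ball: differentiation under the integral sign is applied on boxes,
  and the volume is elementary.\<close>

definition bx :: "real \<Rightarrow> vec3 set" where "bx r = cbox (vec (- r)) (vec r)"

definition cs :: "real \<Rightarrow> (vec3 \<Rightarrow> 'b::real_normed_vector) \<Rightarrow> bool" where
 "cs r \<phi> \<longleftrightarrow> continuous_on UNIV \<phi> \<and> (\<forall>x. r < norm x \<longrightarrow> \<phi> x = 0)"

lemma cball_bx: "norm x \<le> r \<Longrightarrow> x \<in> bx r"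
proof -
 assume "norm x \<le> r"
 then have "\<bar>x $ i\<bar> \<le> r" for i using component_le_norm_cart[of x i] by linarith
 then show ?thesis by (simp add: bx_def mem_box_cart abs_le_iff minus_le_iff)
qed

lemma content_bx: "0 \<le> r \<Longrightarrow> measure lborel (bx r) = 8 * r ^ 3"
proof -
 assume "0 \<le> r"
 then have "bx r \<noteq> {}" using cball_bx[of 0 r] by auto
 then show ?thesis unfolding bx_def by (subst content_cbox_cart) (simp_all add: power3_eq_cube)
qed

lemma cs_has_integral_bx:
 fixes \<phi> :: "vec3 \<Rightarrow> 'b::banach"
 assumes "cs r \<phi>" "r \<le> R"
 shows "(\<phi> has_integral integral (bx R) \<phi>) (bx R)" "(\<phi> has_integral integral (bx R) \<phi>) UNIV"
proof -
 have c: "continuous_on UNIV \<phi>" and z: "\<And>x. r < norm x \<Longrightarrow> \<phi> x = 0" using assms unfolding cs_def by auto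
 show 1: "(\<phi> has_integral integral (bx R) \<phi>) (bx R)"
  unfolding bx_def by (intro integrable_integral integrable_continuous continuous_on_subset[OF c]) simp
 show "(\<phi> has_integral integral (bx R) \<phi>) UNIV"
  by (rule has_integral_on_superset[OF 1]) (use z cball_bx[of _ R] assms(2) in force)+
qed

lemma cs_integrable:
 fixes \<phi> :: "vec3 \<Rightarrow> 'b::banach"
 shows "cs r \<phi> \<Longrightarrow> \<phi> integrable_on UNIV"
 using cs_has_integral_bx(2)[of r \<phi> r] by blast

lemma cs_integral_bx:
 fixes \<phi> :: "vec3 \<Rightarrow> 'b::banach"
 shows "cs r \<phi> \<Longrightarrow> r \<le> R \<Longrightarrow> integral UNIV \<phi> = integral (bx R) \<phi>"
 using cs_has_integral_bx(2) by blast

lemma cs_bound: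
 fixes \<phi> :: "vec3 \<Rightarrow> 'b::banach"
 assumes "cs r \<phi>" "0 \<le> r" and b: "\<And>x. norm x \<le> r \<Longrightarrow> norm (\<phi> x) \<le> A"
 shows "norm (integral UNIV \<phi>) \<le> 8 * r ^ 3 * A"
proof -
 have A: "0 \<le> A" by (rule order_trans[OF norm_ge_zero b[of 0]]) (use assms(2) in simp)
 have "norm (integral UNIV \<phi>) \<le> A * measure lborel (bx r)"
  unfolding bx_def
 proof (rule has_integral_bound[OF A])
  show "(\<phi> has_integral integral UNIV \<phi>) (cbox (vec (- r)) (vec r))"
   using cs_has_integral_bx(1)[OF assms(1) order_refl] cs_integral_bx[OF assms(1) order_refl] by (simp add: bx_def)
  show "norm (\<phi> x) \<le> A" for x using b[of x] A assms(1) by (cases "norm x \<le> r") (auto simp: cs_def)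
 qed
 then show ?thesis using content_bx[OF assms(2)] by (simp add: mult.commute)
qed

lemma cs_affine:
 fixes \<phi> :: "vec3 \<Rightarrow> 'b::banach"
 assumes "cs r \<phi>" "k \<noteq> 0"
 shows "integral UNIV (\<lambda>u. \<phi> (k *\<^sub>R u + c)) = (1 / \<bar>k\<bar> ^ 3) *\<^sub>R integral UNIV \<phi>"
proof (rule integral_unique)
 have i: "(\<phi> has_integral integral UNIV \<phi>) (cbox (vec (- r)) (vec r))"
  using cs_has_integral_bx(1)[OF assms(1) order_refl] cs_integral_bx[OF assms(1) order_refl] by (simp add: bx_def)
 let ?S = "(\<lambda>x. (1 / k) *\<^sub>R x + - ((1 / k) *\<^sub>R c)) ` cbox (vec (- r)) (vec r)"
 have h: "((\<lambda>u. \<phi> (k *\<^sub>R u + c)) has_integral (1 / \<bar>k\<bar> ^ 3) *\<^sub>R integral UNIV \<phi>) ?S"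
  using has_integral_affinity[OF i assms(2), of c] by simp
 show "((\<lambda>u. \<phi> (k *\<^sub>R u + c)) has_integral (1 / \<bar>k\<bar> ^ 3) *\<^sub>R integral UNIV \<phi>) UNIV"
 proof (rule has_integral_on_superset[OF h])
  fix u assume u: "u \<notin> ?S"
  have "k *\<^sub>R u + c \<notin> cbox (vec (- r)) (vec r)"
  proof
   assume "k *\<^sub>R u + c \<in> cbox (vec (- r)) (vec r)"
   then have "(1 / k) *\<^sub>R (k *\<^sub>R u + c) + - ((1 / k) *\<^sub>R c) \<in> ?S" by blast
   moreover have "(1 / k) *\<^sub>R (k *\<^sub>R u + c) + - ((1 / k) *\<^sub>R c) = u" using assms(2) by (simp add: scaleR_add_right)
   ultimately show False using u by simp
  qed
  then have "r < norm (k *\<^sub>R u + c)" using cball_bx[of "k *\<^sub>R u + c" r] by (fastforce simp: bx_def)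
  then show "\<phi> (k *\<^sub>R u + c) = 0" using assms(1) by (simp add: cs_def)
 qed simp
qed

lemma cs_translate:
 fixes \<phi> :: "vec3 \<Rightarrow> 'b::banach"
 assumes "cs r \<phi>"
 shows "integral UNIV (\<lambda>u. \<phi> (c + u)) = integral UNIV \<phi>"
 using cs_affine[OF assms, of 1 c] by (simp add: add.commute)

lemma has_derivative_zero_outside:
 fixes \<phi> :: "'a::real_normed_vector \<Rightarrow> 'b::real_normed_vector"
 assumes "(\<phi> has_derivative \<phi>') (at z)" "\<And>x. r < norm x \<Longrightarrow> \<phi> x = 0" "r < norm z"
 shows "\<phi>' = (\<lambda>_. 0)"
proof -
 have "open {x::'a. r < norm x}" by (intro open_Collect_less continuous_intros)
 from has_derivative_transform_within_open[OF has_derivative_const this, of z 0 \<phi> UNIV]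
 have "(\<phi> has_derivative (\<lambda>_. 0)) (at z)" using assms by auto
 then show ?thesis by (rule has_derivative_unique[OF assms(1)])
qed

text \<open>The integral of \<phi> translated by h a does not depend on h; differentiating under the
  integral sign at h = 0 gives zero.\<close>

lemma integral_derivative_zero:
 fixes \<phi> :: "vec3 \<Rightarrow> real"
 assumes C1: "C1_on UNIV \<phi>" and z: "\<And>x. r < norm x \<Longrightarrow> \<phi> x = 0"
  and d: "\<And>x. (\<phi> has_derivative \<phi>' x) (at x)"
 shows "((\<lambda>x. \<phi>' x a) has_integral 0) UNIV" "continuous_on UNIV (\<lambda>x. \<phi>' x a)"
proof -
 obtain D where D: "\<And>z. (\<phi> has_derivative D z) (at z)" "\<And>h. continuous_on UNIV (\<lambda>z. D z h)"
  by (rule C1_onE[OF C1]) auto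
 have DD: "D = \<phi>'" using D(1) d has_derivative_unique by blast
 show c: "continuous_on UNIV (\<lambda>x. \<phi>' x a)" using D(2) DD by simp
 have cphi: "cs r \<phi>" using C1_on_continuous_on[OF C1] z by (simp add: cs_def)
 \<comment> \<open>Large enough to contain the supports of all translates by
   \<open>h *\<^sub>R a\<close> with |h| < 1.\<close>
 define R where "R = r + norm a"
 have csd: "cs R (\<lambda>x. \<phi>' x a)"
  using c has_derivative_zero_outside[OF d z] by (auto simp: cs_def R_def intro: order.strict_trans1[rotated])
   (smt (verit) norm_ge_zero)
 let ?F = "\<lambda>h. integral (bx R) (\<lambda>z. \<phi> (z + h *\<^sub>R a))"
 have "(?F has_field_derivative integral (bx R) (\<lambda>z. \<phi>' (z + 0 *\<^sub>R a) a)) (at 0 within {-1<..<1})"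
  unfolding bx_def
 proof (rule leibniz_rule_field_derivative[where fx = "\<lambda>h z. \<phi>' (z + h *\<^sub>R a) a"])
  fix h :: real and z
  have "((\<lambda>h. z + h *\<^sub>R a) has_derivative (\<lambda>k. k *\<^sub>R a)) (at h)" by (auto intro!: derivative_eq_intros)
  from has_derivative_compose[OF this d]
  have "((\<lambda>h. \<phi> (z + h *\<^sub>R a)) has_derivative (\<lambda>k. \<phi>' (z + h *\<^sub>R a) (k *\<^sub>R a))) (at h)" .
  moreover have "\<phi>' (z + h *\<^sub>R a) (k *\<^sub>R a) = \<phi>' (z + h *\<^sub>R a) a * k" for k
   using linear_cmul[OF has_derivative_linear[OF d]] by simp
  ultimately show "((\<lambda>h. \<phi> (z + h *\<^sub>R a)) has_field_derivative \<phi>' (z + h *\<^sub>R a) a) (at h within {-1<..<1})"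
   by (simp add: has_field_derivative_def has_derivative_at_withinI)
  show "(\<lambda>z. \<phi> (z + h *\<^sub>R a)) integrable_on cbox (vec (- R)) (vec R)"
   by (intro integrable_continuous continuous_on_compose2[OF C1_on_continuous_on[OF C1]] continuous_intros) auto
 next
  show "continuous_on ({-1<..<1} \<times> cbox (vec (- R)) (vec R)) (\<lambda>(h, z). \<phi>' (z + h *\<^sub>R a) a)"
   unfolding split_beta
   by (rule continuous_on_compose2[OF c]) (auto intro!: continuous_intros)
 qed auto
 then have 1: "(?F has_field_derivative integral (bx R) (\<lambda>z. \<phi>' z a)) (at 0)"
  by (simp add: at_within_open[of 0 "{-1<..<1}"])
 have F: "?F h = integral UNIV \<phi>" if "h \<in> {-1<..<1}" for h
 proof -
  have "cs R (\<lambda>z. \<phi> (z + h *\<^sub>R a))"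
   unfolding cs_def
  proof (intro conjI allI impI)
   show "continuous_on UNIV (\<lambda>z. \<phi> (z + h *\<^sub>R a))"
    by (intro continuous_on_compose2[OF C1_on_continuous_on[OF C1]] continuous_intros) auto
   fix x :: vec3 assume "R < norm x"
   moreover have "norm (h *\<^sub>R a) \<le> norm a" using that by (auto intro!: mult_left_le_one_le)
   moreover have "norm x \<le> norm (x + h *\<^sub>R a) + norm (h *\<^sub>R a)" using norm_triangle_ineq4[of "x + h *\<^sub>R a" "h *\<^sub>R a"] by simp
   ultimately show "\<phi> (x + h *\<^sub>R a) = 0" using z by (auto simp: R_def)
  qed
  from cs_integral_bx[OF this order_refl] cs_affine[OF cphi, of 1 "h *\<^sub>R a"] show ?thesis by simp
 qed
 have "(?F has_field_derivative 0) (at 0)"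
  by (rule has_field_derivative_transform_within_open[OF DERIV_const[of "integral UNIV \<phi>"], of "{-1<..<1}"])
   (use F in auto)
 with 1 have "integral (bx R) (\<lambda>z. \<phi>' z a) = 0" by (rule DERIV_unique)
 then show "((\<lambda>x. \<phi>' x a) has_integral 0) UNIV" using cs_has_integral_bx(2)[OF csd order_refl] by simp
qed

lemma vec3_basis_expansion: "(x::vec3) = (\<Sum>i\<in>UNIV. (x $ i) *\<^sub>R axis i 1)"
 using basis_expansion[of x] by (simp add: scalar_mult_eq_scaleR)

lemma integral_divergence_free:
 fixes \<phi> :: "vec3 \<Rightarrow> real" and K :: "vec3 \<Rightarrow> vec3"
 assumes C1: "C1_on UNIV \<phi>" and z: "\<And>x. r < norm x \<Longrightarrow> \<phi> x = 0"
  and d: "\<And>x. (\<phi> has_derivative \<phi>' x) (at x)"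
  and CK: "C1_on UNIV K" and dK: "\<And>x. (K has_derivative K' x) (at x)"
 shows "((\<lambda>x. \<phi>' x (K x) + \<phi> x * (\<Sum>i\<in>UNIV. K' x (axis i 1) $ i)) has_integral 0) UNIV"
proof -
 have i: "((\<lambda>x. \<phi> x * (K' x (axis i 1) $ i) + \<phi>' x (axis i 1) * (K x $ i)) has_integral 0) UNIV" for i
 proof (rule integral_derivative_zero(1)[where \<phi> = "\<lambda>x. \<phi> x * (K x $ i)" and \<phi>' = "\<lambda>x h. \<phi> x * (K' x h $ i) + \<phi>' x h * (K x $ i)"])
  show "C1_on UNIV (\<lambda>x. \<phi> x * (K x $ i))"
   by (intro C1_on_bilinear[OF bounded_bilinear_mult] C1 C1_on_blinear_compose[OF bounded_linear_vec_nth] CK)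
  show "\<phi> x * (K x $ i) = 0" if "r < norm x" for x using z[OF that] by simp
  show "((\<lambda>x. \<phi> x * (K x $ i)) has_derivative (\<lambda>h. \<phi> x * (K' x h $ i) + \<phi>' x h * (K x $ i))) (at x)" for x
   by (intro has_derivative_mult d bounded_linear.has_derivative[OF bounded_linear_vec_nth] dK)
 qed
 have "((\<lambda>x. \<Sum>i\<in>UNIV. \<phi> x * (K' x (axis i 1) $ i) + \<phi>' x (axis i 1) * (K x $ i)) has_integral (\<Sum>i\<in>(UNIV::3 set). 0)) UNIV"
  by (intro has_integral_sum i) auto
 moreover have "(\<Sum>i\<in>UNIV. \<phi> x * (K' x (axis i 1) $ i) + \<phi>' x (axis i 1) * (K x $ i)) = \<phi>' x (K x) + \<phi> x * (\<Sum>i\<in>UNIV. K' x (axis i 1) $ i)" for x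
 proof -
  have l: "linear (\<phi>' x)" using has_derivative_linear[OF d] .
  have "\<phi>' x (K x) = \<phi>' x (\<Sum>i\<in>UNIV. (K x $ i) *\<^sub>R axis i 1)" using vec3_basis_expansion[of "K x"] by simp
  also have "\<dots> = (\<Sum>i\<in>UNIV. \<phi>' x (axis i 1) * (K x $ i))" by (simp add: linear_sum[OF l] linear_cmul[OF l] mult.commute)
  finally show ?thesis by (simp add: sum.distrib sum_distrib_left)
 qed
 ultimately show ?thesis by simp
qed

text \<open>Change of variables from the unit ball of velocities to momenta, with
  \<open>1 / Djac m p\<close> the Jacobian determinant of the velocity map. \<open>F\<close> is
  passed through \<open>real^1\<close> to match the vector-valued form of the substitution
  theorem.\<close>

lemma integral_velocity_substitution:
 fixes F :: "vec3 \<Rightarrow> real"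
 assumes m: "0 < m" and c: "continuous_on UNIV F" and z: "\<And>w. 1 \<le> norm w \<Longrightarrow> F w = 0"
 shows "integral UNIV F = integral UNIV (\<lambda>p. 1 / Djac m p * F (vel m p))"
proof -
 define f where "f w = (vec (F w) :: real^1)" for w
 have cf: "continuous_on UNIV f" unfolding f_def
  by (intro bounded_linear.continuous_on[OF _ c]) (auto simp: linear_conv_bounded_linear[symmetric] intro!: linearI vec_add simp: vec_cmul vec_eq_iff)
 have "f absolutely_integrable_on (bx 1)"
  unfolding bx_def by (intro absolutely_integrable_continuous continuous_on_subset[OF cf]) simp
 moreover have "ball 0 1 \<subseteq> bx 1" using cball_bx[of _ 1] by auto
 ultimately have ab: "f absolutely_integrable_on (ball 0 1)"
  using set_integrable_subset[of lebesgue "bx 1" f "ball 0 1"] by auto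
 then have iball: "f integrable_on ball 0 1" by (rule set_lebesgue_integral_eq_integral(1))
 have "integral (range (vel m)) f = integral UNIV (\<lambda>p. \<bar>det (matrix (dvel m p))\<bar> *\<^sub>R f (vel m p))"
  by (rule integral_change_of_variables)
   (use ab vel_has_derivative[OF m] inj_vel[OF m] range_vel[OF m] in auto)
 moreover have "(\<lambda>p. \<bar>det (matrix (dvel m p))\<bar> *\<^sub>R f (vel m p)) absolutely_integrable_on UNIV"
  using has_absolute_integral_change_of_variables[of UNIV "vel m" "dvel m" f "integral (range (vel m)) f"]
   ab vel_has_derivative[OF m] inj_vel[OF m] range_vel[OF m] by auto
 then have iR: "(\<lambda>p. \<bar>det (matrix (dvel m p))\<bar> *\<^sub>R f (vel m p)) integrable_on UNIV"
  by (simp add: absolutely_integrable_on_def)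
 moreover have dj: "\<bar>det (matrix (dvel m p))\<bar> = 1 / Djac m p" for p
  using frechet_derivative_at[OF vel_has_derivative[OF m, of p UNIV], symmetric] by (simp add: Djac_def inverse_eq_divide)
 ultimately have "integral (ball 0 1) f $ 1 = integral UNIV (\<lambda>p. \<bar>det (matrix (dvel m p))\<bar> *\<^sub>R f (vel m p)) $ 1"
  using range_vel[OF m] by simp
 moreover have "integral (ball 0 1) f $ 1 = integral (ball 0 1) (\<lambda>w. f w $ 1)"
  using integral_component_eq_cart[OF iball] by simp
 moreover have "integral UNIV (\<lambda>p. \<bar>det (matrix (dvel m p))\<bar> *\<^sub>R f (vel m p)) $ 1 = integral UNIV (\<lambda>p. (\<bar>det (matrix (dvel m p))\<bar> *\<^sub>R f (vel m p)) $ 1)"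
  using integral_component_eq_cart[OF iR] by simp
 moreover have "integral (ball 0 1) F = integral UNIV F"
 proof -
  have "integral UNIV (\<lambda>w. if w \<in> ball 0 1 then F w else 0) = integral (ball 0 1) F" by (rule integral_restrict_UNIV)
  moreover have "(\<lambda>w. if w \<in> ball 0 1 then F w else 0) = F" using z by (auto simp: fun_eq_iff)
  ultimately show ?thesis by simp
 qed
 ultimately show ?thesis by (simp add: f_def dj)
qed

text \<open>At fixed \<open>u\<close> the parameter \<open>q\<close> enters only through the second
  argument of \<kappa>, so every estimate on \<kappa> passes through the integral. The support in
  \<open>u\<close> contributes the volume factor 8 r^3.\<close>

lemma moment_bounds:
 fixes \<kappa> :: "vec3 \<Rightarrow> vec3 \<Rightarrow> real" and \<omega> :: "vec3 \<Rightarrow> real"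
 assumes c: "\<And>q. continuous_on UNIV (\<lambda>u. \<kappa> u (q + u))" and z: "\<And>u w. r < norm u \<Longrightarrow> \<kappa> u w = 0" and r: "0 \<le> r"
  and co: "continuous_on UNIV \<omega>" and bo: "\<And>u. norm u \<le> r \<Longrightarrow> \<bar>\<omega> u\<bar> \<le> \<Omega>"
  and b0: "\<And>u w. \<bar>\<kappa> u w\<bar> \<le> M0"
  and b1: "\<And>u w w'. \<bar>\<kappa> u w - \<kappa> u w'\<bar> \<le> M1 * norm (w - w')"
  and b2: "\<And>u w a b. \<bar>\<kappa> u (w + a + b) - \<kappa> u (w + a) - \<kappa> u (w + b) + \<kappa> u w\<bar> \<le> M2 * norm a * norm b"
 defines "\<mu> \<equiv> \<lambda>q. integral UNIV (\<lambda>u. \<omega> u * \<kappa> u (q + u))"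
 shows "\<bar>\<mu> q\<bar> \<le> 8 * r ^ 3 * (\<Omega> * M0)"
  "\<bar>\<mu> q - \<mu> q'\<bar> \<le> 8 * r ^ 3 * (\<Omega> * M1) * norm (q - q')"
  "\<bar>\<mu> (q + a + b) - \<mu> (q + a) - \<mu> (q + b) + \<mu> q\<bar> \<le> 8 * r ^ 3 * (\<Omega> * M2) * norm a * norm b"
proof -
 have O: "0 \<le> \<Omega>" using bo[of 0] r by simp
 have cs: "cs r (\<lambda>u. \<omega> u * \<kappa> u (q + u))" for q
  using z by (auto simp: cs_def intro!: continuous_intros co c)
 note int = cs_integrable[OF cs]
 have "norm (integral UNIV (\<lambda>u. \<omega> u * \<kappa> u (q + u))) \<le> 8 * r ^ 3 * (\<Omega> * M0)"
  by (rule cs_bound[OF cs r]) (use bo b0 O in \<open>auto simp: abs_mult intro!: mult_mono\<close>)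
 then show "\<bar>\<mu> q\<bar> \<le> 8 * r ^ 3 * (\<Omega> * M0)" by (simp add: \<mu>_def)
 have "\<mu> q - \<mu> q' = integral UNIV (\<lambda>u. \<omega> u * \<kappa> u (q + u) - \<omega> u * \<kappa> u (q' + u))"
  unfolding \<mu>_def by (rule integral_diff[symmetric, OF int int])
 also have "norm \<dots> \<le> 8 * r ^ 3 * (\<Omega> * (M1 * norm (q - q')))"
 proof (rule cs_bound[OF _ r])
  show "cs r (\<lambda>u. \<omega> u * \<kappa> u (q + u) - \<omega> u * \<kappa> u (q' + u))"
   using z by (auto simp: cs_def intro!: continuous_intros co c)
  fix u :: vec3 assume u: "norm u \<le> r"
  have "\<bar>\<kappa> u (q + u) - \<kappa> u (q' + u)\<bar> \<le> M1 * norm (q - q')" using b1[of u "q + u" "q' + u"] by simp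
  then have "\<bar>\<omega> u\<bar> * \<bar>\<kappa> u (q + u) - \<kappa> u (q' + u)\<bar> \<le> \<Omega> * (M1 * norm (q - q'))" using bo[OF u] O by (intro mult_mono) auto
  then show "norm (\<omega> u * \<kappa> u (q + u) - \<omega> u * \<kappa> u (q' + u)) \<le> \<Omega> * (M1 * norm (q - q'))"
   by (simp add: right_diff_distrib[symmetric] abs_mult)
 qed
 finally show "\<bar>\<mu> q - \<mu> q'\<bar> \<le> 8 * r ^ 3 * (\<Omega> * M1) * norm (q - q')" by (simp add: mult_ac)
 have "\<mu> (q + a + b) - \<mu> (q + a) - \<mu> (q + b) + \<mu> q = integral UNIV (\<lambda>u. \<omega> u * \<kappa> u (q + a + b + u) - \<omega> u * \<kappa> u (q + a + u) - \<omega> u * \<kappa> u (q + b + u) + \<omega> u * \<kappa> u (q + u))"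
  unfolding \<mu>_def
  by (rule integral_unique[symmetric]) (intro has_integral_add has_integral_diff integrable_integral int)
 also have "norm \<dots> \<le> 8 * r ^ 3 * (\<Omega> * (M2 * norm a * norm b))"
 proof (rule cs_bound[OF _ r])
  show "cs r (\<lambda>u. \<omega> u * \<kappa> u (q + a + b + u) - \<omega> u * \<kappa> u (q + a + u) - \<omega> u * \<kappa> u (q + b + u) + \<omega> u * \<kappa> u (q + u))"
   using z by (auto simp: cs_def intro!: continuous_intros co c)
  fix u :: vec3 assume u: "norm u \<le> r"
  have "\<bar>\<kappa> u (q + a + b + u) - \<kappa> u (q + a + u) - \<kappa> u (q + b + u) + \<kappa> u (q + u)\<bar> \<le> M2 * norm a * norm b"
   using b2[of u "q + u" a b] by (simp add: add_ac)
  then have "\<bar>\<omega> u\<bar> * \<bar>\<kappa> u (q + a + b + u) - \<kappa> u (q + a + u) - \<kappa> u (q + b + u) + \<kappa> u (q + u)\<bar> \<le> \<Omega> * (M2 * norm a * norm b)"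
   using bo[OF u] O by (intro mult_mono) auto
  then show "norm (\<omega> u * \<kappa> u (q + a + b + u) - \<omega> u * \<kappa> u (q + a + u) - \<omega> u * \<kappa> u (q + b + u) + \<omega> u * \<kappa> u (q + u)) \<le> \<Omega> * (M2 * norm a * norm b)"
   by (simp only: right_diff_distrib[symmetric] distrib_left[symmetric] abs_mult real_norm_def)
 qed
 finally show "\<bar>\<mu> (q + a + b) - \<mu> (q + a) - \<mu> (q + b) + \<mu> q\<bar> \<le> 8 * r ^ 3 * (\<Omega> * M2) * norm a * norm b" by (simp add: mult_ac)
qed

lemma derivative_bound_of_lipschitz:
 fixes f :: "'a::real_normed_vector \<Rightarrow> 'b::real_normed_vector"
 assumes d: "(f has_derivative D) (at x)" and l: "\<And>y. norm (f y - f x) \<le> K * norm (y - x)"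
 shows "norm (D h) \<le> K * norm h"
proof -
 have "((\<lambda>s. x + s *\<^sub>R h) has_derivative (\<lambda>k. k *\<^sub>R h)) (at 0)" by (auto intro!: derivative_eq_intros)
 moreover have "(f has_derivative D) (at (x + 0 *\<^sub>R h))" using d by simp
 ultimately have "((\<lambda>s. f (x + s *\<^sub>R h)) has_derivative (\<lambda>k. D (k *\<^sub>R h))) (at 0)" by (rule has_derivative_compose)
 then have lim: "((\<lambda>k. norm (f (x + (0 + k) *\<^sub>R h) - f (x + 0 *\<^sub>R h) - D (k *\<^sub>R h)) / norm k) \<longlongrightarrow> 0) (at 0)"
  unfolding has_derivative_at by blast
 have "((\<lambda>k. K * norm h + norm (f (x + (0 + k) *\<^sub>R h) - f (x + 0 *\<^sub>R h) - D (k *\<^sub>R h)) / norm k) \<longlongrightarrow> K * norm h + 0) (at 0)"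
  by (intro tendsto_add tendsto_const lim)
 moreover have "\<forall>\<^sub>F k in at 0. norm (D h) \<le> K * norm h + norm (f (x + (0 + k) *\<^sub>R h) - f (x + 0 *\<^sub>R h) - D (k *\<^sub>R h)) / norm k"
 proof -
  have "norm (D h) \<le> K * norm h + norm (f (x + (0 + k) *\<^sub>R h) - f (x + 0 *\<^sub>R h) - D (k *\<^sub>R h)) / norm k" if k: "k \<noteq> 0" for k
  proof -
   have "\<bar>k\<bar> * norm (D h) = norm (D (k *\<^sub>R h))" using linear_cmul[OF has_derivative_linear[OF d], of k h] by simp
   also have "\<dots> \<le> norm (f (x + k *\<^sub>R h) - f x) + norm (f (x + k *\<^sub>R h) - f x - D (k *\<^sub>R h))"
    using norm_triangle_ineq4[of "f (x + k *\<^sub>R h) - f x" "f (x + k *\<^sub>R h) - f x - D (k *\<^sub>R h)"] by simp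
   also have "\<dots> \<le> K * (\<bar>k\<bar> * norm h) + norm (f (x + k *\<^sub>R h) - f x - D (k *\<^sub>R h))" using l[of "x + k *\<^sub>R h"] by simp
   finally show ?thesis using k by (simp add: field_simps)
  qed
  then show ?thesis by (auto simp: eventually_at_filter)
 qed
 ultimately show ?thesis using tendsto_lowerbound[of _ "K * norm h + 0" "at (0::real)" "norm (D h)"] by simp
qed

text \<open>The function f(z + (x - y)) - f(z) is Lipschitz in z by the second-difference bound, and
  its derivative at y is the difference of derivatives in question. No second derivative of
  \<open>f\<close> is involved.\<close>

lemma derivative_diff_bound:
 fixes f :: "'a::real_normed_vector \<Rightarrow> real"
 assumes d: "\<And>x. (f has_derivative D x) (at x)"
  and l: "\<And>x a b. \<bar>f (x + a + b) - f (x + a) - f (x + b) + f x\<bar> \<le> M * norm a * norm b"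
 shows "\<bar>D x a - D y a\<bar> \<le> M * norm a * norm (x - y)"
proof -
 have "((\<lambda>z. f (z + (x - y)) - f z) has_derivative (\<lambda>h. D (y + (x - y)) h - D y h)) (at y)"
  by (intro has_derivative_diff d has_derivative_compose[OF _ d]) (auto intro!: derivative_eq_intros)
 then have "norm ((\<lambda>h. D (y + (x - y)) h - D y h) a) \<le> (M * norm (x - y)) * norm a"
 proof (rule derivative_bound_of_lipschitz)
  fix z
  show "norm (f (z + (x - y)) - f z - (f (y + (x - y)) - f y)) \<le> M * norm (x - y) * norm (z - y)"
   using l[of y "z - y" "x - y"] by (simp add: algebra_simps)
 qed
 then show ?thesis by (simp add: mult_ac)
qed

section \<open>Momentum moments of the density and their balance equations\<close>

context species
begin

definition Gd :: "real \<Rightarrow> vec3 \<Rightarrow> vec3 \<Rightarrow> real \<times> vec3 \<times> vec3 \<Rightarrow> real" where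
 "Gd t x p = frechet_derivative (\<lambda>z::real \<times> vec3 \<times> vec3. g (fst z) (fst (snd z)) (snd (snd z))) (at (t, x, p))"

lemma Gd_blinfun:
 obtains D :: "real \<times> vec3 \<times> vec3 \<Rightarrow> (real \<times> vec3 \<times> vec3) \<Rightarrow>\<^sub>L real"
 where "continuous_on {z. 0 < fst z} D" "\<And>t x p. 0 < t \<Longrightarrow> blinfun_apply (D (t, x, p)) = Gd t x p"
  "\<And>t x p. 0 < t \<Longrightarrow> ((unc3 g) has_derivative Gd t x p) (at (t, x, p))"
proof -
 obtain D where D0: "\<forall>z\<in>{z. 0 \<le> fst z}. ((unc3 g) has_derivative blinfun_apply (D z)) (at z within {z. 0 \<le> fst z})"
  and c: "continuous_on {z::real \<times> vec3 \<times> vec3. 0 \<le> fst z} D"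
  using C1g unfolding C1_on_def by blast
 have D: "((unc3 g) has_derivative blinfun_apply (D z)) (at z within {z. 0 \<le> fst z})"
  if "0 \<le> fst z" for z using D0 that by blast
 have e: "blinfun_apply (D (t, x, p)) = Gd t x p"
  "((unc3 g) has_derivative Gd t x p) (at (t, x, p))" if t: "0 < t" for t x p
 proof -
  have "(t, x, p) \<in> interior {z :: real \<times> vec3 \<times> vec3. 0 \<le> fst z}"
   by (rule interiorI[of "{z. 0 < fst z}"]) (use t in \<open>auto intro!: open_Collect_less continuous_intros\<close>)
  then have d: "((unc3 g) has_derivative blinfun_apply (D (t, x, p))) (at (t, x, p))"
   using D[of "(t, x, p)"] t at_within_interior[of "(t, x, p)" "{z :: real \<times> vec3 \<times> vec3. 0 \<le> fst z}"] by simp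
  from frechet_derivative_at[OF d] show e1: "blinfun_apply (D (t, x, p)) = Gd t x p" by (simp add: Gd_def)
  show "((unc3 g) has_derivative Gd t x p) (at (t, x, p))" using d unfolding e1 .
 qed
 have "continuous_on {z::real \<times> vec3 \<times> vec3. 0 < fst z} D" by (rule continuous_on_subset[OF c]) auto
 then show ?thesis using e by (rule that)
qed

lemma Gd_deriv: "0 < t \<Longrightarrow> ((unc3 g) has_derivative Gd t x p) (at (t, x, p))"
 by (rule Gd_blinfun) blast

lemma Gd_linear: "0 < t \<Longrightarrow> linear (Gd t x p)"
 using has_derivative_linear[OF Gd_deriv] .

lemma Gd_continuous:
 assumes "continuous_on X a" "continuous_on X b" "continuous_on X c" "continuous_on X h" "\<And>z. z \<in> X \<Longrightarrow> 0 < a z"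
 shows "continuous_on X (\<lambda>z. Gd (a z) (b z) (c z) (h z))"
proof -
 obtain D where D: "continuous_on {z. 0 < fst z} D" "\<And>t x p. 0 < t \<Longrightarrow> blinfun_apply (D (t, x, p)) = Gd t x p"
  by (rule Gd_blinfun) blast
 have im: "(\<lambda>z. (a z, b z, c z)) ` X \<subseteq> {z. 0 < fst z}" using assms(5) by auto
 have "continuous_on X (\<lambda>z. D (a z, b z, c z))"
  by (rule continuous_on_compose2[OF D(1) _ im]) (intro continuous_intros assms)
 then have "continuous_on X (\<lambda>z. blinfun_apply (D (a z, b z, c z)) (h z))" by (intro continuous_intros assms)
 then show ?thesis by (rule continuous_on_eq) (simp add: D(2) assms(5))
qed

lemma continuous_g:
 assumes "continuous_on X a" "continuous_on X b" "continuous_on X c" "\<And>z. z \<in> X \<Longrightarrow> 0 \<le> a z"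
 shows "continuous_on X (\<lambda>z. g (a z) (b z) (c z))"
proof -
 have "(\<lambda>z. (a z, b z, c z)) ` X \<subseteq> {z. 0 \<le> fst z}" using assms(4) by auto
 from continuous_on_compose2[OF C1_on_continuous_on[OF C1g] _ this] show ?thesis
  using assms(1-3) by (simp add: continuous_on_Pair)
qed

definition Iw :: "(vec3 \<Rightarrow> real) \<Rightarrow> real \<Rightarrow> vec3 \<Rightarrow> real" where
 "Iw \<eta> t x = integral UNIV (\<lambda>p. \<eta> p * g t x p)"

definition dIw :: "(vec3 \<Rightarrow> real) \<Rightarrow> real \<Rightarrow> vec3 \<Rightarrow> real \<times> vec3 \<Rightarrow> real" where
 "dIw \<eta> t x h = integral UNIV (\<lambda>p. \<eta> p * Gd t x p (fst h, snd h, 0))"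

lemma cs_Iw: assumes "continuous_on UNIV \<eta>" "0 \<le> t" shows "cs \<beta> (\<lambda>p. \<eta> p * g t x p)"
 unfolding cs_def using assms g_supp[of t] by (auto intro!: continuous_intros continuous_g)

lemma Gd_zero: assumes "0 < t" "\<beta> < norm p" shows "Gd t x p = (\<lambda>_. 0)"
proof -
 have op: "open {z::real \<times> vec3 \<times> vec3. 0 < fst z \<and> \<beta> < norm (snd (snd z))}"
  by (intro open_Collect_conj open_Collect_less continuous_intros)
 have "((unc3 g) has_derivative (\<lambda>_. 0)) (at (t, x, p))"
  by (rule has_derivative_transform_within_open[OF has_derivative_const[of 0] op]) (use assms g_supp in auto)
 from has_derivative_unique[OF Gd_deriv[OF assms(1)] this] show ?thesis .
qed

lemma cs_dIw: assumes "continuous_on UNIV \<eta>" "0 < t" "continuous_on UNIV h"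
 shows "cs \<beta> (\<lambda>p. \<eta> p * Gd t x p (h p))"
 unfolding cs_def using assms Gd_zero[of t] by (auto intro!: continuous_intros Gd_continuous)

text \<open>Differentiation under the integral sign, with the derivative as a continuous family of
  linear maps. \<open>emb\<close> embeds an increment of time and position into phase space with
  zero momentum part.\<close>

lemma Iw_deriv:
 assumes \<eta>: "continuous_on UNIV \<eta>" and t: "0 < t"
 shows "((\<lambda>z. Iw \<eta> (fst z) (snd z)) has_derivative dIw \<eta> t x) (at (t, x))"
proof -
 obtain D where D: "continuous_on {z. 0 < fst z} D" "\<And>t x p. 0 < t \<Longrightarrow> blinfun_apply (D (t, x, p)) = Gd t x p"
  by (rule Gd_blinfun) blast
 define emb :: "(real \<times> vec3) \<Rightarrow>\<^sub>L (real \<times> vec3 \<times> vec3)" where "emb = Blinfun (\<lambda>h. (fst h, snd h, 0))"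
 have emb: "blinfun_apply emb h = (fst h, snd h, 0)" for h
  unfolding emb_def by (subst bounded_linear_Blinfun_apply)
   (auto intro!: bounded_linear_Pair bounded_linear_fst bounded_linear_snd bounded_linear_zero)
 define fx where "fx z p = \<eta> p *\<^sub>R (D (fst z, snd z, p) o\<^sub>L emb)" for z p
 let ?U = "{z::real \<times> vec3. 0 < fst z}"
 have fx: "blinfun_apply (fx z p) h = \<eta> p * Gd (fst z) (snd z) p (fst h, snd h, 0)" if "0 < fst z" for z p h
  using that by (simp add: fx_def D(2) emb scaleR_blinfun.rep_eq)
 have "((\<lambda>z. integral (cbox (vec (- \<beta>)) (vec \<beta>)) (\<lambda>p. \<eta> p * g (fst z) (snd z) p)) has_derivative
  blinfun_apply (integral (cbox (vec (- \<beta>)) (vec \<beta>)) (fx (t, x)))) (at (t, x) within ?U)"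
 proof (rule leibniz_rule)
  fix z :: "real \<times> vec3" and p :: vec3 assume z: "z \<in> ?U"
  have "((\<lambda>z::real \<times> vec3. (fst z, snd z, p)) has_derivative (\<lambda>h. (fst h, snd h, 0))) (at z within ?U)"
   by (intro has_derivative_Pair has_derivative_const) (auto intro!: derivative_eq_intros)
  from has_derivative_compose[OF this, of "\<lambda>z. g (fst z) (fst (snd z)) (snd (snd z))" "Gd (fst z) (snd z) p"]
   Gd_deriv[of "fst z" "snd z" p] z
  have "((\<lambda>z. g (fst z) (snd z) p) has_derivative (\<lambda>h. Gd (fst z) (snd z) p (fst h, snd h, 0))) (at z within ?U)" by simp
  from has_derivative_mult_right[OF this, of "\<eta> p"]
  have "((\<lambda>z. \<eta> p * g (fst z) (snd z) p) has_derivative (\<lambda>h. \<eta> p * Gd (fst z) (snd z) p (fst h, snd h, 0))) (at z within ?U)" .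
  moreover have "blinfun_apply (fx z p) = (\<lambda>h. \<eta> p * Gd (fst z) (snd z) p (fst h, snd h, 0))" by (rule ext) (use fx[of z p] z in simp)
  ultimately show "((\<lambda>z. \<eta> p * g (fst z) (snd z) p) has_derivative blinfun_apply (fx z p)) (at z within ?U)" by simp
 next
  fix z :: "real \<times> vec3" assume z: "z \<in> ?U"
  show "(\<lambda>p. \<eta> p * g (fst z) (snd z) p) integrable_on cbox (vec (- \<beta>)) (vec \<beta>)"
   using cs_has_integral_bx(1)[OF cs_Iw[OF \<eta>, of "fst z" "snd z"] order_refl] z by (auto simp: bx_def)
 next
  have im: "(\<lambda>z::(real \<times> vec3) \<times> vec3. (fst (fst z), snd (fst z), snd z)) ` (?U \<times> cbox (vec (- \<beta>)) (vec \<beta>)) \<subseteq> {z. 0 < fst z}" by auto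
  have "continuous_on (?U \<times> cbox (vec (- \<beta>)) (vec \<beta>)) (\<lambda>z. D (fst (fst z), snd (fst z), snd z))"
   by (rule continuous_on_compose2[OF D(1) _ im]) (intro continuous_intros)
  then show "continuous_on (?U \<times> cbox (vec (- \<beta>)) (vec \<beta>)) (\<lambda>(z, p). fx z p)"
   unfolding fx_def split_beta
   by (intro continuous_intros continuous_on_compose2[OF \<eta>]
     bounded_bilinear.continuous_on[OF bounded_bilinear_blinfun_compose]) auto
 next
  have "?U = {0<..} \<times> UNIV" by auto
  then show "convex ?U" by (simp only:) (intro convex_Times convex_UNIV convex_real_interval)
 qed (use t in auto)
 moreover have "open ?U" by (intro open_Collect_less continuous_intros)
 ultimately have 1: "((\<lambda>z. integral (bx \<beta>) (\<lambda>p. \<eta> p * g (fst z) (snd z) p)) has_derivative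
  blinfun_apply (integral (bx \<beta>) (fx (t, x)))) (at (t, x))"
  using t at_within_open[of "(t, x)" ?U] by (simp add: bx_def)
 have 2: "((\<lambda>z. Iw \<eta> (fst z) (snd z)) has_derivative blinfun_apply (integral (bx \<beta>) (fx (t, x)))) (at (t, x))"
 proof (rule has_derivative_transform_within_open[OF 1 \<open>open ?U\<close>])
  show "integral (bx \<beta>) (\<lambda>p. \<eta> p * g (fst z) (snd z) p) = Iw \<eta> (fst z) (snd z)" if "z \<in> ?U" for z
   unfolding Iw_def using cs_integral_bx[OF cs_Iw[OF \<eta>, of "fst z" "snd z"] order_refl] that by simp
 qed (use t in simp)
 have "blinfun_apply (integral (bx \<beta>) (fx (t, x))) h = dIw \<eta> t x h" for h
 proof -
  have cfx: "continuous_on (cbox (vec (- \<beta>)) (vec \<beta>)) (fx (t, x))"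
  proof -
   have im: "(\<lambda>p::vec3. (t, x, p)) ` (cbox (vec (- \<beta>)) (vec \<beta>)) \<subseteq> {z. 0 < fst z}" using t by auto
   have "continuous_on (cbox (vec (- \<beta>)) (vec \<beta>)) (\<lambda>p. D (t, x, p))"
    by (rule continuous_on_compose2[OF D(1) _ im]) (intro continuous_intros)
   then show ?thesis unfolding fx_def
    by (auto intro!: continuous_intros continuous_on_subset[OF \<eta>] bounded_bilinear.continuous_on[OF bounded_bilinear_blinfun_compose])
  qed
  then have "fx (t, x) integrable_on bx \<beta>" unfolding bx_def by (rule integrable_continuous)
  then have "blinfun_apply (integral (bx \<beta>) (fx (t, x))) h = integral (bx \<beta>) (\<lambda>p. blinfun_apply (fx (t, x) p) h)"
   by (rule blinfun_apply_integral)
  also have "\<dots> = integral (bx \<beta>) (\<lambda>p. \<eta> p * Gd t x p (fst h, snd h, 0))" using fx[of "(t, x)"] t by simp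
  also have "\<dots> = dIw \<eta> t x h" unfolding dIw_def
   by (rule cs_integral_bx[symmetric, OF cs_dIw[OF \<eta> t] order_refl]) simp
  finally show ?thesis .
 qed
 then have "blinfun_apply (integral (bx \<beta>) (fx (t, x))) = dIw \<eta> t x" by (rule ext)
 with 2 show ?thesis by simp
qed

lemma dIw_linear: "continuous_on UNIV \<eta> \<Longrightarrow> 0 < t \<Longrightarrow> linear (dIw \<eta> t x)"
 using has_derivative_linear[OF Iw_deriv] .

lemma Iw_deriv_x: assumes "continuous_on UNIV \<eta>" "0 < t"
 shows "(Iw \<eta> t has_derivative (\<lambda>h. dIw \<eta> t x (0, h))) (at x)"
proof -
 have "((\<lambda>x. (t, x)) has_derivative (\<lambda>h. (0, h))) (at x)" by (intro has_derivative_Pair) (auto intro!: derivative_eq_intros)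
 from has_derivative_compose[OF this Iw_deriv[OF assms]] show ?thesis by simp
qed

lemma Iw_deriv_t: assumes "continuous_on UNIV \<eta>" "0 < t"
 shows "((\<lambda>t. Iw \<eta> t x) has_real_derivative dIw \<eta> t x (1, 0)) (at t)"
proof -
 have "((\<lambda>t. (t, x)) has_derivative (\<lambda>h. (h, 0))) (at t)" by (intro has_derivative_Pair) (auto intro!: derivative_eq_intros)
 from has_derivative_compose[OF this Iw_deriv[OF assms]]
 have "((\<lambda>t. Iw \<eta> t x) has_derivative (\<lambda>h. dIw \<eta> t x (h, 0))) (at t)" by simp
 moreover have "(\<lambda>h. dIw \<eta> t x (h, 0)) = (*) (dIw \<eta> t x (1, 0))"
 proof
  fix h :: real
  have "(h, 0::vec3) = h *\<^sub>R (1, 0)" by simp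
  then have "dIw \<eta> t x (h, 0) = h *\<^sub>R dIw \<eta> t x (1, 0)"
   using linear_cmul[OF dIw_linear[OF assms, of x], of h "(1, 0)"] by (simp only:)
  then show "dIw \<eta> t x (h, 0) = dIw \<eta> t x (1, 0) * h" by (simp only: real_scaleR_def mult.commute)
 qed
 ultimately show ?thesis by (simp only: has_field_derivative_def)
qed

lemma g_deriv_p: assumes "0 < t" shows "(g t x has_derivative (\<lambda>k. Gd t x p (0, 0, k))) (at p)"
proof -
 have "((\<lambda>p. (t, x, p)) has_derivative (\<lambda>h. (0, 0, h))) (at p)" by (intro has_derivative_Pair) (auto intro!: derivative_eq_intros)
 from has_derivative_compose[OF this Gd_deriv[OF assms]] show ?thesis by simp
qed

text \<open>The Lorentz force is divergence-free in momentum: E and B do not depend on p, and the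
  velocity is a gradient in p, so div (v x B) = B . curl v = 0. Integration by parts therefore only
  moves the force onto the weight.\<close>

lemma integral_force_term:
 assumes \<eta>: "C1_on UNIV \<eta>" and d\<eta>: "\<And>p. (\<eta> has_derivative \<eta>' p) (at p)" and t: "0 < t"
 shows "((\<lambda>p. \<eta> p * Gd t x p (0, 0, force t x p) + \<eta>' p (force t x p) * g t x p) has_integral 0) UNIV"
proof -
 define K' where "K' p h = q *\<^sub>R cross3 (dvel m p h) (B t x)" for p h
 have C1K: "C1_on UNIV (force t x)"
  unfolding force_def[abs_def]
  by (intro C1_on_blinear_compose[OF bounded_linear_scaleR_right] C1_on_add C1_on_const C1_on_bilinear[OF bounded_bilinear_cross3] C1_on_vel m)
 have dK: "(force t x has_derivative K' p) (at p)" for p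
 proof -
  have "((\<lambda>p. cross3 (vel m p) (B t x)) has_derivative (\<lambda>h. cross3 (dvel m p h) (B t x))) (at p)"
   by (rule bounded_linear.has_derivative[OF bounded_bilinear.bounded_linear_left[OF bounded_bilinear_cross3] vel_has_derivative[OF m]])
  from has_derivative_scaleR_right[OF has_derivative_add[OF has_derivative_const this], of q "E t x"]
  show ?thesis by (simp add: force_def[abs_def] K'_def[abs_def])
 qed
 have div: "(\<Sum>i\<in>UNIV. K' p (axis i 1) $ i) = 0" for p
  unfolding K'_def dvel_def sum_3
  by (simp add: inner_axis cross3_def) (simp add: axis_def algebra_simps)
 have "((\<lambda>p. (\<eta> p * Gd t x p (0, 0, force t x p) + \<eta>' p (force t x p) * g t x p) + \<eta> p * g t x p * (\<Sum>i\<in>UNIV. K' p (axis i 1) $ i)) has_integral 0) UNIV"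
 proof (rule integral_divergence_free[where \<phi> = "\<lambda>p. \<eta> p * g t x p" and \<phi>' = "\<lambda>p k. \<eta> p * Gd t x p (0, 0, k) + \<eta>' p k * g t x p" and r = \<beta>])
  show "C1_on UNIV (\<lambda>p. \<eta> p * g t x p)"
   by (intro C1_on_bilinear[OF bounded_bilinear_mult] \<eta> C1_on_g_compose C1_on_const C1_on_linear bounded_linear_ident) (use t in auto)
  show "((\<lambda>p. \<eta> p * g t x p) has_derivative (\<lambda>k. \<eta> p * Gd t x p (0, 0, k) + \<eta>' p k * g t x p)) (at p)" for p
   by (intro has_derivative_mult d\<eta> g_deriv_p t)
 qed (use g_supp[of t] t C1K dK in auto)
 then show ?thesis unfolding div by simp
qed

text \<open>The moment of Vlasov's equation with weight \<eta>: transport gives the divergence of a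
  moment with one more velocity factor, and the force term is integrated by parts.\<close>

lemma dIw_time:
 assumes \<eta>: "C1_on UNIV \<eta>" and d\<eta>: "\<And>p. (\<eta> has_derivative \<eta>' p) (at p)" and t: "0 < t"
 shows "dIw \<eta> t x (1, 0) = - (\<Sum>i\<in>UNIV. dIw (\<lambda>p. \<eta> p * (vel m p $ i)) t x (0, axis i 1)) + integral UNIV (\<lambda>p. \<eta>' p (force t x p) * g t x p)"
proof -
 have c\<eta>: "continuous_on UNIV \<eta>" by (rule C1_on_continuous_on[OF \<eta>])
 have cf: "continuous_on UNIV (force t x)"
  unfolding force_def[abs_def] by (intro continuous_intros continuous_vel bounded_bilinear.continuous_on[OF bounded_bilinear_cross3])
 note l = Gd_linear[OF t]
 have i1: "((\<lambda>p. \<eta> p * Gd t x p (1, 0, 0)) has_integral dIw \<eta> t x (1, 0)) UNIV"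
  unfolding dIw_def using cs_integrable[OF cs_dIw[OF c\<eta> t, of "\<lambda>_. (1, 0, 0)" x]] by (simp add: integrable_integral)
 have i2: "((\<lambda>p. (\<eta> p * (vel m p $ i)) * Gd t x p (0, axis i 1, 0)) has_integral dIw (\<lambda>p. \<eta> p * (vel m p $ i)) t x (0, axis i 1)) UNIV" for i
  unfolding dIw_def using cs_integrable[OF cs_dIw[OF _ t, of "\<lambda>p. \<eta> p * (vel m p $ i)" "\<lambda>_. (0, axis i 1, 0)" x]]
  by (simp add: integrable_integral continuous_intros c\<eta> continuous_vel)
 have i3: "((\<lambda>p. \<Sum>i\<in>UNIV. (\<eta> p * (vel m p $ i)) * Gd t x p (0, axis i 1, 0)) has_integral (\<Sum>i\<in>UNIV. dIw (\<lambda>p. \<eta> p * (vel m p $ i)) t x (0, axis i 1))) UNIV"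
  by (intro has_integral_sum i2) auto
 have i4: "((\<lambda>p. \<eta> p * Gd t x p (0, 0, force t x p)) has_integral integral UNIV (\<lambda>p. \<eta> p * Gd t x p (0, 0, force t x p))) UNIV"
  using cs_integrable[OF cs_dIw[OF c\<eta> t, of "\<lambda>p. (0, 0, force t x p)" x]] by (simp add: integrable_integral continuous_intros cf)
 from has_integral_diff[OF integral_force_term[OF \<eta> d\<eta> t, of x] i4]
 have i5: "((\<lambda>p. \<eta>' p (force t x p) * g t x p) has_integral 0 - integral UNIV (\<lambda>p. \<eta> p * Gd t x p (0, 0, force t x p))) UNIV" by simp
 have pt: "\<eta> p * Gd t x p (1, 0, 0) = - (\<Sum>i\<in>UNIV. (\<eta> p * (vel m p $ i)) * Gd t x p (0, axis i 1, 0)) - \<eta> p * Gd t x p (0, 0, force t x p)" for p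
 proof -
  have "0 = Gd t x p (1, vel m p, force t x p)" using vlasov[OF t, of x p] by (simp add: Gd_def force_def)
  also have "(1::real, vel m p, force t x p) = (1, 0, 0) + (0, vel m p, 0) + (0, 0, force t x p)" by simp
  also have "Gd t x p \<dots> = Gd t x p (1, 0, 0) + Gd t x p (0, vel m p, 0) + Gd t x p (0, 0, force t x p)" by (simp only: linear_add[OF l])
  finally have 1: "Gd t x p (1, 0, 0) = - Gd t x p (0, vel m p, 0) - Gd t x p (0, 0, force t x p)" by simp
  have "(0, vel m p, 0) = (\<Sum>i\<in>UNIV. (vel m p $ i) *\<^sub>R (0::real, axis i (1::real), 0::vec3))"
   by (subst vec3_basis_expansion[of "vel m p"]) (simp add: sum_3)
  then have "Gd t x p (0, vel m p, 0) = (\<Sum>i\<in>UNIV. (vel m p $ i) * Gd t x p (0, axis i 1, 0))"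
   by (simp only: linear_sum[OF l] linear_cmul[OF l] real_scaleR_def)
  then show ?thesis unfolding 1 by (simp add: sum_distrib_left algebra_simps)
 qed
 have "((\<lambda>p. \<eta> p * Gd t x p (1, 0, 0)) has_integral - (\<Sum>i\<in>UNIV. dIw (\<lambda>p. \<eta> p * (vel m p $ i)) t x (0, axis i 1)) - integral UNIV (\<lambda>p. \<eta> p * Gd t x p (0, 0, force t x p))) UNIV"
  unfolding pt by (intro has_integral_diff has_integral_neg i3 i4)
 from has_integral_unique[OF i1 this] integral_unique[OF i5] show ?thesis by simp
qed

lemma psi_continuous:
 assumes "continuous_on X a" "continuous_on X b" "0 \<le> t"
 shows "continuous_on X (\<lambda>z. psi t (a z) (b z))"
proof -
 let ?A = "{z::vec3 \<times> vec3. norm (snd z) < 1}" and ?B = "{z::vec3 \<times> vec3. \<gamma> < norm (snd z)}"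
 have lorc: "continuous_on ?A (\<lambda>z. lor (snd z) ^ 5)"
  by (rule continuous_on_compose2[OF C1_on_continuous_on[OF C1_on_lor_power[of 5]]]) (auto intro!: continuous_intros)
 have vic: "continuous_on ?A (\<lambda>z. vel_inv m (snd z))"
  by (rule continuous_on_compose2[OF C1_on_continuous_on[OF C1_on_vel_inv[of m]]]) (auto intro!: continuous_intros)
 have "continuous_on (?A \<union> ?B) (\<lambda>z. psi t (fst z) (snd z))"
 proof (rule continuous_on_open_Un)
  show "open ?A" "open ?B" by (intro open_Collect_less continuous_intros)+
  have "continuous_on ?A (\<lambda>z. m ^ 3 * lor (snd z) ^ 5 * g t (fst z + t *\<^sub>R snd z) (vel_inv m (snd z)))"
   by (intro continuous_intros lorc vic continuous_g) (use assms(3) in auto)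
  then show "continuous_on ?A (\<lambda>z. psi t (fst z) (snd z))"
   by (rule continuous_on_eq) (auto simp: psi_def gv_def)
  have "continuous_on ?B (\<lambda>z. 0::real)" by (rule continuous_on_const)
  then show "continuous_on ?B (\<lambda>z. psi t (fst z) (snd z))"
   by (rule continuous_on_eq) (auto simp: psi_zero[OF assms(3)])
 qed
 moreover have "?A \<union> ?B = UNIV" using \<gamma>(2) by force
 ultimately have "continuous_on UNIV (\<lambda>z. psi t (fst z) (snd z))" by simp
 from continuous_on_compose2[OF this continuous_on_Pair[OF assms(1,2)]] show ?thesis by simp
qed

text \<open>In \<open>kap t u (y + u)\<close> the position is \<open>t *\<^sub>R y\<close> and the
  velocity \<open>y + u\<close>, so \<open>u\<close> is the deviation from the velocity of the ray x
  = t y; integrating gives local moments. In \<open>kap t u y\<close> the velocity stays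
  \<open>y\<close> and the position \<open>t *\<^sub>R (y - u)\<close> sweeps space; integrating
  gives the spatial average.\<close>

definition kap :: "real \<Rightarrow> vec3 \<Rightarrow> vec3 \<Rightarrow> real" where "kap t u w = psi t (- (t *\<^sub>R u)) w"

definition mu :: "(vec3 \<Rightarrow> real) \<Rightarrow> real \<Rightarrow> vec3 \<Rightarrow> real" where
 "mu \<omega> t y = integral UNIV (\<lambda>u. \<omega> u * kap t u (y + u))"

text \<open>Substitution of the velocity for the momentum; its Jacobian cancels the one contained in
  \<open>psi\<close>.\<close>

lemma mu_eq_Iw:
 assumes t: "0 \<le> t" and \<omega>: "continuous_on UNIV \<omega>"
 shows "mu \<omega> t y = Iw (\<lambda>p. \<omega> (vel m p - y)) t (t *\<^sub>R y)"
proof -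
 define F where "F w = \<omega> (w - y) * psi t (t *\<^sub>R y - t *\<^sub>R w) w" for w
 have cF: "continuous_on UNIV F" unfolding F_def
  by (intro continuous_intros psi_continuous continuous_on_compose2[OF \<omega>] t) auto
 have zF: "F w = 0" if "1 \<le> norm w" for w using that by (simp add: F_def psi_def)
 have "cs 1 F" using cF zF by (simp add: cs_def)
 from cs_translate[OF this, of y] have "integral UNIV F = integral UNIV (\<lambda>u. F (y + u))" by simp
 also have "\<dots> = mu \<omega> t y" by (simp add: mu_def F_def kap_def algebra_simps)
 finally have 1: "mu \<omega> t y = integral UNIV F" by simp
 have "1 / Djac m p * F (vel m p) = \<omega> (vel m p - y) * g t (t *\<^sub>R y) p" for p
 proof -
  have n: "norm (vel m p) < 1" by (rule norm_vel_less_1[OF m])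
  have "Djac m p \<noteq> 0" using Djac_eq[OF m, of p] m lor_pos[OF n] by simp
  moreover have "F (vel m p) = \<omega> (vel m p - y) * (Djac m p * g t (t *\<^sub>R y) p)"
   using n by (simp add: F_def psi_def gv_def Djac_eq[OF m] vel_inv_vel[OF m])
  ultimately show ?thesis by simp
 qed
 with integral_velocity_substitution[OF m cF zF] 1 show ?thesis by (simp add: Iw_def)
qed

text \<open>For \<open>t\<close> at least 3 one has t + 2 <= t^2 and ln t >= 1, so
  \<open>wlam (2 * a1) t\<close> is at most a multiple of (ln t)^2. The bound on \<open>u\<close> is
  the logarithmic drift divided by \<open>t\<close>.\<close>

lemma kap_bounds:
 "\<exists>K\<ge>0. \<forall>t\<ge>3. \<forall>u w w' a b. (kap t u w \<noteq> 0 \<longrightarrow> norm u \<le> K * (ln t / t)) \<and> \<bar>kap t u w\<bar> \<le> K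
  \<and> \<bar>kap t u w - kap t u w'\<bar> \<le> K * (ln t)^2 * norm (w - w')
  \<and> \<bar>kap t u (w + a + b) - kap t u (w + a) - kap t u (w + b) + kap t u w\<bar> \<le> K * (ln t) ^ 4 * norm a * norm b"
proof -
 obtain C where C: "0 \<le> C" "\<And>t x p. 0 \<le> t \<Longrightarrow> g t x p \<noteq> 0 \<Longrightarrow> norm (x - t *\<^sub>R vel m p) \<le> L + C * ln (t + 2)"
  using orb_support by blast
 obtain M where M: "0 \<le> M" "\<And>t y w w' a b. 0 \<le> t \<Longrightarrow> \<bar>psi t y w\<bar> \<le> M \<and> \<bar>psi t y w - psi t y w'\<bar> \<le> M * wlam (2 * a1) t * norm (w - w') \<and>
  \<bar>psi t y (w + a + b) - psi t y (w + a) - psi t y (w + b) + psi t y w\<bar> \<le> 4 * M * (wlam (2 * a1) t)^2 * norm a * norm b"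
  using psi_regularity by blast
 define A where "A = 1 + 4 * a1"
 have A: "1 \<le> A" using a1(1) by (simp add: A_def)
 define K where "K = L + 2 * C + M + M * A + 4 * M * A^2"
 have Kn: "0 \<le> M * A" "0 \<le> 4 * M * A^2" using M(1) A by auto
 have K0: "0 \<le> K" "L + 2 * C \<le> K" "M \<le> K" "M * A \<le> K" "4 * M * A^2 \<le> K"
  using L C(1) M(1) Kn unfolding K_def by linarith+
 show ?thesis
 proof (intro exI[of _ K] conjI allI impI K0(1))
  fix t :: real and u w w' a b :: vec3
  assume t: "3 \<le> t"
  then have t0: "0 \<le> t" "0 < t" by auto
  have l1: "1 \<le> ln t" using t exp_le by (subst ln_ge_iff) auto
  have "t + 2 \<le> t^2"
  proof -
   have "3 * t \<le> t * t" using t by (intro mult_right_mono) auto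
   then show ?thesis unfolding power2_eq_square using t by linarith
  qed
  then have "ln (t + 2) \<le> ln (t^2)" using t by simp
  then have l2: "ln (t + 2) \<le> 2 * ln t" using t by (simp add: ln_realpow)
  have l0: "0 \<le> ln (t + 2)" using t by simp
  have lam: "wlam (2 * a1) t \<le> A * (ln t)^2"
  proof -
   have "(ln (t + 2))^2 \<le> (2 * ln t)^2" using l0 l2 by (intro power_mono)
   then have "a1 * (ln (t + 2))^2 \<le> a1 * (2 * ln t)^2" using a1(1) by (intro mult_left_mono) auto
   moreover have "1 \<le> (ln t)^2" using l1 by simp
   ultimately show ?thesis by (simp add: wlam_def A_def power_mult_distrib algebra_simps)
  qed
  have lam0: "0 \<le> wlam (2 * a1) t" using wlam_ge_1[of "2 * a1" t] a1(1) by simp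
  show "norm u \<le> K * (ln t / t)" if "kap t u w \<noteq> 0"
  proof -
   have w: "norm w < 1" "g t (- (t *\<^sub>R u) + t *\<^sub>R w) (vel_inv m w) \<noteq> 0" using that by (auto simp: kap_def psi_def gv_def split: if_splits)
   have "t * norm u \<le> L + C * ln (t + 2)" using C(2)[OF t0(1) w(2)] vel_vel_inv[OF m w(1)] t0 by simp
   also have "\<dots> \<le> L * ln t + C * (2 * ln t)" using L C(1) l1 l2 by (intro add_mono mult_left_mono) auto
   also have "\<dots> = (L + 2 * C) * ln t" by (simp add: algebra_simps)
   also have "\<dots> \<le> K * ln t" using K0(2) l1 by (intro mult_right_mono) auto
   finally show ?thesis using t0 by (simp add: field_simps)
  qed
  show "\<bar>kap t u w\<bar> \<le> K" using M(2)[OF t0(1)] K0(3) unfolding kap_def by (meson order_trans)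
  have "M * wlam (2 * a1) t \<le> M * (A * (ln t)^2)" using lam M(1) by (intro mult_left_mono)
  also have "\<dots> \<le> K * (ln t)^2" using mult_right_mono[OF K0(4), of "(ln t)^2"] by (simp add: mult.assoc)
  finally have "M * wlam (2 * a1) t * norm (w - w') \<le> K * (ln t)^2 * norm (w - w')" by (rule mult_right_mono) simp
  then show "\<bar>kap t u w - kap t u w'\<bar> \<le> K * (ln t)^2 * norm (w - w')"
   using M(2)[OF t0(1)] unfolding kap_def by (meson order_trans)
  have "(wlam (2 * a1) t)^2 \<le> (A * (ln t)^2)^2" using lam lam0 by (intro power_mono)
  then have "4 * M * (wlam (2 * a1) t)^2 \<le> 4 * M * (A * (ln t)^2)^2" using M(1) by (intro mult_left_mono) auto
  also have "\<dots> = (4 * M * A^2) * (ln t) ^ 4" by (simp add: power_mult_distrib power_mult[symmetric])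
  also have "\<dots> \<le> K * (ln t) ^ 4" using K0(5) l1 by (intro mult_right_mono) auto
  finally have "4 * M * (wlam (2 * a1) t)^2 * norm a * norm b \<le> K * (ln t) ^ 4 * norm a * norm b"
   by (intro mult_right_mono) auto
  then show "\<bar>kap t u (w + a + b) - kap t u (w + a) - kap t u (w + b) + kap t u w\<bar> \<le> K * (ln t) ^ 4 * norm a * norm b"
   using M(2)[OF t0(1)] unfolding kap_def by (meson order_trans)
 qed
qed

lemma ln_ge_1: "3 \<le> t \<Longrightarrow> 1 \<le> ln (t::real)"
 using exp_le by (subst ln_ge_iff) auto

lemma kap_cont: "0 \<le> t \<Longrightarrow> continuous_on UNIV (\<lambda>u. kap t u (y + u))" "0 \<le> t \<Longrightarrow> continuous_on UNIV (\<lambda>u. kap t u y)"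
 unfolding kap_def by (intro psi_continuous continuous_intros; simp)+

lemma mu_bounds:
 "\<exists>K\<ge>0. \<forall>t\<ge>3. \<forall>\<omega> (\<Omega>::real). continuous_on UNIV \<omega> \<and> (\<forall>u. norm u \<le> K * (ln t / t) \<longrightarrow> \<bar>\<omega> u\<bar> \<le> \<Omega>) \<longrightarrow>
  (\<forall>y y' a b. \<bar>mu \<omega> t y\<bar> \<le> K * (ln t / t) ^ 3 * \<Omega> \<and> \<bar>mu \<omega> t y - mu \<omega> t y'\<bar> \<le> K * (ln t / t) ^ 3 * \<Omega> * (ln t)^2 * norm (y - y')
   \<and> \<bar>mu \<omega> t (y + a + b) - mu \<omega> t (y + a) - mu \<omega> t (y + b) + mu \<omega> t y\<bar> \<le> K * (ln t / t) ^ 3 * \<Omega> * (ln t) ^ 4 * norm a * norm b)"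
proof -
 obtain K where K: "0 \<le> K" "\<And>t u w w' a b. 3 \<le> t \<Longrightarrow> (kap t u w \<noteq> 0 \<longrightarrow> norm u \<le> K * (ln t / t)) \<and> \<bar>kap t u w\<bar> \<le> K
  \<and> \<bar>kap t u w - kap t u w'\<bar> \<le> K * (ln t)^2 * norm (w - w')
  \<and> \<bar>kap t u (w + a + b) - kap t u (w + a) - kap t u (w + b) + kap t u w\<bar> \<le> K * (ln t) ^ 4 * norm a * norm b"
  using kap_bounds by blast
 define K' where "K' = K + 8 * K ^ 3 * K"
 have K': "0 \<le> K'" "K \<le> K'" "8 * K ^ 3 * K \<le> K'" using K(1) by (auto simp: K'_def)
 show ?thesis
 proof (intro exI[of _ K'] conjI allI impI K'(1))
  fix t \<Omega> :: real and \<omega> :: "vec3 \<Rightarrow> real" and y y' a b :: vec3 assume t: "3 \<le> t"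
  assume h: "continuous_on UNIV \<omega> \<and> (\<forall>u. norm u \<le> K' * (ln t / t) \<longrightarrow> \<bar>\<omega> u\<bar> \<le> \<Omega>)"
  have l1: "1 \<le> ln t" "0 \<le> ln t / t" using t ln_ge_1[OF t] by auto
  define r where "r = K * (ln t / t)"
  have r: "0 \<le> r" unfolding r_def by (rule mult_nonneg_nonneg[OF K(1) l1(2)])
  have "r \<le> K' * (ln t / t)" using K' l1 unfolding r_def by (intro mult_right_mono)
  then have bo: "\<And>u. norm u \<le> r \<Longrightarrow> \<bar>\<omega> u\<bar> \<le> \<Omega>" using h by auto
  have z: "\<And>u w. r < norm u \<Longrightarrow> kap t u w = 0" using K(2)[OF t] unfolding r_def by force
  have \<Omega>: "0 \<le> \<Omega>" using bo[of 0] r by simp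
  have cu: "continuous_on UNIV (\<lambda>u. kap t u (y + u))" for y using kap_cont t by simp
  note mb = moment_bounds[where \<kappa> = "kap t" and \<omega> = \<omega> and r = r and \<Omega> = \<Omega> and ?M0.0 = K and ?M1.0 = "K * (ln t)^2" and ?M2.0 = "K * (ln t) ^ 4",
    OF cu z r _ bo, folded mu_def]
  have k: "8 * r ^ 3 * (\<Omega> * (K * x)) \<le> K' * (ln t / t) ^ 3 * \<Omega> * x" if "0 \<le> x" for x
  proof -
   have "8 * r ^ 3 * (\<Omega> * (K * x)) = (8 * K ^ 3 * K) * ((ln t / t) ^ 3 * \<Omega> * x)" by (simp add: r_def power_mult_distrib power_divide)
   also have "\<dots> \<le> K' * ((ln t / t) ^ 3 * \<Omega> * x)" using K'(3) l1 \<Omega> that by (intro mult_right_mono mult_nonneg_nonneg) auto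
   finally show ?thesis by (simp add: mult.assoc)
  qed
  have "\<bar>mu \<omega> t y\<bar> \<le> 8 * r ^ 3 * (\<Omega> * K)"
   by (rule mb(1)) (use h K(2)[OF t] in auto)
  then show "\<bar>mu \<omega> t y\<bar> \<le> K' * (ln t / t) ^ 3 * \<Omega>" using k[of 1] by simp
  have "\<bar>mu \<omega> t y - mu \<omega> t y'\<bar> \<le> 8 * r ^ 3 * (\<Omega> * (K * (ln t)^2)) * norm (y - y')"
   by (rule mb(2)) (use h K(2)[OF t] in auto)
  also have "\<dots> \<le> K' * (ln t / t) ^ 3 * \<Omega> * (ln t)^2 * norm (y - y')" using k[of "(ln t)^2"] by (intro mult_right_mono) auto
  finally show "\<bar>mu \<omega> t y - mu \<omega> t y'\<bar> \<le> K' * (ln t / t) ^ 3 * \<Omega> * (ln t)^2 * norm (y - y')" .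
  have "\<bar>mu \<omega> t (y + a + b) - mu \<omega> t (y + a) - mu \<omega> t (y + b) + mu \<omega> t y\<bar> \<le> 8 * r ^ 3 * (\<Omega> * (K * (ln t) ^ 4)) * norm a * norm b"
   by (rule mb(3)) (use h K(2)[OF t] in auto)
  also have "\<dots> \<le> K' * (ln t / t) ^ 3 * \<Omega> * (ln t) ^ 4 * norm a * norm b" using k[of "(ln t) ^ 4"] l1 by (intro mult_right_mono) auto
  finally show "\<bar>mu \<omega> t (y + a + b) - mu \<omega> t (y + a) - mu \<omega> t (y + b) + mu \<omega> t y\<bar> \<le> K' * (ln t / t) ^ 3 * \<Omega> * (ln t) ^ 4 * norm a * norm b" .
 qed
qed

lemma Iw_has_integral: "continuous_on UNIV \<eta> \<Longrightarrow> 0 \<le> t \<Longrightarrow> ((\<lambda>p. \<eta> p * g t x p) has_integral Iw \<eta> t x) UNIV"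
 unfolding Iw_def using cs_integrable[OF cs_Iw] by (simp add: integrable_integral)

definition vc :: "3 \<Rightarrow> vec3 \<Rightarrow> real" where "vc i p = vel m p $ i"

lemma vc_cont: "continuous_on UNIV (vc i)"
 unfolding vc_def[abs_def] by (intro continuous_intros continuous_vel)

text \<open>The first moment centred at the ray velocity \<open>y\<close>. On the support the
  deviation from \<open>y\<close> is O(ln t / t), and each centred factor gains that much over the
  plain density.\<close>

definition V1 :: "3 \<Rightarrow> real \<Rightarrow> vec3 \<Rightarrow> real" where
 "V1 i t y = Iw (vc i) t (t *\<^sub>R y) - y $ i * Iw (\<lambda>_. 1) t (t *\<^sub>R y)"

definition V2 :: "3 \<Rightarrow> 3 \<Rightarrow> real \<Rightarrow> vec3 \<Rightarrow> real" where
 "V2 i j t y = Iw (\<lambda>p. vc i p * vc j p) t (t *\<^sub>R y) - y $ i * Iw (vc j) t (t *\<^sub>R y) - y $ j * Iw (vc i) t (t *\<^sub>R y)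
  + y $ i * (y $ j * Iw (\<lambda>_. 1) t (t *\<^sub>R y))"

lemma V1_mu: assumes t: "0 \<le> t" shows "V1 i t = mu (\<lambda>u. u $ i) t"
proof
 fix y
 have "((\<lambda>p. vc i p * g t (t *\<^sub>R y) p - y $ i * (1 * g t (t *\<^sub>R y) p)) has_integral V1 i t y) UNIV"
  unfolding V1_def by (intro has_integral_diff has_integral_mult_right Iw_has_integral vc_cont continuous_on_const t)
 moreover have "(\<lambda>p. vc i p * g t (t *\<^sub>R y) p - y $ i * (1 * g t (t *\<^sub>R y) p)) = (\<lambda>p. (vel m p - y) $ i * g t (t *\<^sub>R y) p)"
  by (auto simp: vc_def algebra_simps)
 ultimately have "V1 i t y = Iw (\<lambda>p. (vel m p - y) $ i) t (t *\<^sub>R y)" by (simp add: Iw_def integral_unique)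
 also have "\<dots> = mu (\<lambda>u. u $ i) t y"
  by (rule mu_eq_Iw[symmetric, OF t, of "\<lambda>u. u $ i"]) (intro continuous_intros)
 finally show "V1 i t y = mu (\<lambda>u. u $ i) t y" .
qed

lemma V2_mu: assumes t: "0 \<le> t" shows "V2 i j t = mu (\<lambda>u. u $ i * u $ j) t"
proof
 fix y
 have "((\<lambda>p. (vc i p * vc j p) * g t (t *\<^sub>R y) p - y $ i * (vc j p * g t (t *\<^sub>R y) p) - y $ j * (vc i p * g t (t *\<^sub>R y) p)
  + y $ i * (y $ j * (1 * g t (t *\<^sub>R y) p))) has_integral V2 i j t y) UNIV"
  unfolding V2_def by (intro has_integral_diff has_integral_add has_integral_mult_right Iw_has_integral vc_cont continuous_intros t)
 moreover have "(\<lambda>p. (vc i p * vc j p) * g t (t *\<^sub>R y) p - y $ i * (vc j p * g t (t *\<^sub>R y) p) - y $ j * (vc i p * g t (t *\<^sub>R y) p)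
  + y $ i * (y $ j * (1 * g t (t *\<^sub>R y) p))) = (\<lambda>p. ((vel m p - y) $ i * (vel m p - y) $ j) * g t (t *\<^sub>R y) p)"
  by (auto simp: vc_def algebra_simps)
 ultimately have "V2 i j t y = Iw (\<lambda>p. (vel m p - y) $ i * (vel m p - y) $ j) t (t *\<^sub>R y)" by (simp add: Iw_def integral_unique)
 also have "\<dots> = mu (\<lambda>u. u $ i * u $ j) t y"
  by (rule mu_eq_Iw[symmetric, OF t, of "\<lambda>u. u $ i * u $ j"]) (intro continuous_intros)
 finally show "V2 i j t y = mu (\<lambda>u. u $ i * u $ j) t y" .
qed

lemma V0_mu: assumes t: "0 \<le> t" shows "Iw (\<lambda>_. 1) t (t *\<^sub>R y) = mu (\<lambda>_. 1) t y"
 by (rule mu_eq_Iw[symmetric, OF t, of "\<lambda>_. 1"]) (intro continuous_intros)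

definition qI :: "(vec3 \<Rightarrow> real) \<Rightarrow> real \<Rightarrow> vec3 \<Rightarrow> vec3 \<Rightarrow> real" where
 "qI \<eta> t y k = dIw \<eta> t (t *\<^sub>R y) (0, t *\<^sub>R k)"

lemma qI_deriv: assumes "continuous_on UNIV \<eta>" "0 < t"
 shows "((\<lambda>y. Iw \<eta> t (t *\<^sub>R y)) has_derivative qI \<eta> t y) (at y)"
proof -
 have "((\<lambda>y. t *\<^sub>R y) has_derivative (\<lambda>k. t *\<^sub>R k)) (at y)" by (auto intro!: derivative_eq_intros)
 from has_derivative_compose[OF this Iw_deriv_x[OF assms]] show ?thesis by (simp add: qI_def[abs_def])
qed

lemma nth_deriv: "((\<lambda>y::vec3. y $ i) has_derivative (\<lambda>k. k $ i)) (at y)"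
 by (rule bounded_linear_imp_has_derivative[OF bounded_linear_vec_nth])

definition dV1 :: "3 \<Rightarrow> real \<Rightarrow> vec3 \<Rightarrow> vec3 \<Rightarrow> real" where
 "dV1 i t y k = qI (vc i) t y k - (y $ i * qI (\<lambda>_. 1) t y k + k $ i * Iw (\<lambda>_. 1) t (t *\<^sub>R y))"

lemma V1_deriv: assumes "0 < t" shows "(V1 i t has_derivative dV1 i t y) (at y)"
 unfolding V1_def[abs_def] dV1_def[abs_def]
 by (intro has_derivative_diff has_derivative_mult nth_deriv qI_deriv vc_cont continuous_on_const assms)

definition dV2 :: "3 \<Rightarrow> 3 \<Rightarrow> real \<Rightarrow> vec3 \<Rightarrow> vec3 \<Rightarrow> real" where
 "dV2 i j t y k = qI (\<lambda>p. vc i p * vc j p) t y k - (y $ i * qI (vc j) t y k + k $ i * Iw (vc j) t (t *\<^sub>R y))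
  - (y $ j * qI (vc i) t y k + k $ j * Iw (vc i) t (t *\<^sub>R y))
  + (y $ i * (y $ j * qI (\<lambda>_. 1) t y k + k $ j * Iw (\<lambda>_. 1) t (t *\<^sub>R y)) + k $ i * (y $ j * Iw (\<lambda>_. 1) t (t *\<^sub>R y)))"

lemma V2_deriv: assumes "0 < t" shows "(V2 i j t has_derivative dV2 i j t y) (at y)"
 unfolding V2_def[abs_def] dV2_def[abs_def]
 by (intro has_derivative_diff has_derivative_add has_derivative_mult nth_deriv qI_deriv vc_cont continuous_intros assms)

definition hd :: "real \<Rightarrow> vec3 \<Rightarrow> real" where
 "hd t y = 3 * t^2 * Iw (\<lambda>_. 1) t (t *\<^sub>R y) + t ^ 3 * dIw (\<lambda>_. 1) t (t *\<^sub>R y) (1, y)"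

lemma hd_deriv: assumes "0 < t"
 shows "((\<lambda>t. t ^ 3 * Iw (\<lambda>_. 1) t (t *\<^sub>R y)) has_real_derivative hd t y) (at t)"
proof -
 note c1 = continuous_on_const[of UNIV "1::real"]
 have "((\<lambda>t. (t, t *\<^sub>R y)) has_derivative (\<lambda>h. (h, h *\<^sub>R y))) (at t)" by (intro has_derivative_Pair) (auto intro!: derivative_eq_intros)
 from has_derivative_compose[OF this Iw_deriv[OF c1 assms]]
 have d: "((\<lambda>t. Iw (\<lambda>_. 1) t (t *\<^sub>R y)) has_derivative (\<lambda>h. dIw (\<lambda>_. 1) t (t *\<^sub>R y) (h, h *\<^sub>R y))) (at t)" by simp
 have "(\<lambda>h. dIw (\<lambda>_. 1) t (t *\<^sub>R y) (h, h *\<^sub>R y)) = (*) (dIw (\<lambda>_. 1) t (t *\<^sub>R y) (1, y))"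
 proof
  fix h :: real
  have "(h, h *\<^sub>R y) = h *\<^sub>R (1, y)" by simp
  then show "dIw (\<lambda>_. 1) t (t *\<^sub>R y) (h, h *\<^sub>R y) = dIw (\<lambda>_. 1) t (t *\<^sub>R y) (1, y) * h"
   using linear_cmul[OF dIw_linear[OF c1 assms, of "t *\<^sub>R y"], of h "(1, y)"] by (simp only: real_scaleR_def mult.commute)
 qed
 with d have D: "((\<lambda>t. Iw (\<lambda>_. 1) t (t *\<^sub>R y)) has_real_derivative dIw (\<lambda>_. 1) t (t *\<^sub>R y) (1, y)) (at t)"
  by (simp only: has_field_derivative_def)
 have "((\<lambda>t. t ^ 3) has_real_derivative 3 * t^2) (at t)" by (auto intro!: derivative_eq_intros)
 from DERIV_mult[OF this D] show ?thesis by (simp add: hd_def mult_ac)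
qed

lemma vel_has_deriv_nth: "(vc i has_derivative (\<lambda>h. dvel m p h $ i)) (at p)"
 unfolding vc_def[abs_def] by (rule bounded_linear.has_derivative[OF bounded_linear_vec_nth vel_has_derivative[OF m]])

text \<open>Let n be the density moment and j the velocity moment. The continuity equation reads
  dn/dt = - div j, and the divergence in y of j - y n, taken at x = t y, is t div j - t y . grad n -
  3 n. Up to the factor - t^2 this is the time derivative of t^3 n along the ray, so only the
  centred moment survives.\<close>

lemma hd_eq_divergence: assumes t: "0 < t" shows "hd t y = - (t^2 * (\<Sum>i\<in>UNIV. dV1 i t y (axis i 1)))"
proof -
 note c1 = continuous_on_const[of UNIV "1::real"]
 let ?x = "t *\<^sub>R y"
 have l: "linear (dIw \<eta> t ?x)" if "continuous_on UNIV \<eta>" for \<eta> by (rule dIw_linear[OF that t])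
 have qIt: "qI \<eta> t y k = t * dIw \<eta> t ?x (0, k)" if "continuous_on UNIV \<eta>" for \<eta> k
  using linear_cmul[OF l[OF that], of t "(0, k)"] by (simp add: qI_def)
 have tm: "dIw (\<lambda>_. 1) t ?x (1, 0) = - (\<Sum>i\<in>UNIV. dIw (vc i) t ?x (0, axis i 1))"
  using dIw_time[OF C1_on_const has_derivative_const t, of "1::real" ?x] by (simp add: vc_def[abs_def])
 have q0: "dIw (\<lambda>_. 1) t ?x (0, y) = (\<Sum>i\<in>UNIV. y $ i * dIw (\<lambda>_. 1) t ?x (0, axis i 1))"
 proof -
  have "(0::real, y) = (\<Sum>i\<in>UNIV. (y $ i) *\<^sub>R (0, axis i 1))"
   by (subst vec3_basis_expansion[of y]) (simp add: sum_3)
  then show ?thesis by (simp only: linear_sum[OF l[OF c1]] linear_cmul[OF l[OF c1]] real_scaleR_def)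
 qed
 have "dIw (\<lambda>_. 1) t ?x (1, y) = dIw (\<lambda>_. 1) t ?x (1, 0) + dIw (\<lambda>_. 1) t ?x (0, y)"
  using linear_add[OF l[OF c1], of "(1, 0)" "(0, y)"] by simp
 then have 1: "dIw (\<lambda>_. 1) t ?x (1, y) = (\<Sum>i\<in>UNIV. y $ i * dIw (\<lambda>_. 1) t ?x (0, axis i 1) - dIw (vc i) t ?x (0, axis i 1))"
  by (simp add: tm q0 sum_subtractf)
 have "(\<Sum>i\<in>UNIV. dV1 i t y (axis i 1)) = (\<Sum>i\<in>UNIV. t * (dIw (vc i) t ?x (0, axis i 1) - y $ i * dIw (\<lambda>_. 1) t ?x (0, axis i 1)) - Iw (\<lambda>_. 1) t ?x)"
  unfolding dV1_def by (intro sum.cong refl) (simp add: qIt[OF c1] qIt[OF vc_cont] axis_def algebra_simps)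
 also have "\<dots> = - t * dIw (\<lambda>_. 1) t ?x (1, y) - 3 * Iw (\<lambda>_. 1) t ?x"
  unfolding 1 by (simp add: sum_subtractf sum_negf sum_distrib_left right_diff_distrib)
 finally have S: "(\<Sum>i\<in>UNIV. dV1 i t y (axis i 1)) = - t * dIw (\<lambda>_. 1) t ?x (1, y) - 3 * Iw (\<lambda>_. 1) t ?x" .
 show ?thesis unfolding S hd_def by (simp add: power2_eq_square power3_eq_cube algebra_simps)
qed

text \<open>A weight of degree d in the deviation is at most (K r)^d on the support, where r = ln t
  / t, and the volume gives r^3. The gradient bounds follow from the first and second differences of
  \<open>mu\<close>, the centred moments being differentiable in \<open>y\<close>.\<close>

lemma moment_estimates:
 "\<exists>K\<ge>0. \<forall>t\<ge>3. \<forall>y y' k i j. \<bar>Iw (\<lambda>_. 1) t (t *\<^sub>R y)\<bar> \<le> K * (ln t / t) ^ 3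
  \<and> \<bar>V1 i t y\<bar> \<le> K * (ln t / t) ^ 4 \<and> \<bar>V2 i j t y\<bar> \<le> K * (ln t / t) ^ 5
  \<and> \<bar>dV1 i t y k\<bar> \<le> K * (ln t / t) ^ 4 * (ln t)^2 * norm k
  \<and> \<bar>dV2 i j t y k\<bar> \<le> K * (ln t / t) ^ 5 * (ln t)^2 * norm k
  \<and> \<bar>dV1 i t y k - dV1 i t y' k\<bar> \<le> K * (ln t / t) ^ 4 * (ln t) ^ 4 * norm k * norm (y - y')"
proof -
 obtain K where K: "0 \<le> K" "\<And>t \<omega> \<Omega> y y' a b. 3 \<le> t \<Longrightarrow> continuous_on UNIV \<omega> \<Longrightarrow> (\<And>u. norm u \<le> K * (ln t / t) \<Longrightarrow> \<bar>\<omega> u\<bar> \<le> \<Omega>) \<Longrightarrow>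
  \<bar>mu \<omega> t y\<bar> \<le> K * (ln t / t) ^ 3 * \<Omega> \<and> \<bar>mu \<omega> t y - mu \<omega> t y'\<bar> \<le> K * (ln t / t) ^ 3 * \<Omega> * (ln t)^2 * norm (y - y')
   \<and> \<bar>mu \<omega> t (y + a + b) - mu \<omega> t (y + a) - mu \<omega> t (y + b) + mu \<omega> t y\<bar> \<le> K * (ln t / t) ^ 3 * \<Omega> * (ln t) ^ 4 * norm a * norm b"
  using mu_bounds by blast
 define K' where "K' = K + K^2 + K ^ 3"
 have K': "0 \<le> K'" "K \<le> K'" "K^2 \<le> K'" "K ^ 3 \<le> K'" using K(1) by (auto simp: K'_def)
 show ?thesis
 proof (intro exI[of _ K'] conjI allI impI K'(1))
  fix t :: real and y y' k :: vec3 and i j :: 3 assume t: "3 \<le> t"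
  define r where "r = ln t / t"
  have t0: "0 < t" "0 \<le> t" using t by auto
  have r: "0 \<le> r" "0 \<le> ln t" using t ln_ge_1[OF t] by (auto simp: r_def)
  have c: "\<bar>u $ i\<bar> \<le> norm u" for u :: vec3 and i by (rule component_le_norm_cart)
  have o1: "\<bar>u $ i\<bar> \<le> K * r" if "norm u \<le> K * (ln t / t)" for u :: vec3 and i
   using c[of u i] that unfolding r_def by linarith
  have o2: "\<bar>u $ i * u $ j\<bar> \<le> (K * r) * (K * r)" if "norm u \<le> K * (ln t / t)" for u :: vec3
   unfolding abs_mult using o1[OF that] K(1) r by (intro mult_mono) auto
  have m1: "continuous_on UNIV (\<lambda>u::vec3. u $ i)" for i by (intro continuous_intros)
  have m2: "continuous_on UNIV (\<lambda>u::vec3. u $ i * u $ j)" by (intro continuous_intros)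
  note B0 = K(2)[OF t continuous_on_const[of UNIV "1::real"], of 1, folded r_def]
  note B1 = K(2)[OF t m1 o1, folded r_def]
  note B2 = K(2)[OF t m2 o2, folded r_def]
  have le: "c * x \<le> K' * x" if "c \<le> K'" "0 \<le> x" for c x using that by (rule mult_right_mono)
  have "\<bar>mu (\<lambda>_. 1) t y\<bar> \<le> K * r ^ 3" using B0 by auto
  also have "\<dots> \<le> K' * r ^ 3" using K'(2) r by (intro le) auto
  finally show "\<bar>Iw (\<lambda>_. 1) t (t *\<^sub>R y)\<bar> \<le> K' * (ln t / t) ^ 3" by (simp add: V0_mu[OF t0(2)] r_def)
  have "\<bar>V1 i t y\<bar> \<le> K * r ^ 3 * (K * r)" using B1[of i] by (auto simp: V1_mu[OF t0(2)])
  also have "\<dots> = K^2 * r ^ 4" by (simp add: power2_eq_square eval_nat_numeral)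
  also have "\<dots> \<le> K' * r ^ 4" using K'(3) r by (intro le) auto
  finally show "\<bar>V1 i t y\<bar> \<le> K' * (ln t / t) ^ 4" by (simp add: r_def)
  have "\<bar>V2 i j t y\<bar> \<le> K * r ^ 3 * ((K * r) * (K * r))" using B2 by (auto simp: V2_mu[OF t0(2)])
  also have "\<dots> = K ^ 3 * r ^ 5" by (simp add: eval_nat_numeral)
  also have "\<dots> \<le> K' * r ^ 5" using K'(4) r by (intro le) auto
  finally show "\<bar>V2 i j t y\<bar> \<le> K' * (ln t / t) ^ 5" by (simp add: r_def)
  have "norm (dV1 i t y k) \<le> (K * r ^ 3 * (K * r) * (ln t)^2) * norm k"
   by (rule derivative_bound_of_lipschitz[OF V1_deriv[OF t0(1)]]) (use B1[of i] in \<open>simp add: V1_mu[OF t0(2)]\<close>)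
  also have "\<dots> = K^2 * (r ^ 4 * (ln t)^2 * norm k)" by (simp add: power2_eq_square eval_nat_numeral)
  also have "\<dots> \<le> K' * (r ^ 4 * (ln t)^2 * norm k)" using K'(3) r by (intro le) auto
  finally show "\<bar>dV1 i t y k\<bar> \<le> K' * (ln t / t) ^ 4 * (ln t)^2 * norm k" by (simp add: r_def mult.assoc)
  have "norm (dV2 i j t y k) \<le> (K * r ^ 3 * ((K * r) * (K * r)) * (ln t)^2) * norm k"
   by (rule derivative_bound_of_lipschitz[OF V2_deriv[OF t0(1)]]) (use B2 in \<open>simp add: V2_mu[OF t0(2)]\<close>)
  also have "\<dots> = K ^ 3 * (r ^ 5 * (ln t)^2 * norm k)" by (simp add: eval_nat_numeral)
  also have "\<dots> \<le> K' * (r ^ 5 * (ln t)^2 * norm k)" using K'(4) r by (intro le) auto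
  finally show "\<bar>dV2 i j t y k\<bar> \<le> K' * (ln t / t) ^ 5 * (ln t)^2 * norm k" by (simp add: r_def mult.assoc)
  have "\<bar>dV1 i t y k - dV1 i t y' k\<bar> \<le> (K * r ^ 3 * (K * r) * (ln t) ^ 4) * norm k * norm (y - y')"
   by (rule derivative_diff_bound[where f = "V1 i t", OF V1_deriv[OF t0(1)]]) (use B1[of i] in \<open>simp add: V1_mu[OF t0(2)]\<close>)
  also have "\<dots> = K^2 * (r ^ 4 * (ln t) ^ 4 * norm k * norm (y - y'))" by (simp add: power2_eq_square eval_nat_numeral)
  also have "\<dots> \<le> K' * (r ^ 4 * (ln t) ^ 4 * norm k * norm (y - y'))" using K'(3) r by (intro le) auto
  finally show "\<bar>dV1 i t y k - dV1 i t y' k\<bar> \<le> K' * (ln t / t) ^ 4 * (ln t) ^ 4 * norm k * norm (y - y')" by (simp add: r_def mult.assoc)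
 qed
qed

lemma hd_estimates:
 "\<exists>K\<ge>0. \<forall>t\<ge>3. \<forall>y y'. \<bar>hd t y\<bar> \<le> K * ((ln t) ^ 6 / t^2) \<and> \<bar>hd t y - hd t y'\<bar> \<le> K * ((ln t) ^ 8 / t^2) * norm (y - y')"
proof -
 obtain K where K: "0 \<le> K" "\<And>t y y' k i. 3 \<le> t \<Longrightarrow> \<bar>dV1 i t y k\<bar> \<le> K * (ln t / t) ^ 4 * (ln t)^2 * norm k
  \<and> \<bar>dV1 i t y k - dV1 i t y' k\<bar> \<le> K * (ln t / t) ^ 4 * (ln t) ^ 4 * norm k * norm (y - y')"
  using moment_estimates by meson
 show ?thesis
 proof (intro exI[of _ "3 * K"] conjI allI impI)
  fix t :: real and y y' :: vec3 assume t: "3 \<le> t"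
  then have t0: "0 < t" by simp
  have "\<bar>\<Sum>i\<in>UNIV. dV1 i t y (axis i 1)\<bar> \<le> (\<Sum>i\<in>(UNIV::3 set). K * (ln t / t) ^ 4 * (ln t)^2)"
   using K(2)[OF t, of _ y "axis _ 1"] by (intro order_trans[OF sum_abs] sum_mono) (auto simp: norm_axis_1)
  then have "t^2 * \<bar>\<Sum>i\<in>UNIV. dV1 i t y (axis i 1)\<bar> \<le> t^2 * (3 * (K * (ln t / t) ^ 4 * (ln t)^2))"
   by (intro mult_left_mono) auto
  also have "\<dots> = 3 * K * ((ln t) ^ 6 / t^2)" using t0 by (simp add: power_divide eval_nat_numeral)
  finally show "\<bar>hd t y\<bar> \<le> 3 * K * ((ln t) ^ 6 / t^2)" by (simp add: hd_eq_divergence[OF t0] abs_mult)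
  have "hd t y - hd t y' = - (t^2 * (\<Sum>i\<in>UNIV. dV1 i t y (axis i 1) - dV1 i t y' (axis i 1)))"
   by (simp add: hd_eq_divergence[OF t0] sum_subtractf algebra_simps)
  then have e: "\<bar>hd t y - hd t y'\<bar> = t^2 * \<bar>\<Sum>i\<in>UNIV. dV1 i t y (axis i 1) - dV1 i t y' (axis i 1)\<bar>" by (simp add: abs_mult)
  have "\<bar>\<Sum>i\<in>UNIV. dV1 i t y (axis i 1) - dV1 i t y' (axis i 1)\<bar> \<le> (\<Sum>i\<in>(UNIV::3 set). K * (ln t / t) ^ 4 * (ln t) ^ 4 * norm (y - y'))"
   using K(2)[OF t, of _ y "axis _ 1" y'] by (intro order_trans[OF sum_abs] sum_mono) (auto simp: norm_axis_1)
  then have "t^2 * \<bar>\<Sum>i\<in>UNIV. dV1 i t y (axis i 1) - dV1 i t y' (axis i 1)\<bar> \<le> t^2 * (3 * (K * (ln t / t) ^ 4 * (ln t) ^ 4 * norm (y - y')))"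
   by (intro mult_left_mono) auto
  also have "\<dots> = 3 * K * ((ln t) ^ 8 / t^2) * norm (y - y')" using t0 by (simp add: power_divide eval_nat_numeral)
  finally show "\<bar>hd t y - hd t y'\<bar> \<le> 3 * K * ((ln t) ^ 8 / t^2) * norm (y - y')" unfolding e .
 qed (use K(1) in simp)
qed

lemma g_x_support: assumes "0 \<le> t" "L + \<gamma> * t < norm x" shows "g t x p = 0"
proof (rule ccontr)
 assume "g t x p \<noteq> 0"
 then obtain X P where "orb t x p X P" using orb_exists[OF assms(1)] by blast
 from orbD(3)[OF this, of t] orbD(6)[OF this] assms show False by simp
qed

lemma Iw_zero: assumes "0 \<le> t" "L + \<gamma> * t < norm x" shows "Iw \<eta> t x = 0"
 unfolding Iw_def using g_x_support[OF assms] by simp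

lemma dIw_zero: assumes "0 < t" "L + \<gamma> * t < norm x" "continuous_on UNIV \<eta>" shows "dIw \<eta> t x h = 0"
proof -
 have op: "open {z::real \<times> vec3. 0 < fst z \<and> L + \<gamma> * fst z < norm (snd z)}"
  by (intro open_Collect_conj open_Collect_less continuous_intros)
 have "((\<lambda>z. Iw \<eta> (fst z) (snd z)) has_derivative (\<lambda>_. 0)) (at (t, x))"
  by (rule has_derivative_transform_within_open[OF has_derivative_const[of 0] op]) (use assms Iw_zero in auto)
 from has_derivative_unique[OF Iw_deriv[OF assms(3,1)] this] show ?thesis by simp
qed

text \<open>The density per unit of velocity, integrated over space. Weighted with the charges and
  summed over the species it tends to \<open>rho_inf\<close>.\<close>

definition dens :: "real \<Rightarrow> vec3 \<Rightarrow> real" where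
 "dens t y = (if norm y < 1 then Djac m (vel_inv m y) * integral UNIV (\<lambda>x. g t x (vel_inv m y)) else 0)"

text \<open>Substitution x = t (y - u) at fixed velocity \<open>y\<close>, with Jacobian
  t^3.\<close>

lemma dens_kap: assumes t: "0 < t" shows "dens t y = t ^ 3 * integral UNIV (\<lambda>u. kap t u y)"
proof (cases "norm y < 1")
 case True
 define p where "p = vel_inv m y"
 have D: "Djac m p = m ^ 3 * lor y ^ 5" using Djac_eq[OF m, of p] vel_vel_inv[OF m True] by (simp add: p_def)
 have "cs (L + \<gamma> * t) (\<lambda>x. g t x p)"
  unfolding cs_def using g_x_support[of t] t by (auto intro!: continuous_g continuous_intros)
 from cs_affine[OF this, of "- t" "t *\<^sub>R y"] t
 have "integral UNIV (\<lambda>u. g t (- (t *\<^sub>R u) + t *\<^sub>R y) p) = 1 / t ^ 3 * integral UNIV (\<lambda>x. g t x p)" by simp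
 then have "integral UNIV (\<lambda>x. g t x p) = t ^ 3 * integral UNIV (\<lambda>u. g t (- (t *\<^sub>R u) + t *\<^sub>R y) p)" using t by simp
 moreover have "kap t u y = Djac m p * g t (- (t *\<^sub>R u) + t *\<^sub>R y) p" for u
  using True by (simp add: kap_def psi_def gv_def D[unfolded p_def] p_def)
 ultimately show ?thesis using True by (simp add: dens_def p_def)
next
 case False
 then have "kap t u y = 0" for u by (simp add: kap_def psi_def)
 then show ?thesis using False by (simp add: dens_def)
qed

text \<open>Both quantities are t^3 times an integral of \<open>kap t u\<close> over |u| <= r = O(ln
  t / t), one at velocity y + u and the other at y. Exchanging them costs the Lipschitz constant (ln
  t)^2 times r, in total t^3 r^4 (ln t)^2.\<close>

lemma dens_limit:
 "\<exists>K\<ge>0. \<forall>t\<ge>3. \<forall>y. \<bar>t ^ 3 * Iw (\<lambda>_. 1) t (t *\<^sub>R y) - dens t y\<bar> \<le> K * ((ln t) ^ 6 / t)"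
proof -
 obtain K where K: "0 \<le> K" "\<And>t u w w'. 3 \<le> t \<Longrightarrow> (kap t u w \<noteq> 0 \<longrightarrow> norm u \<le> K * (ln t / t))
  \<and> \<bar>kap t u w - kap t u w'\<bar> \<le> K * (ln t)^2 * norm (w - w')"
  using kap_bounds by meson
 show ?thesis
 proof (intro exI[of _ "8 * K ^ 5"] conjI allI impI)
  fix t :: real and y :: vec3 assume t: "3 \<le> t"
  then have t0: "0 < t" "0 \<le> t" by auto
  define r where "r = K * (ln t / t)"
  have l: "0 \<le> ln t" using t by simp
  have r: "0 \<le> r" unfolding r_def using K(1) t0 l by (intro mult_nonneg_nonneg divide_nonneg_nonneg) auto
  have z: "kap t u w = 0" if "r < norm u" for u w using K(2)[OF t] that unfolding r_def by force
  have cs1: "cs r (\<lambda>u. kap t u (y + u))" "cs r (\<lambda>u. kap t u y)" unfolding cs_def using z kap_cont[OF t0(2)] by auto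
  have cs2: "cs r (\<lambda>u. kap t u (y + u) - kap t u y)" using cs1 by (auto simp: cs_def intro!: continuous_intros)
  have "norm (integral UNIV (\<lambda>u. kap t u (y + u) - kap t u y)) \<le> 8 * r ^ 3 * (K * (ln t)^2 * r)"
  proof (rule cs_bound[OF cs2 r])
   fix u :: vec3 assume u: "norm u \<le> r"
   have "\<bar>kap t u (y + u) - kap t u y\<bar> \<le> K * (ln t)^2 * norm u" using K(2)[OF t, of u "y + u" y] by simp
   also have "\<dots> \<le> K * (ln t)^2 * r" using u K(1) by (intro mult_left_mono) auto
   finally show "norm (kap t u (y + u) - kap t u y) \<le> K * (ln t)^2 * r" by simp
  qed
  moreover have "integral UNIV (\<lambda>u. kap t u (y + u) - kap t u y) = mu (\<lambda>_. 1) t y - integral UNIV (\<lambda>u. kap t u y)"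
   unfolding mu_def using integral_diff[OF cs_integrable[OF cs1(1)] cs_integrable[OF cs1(2)]] by simp
  ultimately have "t ^ 3 * \<bar>mu (\<lambda>_. 1) t y - integral UNIV (\<lambda>u. kap t u y)\<bar> \<le> t ^ 3 * (8 * r ^ 3 * (K * (ln t)^2 * r))"
   using t0 by (intro mult_left_mono) auto
  also have "\<dots> = 8 * K ^ 5 * ((ln t) ^ 6 / t)" using t0 by (simp add: r_def power_divide power_mult_distrib eval_nat_numeral)
  finally have "\<bar>t ^ 3 * (mu (\<lambda>_. 1) t y - integral UNIV (\<lambda>u. kap t u y))\<bar> \<le> 8 * K ^ 5 * ((ln t) ^ 6 / t)"
   using t0 by (simp add: abs_mult)
  then show "\<bar>t ^ 3 * Iw (\<lambda>_. 1) t (t *\<^sub>R y) - dens t y\<bar> \<le> 8 * K ^ 5 * ((ln t) ^ 6 / t)"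
   by (simp add: V0_mu[OF t0(2)] dens_kap[OF t0(1)] right_diff_distrib)
 qed (use K(1) in simp)
qed

lemma vc_C1: "C1_on UNIV (vc i)"
 unfolding vc_def[abs_def] by (intro C1_on_blinear_compose[OF bounded_linear_vec_nth] C1_on_vel m)

definition frc :: "3 \<Rightarrow> real \<Rightarrow> vec3 \<Rightarrow> real" where
 "frc j t x = integral UNIV (\<lambda>p. dvel m p (force t x p) $ j * g t x p)"

lemma dIw_time_vc: assumes "0 < t"
 shows "dIw (vc j) t x (1, 0) = - (\<Sum>i\<in>UNIV. dIw (\<lambda>p. vc j p * vc i p) t x (0, axis i 1)) + frc j t x"
 using dIw_time[OF vc_C1 vel_has_deriv_nth assms, of j x] by (simp add: vc_def[abs_def] frc_def)

text \<open>A force of size t^(-2) acts on a density of size (ln t / t)^3. The product t^(-5) (ln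
  t)^3 is small enough without any cancellation between species.\<close>

lemma frc_bound: "\<exists>K\<ge>0. \<forall>t\<ge>3. \<forall>x j. \<bar>frc j t x\<bar> \<le> K * (1 / t^2 * (ln t / t) ^ 3)"
proof -
 obtain K where K: "0 \<le> K" "\<And>t y. 3 \<le> t \<Longrightarrow> \<bar>Iw (\<lambda>_. 1) t (t *\<^sub>R y)\<bar> \<le> K * (ln t / t) ^ 3"
  using moment_estimates by meson
 define c where "c = 2 / m * (\<bar>q\<bar> * (2 * K0 / aper))"
 have c: "0 \<le> c" using m K0 aper(1) by (simp add: c_def)
 show ?thesis
 proof (intro exI[of _ "c * K"] conjI allI impI)
  fix t :: real and x :: vec3 and j :: 3 assume t: "3 \<le> t"
  then have t0: "0 < t" "0 \<le> t" by auto
  show "\<bar>frc j t x\<bar> \<le> c * K * (1 / t^2 * (ln t / t) ^ 3)"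
  proof (cases "norm x \<le> L + \<gamma> * t")
   case False
   then have "frc j t x = 0" using g_x_support[OF t0(2), of x] by (simp add: frc_def)
   then show ?thesis using c K(1) t0 t by (simp add: )
  next
   case True
   have f: "norm (force t x p) \<le> \<bar>q\<bar> * ((2 * K0 / aper) / t^2)" for p
   proof -
    have "norm (cross3 (vel m p) (B t x)) \<le> 1 * norm (B t x)"
     by (rule order_trans[OF norm_cross3_le mult_right_mono]) (use norm_vel_less_1[OF m, of p] in auto)
    then have "norm (E t x + cross3 (vel m p) (B t x)) \<le> norm (E t x) + norm (B t x)" by (intro norm_triangle_le) simp
    also have "\<dots> \<le> (2 * K0 / aper) / (t + 2)^2" by (rule field_decay[OF t0(2) True])
    also have "\<dots> \<le> (2 * K0 / aper) / t^2"
     using K0 aper(1) t0 by (intro divide_left_mono power_mono) auto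
    finally have "norm (E t x + cross3 (vel m p) (B t x)) \<le> (2 * K0 / aper) / t^2" .
    from mult_left_mono[OF this, of "\<bar>q\<bar>"] show ?thesis by (simp add: force_def)
   qed
   have pt: "norm (dvel m p (force t x p) $ j * g t x p) \<le> c / t^2 * (1 * g t x p)" for p
   proof -
    have "\<bar>dvel m p (force t x p) $ j\<bar> \<le> norm (dvel m p (force t x p))" by (rule component_le_norm_cart)
    also have "\<dots> \<le> 2 / m * norm (force t x p)" by (rule norm_dvel[OF m])
    also have "\<dots> \<le> 2 / m * (\<bar>q\<bar> * ((2 * K0 / aper) / t^2))" using f[of p] m by (intro mult_left_mono) auto
    also have "\<dots> = c / t^2" by (simp add: c_def)
    finally have "\<bar>dvel m p (force t x p) $ j\<bar> * g t x p \<le> c / t^2 * g t x p" using g_nonneg[OF t0(2)] by (intro mult_right_mono)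
    then show ?thesis using g_nonneg[OF t0(2), of x p] by (simp add: abs_mult)
   qed
   have cf: "continuous_on UNIV (force t x)"
    unfolding force_def[abs_def] by (intro continuous_intros continuous_vel bounded_bilinear.continuous_on[OF bounded_bilinear_cross3])
   have cd: "continuous_on UNIV (\<lambda>p. dvel m p (force t x p) $ j)"
    unfolding dvel_def vrad_def by (intro continuous_intros cf continuous_vel) (use m in \<open>auto simp: add_pos_nonneg less_imp_neq[symmetric]\<close>)
   have i1: "(\<lambda>p. dvel m p (force t x p) $ j * g t x p) integrable_on UNIV" by (rule cs_integrable[OF cs_Iw[OF cd t0(2)]])
   have i2: "((\<lambda>p. c / t^2 * (1 * g t x p)) has_integral c / t^2 * Iw (\<lambda>_. 1) t x) UNIV"
    by (intro has_integral_mult_right Iw_has_integral continuous_on_const t0)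
   have "norm (frc j t x) \<le> integral UNIV (\<lambda>p. c / t^2 * (1 * g t x p))"
    unfolding frc_def by (rule integral_norm_bound_integral[OF i1 _ pt]) (use i2 in blast)
   also have "\<dots> = c / t^2 * Iw (\<lambda>_. 1) t x" using i2 by (rule integral_unique)
   also have "\<dots> \<le> c / t^2 * (K * (ln t / t) ^ 3)"
    using K(2)[OF t, of "(1 / t) *\<^sub>R x"] c t0 by (intro mult_left_mono) auto
   finally show ?thesis by (simp add: mult_ac)
  qed
 qed (use c K(1) in simp)
qed

end

section \<open>Fields near the light cone\<close>

text \<open>Magnetic sources are included so that (E, B) and (B, -E) are both instances: in the
  second the current takes the place of \<open>k\<close> and the charge is zero. One estimate for
  \<open>U\<close> then serves both fields.\<close>

locale maxwell =
 fixes U V j k :: "real \<Rightarrow> vec3 \<Rightarrow> vec3" and \<rho> :: "real \<Rightarrow> vec3 \<Rightarrow> real" and L :: real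
 assumes L: "0 < L"
  and CU: "C1_on {z. 0 < fst z} (unc U)"
  and CV: "C1_on {z. 0 < fst z} (unc V)"
  and pde1: "\<And>t x. 0 < t \<Longrightarrow> dt U t x = curl V t x - j t x"
  and pde2: "\<And>t x. 0 < t \<Longrightarrow> dt V t x = - curl U t x - k t x"
  and pde3: "\<And>t x. 0 < t \<Longrightarrow> div3 U t x = \<rho> t x"
  and vanishU: "\<And>t x. 0 < t \<Longrightarrow> t + L < norm x \<Longrightarrow> U t x = 0"
  and vanishV: "\<And>t x. 0 < t \<Longrightarrow> t + L < norm x \<Longrightarrow> V t x = 0"

section \<open>Fields vanishing outside a light cone\<close>

definition C1v :: "real \<Rightarrow> (real \<Rightarrow> vec3 \<Rightarrow> vec3) \<Rightarrow> bool" where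
 "C1v L W \<longleftrightarrow> C1_on {z. 0 < fst z} (unc W) \<and> (\<forall>t x. 0 < t \<longrightarrow> t + L < norm x \<longrightarrow> W t x = 0)"

abbreviation (input) tx_deriv :: "(real \<Rightarrow> vec3 \<Rightarrow> vec3) \<Rightarrow> real \<Rightarrow> vec3 \<Rightarrow> real \<times> vec3 \<Rightarrow> vec3" where
 "tx_deriv W t x h \<equiv> fst h *\<^sub>R dt W t x + (\<Sum>i\<in>UNIV. (snd h $ i) *\<^sub>R dx i W t x)"

lemma C1v_deriv:
 assumes "C1v L W" "0 < t"
 shows "(unc W has_derivative (tx_deriv W t x)) (at (t, x))"
proof -
 obtain D where D: "\<And>z. z \<in> {z. 0 < fst z} \<Longrightarrow> (unc W has_derivative D z) (at z within {z. 0 < fst z})"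
  by (rule C1_onE[OF conjunct1[OF assms(1)[unfolded C1v_def]]]) blast
 have op: "open {z::real \<times> vec3. 0 < fst z}" by (intro open_Collect_less continuous_intros)
 have "(unc W has_derivative D (t, x)) (at (t, x))"
  using D[of "(t, x)"] assms(2) at_within_open[OF _ op, of "(t, x)"] by simp
 then have d: "(unc W has_derivative frechet_derivative (unc W) (at (t, x))) (at (t, x))"
  by (simp only: frechet_derivative_at[symmetric])
 note l = has_derivative_linear[OF d]
 have "frechet_derivative (unc W) (at (t, x)) h = tx_deriv W t x h" for h
 proof -
  have "h = fst h *\<^sub>R (1, 0) + (\<Sum>i\<in>UNIV. (snd h $ i) *\<^sub>R (0, axis i 1))"
   by (rule prod_eqI) (subst vec3_basis_expansion[of "snd h"], simp add: sum_3)+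
  then have "frechet_derivative (unc W) (at (t, x)) h =
   frechet_derivative (unc W) (at (t, x)) (fst h *\<^sub>R (1, 0) + (\<Sum>i\<in>UNIV. (snd h $ i) *\<^sub>R (0, axis i 1)))" by simp
  also have "\<dots> = tx_deriv W t x h"
   by (simp only: linear_add[OF l] linear_sum[OF l] linear_cmul[OF l] dt_def dx_def)
  finally show ?thesis .
 qed
 then have "frechet_derivative (unc W) (at (t, x)) = (tx_deriv W t x)"
  by (rule ext)
 with d show ?thesis by simp
qed

lemma C1v_continuous:
 assumes "C1v L W"
 shows "continuous_on {z. 0 < fst z} (unc W)"
  "continuous_on {z. 0 < fst z} (unc (dt W))"
  "continuous_on {z. 0 < fst z} (unc (dx i W))"
proof -
 have C: "C1_on {z. 0 < fst z} (unc W)" using assms by (simp add: C1v_def)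
 show "continuous_on {z. 0 < fst z} (unc W)" by (rule C1_on_continuous_on[OF C])
 obtain D where D: "\<And>z. z \<in> {z. 0 < fst z} \<Longrightarrow> (unc W has_derivative D z) (at z within {z. 0 < fst z})"
  and c: "\<And>h. continuous_on {z. 0 < fst z} (\<lambda>z. D z h)"
  by (rule C1_onE[OF C]) blast
 have op: "open {z::real \<times> vec3. 0 < fst z}" by (intro open_Collect_less continuous_intros)
 have e: "frechet_derivative (unc W) (at z) = D z" if "0 < fst z" for z
 proof -
  have "(unc W has_derivative D z) (at z)"
   using D[of z] that at_within_open[OF _ op, of z] by simp
  then show ?thesis by (rule frechet_derivative_at[symmetric])
 qed
 show "continuous_on {z. 0 < fst z} (unc (dt W))"
  using c[of "(1, 0)"] by (rule continuous_on_eq) (simp add: dt_def e)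
 show "continuous_on {z. 0 < fst z} (unc (dx i W))"
  using c[of "(0, axis i 1)"] by (rule continuous_on_eq) (simp add: dx_def e)
qed

lemma C1v_vanish:
 assumes "C1v L W" "0 < t" "t + L < norm x"
 shows "W t x = 0" "dt W t x = 0" "dx i W t x = 0"
proof -
 show "W t x = 0" using assms by (simp add: C1v_def)
 have op: "open {z::real \<times> vec3. 0 < fst z \<and> fst z + L < norm (snd z)}"
  by (intro open_Collect_conj open_Collect_less continuous_intros)
 have "(unc W has_derivative (\<lambda>_. 0)) (at (t, x))"
  by (rule has_derivative_transform_within_open[OF has_derivative_const[of 0] op]) (use assms in \<open>auto simp: C1v_def\<close>)
 then have "frechet_derivative (unc W) (at (t, x)) = (\<lambda>_. 0)" by (rule frechet_derivative_at[symmetric])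
 then show "dt W t x = 0" "dx i W t x = 0" by (simp_all add: dt_def dx_def)
qed

definition Cv :: "real \<Rightarrow> (real \<Rightarrow> vec3 \<Rightarrow> 'b::real_normed_vector) \<Rightarrow> bool" where
 "Cv L W \<longleftrightarrow> continuous_on {z. 0 < fst z} (unc W) \<and> (\<forall>t x. 0 < t \<longrightarrow> t + L < norm x \<longrightarrow> W t x = 0)"

lemma C1v_Cv: assumes "C1v L W" shows "Cv L W" "Cv L (dt W)" "Cv L (dx i W)"
 using C1v_continuous[OF assms] C1v_vanish[OF assms] unfolding Cv_def by auto

text \<open>The light cone with apex \<open>(t, x0)\<close> is smoothed to the hyperboloid of radius \<open>\<epsilon>\<close>, so that retarded
 fields stay continuously differentiable at the apex.\<close>

locale cone_point =
 fixes L :: real and x0 :: vec3 and t0 \<epsilon> :: real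
 assumes L: "0 < L" and far: "norm x0 + L + 8 \<le> t0" and \<epsilon>: "0 < \<epsilon>" "\<epsilon> \<le> 1"
begin

definition s :: "vec3 \<Rightarrow> real" where "s z = sqrt (\<epsilon>^2 + (norm z)^2)"
text \<open>For |z| > R and t < t0 + 2 the retarded point \<open>x0 + z\<close> lies outside the
  support cone, because 2 |z| > t + |x0| + L. The margin in \<open>far\<close> gives R <= t0 - 3,
  which keeps the retarded times inside radius R positive.\<close>

definition R :: real where "R = (t0 + 2 + norm x0 + L) / 2"

lemma s: "0 < s z" "\<epsilon> \<le> s z" "norm z \<le> s z" "s z \<le> norm z + \<epsilon>" "(s z)^2 = \<epsilon>^2 + (norm z)^2"
proof -
 have p: "0 < \<epsilon>^2 + (norm z)^2" using \<epsilon> by (simp add: add_pos_nonneg)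
 show "0 < s z" "(s z)^2 = \<epsilon>^2 + (norm z)^2" using p by (auto simp: s_def)
 show "\<epsilon> \<le> s z" "norm z \<le> s z" by (auto simp: s_def real_le_rsqrt)
 show "s z \<le> norm z + \<epsilon>" unfolding s_def
  by (rule real_le_lsqrt) (use \<epsilon> in \<open>auto simp: power2_eq_square algebra_simps\<close>)
qed

lemma R: "R \<le> t0 - 3" "1 \<le> R"
proof -
 have "(t0 + 2 + n + L) / 2 \<le> t0 - 3 \<and> 1 \<le> (t0 + 2 + n + L) / 2" if "n + L + 8 \<le> t0" "0 \<le> n" for n
  using that L by (simp add: field_simps)
 from this[OF far norm_ge_zero] show "R \<le> t0 - 3" "1 \<le> R" unfolding R_def by blast+
qed

lemma s_C1: "C1_on S s"
proof -
 have "C1_on S (\<lambda>p. sqrt (\<epsilon>^2 + 1 * (norm p)^2))"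
 proof (rule C1_on_real_fun[OF C1_on_norm_sq, of "{0<..}" _ "\<lambda>y. 1 / (2 * sqrt y)"])
  show "(sqrt has_real_derivative 1 / (2 * sqrt y)) (at y)" if "y \<in> {0<..}" for y
   using DERIV_real_sqrt[of y] that by (simp add: inverse_eq_divide mult.commute)
 qed (use \<epsilon> in \<open>auto intro!: continuous_intros add_pos_nonneg\<close>)
 then show ?thesis by (simp add: s_def[abs_def])
qed

lemma s_cont: "continuous_on S s" by (rule C1_on_continuous_on[OF s_C1])

lemma s_deriv: "(s has_derivative (\<lambda>h. (z \<bullet> h) / s z)) (at z)"
proof -
 have "(sqrt has_real_derivative 1 / (2 * s z)) (at (\<epsilon>^2 + (norm z)^2))"
  using DERIV_real_sqrt[of "\<epsilon>^2 + (norm z)^2"] \<epsilon> by (simp add: s_def add_pos_nonneg inverse_eq_divide mult.commute)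
 from DERIV_compose_FDERIV[OF this has_derivative_add_norm_sq[of "\<epsilon>^2" z UNIV]]
 show ?thesis by (simp add: s_def[abs_def])
qed

text \<open>The default 0 applies where the retarded time is not positive. For
  \<open>t > t0 - 1\<close> that happens only beyond radius \<open>R\<close>
  (\<open>ret_cover\<close>), where the retarded field is zero anyway, so the cutoff does not spoil
  regularity.\<close>

definition ret :: "(real \<Rightarrow> vec3 \<Rightarrow> 'b::real_normed_vector) \<Rightarrow> real \<Rightarrow> vec3 \<Rightarrow> 'b" where
 "ret W t z = (if s z < t then W (t - s z) (x0 + z) else 0)"

lemma ret_zero: assumes "Cv L W" "t < t0 + 2" "R < norm z" shows "ret W t z = 0"
proof (cases "s z < t")
 case True
 have "norm z \<le> norm (x0 + z) + norm x0" using norm_triangle_ineq4[of "x0 + z" x0] by simp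
 then have "t - s z + L < norm (x0 + z)" using assms(2,3) s(3)[of z] by (simp add: R_def)
 then show ?thesis using assms(1) True by (simp add: ret_def Cv_def)
qed (simp add: ret_def)

lemma ret_cover: assumes "t0 - 1 < t" shows "s z < t \<or> R < norm z"
 using s(4)[of z] \<epsilon> R assms by linarith

lemma ret_inside: assumes "t0 - 1 < t" "norm z \<le> R" shows "s z < t" "t0 - R - 2 < t - s z"
 using s(4)[of z] \<epsilon> R assms by linarith+

lemma ret_joint_continuous:
 assumes W: "Cv L W"
 shows "continuous_on ({t0 - 1<..<t0 + 2} \<times> UNIV) (unc (ret W))"
proof -
 let ?A = "{z::real \<times> vec3. t0 - 1 < fst z \<and> fst z < t0 + 2 \<and> s (snd z) < fst z}"
 let ?B = "{z::real \<times> vec3. t0 - 1 < fst z \<and> fst z < t0 + 2 \<and> R < norm (snd z)}"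
 have sc: "continuous_on X (\<lambda>z::real \<times> vec3. s (snd z))" for X
  by (rule continuous_on_compose2[OF s_cont[of UNIV]]) (auto intro!: continuous_intros)
 have "continuous_on (?A \<union> ?B) (unc (ret W))"
 proof (rule continuous_on_open_Un)
  show "open ?A" "open ?B" by (intro open_Collect_conj open_Collect_less continuous_intros sc)+
  have "continuous_on ?A (\<lambda>z. (fst z - s (snd z), x0 + snd z))" by (intro continuous_intros sc)
  moreover have "(\<lambda>z. (fst z - s (snd z), x0 + snd z)) ` ?A \<subseteq> {z. 0 < fst z}" by auto
  moreover have "continuous_on {z. 0 < fst z} (unc W)" using W by (simp add: Cv_def)
  ultimately have "continuous_on ?A (\<lambda>z. (unc W) (fst z - s (snd z), x0 + snd z))"
   using continuous_on_compose2 by blast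
  then show "continuous_on ?A (unc (ret W))" by (rule continuous_on_eq) (simp add: ret_def)
  have "continuous_on ?B (\<lambda>z. 0::'a)" by (rule continuous_on_const)
  then show "continuous_on ?B (unc (ret W))" by (rule continuous_on_eq) (simp add: ret_zero[OF W])
 qed
 moreover have "{t0 - 1<..<t0 + 2} \<times> UNIV = ?A \<union> ?B"
 proof (rule set_eqI)
  fix z :: "real \<times> vec3"
  show "z \<in> {t0 - 1<..<t0 + 2} \<times> UNIV \<longleftrightarrow> z \<in> ?A \<union> ?B"
   using ret_cover[of "fst z" "snd z"] by (cases z) auto
 qed
 ultimately show ?thesis by simp
qed

lemma ret_cs: assumes W: "Cv L W" and t: "t0 - 1 < t" "t < t0 + 2" shows "cs R (ret W t)"
proof -
 have "continuous_on UNIV (\<lambda>z. (unc (ret W)) (t, z))"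
  by (rule continuous_on_compose2[OF ret_joint_continuous[OF W]]) (use t in \<open>auto intro!: continuous_intros\<close>)
 then show ?thesis using ret_zero[OF W t(2)] by (simp add: cs_def)
qed

lemma ret_continuous: "Cv L W \<Longrightarrow> t0 - 1 < t \<Longrightarrow> t < t0 + 2 \<Longrightarrow> continuous_on UNIV (ret W t)"
 using ret_cs unfolding cs_def by blast

text \<open>The second term is the change of the retarded time with \<open>z\<close>. It is the
  source of all the time derivatives in the integral identities.\<close>

definition dret :: "(real \<Rightarrow> vec3 \<Rightarrow> vec3) \<Rightarrow> real \<Rightarrow> vec3 \<Rightarrow> vec3 \<Rightarrow> vec3" where
 "dret W t z h = (\<Sum>i\<in>UNIV. (h $ i) *\<^sub>R ret (dx i W) t z) - ((z \<bullet> h) / s z) *\<^sub>R ret (dt W) t z"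

lemma ret_deriv:
 assumes W: "C1v L W" and t: "t0 - 1 < t" "t < t0 + 2"
 shows "(ret W t has_derivative dret W t z) (at z)"
proof (cases "s z < t")
 case True
 have op: "open {z. s z < t}" by (intro open_Collect_less continuous_intros s_cont)
 have "((\<lambda>z. (t - s z, x0 + z)) has_derivative (\<lambda>h. (- ((z \<bullet> h) / s z), h))) (at z)"
  by (intro has_derivative_Pair) (auto intro!: derivative_eq_intros s_deriv)
 moreover have "0 < t - s z" using True by simp
 note C1v_deriv[OF W this, of "x0 + z"]
 ultimately have "((\<lambda>z. (unc W) (t - s z, x0 + z)) has_derivative
  (\<lambda>h. fst (- ((z \<bullet> h) / s z), h) *\<^sub>R dt W (t - s z) (x0 + z) + (\<Sum>i\<in>UNIV. (snd (- ((z \<bullet> h) / s z), h) $ i) *\<^sub>R dx i W (t - s z) (x0 + z)))) (at z)"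
  by (rule has_derivative_compose)
 then have "((\<lambda>z. W (t - s z) (x0 + z)) has_derivative dret W t z) (at z)"
  using True by (simp add: dret_def[abs_def] ret_def algebra_simps)
 then show ?thesis by (rule has_derivative_transform_within_open[OF _ op]) (use True in \<open>auto simp: ret_def\<close>)
next
 case False
 then have z: "R < norm z" using ret_cover[OF t(1), of z] by blast
 have op: "open {z::vec3. R < norm z}" by (intro open_Collect_less continuous_intros)
 have "dret W t z = (\<lambda>h. 0)"
  using ret_zero[OF C1v_Cv(2)[OF W] t(2) z] ret_zero[OF C1v_Cv(3)[OF W] t(2) z] by (simp add: dret_def[abs_def])
 then show ?thesis
  using has_derivative_transform_within_open[OF has_derivative_const[of 0] op, of z "ret W t"] z ret_zero[OF C1v_Cv(1)[OF W] t(2)] by auto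
qed

lemma dret_axis: "dret W t z (axis i 1) = ret (dx i W) t z - (z $ i / s z) *\<^sub>R ret (dt W) t z"
proof -
 have "(\<Sum>l\<in>UNIV. (axis i 1 $ l) *\<^sub>R ret (dx l W) t z) = (\<Sum>l\<in>UNIV. if l = i then ret (dx l W) t z else 0)"
  by (intro sum.cong) (auto simp: axis_def)
 then show ?thesis by (simp add: dret_def inner_axis)
qed

lemma ret_C1: assumes W: "C1v L W" and t: "t0 - 1 < t" "t < t0 + 2" shows "C1_on UNIV (ret W t)"
proof (rule C1_onI)
 show "(ret W t has_derivative dret W t z) (at z within UNIV)" for z using ret_deriv[OF W t] by simp
 show "continuous_on UNIV (\<lambda>z. dret W t z h)" for h
  unfolding dret_def
  by (intro continuous_intros ret_continuous C1v_Cv[OF W] s_cont t) (use s(1) in \<open>auto simp: less_imp_neq[symmetric]\<close>)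
qed

lemma ret_deriv_t:
 assumes W: "C1v L W" and t: "t0 - 1 < t" "t < t0 + 2"
 shows "((\<lambda>t. ret W t z) has_vector_derivative ret (dt W) t z) (at t)"
proof (cases "s z < t")
 case True
 have "((\<lambda>t. (t - s z, x0 + z)) has_derivative (\<lambda>h. (h, 0))) (at t)"
  by (intro has_derivative_Pair) (auto intro!: derivative_eq_intros)
 moreover have "0 < t - s z" using True by simp
 note C1v_deriv[OF W this, of "x0 + z"]
 ultimately have "((\<lambda>t. (unc W) (t - s z, x0 + z)) has_derivative
  (\<lambda>h. fst (h, 0::vec3) *\<^sub>R dt W (t - s z) (x0 + z) + (\<Sum>i\<in>UNIV. (snd (h, 0::vec3) $ i) *\<^sub>R dx i W (t - s z) (x0 + z)))) (at t)"
  by (rule has_derivative_compose)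
 then have "((\<lambda>t. W (t - s z) (x0 + z)) has_derivative (\<lambda>h. h *\<^sub>R ret (dt W) t z)) (at t)"
  using True by (simp add: ret_def)
 then have "((\<lambda>t. ret W t z) has_derivative (\<lambda>h. h *\<^sub>R ret (dt W) t z)) (at t)"
  by (rule has_derivative_transform_within_open[of _ _ _ _ "{s z<..}"]) (use True in \<open>auto simp: ret_def\<close>)
 then show ?thesis by (simp add: has_vector_derivative_def)
next
 case False
 then have z: "R < norm z" using ret_cover[OF t(1), of z] by blast
 have "((\<lambda>t. ret W t z) has_derivative (\<lambda>_. 0)) (at t)"
  by (rule has_derivative_transform_within_open[OF has_derivative_const[of 0], of "{..<t0 + 2}"])
   (use t z ret_zero[OF C1v_Cv(1)[OF W]] in auto)
 moreover have "ret (dt W) t z = 0" by (rule ret_zero[OF C1v_Cv(2)[OF W] t(2) z])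
 ultimately show ?thesis by (simp add: has_vector_derivative_def)
qed

lemma power_s_deriv: "((\<lambda>z. 1 / s z ^ n) has_derivative (\<lambda>h. - real n * (z \<bullet> h) / s z ^ (n + 2))) (at z)"
proof -
 have "((\<lambda>y. 1 / y ^ n) has_real_derivative - real n / s z ^ (n + 1)) (at (s z))"
 proof (cases n)
  case (Suc l)
  have nz: "s z ^ n \<noteq> 0" using s(1)[of z] by simp
  have "((\<lambda>y. inverse (y ^ n)) has_real_derivative - (inverse (s z ^ n) * (real n * s z ^ (n - Suc 0)) * inverse (s z ^ n))) (at (s z))"
   by (rule DERIV_inverse'[OF DERIV_pow nz])
  moreover have "- (inverse (s z ^ n) * (real n * s z ^ (n - Suc 0)) * inverse (s z ^ n)) = - real n / s z ^ (n + 1)"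
  proof -
   have "inverse (b * c) * (x * c) * inverse (b * c) = x / (b * (b * c))" if "b \<noteq> 0" "c \<noteq> 0" for b c x :: real
    using that by (simp add: divide_simps)
   from this[of "s z" "s z ^ l" "real n"] have "inverse (s z ^ n) * (real n * s z ^ (n - Suc 0)) * inverse (s z ^ n) = real n / s z ^ (n + 1)"
    using s(1)[of z] by (simp add: Suc)
   then show ?thesis by (simp only: minus_divide_left)
  qed
  ultimately show ?thesis by (simp add: inverse_eq_divide)
 qed simp
 from DERIV_compose_FDERIV[OF this s_deriv]
 show ?thesis using s(1)[of z] by (simp add: field_simps)
qed

lemma power_s_C1: "C1_on UNIV (\<lambda>z. 1 / s z ^ n)"
proof (rule C1_onI)
 show "((\<lambda>z. 1 / s z ^ n) has_derivative (\<lambda>h. - real n * (z \<bullet> h) / s z ^ (n + 2))) (at z within UNIV)" for z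
  using power_s_deriv by simp
 show "continuous_on UNIV (\<lambda>z. - real n * (z \<bullet> h) / s z ^ (n + 2))" for h
  by (intro continuous_intros s_cont) (use s(1) in \<open>auto simp: less_imp_neq[symmetric]\<close>)
qed

end

text \<open>The pointwise divergence behind \<open>identity_kernel\<close>: \<open>d i\<close> are
  the spatial derivatives of the field, \<open>ut\<close> its time derivative, \<open>c\<close> is 1
  / s, and \<open>w\<close> is minus the curl. The spatial derivatives combine to a divergence and a
  curl, the combinations that Maxwell's equations express through sources and time
  derivatives.\<close>

lemma kernel_sum_algebra:
 fixes z a u ut w :: vec3 and d :: "3 \<Rightarrow> vec3" and A B c :: real
 assumes w: "w $ 1 = - (d 2 $ 3 - d 3 $ 2)" "w $ 2 = - (d 3 $ 1 - d 1 $ 3)" "w $ 3 = - (d 1 $ 2 - d 2 $ 1)"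
 shows "(\<Sum>i\<in>UNIV. A * ((a \<bullet> z) * ((d i $ i) - (z $ i * c) * ut $ i) + a $ i * (u $ i)
   - (a $ i) * (u $ i + (d i \<bullet> z - (z $ i * c) * (ut \<bullet> z))) + ((z $ i) * (d i \<bullet> a - (z $ i * c) * (ut \<bullet> a)) + (u \<bullet> a)))
   - B * (z $ i) * ((a \<bullet> z) * (u $ i) - (a $ i) * (u \<bullet> z) + (z $ i) * (u \<bullet> a)))
  = (3 * A - B * (norm z)^2) * (a \<bullet> u)
  + A * ((a \<bullet> z) * (d 1 $ 1 + d 2 $ 2 + d 3 $ 3) + a \<bullet> cross3 z w - (norm z)^2 * (a \<bullet> ut) * c)"
proof -
 have N: "(norm z)^2 = z $ 1 * z $ 1 + z $ 2 * z $ 2 + z $ 3 * z $ 3" by (simp add: power2_norm_eq_inner inner_vec_def sum_3)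
 have 1: "(\<Sum>i\<in>UNIV. (a \<bullet> z) * (d i $ i) - (a $ i) * (d i \<bullet> z) + (z $ i) * (d i \<bullet> a)) = (a \<bullet> z) * (d 1 $ 1 + d 2 $ 2 + d 3 $ 3) + a \<bullet> cross3 z w"
  by (simp add: inner_vec_def sum_3 cross3_def w algebra_simps)
 have 2: "(\<Sum>i\<in>UNIV. (z $ i) * ((a \<bullet> z) * (v $ i) - (a $ i) * (v \<bullet> z) + (z $ i) * (v \<bullet> a))) = (norm z)^2 * (a \<bullet> v)" for v :: vec3
  unfolding N by (simp add: inner_vec_def sum_3 algebra_simps)
 have "A * ((a \<bullet> z) * ((d i $ i) - (z $ i * c) * ut $ i) + a $ i * (u $ i)
   - (a $ i) * (u $ i + (d i \<bullet> z - (z $ i * c) * (ut \<bullet> z))) + ((z $ i) * (d i \<bullet> a - (z $ i * c) * (ut \<bullet> a)) + (u \<bullet> a)))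
   - B * (z $ i) * ((a \<bullet> z) * (u $ i) - (a $ i) * (u \<bullet> z) + (z $ i) * (u \<bullet> a))
  = A * ((a \<bullet> z) * (d i $ i) - (a $ i) * (d i \<bullet> z) + (z $ i) * (d i \<bullet> a))
   - A * c * ((z $ i) * ((a \<bullet> z) * (ut $ i) - (a $ i) * (ut \<bullet> z) + (z $ i) * (ut \<bullet> a))) + A * (u \<bullet> a)
   - B * ((z $ i) * ((a \<bullet> z) * (u $ i) - (a $ i) * (u \<bullet> z) + (z $ i) * (u \<bullet> a)))" for i
  by (simp add: algebra_simps)
 moreover have "(\<Sum>i\<in>(UNIV::3 set). A * f i - A * c * g i + A * (u \<bullet> a) - B * k i) = A * sum f UNIV - A * c * sum g UNIV + A * (3 * (a \<bullet> u)) - B * sum k UNIV" for f g k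
  by (simp add: sum_3 inner_commute algebra_simps)
 ultimately show ?thesis by (simp only: 1 2) (simp add: algebra_simps)
qed

lemma curl_sum_algebra:
 fixes z a v vt w :: vec3 and d :: "3 \<Rightarrow> vec3" and B c :: real
 assumes w: "w $ 1 = d 2 $ 3 - d 3 $ 2" "w $ 2 = d 3 $ 1 - d 1 $ 3" "w $ 3 = d 1 $ 2 - d 2 $ 1"
 shows "(\<Sum>i\<in>UNIV. c * (cross3 (d i - (z $ i * c) *\<^sub>R vt) a $ i) - B * (z $ i) * (cross3 v a $ i))
  = c * (a \<bullet> w - a \<bullet> cross3 z vt * c) - a \<bullet> cross3 z v * B"
 by (simp add: inner_vec_def sum_3 cross3_def w algebra_simps)

section \<open>Integral identities on the hyperboloid\<close>

locale maxwell_point = maxwell U V j k \<rho> L + cone_point L x0 t0 \<epsilon>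
 for U V j k :: "real \<Rightarrow> vec3 \<Rightarrow> vec3" and \<rho> :: "real \<Rightarrow> vec3 \<Rightarrow> real" and L :: real and x0 :: vec3 and t0 \<epsilon> :: real
begin

lemma vU: "C1v L U" and vV: "C1v L V"
 using CU CV vanishU vanishV by (auto simp: C1v_def)

lemma curl_Cv: assumes "C1v L W" shows "Cv L (curl W)"
proof -
 have "continuous_on {z. 0 < fst z} (unc (curl W))"
  unfolding curl_def
  by (subst continuous_on_componentwise)
   (auto simp: cart_eq_inner_axis[symmetric] Basis_vec_def forall_3 intro!: continuous_intros C1v_continuous(3)[OF assms])
 moreover have "curl W t x = 0" if "0 < t" "t + L < norm x" for t x
  using C1v_vanish(3)[OF assms that] by (simp add: curl_def vec_eq_iff forall_3)
 ultimately show ?thesis by (simp add: Cv_def)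
qed

lemma Cv_eq: "Cv L f \<Longrightarrow> (\<And>t x. 0 < t \<Longrightarrow> g t x = f t x) \<Longrightarrow> Cv L g"
 unfolding Cv_def by (auto cong: continuous_on_cong_simp)

lemma jCv: "Cv L j"
proof (rule Cv_eq[of "\<lambda>t x. curl V t x - dt U t x"])
 show "Cv L (\<lambda>t x. curl V t x - dt U t x)"
  using curl_Cv[OF vV] C1v_Cv(2)[OF vU] by (auto simp: Cv_def intro!: continuous_intros)
qed (simp add: pde1)

lemma kCv: "Cv L k"
proof (rule Cv_eq[of "\<lambda>t x. - curl U t x - dt V t x"])
 show "Cv L (\<lambda>t x. - curl U t x - dt V t x)"
  using curl_Cv[OF vU] C1v_Cv(2)[OF vV] by (auto simp: Cv_def intro!: continuous_intros)
qed (simp add: pde2)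

lemma rCv: "Cv L \<rho>"
proof (rule Cv_eq[of "div3 U"])
 show "Cv L (div3 U)"
  unfolding div3_def[abs_def] using C1v_continuous(3)[OF vU] C1v_vanish(3)[OF vU] by (auto simp: Cv_def intro!: continuous_intros)
qed (simp add: pde3)

lemma ret_k: "ret k t z $ 1 = - (ret (dx 2 U) t z $ 3 - ret (dx 3 U) t z $ 2) - ret (dt V) t z $ 1"
 "ret k t z $ 2 = - (ret (dx 3 U) t z $ 1 - ret (dx 1 U) t z $ 3) - ret (dt V) t z $ 2"
 "ret k t z $ 3 = - (ret (dx 1 U) t z $ 2 - ret (dx 2 U) t z $ 1) - ret (dt V) t z $ 3"
 using pde2[of "t - s z" "x0 + z"] by (simp_all add: ret_def curl_def)

lemma ret_j: "ret j t z $ 1 = ret (dx 2 V) t z $ 3 - ret (dx 3 V) t z $ 2 - ret (dt U) t z $ 1"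
 "ret j t z $ 2 = ret (dx 3 V) t z $ 1 - ret (dx 1 V) t z $ 3 - ret (dt U) t z $ 2"
 "ret j t z $ 3 = ret (dx 1 V) t z $ 2 - ret (dx 2 V) t z $ 1 - ret (dt U) t z $ 3"
 using pde1[of "t - s z" "x0 + z"] by (simp_all add: ret_def curl_def)

lemma ret_rho: "ret \<rho> t z = ret (dx 1 U) t z $ 1 + ret (dx 2 U) t z $ 2 + ret (dx 3 U) t z $ 3"
 using pde3[of "t - s z" "x0 + z"] by (simp add: ret_def div3_def)

text \<open>Divergence theorem for the Maxwell stress tensor polarised between the field and
  \<open>z\<close>, contracted with \<open>a\<close> and multiplied by s^(-n). As \<open>z\<close>
  is curl-free with divergence 3, only the field, its divergence and its curl occur, besides time
  derivatives from the retardation. Two exponents matter: n = 2, where the coefficient of U is 1 /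
  s^2 up to \<epsilon>, and n = 3, where it concentrates at the apex.\<close>

lemma identity_kernel:
 assumes t: "t0 - 1 < t" "t < t0 + 2"
 shows "((\<lambda>z. (3 / s z ^ n - real n * (norm z)^2 / s z ^ (n + 2)) * (a \<bullet> ret U t z)
  + 1 / s z ^ n * ((a \<bullet> z) * ret \<rho> t z + a \<bullet> cross3 z (ret (dt V) t z + ret k t z) - (norm z)^2 * (a \<bullet> ret (dt U) t z) / s z)) has_integral 0) UNIV"
proof -
 define W where "W i z = 1 / s z ^ n * ((a \<bullet> z) * (ret U t z $ i) - (a $ i) * (ret U t z \<bullet> z) + (z $ i) * (ret U t z \<bullet> a))" for i z
 define W' where "W' i z h = 1 / s z ^ n * ((a \<bullet> z) * (dret U t z h $ i) + (a \<bullet> h) * (ret U t z $ i)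
   - (a $ i) * (ret U t z \<bullet> h + dret U t z h \<bullet> z) + ((z $ i) * (dret U t z h \<bullet> a) + (h $ i) * (ret U t z \<bullet> a)))
   + (- real n * (z \<bullet> h) / s z ^ (n + 2)) * ((a \<bullet> z) * (ret U t z $ i) - (a $ i) * (ret U t z \<bullet> z) + (z $ i) * (ret U t z \<bullet> a))" for i z h
 note CU1 = ret_C1[OF vU t]
 have i: "((\<lambda>z. W' i z (axis i 1)) has_integral 0) UNIV" for i
 proof (rule integral_derivative_zero(1)[where \<phi> = "W i" and \<phi>' = "W' i" and r = R])
  show "C1_on UNIV (W i)" unfolding W_def
   by (intro C1_on_bilinear[OF bounded_bilinear_mult] C1_on_bilinear[OF bounded_bilinear_inner] power_s_C1 C1_on_add C1_on_diff CU1
     C1_on_blinear_compose[OF bounded_linear_vec_nth] C1_on_const C1_on_linear[OF bounded_linear_ident] C1_on_linear[OF bounded_linear_vec_nth])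
  show "W i z = 0" if "R < norm z" for z using ret_zero[OF C1v_Cv(1)[OF vU] t(2) that] by (simp add: W_def)
  show "(W i has_derivative W' i z) (at z)" for z
  proof -
   have 1: "((\<lambda>z. (a \<bullet> z) * (ret U t z $ i)) has_derivative (\<lambda>h. (a \<bullet> z) * (dret U t z h $ i) + (a \<bullet> h) * (ret U t z $ i))) (at z)"
    by (intro has_derivative_mult has_derivative_inner_right has_derivative_ident bounded_linear.has_derivative[OF bounded_linear_vec_nth] ret_deriv[OF vU t])
   have 2: "((\<lambda>z. (a $ i) * (ret U t z \<bullet> z)) has_derivative (\<lambda>h. (a $ i) * (ret U t z \<bullet> h + dret U t z h \<bullet> z))) (at z)"
    by (intro has_derivative_mult_right has_derivative_inner has_derivative_ident ret_deriv[OF vU t])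
   have 3: "((\<lambda>z. (z $ i) * (ret U t z \<bullet> a)) has_derivative (\<lambda>h. (z $ i) * (dret U t z h \<bullet> a) + (h $ i) * (ret U t z \<bullet> a))) (at z)"
    by (intro has_derivative_mult has_derivative_inner_left bounded_linear_imp_has_derivative[OF bounded_linear_vec_nth] ret_deriv[OF vU t])
   show ?thesis unfolding W_def[abs_def] W'_def[abs_def]
    by (rule has_derivative_mult[OF power_s_deriv has_derivative_add[OF has_derivative_diff[OF 1 2] 3]])
  qed
 qed
 have "((\<lambda>z. \<Sum>i\<in>UNIV. W' i z (axis i 1)) has_integral (\<Sum>i\<in>(UNIV::3 set). 0)) UNIV" by (intro has_integral_sum i) auto
 moreover have "(\<Sum>i\<in>UNIV. W' i z (axis i 1)) = (3 / s z ^ n - real n * (norm z)^2 / s z ^ (n + 2)) * (a \<bullet> ret U t z)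
  + 1 / s z ^ n * ((a \<bullet> z) * ret \<rho> t z + a \<bullet> cross3 z (ret (dt V) t z + ret k t z) - (norm z)^2 * (a \<bullet> ret (dt U) t z) / s z)" for z
 proof -
  define A where "A = 1 / s z ^ n"
  define B where "B = real n / s z ^ (n + 2)"
  define c where "c = 1 / s z"
  have W'i: "W' i z (axis i 1) = A * ((a \<bullet> z) * ((ret (dx i U) t z $ i) - (z $ i * c) * ret (dt U) t z $ i) + a $ i * (ret U t z $ i)
   - (a $ i) * (ret U t z $ i + (ret (dx i U) t z \<bullet> z - (z $ i * c) * (ret (dt U) t z \<bullet> z))) + ((z $ i) * (ret (dx i U) t z \<bullet> a - (z $ i * c) * (ret (dt U) t z \<bullet> a)) + (ret U t z \<bullet> a)))
   - B * (z $ i) * ((a \<bullet> z) * (ret U t z $ i) - (a $ i) * (ret U t z \<bullet> z) + (z $ i) * (ret U t z \<bullet> a))" for i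
   by (simp add: W'_def dret_axis A_def B_def c_def inner_axis inner_diff_left)
  have "(\<Sum>i\<in>UNIV. W' i z (axis i 1)) = (3 * A - B * (norm z)^2) * (a \<bullet> ret U t z)
  + A * ((a \<bullet> z) * ret \<rho> t z + a \<bullet> cross3 z (ret (dt V) t z + ret k t z) - (norm z)^2 * (a \<bullet> ret (dt U) t z) * c)"
   unfolding W'i ret_rho by (rule kernel_sum_algebra) (simp_all add: ret_k)
  then show ?thesis by (simp add: A_def B_def c_def)
 qed
 ultimately show ?thesis by simp
qed

text \<open>Divergence theorem for (V x a) / s. It trades the time derivative of \<open>U\<close>
  with kernel 1 / s for the current and terms in \<open>V\<close>.\<close>

lemma identity_curl:
 assumes t: "t0 - 1 < t" "t < t0 + 2"
 shows "((\<lambda>z. 1 / s z ^ 1 * (a \<bullet> (ret (dt U) t z + ret j t z) - a \<bullet> cross3 z (ret (dt V) t z) / s z) - a \<bullet> cross3 z (ret V t z) / s z ^ 3) has_integral 0) UNIV"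
proof -
 define W where "W i z = 1 / s z ^ 1 * (cross3 (ret V t z) a $ i)" for i z
 define W' where "W' i z h = 1 / s z ^ 1 * (cross3 (dret V t z h) a $ i)
   + (- real 1 * (z \<bullet> h) / s z ^ (1 + 2)) * (cross3 (ret V t z) a $ i)" for i z h
 note CV1 = ret_C1[OF vV t]
 have i: "((\<lambda>z. W' i z (axis i 1)) has_integral 0) UNIV" for i
 proof (rule integral_derivative_zero(1)[where \<phi> = "W i" and \<phi>' = "W' i" and r = R])
  show "C1_on UNIV (W i)" unfolding W_def
   by (intro C1_on_bilinear[OF bounded_bilinear_mult] power_s_C1 CV1
     C1_on_blinear_compose[OF bounded_linear_vec_nth] C1_on_bilinear[OF bounded_bilinear_cross3] C1_on_const)
  show "W i z = 0" if "R < norm z" for z using ret_zero[OF C1v_Cv(1)[OF vV] t(2) that] by (simp add: W_def)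
  show "(W i has_derivative W' i z) (at z)" for z
   unfolding W_def[abs_def] W'_def[abs_def]
   by (intro has_derivative_mult power_s_deriv bounded_linear.has_derivative[OF bounded_linear_vec_nth]
     bounded_linear.has_derivative[OF bounded_bilinear.bounded_linear_left[OF bounded_bilinear_cross3]] ret_deriv[OF vV t])
 qed
 have "((\<lambda>z. \<Sum>i\<in>UNIV. W' i z (axis i 1)) has_integral (\<Sum>i\<in>(UNIV::3 set). 0)) UNIV" by (intro has_integral_sum i) auto
 moreover have "(\<Sum>i\<in>UNIV. W' i z (axis i 1)) = 1 / s z ^ 1 * (a \<bullet> (ret (dt U) t z + ret j t z) - a \<bullet> cross3 z (ret (dt V) t z) / s z) - a \<bullet> cross3 z (ret V t z) / s z ^ 3" for z
 proof -
  define c where "c = 1 / s z"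
  define B where "B = 1 / s z ^ 3"
  have W'i: "W' i z (axis i 1) = c * (cross3 (ret (dx i V) t z - (z $ i * c) *\<^sub>R ret (dt V) t z) a $ i) - B * (z $ i) * (cross3 (ret V t z) a $ i)" for i
   by (simp add: W'_def dret_axis c_def B_def inner_axis power3_eq_cube)
  have "(\<Sum>i\<in>UNIV. W' i z (axis i 1)) = c * (a \<bullet> (ret (dt U) t z + ret j t z) - a \<bullet> cross3 z (ret (dt V) t z) * c) - a \<bullet> cross3 z (ret V t z) * B"
   unfolding W'i by (rule curl_sum_algebra) (simp_all add: ret_j)
  then show ?thesis by (simp add: c_def B_def)
 qed
 ultimately show ?thesis by simp
qed

end

section \<open>A weight integrable uniformly in \<epsilon>\<close>

context cone_point begin

text \<open>The weight s^(-5/2). An exponent above 2 leaves a positive power of \<epsilon> when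
  \<epsilon>^2 / s^4 is compared with it; an exponent below 3 is integrable at the origin uniformly
  in \<epsilon>.\<close>

definition w :: "vec3 \<Rightarrow> real" where "w z = 1 / sqrt (s z) ^ 5"

lemma w_nonneg: "0 \<le> w z" using s(1)[of z] by (simp add: w_def)

lemma w_cont: "continuous_on S w"
 unfolding w_def[abs_def]
 by (intro continuous_intros s_cont) (use s(1) in \<open>auto simp: less_imp_neq[symmetric]\<close>)

lemma w_integrable: "w integrable_on bx r"
 unfolding bx_def by (intro integrable_continuous w_cont)

lemma w_le: assumes "0 < r" "r \<le> s z" shows "w z \<le> 1 / sqrt r ^ 5"
proof -
 have "0 < sqrt r" "sqrt r \<le> sqrt (s z)" using assms by auto
 then have "sqrt r ^ 5 \<le> sqrt (s z) ^ 5" "0 < sqrt r ^ 5" by (auto intro: power_mono)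
 then show ?thesis unfolding w_def using s(1)[of z] assms(1) by (intro divide_left_mono mult_pos_pos) auto
qed

lemma sqrt5: assumes "0 < r" shows "r ^ 3 * (1 / sqrt r ^ 5) = sqrt r"
proof -
 define c where "c = sqrt r"
 have c: "0 < c" "r = c^2" using assms by (auto simp: c_def)
 have "r ^ 3 = c * c ^ 5" unfolding c(2) by algebra
 then show ?thesis using c(1) by (simp add: c_def[symmetric])
qed

text \<open>Doubling the cube adds a region where |z| >= r, so the weight there is at most r^(-5/2),
  and its volume is at most 64 r^3.\<close>

lemma w_integral_double:
 assumes r: "0 < r" shows "integral (bx (2 * r)) w \<le> integral (bx r) w + 64 * sqrt r"
proof -
 have sub: "bx r \<subseteq> bx (2 * r)" using r by (auto simp: bx_def mem_box_cart) (smt (verit))+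
 have i1: "((\<lambda>z. if z \<in> bx r then w z else 0) has_integral integral (bx r) w) (bx (2 * r))"
 proof -
  have "(w has_integral integral (bx r) w) (bx r \<inter> bx (2 * r))"
   using integrable_integral[OF w_integrable[of r]] sub by (simp add: Int_absorb2)
  then show ?thesis by (simp only: has_integral_restrict_Int)
 qed
 have i2: "((\<lambda>z. 1 / sqrt r ^ 5) has_integral (64 * sqrt r)) (bx (2 * r))"
 proof -
  have "((\<lambda>z. 1 / sqrt r ^ 5) has_integral measure lborel (bx (2 * r)) *\<^sub>R (1 / sqrt r ^ 5)) (bx (2 * r))"
   unfolding bx_def by (rule has_integral_const)
  moreover have "measure lborel (bx (2 * r)) *\<^sub>R (1 / sqrt r ^ 5) = 64 * sqrt r"
   using content_bx[of "2 * r"] sqrt5[OF r] r by (simp add: power_mult_distrib)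
  ultimately show ?thesis by simp
 qed
 have "integral (bx (2 * r)) w \<le> integral (bx r) w + 64 * sqrt r"
 proof (rule has_integral_le[OF integrable_integral[OF w_integrable] has_integral_add[OF i1 i2]])
  fix z
  show "w z \<le> (if z \<in> bx r then w z else 0) + 1 / sqrt r ^ 5"
  proof (cases "z \<in> bx r")
   case False
   then have "r \<le> norm z" using cball_bx[of z r] by linarith
   then show ?thesis using w_le[OF r, of z] s(3)[of z] False by simp
  qed (use r in simp)
 qed
 then show ?thesis .
qed

text \<open>Dyadic summation, starting at scales below \<epsilon> where the weight is bounded
  pointwise. The constant 160 closes the induction: (160 + 64) sqrt (r / 2) = 160 * 1.4 * sqrt (r /
  2), and 1.4 <= sqrt 2.\<close>

lemma w_integral_aux: "0 < r \<Longrightarrow> r \<le> \<epsilon> * 2 ^ n \<Longrightarrow> integral (bx r) w \<le> 160 * sqrt r"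
proof (induction n arbitrary: r)
 case 0
 have "integral (bx r) w \<le> integral (bx r) (\<lambda>z. 1 / sqrt r ^ 5)"
 proof (rule integral_le[OF w_integrable])
  show "w z \<le> 1 / sqrt r ^ 5" for z using w_le[OF 0(1), of z] s(2)[of z] 0 by simp
  show "(\<lambda>z. 1 / sqrt r ^ 5) integrable_on bx r" unfolding bx_def by (rule integrable_const)
 qed
 also have "\<dots> = 8 * sqrt r"
  using content_bx[of r] sqrt5[OF 0(1)] 0(1) by (simp add: bx_def)
 also have "\<dots> \<le> 160 * sqrt r" using 0(1) by simp
 finally show ?case .
next
 case (Suc n)
 have "integral (bx (2 * (r / 2))) w \<le> integral (bx (r / 2)) w + 64 * sqrt (r / 2)"
  by (rule w_integral_double) (use Suc in simp)
 also have "integral (bx (r / 2)) w \<le> 160 * sqrt (r / 2)" by (rule Suc.IH) (use Suc.prems in auto)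
 also have "160 * sqrt (r / 2) + 64 * sqrt (r / 2) \<le> 160 * sqrt r"
 proof -
  have "sqrt (1.4^2) \<le> sqrt 2" by (rule real_sqrt_le_mono) (simp add: power2_eq_square)
  then have "1.4 * sqrt (r / 2) \<le> sqrt 2 * sqrt (r / 2)" using Suc.prems(1) by (intro mult_right_mono) auto
  also have "\<dots> = sqrt r" by (simp add: real_sqrt_mult[symmetric])
  finally show ?thesis by simp
 qed
 finally show ?case by simp
qed

lemma w_integral: assumes "0 < r" shows "integral (bx r) w \<le> 160 * sqrt r"
proof -
 obtain n where "r / \<epsilon> < 2 ^ n" using real_arch_pow[of 2 "r / \<epsilon>"] by auto
 then have "r \<le> \<epsilon> * 2 ^ n" using \<epsilon> by (simp add: field_simps)
 with assms show ?thesis by (rule w_integral_aux)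
qed

lemma weight_bound:
 fixes F :: "vec3 \<Rightarrow> real"
 assumes F: "cs R F" and b: "\<And>z. norm z \<le> R \<Longrightarrow> \<bar>F z\<bar> \<le> A * w z" and A: "0 \<le> A"
 shows "\<bar>integral UNIV F\<bar> \<le> 160 * A * sqrt R"
proof -
 have "norm (integral (bx R) F) \<le> integral (bx R) (\<lambda>z. A * w z)"
 proof (rule integral_norm_bound_integral)
  show "F integrable_on bx R" using cs_has_integral_bx(1)[OF F order_refl] by blast
  show "(\<lambda>z. A * w z) integrable_on bx R" using integrable_on_mult_right[OF w_integrable] by blast
  show "norm (F z) \<le> A * w z" for z
   using b[of z] A w_nonneg[of z] F by (cases "norm z \<le> R") (auto simp: cs_def)
 qed
 also have "\<dots> = A * integral (bx R) w" by simp
 also have "\<dots> \<le> A * (160 * sqrt R)" using w_integral[of R] R A by (intro mult_left_mono) auto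
 finally show ?thesis using cs_integral_bx[OF F order_refl] by (simp add: ac_simps)
qed

text \<open>Inside radius \<open>R\<close> one has s <= R + 1, so the powers of s missing against
  s^(-5/2) are paid for with powers of R + 1.\<close>

lemma weights:
 assumes "norm z \<le> R"
 shows "1 / s z \<le> (R + 1) * sqrt (R + 1) * w z" "1 / (s z)^2 \<le> sqrt (R + 1) * w z"
proof -
 define c where "c = sqrt (s z)"
 define d where "d = sqrt (R + 1)"
 have c: "0 < c" "s z = c^2" using s(1)[of z] by (auto simp: c_def)
 have d: "c \<le> d" "R + 1 = d^2" "0 \<le> d" using s(4)[of z] assms R \<epsilon> by (auto simp: c_def d_def)
 have w: "w z = 1 / c ^ 5" by (simp add: w_def c_def)
 have "c ^ 3 / c ^ 5 \<le> d ^ 3 / c ^ 5" using c(1) d(1) by (intro divide_right_mono power_mono) auto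
 moreover have "c ^ 3 / c ^ 5 = 1 / c^2" "d ^ 3 = d^2 * d" using c(1) by (simp_all add: field_simps eval_nat_numeral)
 ultimately show "1 / s z \<le> (R + 1) * sqrt (R + 1) * w z" unfolding d_def[symmetric] d(2) c(2) w using d(3) by simp
 have "c / c ^ 5 \<le> d / c ^ 5" using c(1) d(1) by (intro divide_right_mono) auto
 moreover have "c / c ^ 5 = 1 / (c^2)^2" using c(1) by (simp add: field_simps eval_nat_numeral)
 ultimately show "1 / (s z)^2 \<le> sqrt (R + 1) * w z" unfolding d_def[symmetric] c(2) w by simp
qed

lemma weights_eps: "\<epsilon>^2 / s z ^ 3 \<le> sqrt \<epsilon> * w z" "\<epsilon>^2 / s z ^ 4 \<le> sqrt \<epsilon> * w z"
proof -
 define c where "c = sqrt (s z)"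
 define e where "e = sqrt \<epsilon>"
 have c: "0 < c" "s z = c^2" using s(1)[of z] by (auto simp: c_def)
 have e: "0 < e" "\<epsilon> = e^2" "e \<le> c" "e \<le> 1" using s(2)[of z] \<epsilon> by (auto simp: c_def e_def)
 have E: "\<epsilon>^2 = (e^2)^2" by (simp add: e(2)[symmetric])
 have w: "w z = 1 / c ^ 5" by (simp add: w_def c_def)
 have 1: "e * e ^ 3 \<le> e * (1 * c)"
 proof -
  have "e ^ 3 = e^2 * e" by (simp add: eval_nat_numeral)
  also have "\<dots> \<le> 1 * c" using e by (intro mult_mono power_le_one) auto
  finally show ?thesis using e(1) by simp
 qed
 have "e * e ^ 3 / c ^ 6 \<le> e * (1 * c) / c ^ 6" by (rule divide_right_mono[OF 1]) (use c(1) in simp)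
 moreover have "e * (1 * c) / c ^ 6 = e * (1 / c ^ 5)" "e * e ^ 3 / c ^ 6 = (e^2)^2 / (c^2) ^ 3" using c(1) by (simp_all add: field_simps eval_nat_numeral)
 ultimately show "\<epsilon>^2 / s z ^ 3 \<le> sqrt \<epsilon> * w z" unfolding e_def[symmetric] E c(2) w by simp
 have "e * e ^ 3 / c ^ 8 \<le> e * c ^ 3 / c ^ 8" using e c(1) by (intro divide_right_mono mult_left_mono power_mono) auto
 moreover have "e * c ^ 3 / c ^ 8 = e * (1 / c ^ 5)" "e * e ^ 3 / c ^ 8 = (e^2)^2 / (c^2) ^ 4" using c(1) by (simp_all add: field_simps eval_nat_numeral)
 ultimately show "\<epsilon>^2 / s z ^ 4 \<le> sqrt \<epsilon> * w z" unfolding e_def[symmetric] E c(2) w by simp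
qed

text \<open>In the cube of half side \<epsilon> one has s <= 2 \<epsilon>, since \<epsilon>^2 + 3
  \<epsilon>^2 = (2 \<epsilon>)^2. The integrand is thus at least 3 \<epsilon>^2 / (2 \<epsilon>)^5
  on a volume 8 \<epsilon>^3, which gives 24/32. The exact mass over the whole space is 4 pi, but
  any positive lower bound will do.\<close>

lemma mass_lower:
 "3 / 4 \<le> integral (bx R) (\<lambda>z. 3 * \<epsilon>^2 / s z ^ 5)"
proof -
 have c: "continuous_on S (\<lambda>z. 3 * \<epsilon>^2 / s z ^ 5)" for S
  by (intro continuous_intros s_cont) (use s(1) in \<open>auto simp: less_imp_neq[symmetric]\<close>)
 have i: "(\<lambda>z. 3 * \<epsilon>^2 / s z ^ 5) integrable_on bx r" for r unfolding bx_def by (intro integrable_continuous c)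
 have "s z \<le> 2 * \<epsilon>" if "z \<in> bx \<epsilon>" for z
 proof -
  have "\<bar>z $ i\<bar> \<le> \<epsilon>" for i using that by (simp add: bx_def mem_box_cart abs_le_iff minus_le_iff)
  then have "(z $ i)^2 \<le> \<epsilon>^2" for i by (metis abs_le_square_iff abs_of_pos \<epsilon>(1))
  from this[of 1] this[of 2] this[of 3] have "(norm z)^2 \<le> 3 * \<epsilon>^2"
   by (simp add: power2_norm_eq_inner inner_vec_def sum_3 power2_eq_square[symmetric])
  then show ?thesis unfolding s_def using \<epsilon>(1) by (intro real_le_lsqrt) (auto simp: power_mult_distrib)
 qed
 then have le: "3 * \<epsilon>^2 / (2 * \<epsilon>) ^ 5 \<le> 3 * \<epsilon>^2 / s z ^ 5" if "z \<in> bx \<epsilon>" for z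
  using that s(1)[of z] by (intro divide_left_mono power_mono mult_pos_pos) (use \<epsilon>(1) in \<open>auto simp: less_imp_le\<close>)
 have "3 / 4 = integral (bx \<epsilon>) (\<lambda>z. 3 * \<epsilon>^2 / (2 * \<epsilon>) ^ 5)"
  using content_bx[of \<epsilon>] \<epsilon>(1) by (simp add: bx_def field_simps eval_nat_numeral)
 also have "\<dots> \<le> integral (bx \<epsilon>) (\<lambda>z. 3 * \<epsilon>^2 / s z ^ 5)"
  by (rule integral_le[OF _ i le]) (simp_all add: bx_def integrable_const)
 also have "\<dots> \<le> integral (bx R) (\<lambda>z. 3 * \<epsilon>^2 / s z ^ 5)"
 proof (rule integral_subset_le[OF _ i i])
  have "\<epsilon> \<le> R" using R \<epsilon> by simp
  then show "bx \<epsilon> \<subseteq> bx R" by (auto simp: bx_def mem_box_cart) (smt (verit))+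
 qed (use s(1) in \<open>simp add: less_imp_le\<close>)
 finally show ?thesis .
qed

end

section \<open>The field at the apex\<close>

context maxwell_point begin

definition PI :: "vec3 \<Rightarrow> real \<Rightarrow> vec3 \<Rightarrow> real" where
 "PI a t z = (a \<bullet> ret U t z) / (s z)^2 - (a \<bullet> cross3 z (ret V t z)) / s z ^ 3"

definition PI' :: "vec3 \<Rightarrow> real \<Rightarrow> vec3 \<Rightarrow> real" where
 "PI' a t z = (a \<bullet> ret (dt U) t z) / (s z)^2 - (a \<bullet> cross3 z (ret (dt V) t z)) / s z ^ 3"

definition src :: "vec3 \<Rightarrow> real \<Rightarrow> vec3 \<Rightarrow> real" where
 "src a t z = (a \<bullet> z) * ret \<rho> t z + a \<bullet> cross3 z (ret k t z)"

definition GI :: "vec3 \<Rightarrow> real \<Rightarrow> vec3 \<Rightarrow> real" where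
 "GI a t z = (a \<bullet> ret j t z) / s z + src a t z / (s z)^2 + \<epsilon>^2 / s z ^ 3 * (a \<bullet> ret (dt U) t z) + 2 * (\<epsilon>^2 / s z ^ 4 * (a \<bullet> ret U t z))"

definition HI :: "vec3 \<Rightarrow> real \<Rightarrow> vec3 \<Rightarrow> real" where
 "HI a t z = src a t z / s z ^ 3 + \<epsilon>^2 / s z ^ 4 * (a \<bullet> ret (dt U) t z)"

definition QI :: "vec3 \<Rightarrow> real \<Rightarrow> vec3 \<Rightarrow> real" where
 "QI a t z = 3 * \<epsilon>^2 / s z ^ 5 * (a \<bullet> ret U t z)"

lemmas Cvs = C1v_Cv(1,2)[OF vU] C1v_Cv(1,2)[OF vV] jCv kCv rCv

lemma csI_all:
 assumes t: "t0 - 1 < t" "t < t0 + 2"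
 shows "cs R (PI a t)" "cs R (PI' a t)" "cs R (GI a t)" "cs R (HI a t)" "cs R (QI a t)"
proof -
 have sn: "s z \<noteq> 0" for z using s(1)[of z] by simp
 note ct = Cvs[THEN ret_continuous, OF t]
 note zt = Cvs[THEN ret_zero, OF t(2)]
 note ci = continuous_intros s_cont ct bounded_bilinear.continuous_on[OF bounded_bilinear_cross3]
 show "cs R (PI a t)" "cs R (PI' a t)" "cs R (GI a t)" "cs R (HI a t)" "cs R (QI a t)"
  unfolding cs_def PI_def[abs_def] PI'_def[abs_def] GI_def[abs_def] HI_def[abs_def] QI_def[abs_def] src_def
  by (intro conjI allI impI ci; simp add: sn zt)+
qed

text \<open>The sum of \<open>identity_kernel\<close> with n = 2 and \<open>identity_curl\<close>.
  The time derivatives of \<open>V\<close> cancel, and those of \<open>U\<close> leave only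
  \<epsilon>^2 / s^3 because |z|^2 = s^2 - \<epsilon>^2. So \<open>GI\<close> contains nothing but
  sources and terms with \<epsilon>.\<close>

lemma PI_eq:
 assumes t: "t0 - 1 < t" "t < t0 + 2"
 shows "integral UNIV (PI a t) = - integral UNIV (GI a t)"
proof -
 have "PI a t z + GI a t z = ((3 / s z ^ 2 - real 2 * (norm z)^2 / s z ^ (2 + 2)) * (a \<bullet> ret U t z)
  + 1 / s z ^ 2 * ((a \<bullet> z) * ret \<rho> t z + a \<bullet> cross3 z (ret (dt V) t z + ret k t z) - (norm z)^2 * (a \<bullet> ret (dt U) t z) / s z))
  + (1 / s z ^ 1 * (a \<bullet> (ret (dt U) t z + ret j t z) - a \<bullet> cross3 z (ret (dt V) t z) / s z) - a \<bullet> cross3 z (ret V t z) / s z ^ 3)" for z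
 proof -
  define c where "c = 1 / s z"
  define E where "E = \<epsilon>^2"
  have N: "(norm z)^2 = (s z)^2 - E" using s(5)[of z] by (simp add: E_def)
  have c1: "(s z)^2 * (c * c) = 1" using s(1)[of z] by (simp add: c_def power2_eq_square)
  have c2: "1 / (s z)^2 = c * c" "1 / s z ^ 3 = c * c * c" "1 / s z ^ (2 + 2) = c * c * (c * c)" "1 / s z ^ 4 = c * c * (c * c)"
   using s(1)[of z] by (simp_all add: c_def field_simps eval_nat_numeral)
  have c3: "x / (s z)^2 = x * (c * c)" "x / s z ^ 3 = x * (c * c * c)" "x / s z ^ (2 + 2) = x * (c * c * (c * c))"
   "x / s z ^ 4 = x * (c * c * (c * c))" "x / s z = x * c" "x / s z ^ 1 = x * c" for x
   using c2 by (simp_all add: c_def divide_inverse)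
  have 1: "2 * ((s z)^2 - E) * (c * c * (c * c)) = 2 * (c * c) - 2 * E * (c * c * (c * c))"
   using c1 by algebra
  have 2: "c * c * (((s z)^2 - E) * x * c) = x * c - E * x * (c * c * c)" for x
   using c1 by algebra
  show ?thesis
   unfolding PI_def GI_def src_def c3 N E_def[symmetric] of_nat_numeral 1
   by (simp add: inner_add_right bounded_bilinear.add_right[OF bounded_bilinear_cross3] right_diff_distrib distrib_left distrib_right 2[simplified])
 qed
 then have "((\<lambda>z. PI a t z + GI a t z) has_integral 0 + 0) UNIV"
  using has_integral_add[OF identity_kernel[OF t, of 2 a] identity_curl[OF t, of a]] by simp
 then have "integral UNIV (\<lambda>z. PI a t z + GI a t z) = 0" by (simp add: integral_unique)
 moreover have "integral UNIV (\<lambda>z. PI a t z + GI a t z) = integral UNIV (PI a t) + integral UNIV (GI a t)"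
  by (rule integral_add) (use csI_all[OF t, THEN cs_integrable] in auto)
 ultimately show ?thesis by simp
qed

text \<open>\<open>identity_kernel\<close> with n = 3: the coefficient 3 (s^2 - |z|^2) / s^5 of U
  equals 3 \<epsilon>^2 / s^5, an approximate delta function up to normalisation.\<close>

lemma QI_eq:
 assumes t: "t0 - 1 < t" "t < t0 + 2"
 shows "integral UNIV (QI a t) = integral UNIV (PI' a t) - integral UNIV (HI a t)"
proof -
 have "QI a t z - PI' a t z + HI a t z = ((3 / s z ^ 3 - real 3 * (norm z)^2 / s z ^ (3 + 2)) * (a \<bullet> ret U t z)
  + 1 / s z ^ 3 * ((a \<bullet> z) * ret \<rho> t z + a \<bullet> cross3 z (ret (dt V) t z + ret k t z) - (norm z)^2 * (a \<bullet> ret (dt U) t z) / s z))" for z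
 proof -
  define c where "c = 1 / s z"
  define E where "E = \<epsilon>^2"
  have N: "(norm z)^2 = (s z)^2 - E" using s(5)[of z] by (simp add: E_def)
  have c1: "(s z)^2 * (c * c) = 1" using s(1)[of z] by (simp add: c_def power2_eq_square)
  have c2: "1 / (s z)^2 = c * c" "1 / s z ^ 3 = c * c * c" "1 / s z ^ (3 + 2) = c * c * (c * c * c)" "1 / s z ^ 4 = c * c * (c * c)" "1 / s z ^ 5 = c * c * (c * c * c)"
   using s(1)[of z] by (simp_all add: c_def field_simps eval_nat_numeral)
  have c3: "x / (s z)^2 = x * (c * c)" "x / s z ^ 3 = x * (c * c * c)" "x / s z ^ (3 + 2) = x * (c * c * (c * c * c))"
   "x / s z ^ 4 = x * (c * c * (c * c))" "x / s z ^ 5 = x * (c * c * (c * c * c))" "x / s z = x * c" for x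
   using c2 by (simp_all add: c_def divide_inverse)
  have 1: "3 * ((s z)^2 - E) * (c * c * (c * c * c)) = 3 * (c * c * c) - 3 * E * (c * c * (c * c * c))"
   using c1 by algebra
  have 2: "c * c * c * (((s z)^2 - E) * x * c) = x * (c * c) - E * x * (c * c * (c * c))" for x
   using c1 by algebra
  show ?thesis
   unfolding PI'_def QI_def HI_def src_def c3 N E_def[symmetric] of_nat_numeral 1
   by (simp add: inner_add_right bounded_bilinear.add_right[OF bounded_bilinear_cross3] right_diff_distrib distrib_left distrib_right 2[simplified])
 qed
 then have "integral UNIV (\<lambda>z. QI a t z - PI' a t z + HI a t z) = 0"
  using identity_kernel[OF t, of 3 a] by (simp add: integral_unique)
 moreover have "integral UNIV (\<lambda>z. QI a t z - PI' a t z + HI a t z) = integral UNIV (QI a t) - integral UNIV (PI' a t) + integral UNIV (HI a t)"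
  using csI_all[OF t, THEN cs_integrable] by (simp add: integral_add integral_diff integrable_diff)
 ultimately show ?thesis by simp
qed

lemma PI_deriv:
 assumes t: "t0 - 1 < t" "t < t0 + 2"
 shows "((\<lambda>t. integral UNIV (PI a t)) has_real_derivative integral UNIV (PI' a t)) (at t)"
proof -
 let ?T = "{t0 - 1<..<t0 + 2}"
 have sn: "s z \<noteq> 0" for z using s(1)[of z] by simp
 have "((\<lambda>t. integral (bx R) (PI a t)) has_field_derivative integral (bx R) (PI' a t)) (at t within ?T)"
  unfolding bx_def
 proof (rule leibniz_rule_field_derivative[where fx = "PI' a"])
  fix \<tau> z assume \<tau>: "\<tau> \<in> ?T"
  have u: "((\<lambda>t. ret U t z) has_vector_derivative ret (dt U) \<tau> z) (at \<tau> within ?T)"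
   using ret_deriv_t[OF vU, of \<tau> z] \<tau> by (auto intro: has_vector_derivative_at_within)
  have v: "((\<lambda>t. ret V t z) has_vector_derivative ret (dt V) \<tau> z) (at \<tau> within ?T)"
   using ret_deriv_t[OF vV, of \<tau> z] \<tau> by (auto intro: has_vector_derivative_at_within)
  have "((\<lambda>t. a \<bullet> ret U t z) has_real_derivative a \<bullet> ret (dt U) \<tau> z) (at \<tau> within ?T)"
   using bounded_linear.has_vector_derivative[OF bounded_linear_inner_right u, of a]
   by (simp add: has_real_derivative_iff_has_vector_derivative)
  moreover have "((\<lambda>t. a \<bullet> cross3 z (ret V t z)) has_real_derivative a \<bullet> cross3 z (ret (dt V) \<tau> z)) (at \<tau> within ?T)"
   using bounded_linear.has_vector_derivative[OF bounded_linear_compose[OF bounded_linear_inner_right bounded_bilinear.bounded_linear_right[OF bounded_bilinear_cross3]] v, of a z]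
   by (simp add: has_real_derivative_iff_has_vector_derivative)
  ultimately show "((\<lambda>t. PI a t z) has_field_derivative PI' a \<tau> z) (at \<tau> within ?T)"
   unfolding PI_def PI'_def by (intro DERIV_diff DERIV_cdivide)
 next
  fix \<tau> assume "\<tau> \<in> ?T"
  then show "PI a \<tau> integrable_on cbox (vec (- R)) (vec R)"
   using cs_has_integral_bx(1)[OF csI_all(1)[of \<tau> a] order_refl] by (auto simp: bx_def)
 next
  have j: "continuous_on (?T \<times> cbox (vec (- R)) (vec R)) (\<lambda>z. ret (dt U) (fst z) (snd z))"
   "continuous_on (?T \<times> cbox (vec (- R)) (vec R)) (\<lambda>z. ret (dt V) (fst z) (snd z))"
   by (rule continuous_on_subset[OF ret_joint_continuous]; use Cvs in auto)+
  have sc: "continuous_on X (\<lambda>z::real \<times> vec3. s (snd z))" for X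
   by (rule continuous_on_compose2[OF s_cont[of UNIV]]) (auto intro!: continuous_intros)
  show "continuous_on (?T \<times> cbox (vec (- R)) (vec R)) (\<lambda>(t, z). PI' a t z)"
   unfolding split_beta PI'_def
   by (intro continuous_intros sc j bounded_bilinear.continuous_on[OF bounded_bilinear_cross3]) (simp_all add: sn)
 qed (use t in auto)
 then have "((\<lambda>t. integral (bx R) (PI a t)) has_field_derivative integral (bx R) (PI' a t)) (at t)"
  using at_within_open[of t ?T] t by simp
 moreover have "integral (bx R) (PI' a t) = integral UNIV (PI' a t)"
  using cs_integral_bx[OF csI_all(2)[OF t] order_refl] by simp
 ultimately have "((\<lambda>t. integral (bx R) (PI a t)) has_field_derivative integral UNIV (PI' a t)) (at t)" by simp
 then show ?thesis
  by (rule has_field_derivative_transform_within_open[of _ _ _ ?T]) (use t cs_integral_bx[OF csI_all(1) order_refl] in auto)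
qed

lemma src_le:
 assumes a: "norm a \<le> 1" and r: "\<bar>r\<bar> \<le> A" and k: "norm y \<le> A"
 shows "\<bar>(a \<bullet> z) * r + a \<bullet> cross3 z y\<bar> \<le> 2 * A * s z"
proof -
 have A: "0 \<le> A" using r by linarith
 have "\<bar>a \<bullet> z\<bar> \<le> norm a * norm z" by (rule Cauchy_Schwarz_ineq2)
 also have "\<dots> \<le> 1 * s z" using a s(3)[of z] by (intro mult_mono) auto
 finally have "\<bar>(a \<bullet> z) * r\<bar> \<le> s z * A" unfolding abs_mult using r s(1)[of z] by (intro mult_mono) auto
 moreover have "\<bar>a \<bullet> cross3 z y\<bar> \<le> s z * A"
 proof -
  have "\<bar>a \<bullet> cross3 z y\<bar> \<le> norm a * norm (cross3 z y)" by (rule Cauchy_Schwarz_ineq2)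
  also have "\<dots> \<le> 1 * (norm z * norm y)" using a norm_cross3_le[of z y] by (intro mult_mono) auto
  also have "\<dots> \<le> s z * A" using s(3)[of z] s(1)[of z] k by (simp add: mult_mono)
  finally show ?thesis .
 qed
 ultimately show ?thesis by (simp add: algebra_simps)
qed

lemma inner_le: assumes "norm a \<le> 1" "norm y \<le> A" shows "\<bar>a \<bullet> y\<bar> \<le> A"
proof -
 have "\<bar>a \<bullet> y\<bar> \<le> norm a * norm y" by (rule Cauchy_Schwarz_ineq2)
 also have "\<dots> \<le> 1 * A" using assms by (intro mult_mono) auto
 finally show ?thesis by simp
qed

text \<open>\<open>PI_eq\<close> bounds increments in \<open>t\<close> of \<open>\<integral> PI\<close> by those of the sources; its derivative enters \<open>QI_eq\<close>, whose left-hand side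
 concentrates at the apex. The mean value theorem on \<open>[t0, t0 + \<delta>]\<close> connects the two, and \<open>\<epsilon> = \<delta> ^ 4\<close> makes all terms
 with a factor \<open>\<epsilon>\<close> negligible.\<close>

lemma cone_inequality:
 assumes a: "norm a \<le> 1" and \<delta>: "0 < \<delta>" "\<delta> \<le> 1" "\<epsilon> = \<delta> ^ 4"
  and j1: "\<And>\<tau> x. t0 - R - 2 \<le> \<tau> \<Longrightarrow> \<tau> \<le> t0 + 2 \<Longrightarrow> norm (j \<tau> x) \<le> B1 \<and> norm (k \<tau> x) \<le> B1 \<and> \<bar>\<rho> \<tau> x\<bar> \<le> B1"
  and j2: "\<And>\<tau> \<tau>' x. t0 - R - 2 \<le> \<tau> \<Longrightarrow> \<tau> \<le> \<tau>' \<Longrightarrow> \<tau>' \<le> t0 + 2 \<Longrightarrow>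
   norm (j \<tau>' x - j \<tau> x) \<le> B2 * (\<tau>' - \<tau>) \<and> norm (k \<tau>' x - k \<tau> x) \<le> B2 * (\<tau>' - \<tau>) \<and> \<bar>\<rho> \<tau>' x - \<rho> \<tau> x\<bar> \<le> B2 * (\<tau>' - \<tau>)"
  and M1: "\<And>\<tau> x. t0 - R - 2 \<le> \<tau> \<Longrightarrow> \<tau> \<le> t0 + 2 \<Longrightarrow> norm (x - x0) \<le> R \<Longrightarrow> norm (U \<tau> x) \<le> M \<and> norm (dt U \<tau> x) \<le> M"
  and M2: "\<And>\<tau> \<tau>' x. t0 - R - 2 \<le> \<tau> \<Longrightarrow> \<tau> \<le> \<tau>' \<Longrightarrow> \<tau>' \<le> t0 + 2 \<Longrightarrow> norm (x - x0) \<le> R \<Longrightarrow>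
   norm (U \<tau> x - U \<tau>' x0) \<le> M * (\<tau>' - \<tau> + norm (x - x0))"
 shows "3 / 4 * \<bar>a \<bullet> U t0 x0\<bar> \<le> 320 * B1 * (R + 1) + 480 * B2 * (R + 1)^2 + 4000 * (R + 1) * M * \<delta>"
proof -
 define t1 where "t1 = t0 + \<delta>"
 have t1: "t0 - 1 < t1" "t1 < t0 + 2" and t0': "t0 - 1 < t0" "t0 < t0 + 2" using \<delta> by (auto simp: t1_def)
 \<comment> \<open>The terms with \<epsilon> are O(sqrt \<epsilon>) = O(\<delta>^2). The difference
   quotient divides some of them by \<delta>, and a factor \<delta> remains.\<close>
 have e: "sqrt \<epsilon> = \<delta>^2" using \<delta> by (simp add: real_sqrt_unique)
 have R0: "0 \<le> R" "t0 - R - 2 \<le> t0" using R by auto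
 have M0: "0 \<le> M" using M1[of t0 x0] R0 norm_ge_zero[of "U t0 x0"] by (smt (verit) diff_self norm_zero)
 have B10: "0 \<le> B1" using j1[of t0 x0] R0 abs_ge_zero[of "\<rho> t0 x0"] by linarith
 have B20: "0 \<le> B2" using j2[of t0 "t0 + 1" x0] R0 abs_ge_zero[of "\<rho> (t0 + 1) x0 - \<rho> t0 x0"] by auto
 have rw: "ret W t z = W (t - s z) (x0 + z)" if "t0 - 1 < t" "norm z \<le> R" for W t z
  using ret_inside(1)[OF that] by (simp add: ret_def)
 have rng: "t0 - R - 2 \<le> t - s z" "t - s z \<le> t0 + 2" if "t0 - 1 < t" "t < t0 + 2" "norm z \<le> R" for t z
  using ret_inside(2)[OF that(1,3)] s(1)[of z] that by auto
 have aU: "\<bar>a \<bullet> ret U t z\<bar> \<le> M" "\<bar>a \<bullet> ret (dt U) t z\<bar> \<le> M" if "t0 - 1 < t" "t < t0 + 2" "norm z \<le> R" for t z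
  using M1[OF rng[OF that], of "x0 + z"] that by (auto intro!: inner_le[OF a] simp: rw)
 have eps: "\<bar>\<epsilon>^2 / s z ^ n * x\<bar> \<le> M * \<delta>^2 * w z" if "\<bar>x\<bar> \<le> M" "norm z \<le> R" "n = 3 \<or> n = 4" for z x n
 proof -
  have "\<epsilon>^2 / s z ^ n \<le> \<delta>^2 * w z" using weights_eps[of z] that(3) by (auto simp: e)
  then have "(\<epsilon>^2 / s z ^ n) * \<bar>x\<bar> \<le> (\<delta>^2 * w z) * M" using that(1) w_nonneg[of z] by (intro mult_mono) auto
  moreover have "\<bar>\<epsilon>^2 / s z ^ n * x\<bar> = (\<epsilon>^2 / s z ^ n) * \<bar>x\<bar>" using s(1)[of z] by (simp add: abs_mult)
  ultimately show ?thesis by (simp add: ac_simps)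
 qed
 have sqR: "sqrt R \<le> sqrt (R + 1)" "sqrt R \<le> R + 1" "sqrt (R + 1) * sqrt R \<le> R + 1" "sqrt R \<ge> 0"
 proof -
  show 1: "sqrt R \<le> sqrt (R + 1)" "sqrt R \<ge> 0" using R by auto
  have "sqrt R \<le> sqrt (R * R)" using R by (intro real_sqrt_le_mono) simp
  then show "sqrt R \<le> R + 1" using R by (simp add: real_sqrt_mult)
  have "sqrt (R + 1) * sqrt R \<le> sqrt (R + 1) * sqrt (R + 1)" using 1 R by (intro mult_left_mono) auto
  then show "sqrt (R + 1) * sqrt R \<le> R + 1" using R by simp
 qed
 have Hb: "\<bar>integral UNIV (HI a t)\<bar> \<le> 320 * B1 * (R + 1) + 160 * M * \<delta> * (R + 1)" if t: "t0 - 1 < t" "t < t0 + 2" for t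
 proof -
  have "\<bar>integral UNIV (HI a t)\<bar> \<le> 160 * (2 * B1 * sqrt (R + 1) + M * \<delta>^2) * sqrt R"
  proof (rule weight_bound[OF csI_all(4)[OF t]])
   fix z :: vec3 assume z: "norm z \<le> R"
   have "\<bar>src a t z\<bar> \<le> 2 * B1 * s z" unfolding src_def
    by (rule src_le[OF a]) (use j1[OF rng[OF t z]] in \<open>simp_all add: rw t z\<close>)
   then have "\<bar>src a t z\<bar> / s z ^ 3 \<le> 2 * B1 * s z / s z ^ 3" using s(1)[of z] by (intro divide_right_mono) auto
   also have "\<dots> = 2 * B1 * (1 / (s z)^2)" using s(1)[of z] by (simp add: eval_nat_numeral)
   also have "\<dots> \<le> 2 * B1 * (sqrt (R + 1) * w z)" using weights(2)[OF z] B10 by (intro mult_left_mono) auto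
   finally have 1: "\<bar>src a t z / s z ^ 3\<bar> \<le> 2 * B1 * (sqrt (R + 1) * w z)" using s(1)[of z] by simp
   have "\<bar>HI a t z\<bar> \<le> 2 * B1 * (sqrt (R + 1) * w z) + M * \<delta>^2 * w z"
    unfolding HI_def using 1 eps[OF aU(2)[OF t z] z, of 4] by linarith
   then show "\<bar>HI a t z\<bar> \<le> (2 * B1 * sqrt (R + 1) + M * \<delta>^2) * w z" by (simp add: algebra_simps)
  qed (use B10 M0 R in simp)
  also have "\<dots> = 320 * B1 * (sqrt (R + 1) * sqrt R) + 160 * M * (\<delta>^2 * sqrt R)" by (simp add: algebra_simps)
  also have "\<dots> \<le> 320 * B1 * (R + 1) + 160 * M * (\<delta> * (R + 1))"
  proof -
   have "\<delta>^2 \<le> \<delta>" using \<delta> by (simp add: power2_eq_square mult_le_cancel_right1)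
   then have "\<delta>^2 * sqrt R \<le> \<delta> * (R + 1)" using sqR \<delta> by (intro mult_mono) auto
   then show ?thesis using sqR B10 M0 by (intro add_mono mult_left_mono) auto
  qed
  finally show ?thesis by (simp add: ac_simps)
 qed
 \<comment> \<open>Both times use the same kernels, so the sources enter only through their time
   differences, of size B2 \<delta>. The terms with \<epsilon> are not differenced; each is small by
   itself.\<close>
 have Gb: "\<bar>integral UNIV (\<lambda>z. GI a t1 z - GI a t0 z)\<bar> \<le> \<delta> * (480 * B2 * (R + 1)^2 + 960 * M * \<delta> * (R + 1))"
 proof -
  have cs: "cs R (\<lambda>z. GI a t1 z - GI a t0 z)"
   using csI_all(3)[OF t1, of a] csI_all(3)[OF t0', of a] by (auto simp: cs_def intro!: continuous_intros)
  have "\<bar>integral UNIV (\<lambda>z. GI a t1 z - GI a t0 z)\<bar> \<le> 160 * (3 * (B2 * \<delta>) * ((R + 1) * sqrt (R + 1)) + 6 * (M * \<delta>^2)) * sqrt R"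
  proof (rule weight_bound[OF cs])
   fix z :: vec3 assume z: "norm z \<le> R"
   have d: "norm (ret j t1 z - ret j t0 z) \<le> B2 * \<delta>" "norm (ret k t1 z - ret k t0 z) \<le> B2 * \<delta>" "\<bar>ret \<rho> t1 z - ret \<rho> t0 z\<bar> \<le> B2 * \<delta>"
    using j2[of "t0 - s z" "t1 - s z" "x0 + z"] rng[OF t1 z] rng[OF t0' z] \<delta>(1,2) t1 t0' z by (simp_all add: rw) (simp_all add: t1_def)
   have "\<bar>a \<bullet> ret j t1 z / s z - a \<bullet> ret j t0 z / s z\<bar> = \<bar>a \<bullet> (ret j t1 z - ret j t0 z)\<bar> * (1 / s z)"
    using s(1)[of z] by (simp add: inner_diff_right diff_divide_distrib[symmetric])
   also have "\<dots> \<le> (B2 * \<delta>) * ((R + 1) * sqrt (R + 1) * w z)"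
    using inner_le[OF a d(1)] weights(1)[OF z] s(1)[of z] B20 \<delta> by (intro mult_mono) auto
   finally have 1: "\<bar>a \<bullet> ret j t1 z / s z - a \<bullet> ret j t0 z / s z\<bar> \<le> (B2 * \<delta>) * ((R + 1) * sqrt (R + 1) * w z)" .
   have "src a t1 z - src a t0 z = (a \<bullet> z) * (ret \<rho> t1 z - ret \<rho> t0 z) + a \<bullet> cross3 z (ret k t1 z - ret k t0 z)"
    by (simp add: src_def bounded_bilinear.diff_right[OF bounded_bilinear_cross3] inner_diff_right right_diff_distrib)
   then have sd: "\<bar>src a t1 z - src a t0 z\<bar> \<le> 2 * (B2 * \<delta>) * s z" using src_le[OF a d(3) d(2), of z] by simp
   have "\<bar>src a t1 z / (s z)^2 - src a t0 z / (s z)^2\<bar> = \<bar>src a t1 z - src a t0 z\<bar> / (s z)^2"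
    by (simp add: diff_divide_distrib[symmetric])
   also have "\<dots> \<le> 2 * (B2 * \<delta>) * s z / (s z)^2" by (intro divide_right_mono sd) simp
   also have "\<dots> = 2 * (B2 * \<delta>) * (1 / s z)" using s(1)[of z] by (simp add: power2_eq_square)
   also have "\<dots> \<le> 2 * (B2 * \<delta>) * ((R + 1) * sqrt (R + 1) * w z)"
    using weights(1)[OF z] B20 \<delta> by (intro mult_left_mono) auto
   finally have 2: "\<bar>src a t1 z / (s z)^2 - src a t0 z / (s z)^2\<bar> \<le> 2 * (B2 * \<delta>) * ((R + 1) * sqrt (R + 1) * w z)" .
   note 3 = eps[OF aU(2)[OF t1 z] z, of 3] eps[OF aU(2)[OF t0' z] z, of 3] eps[OF aU(1)[OF t1 z] z, of 4] eps[OF aU(1)[OF t0' z] z, of 4]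
   have comb: "\<bar>(j1 + s1 + e1 + 2 * f1) - (j0 + s0 + e0 + 2 * f0)\<bar> \<le> A + 2 * A + 6 * C"
    if "\<bar>j1 - j0\<bar> \<le> A" "\<bar>s1 - s0\<bar> \<le> 2 * A" "\<bar>e1\<bar> \<le> C" "\<bar>e0\<bar> \<le> C" "\<bar>f1\<bar> \<le> C" "\<bar>f0\<bar> \<le> C" for j1 s1 e1 f1 j0 s0 e0 f0 A C :: real
    using that by linarith
   have "\<bar>GI a t1 z - GI a t0 z\<bar> \<le> (B2 * \<delta>) * ((R + 1) * sqrt (R + 1) * w z) + 2 * ((B2 * \<delta>) * ((R + 1) * sqrt (R + 1) * w z)) + 6 * (M * \<delta>^2 * w z)"
    unfolding GI_def by (rule comb) (use 1 2 3 in auto)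
   then show "\<bar>GI a t1 z - GI a t0 z\<bar> \<le> (3 * (B2 * \<delta>) * ((R + 1) * sqrt (R + 1)) + 6 * (M * \<delta>^2)) * w z" by (simp add: algebra_simps)
  qed (use B20 M0 R \<delta> in simp)
  also have "\<dots> = \<delta> * (480 * B2 * ((R + 1) * (sqrt (R + 1) * sqrt R)) + 960 * M * (\<delta> * sqrt R))"
   by (simp add: algebra_simps power2_eq_square)
  also have "\<dots> \<le> \<delta> * (480 * B2 * ((R + 1) * (R + 1)) + 960 * M * (\<delta> * (R + 1)))"
   using sqR B20 M0 R \<delta> by (intro mult_left_mono add_mono) auto
  finally show ?thesis by (simp add: power2_eq_square ac_simps)
 qed
 have "\<exists>t>t0. t < t1 \<and> integral UNIV (PI a t1) - integral UNIV (PI a t0) = (t1 - t0) * integral UNIV (PI' a t)"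
  using MVT2[of t0 t1 "\<lambda>t. integral UNIV (PI a t)" "\<lambda>t. integral UNIV (PI' a t)"] PI_deriv t1 \<delta> by (auto simp: t1_def)
 then obtain ts where ts: "t0 < ts" "ts < t1" and mv: "integral UNIV (PI a t1) - integral UNIV (PI a t0) = \<delta> * integral UNIV (PI' a ts)"
  by (auto simp: t1_def)
 have tsr: "t0 - 1 < ts" "ts < t0 + 2" using ts t1 by auto
 have "integral UNIV (\<lambda>z. GI a t1 z - GI a t0 z) = integral UNIV (GI a t1) - integral UNIV (GI a t0)"
  by (rule integral_diff) (use csI_all(3)[OF t1, THEN cs_integrable] csI_all(3)[OF t0', THEN cs_integrable] in auto)
 then have "\<bar>\<delta> * integral UNIV (PI' a ts)\<bar> \<le> \<delta> * (480 * B2 * (R + 1)^2 + 960 * M * \<delta> * (R + 1))"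
  using Gb mv by (simp add: PI_eq t1 t0' abs_minus_commute)
 then have PI'b: "\<bar>integral UNIV (PI' a ts)\<bar> \<le> 480 * B2 * (R + 1)^2 + 960 * M * \<delta> * (R + 1)"
  using \<delta> by (simp add: abs_mult)
 have Qb: "\<bar>integral UNIV (QI a ts)\<bar> \<le> 480 * B2 * (R + 1)^2 + 960 * M * \<delta> * (R + 1) + (320 * B1 * (R + 1) + 160 * M * \<delta> * (R + 1))"
  using PI'b Hb[OF tsr] unfolding QI_eq[OF tsr] by linarith
 define c where "c = a \<bullet> U ts x0"
 have K: "(\<lambda>z. 3 * \<epsilon>^2 / s z ^ 5) integrable_on bx R"
  unfolding bx_def by (intro integrable_continuous continuous_intros s_cont) (use s(1) in \<open>auto simp: less_imp_neq[symmetric]\<close>)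
 \<comment> \<open>\<open>U\<close> is frozen at \<open>(ts, x0)\<close>. Over the hyperboloid it
   varies by at most 2 M s, which lowers the kernel \<epsilon>^2 / s^5 to \<epsilon>^2 / s^4, and
   that is dominated by \<delta>^2 times the weight.\<close>
 have diff: "\<bar>integral (bx R) (\<lambda>z. QI a ts z - 3 * \<epsilon>^2 / s z ^ 5 * c)\<bar> \<le> 960 * M * \<delta> * (R + 1)"
 proof -
  have "norm (integral (bx R) (\<lambda>z. QI a ts z - 3 * \<epsilon>^2 / s z ^ 5 * c)) \<le> integral (bx R) (\<lambda>z. 6 * M * \<delta>^2 * w z)"
  proof (rule integral_norm_bound_integral)
   show "(\<lambda>z. QI a ts z - 3 * \<epsilon>^2 / s z ^ 5 * c) integrable_on bx R"
    using cs_has_integral_bx(1)[OF csI_all(5)[OF tsr] order_refl] by (intro integrable_diff integrable_on_mult_left K) blast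
   show "(\<lambda>z. 6 * M * \<delta>^2 * w z) integrable_on bx R" using integrable_on_mult_right[OF w_integrable] by blast
   fix z :: vec3
   have l: "\<bar>a \<bullet> ret U ts z - c\<bar> \<le> 2 * M * s z"
   proof (cases "norm z \<le> R")
    case True
    have "norm (U (ts - s z) (x0 + z) - U ts x0) \<le> M * (s z + norm z)"
     using M2[of "ts - s z" ts "x0 + z"] rng[OF tsr True] s(1)[of z] True tsr by simp
    also have "\<dots> \<le> M * (s z + s z)" using s(3)[of z] M0 by (intro mult_left_mono) auto
    finally have "norm (ret U ts z - U ts x0) \<le> 2 * M * s z" using rw[OF tsr(1) True, of U] by simp
    from inner_le[OF a this] show ?thesis by (simp add: c_def inner_diff_right)
   next
    case False
    then have "1 \<le> s z" using R s(3)[of z] by linarith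
    moreover have "\<bar>c\<bar> \<le> M" unfolding c_def using M1[of ts x0] tsr R by (intro inner_le[OF a]) auto
    moreover have "ret U ts z = 0" using False by (intro ret_zero[OF C1v_Cv(1)[OF vU] tsr(2)]) simp
    moreover have "M * 1 \<le> M * s z" using M0 \<open>1 \<le> s z\<close> by (intro mult_left_mono)
    ultimately show ?thesis using M0 by auto
   qed
   have "\<bar>QI a ts z - 3 * \<epsilon>^2 / s z ^ 5 * c\<bar> = 3 * \<epsilon>^2 / s z ^ 5 * \<bar>a \<bullet> ret U ts z - c\<bar>"
    using s(1)[of z] by (simp only: QI_def right_diff_distrib[symmetric] abs_mult) simp
   also have "\<dots> \<le> 3 * \<epsilon>^2 / s z ^ 5 * (2 * M * s z)" using s(1)[of z] l by (intro mult_left_mono) auto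
   also have "\<dots> = 6 * M * (\<epsilon>^2 / s z ^ 4)" using s(1)[of z] by (simp add: eval_nat_numeral)
   also have "\<dots> \<le> 6 * M * (\<delta>^2 * w z)"
   proof -
    have "\<epsilon>^2 / s z ^ 4 \<le> \<delta>^2 * w z" using weights_eps(2)[of z] by (simp add: e)
    then show ?thesis using M0 by (intro mult_left_mono) auto
   qed
   finally show "norm (QI a ts z - 3 * \<epsilon>^2 / s z ^ 5 * c) \<le> 6 * M * \<delta>^2 * w z" by (simp add: ac_simps)
  qed
  also have "\<dots> = 6 * M * \<delta>^2 * integral (bx R) w" by simp
  also have "\<dots> \<le> 6 * M * \<delta>^2 * (160 * sqrt R)" using w_integral[of R] R M0 by (intro mult_left_mono) auto
  also have "\<dots> \<le> 960 * M * (\<delta> * (R + 1))"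
  proof -
   have "\<delta>^2 \<le> \<delta>" using \<delta> by (simp add: power2_eq_square mult_le_cancel_right1)
   then have "\<delta>^2 * sqrt R \<le> \<delta> * (R + 1)" using sqR \<delta> by (intro mult_mono) auto
   then have "960 * M * (\<delta>^2 * sqrt R) \<le> 960 * M * (\<delta> * (R + 1))" using M0 by (intro mult_left_mono) auto
   then show ?thesis by (simp add: ac_simps)
  qed
  finally show ?thesis by (simp add: ac_simps)
 qed
 have "integral (bx R) (\<lambda>z. QI a ts z - 3 * \<epsilon>^2 / s z ^ 5 * c) = integral (bx R) (QI a ts) - integral (bx R) (\<lambda>z. 3 * \<epsilon>^2 / s z ^ 5 * c)"
  using cs_has_integral_bx(1)[OF csI_all(5)[OF tsr] order_refl] by (intro integral_diff integrable_on_mult_left K) blast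
 also have "\<dots> = integral UNIV (QI a ts) - integral (bx R) (\<lambda>z. 3 * \<epsilon>^2 / s z ^ 5) * c"
  using cs_integral_bx[OF csI_all(5)[OF tsr] order_refl] by (simp only: integral_mult_left)
 finally have "\<bar>integral (bx R) (\<lambda>z. 3 * \<epsilon>^2 / s z ^ 5) * c\<bar> \<le> \<bar>integral UNIV (QI a ts)\<bar> + 960 * M * \<delta> * (R + 1)"
  using diff by linarith
 moreover have "3 / 4 * \<bar>c\<bar> \<le> \<bar>integral (bx R) (\<lambda>z. 3 * \<epsilon>^2 / s z ^ 5) * c\<bar>"
  unfolding abs_mult using mass_lower by (intro mult_right_mono) auto
 \<comment> \<open>2080 = 960 + 160 + 960: the first two from \<open>Qb\<close>, the last from
   \<open>diff\<close>.\<close>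
 ultimately have cb: "3 / 4 * \<bar>c\<bar> \<le> 480 * B2 * (R + 1)^2 + 320 * B1 * (R + 1) + 2080 * (M * \<delta> * (R + 1))"
  using Qb by simp
 have "norm (U t0 x0 - U ts x0) \<le> M * (ts - t0)" using M2[of t0 ts x0] ts tsr R by simp
 also have "\<dots> \<le> M * \<delta>" using ts M0 by (intro mult_left_mono) (auto simp: t1_def)
 finally have "\<bar>a \<bullet> (U t0 x0 - U ts x0)\<bar> \<le> M * \<delta>" by (rule inner_le[OF a])
 also have "\<dots> * 1 \<le> M * \<delta> * (R + 1)" using M0 \<delta> R by (intro mult_left_mono) auto
 finally have "\<bar>a \<bullet> U t0 x0\<bar> \<le> \<bar>c\<bar> + M * \<delta> * (R + 1)" by (simp add: c_def inner_diff_right)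
 with cb have "3 / 4 * \<bar>a \<bullet> U t0 x0\<bar> \<le> 480 * B2 * (R + 1)^2 + 320 * B1 * (R + 1) + 2081 * (M * \<delta> * (R + 1))"
  using mult_nonneg_nonneg[OF mult_nonneg_nonneg[OF M0 less_imp_le[OF \<delta>(1)]], of "R + 1"] R(2) by linarith
 also have "\<dots> \<le> 480 * B2 * (R + 1)^2 + 320 * B1 * (R + 1) + 4000 * (M * \<delta> * (R + 1))"
  using M0 \<delta> R by simp
 finally show ?thesis by (simp add: ac_simps)
qed

end

section \<open>Removing the smoothing\<close>

lemma le_of_small_multiples:
 fixes x A C :: real
 assumes "\<And>\<delta>. 0 < \<delta> \<Longrightarrow> \<delta> \<le> 1 \<Longrightarrow> x \<le> A + C * \<delta>" "0 \<le> C"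
 shows "x \<le> A"
proof (rule field_le_epsilon)
 fix e :: real assume e: "0 < e"
 define \<delta> where "\<delta> = min 1 (e / (C + 1))"
 have "x \<le> A + C * \<delta>" by (rule assms(1)) (use e assms(2) in \<open>auto simp: \<delta>_def\<close>)
 moreover have "C * \<delta> \<le> C * (e / (C + 1))" using assms(2) by (intro mult_left_mono) (auto simp: \<delta>_def)
 moreover have "C * (e / (C + 1)) \<le> e" using assms(2) e by (simp add: field_simps)
 ultimately show "x \<le> A + e" by linarith
qed

context maxwell begin

text \<open>A purely qualitative bound by compactness: \<open>M\<close> depends on the point and
  carries no decay. In \<open>cone_inequality\<close> it is multiplied by \<delta> and disappears in
  the limit.\<close>

lemma local_bounds:
 assumes t: "0 < a"
 obtains M where "\<And>\<tau> x. a \<le> \<tau> \<Longrightarrow> \<tau> \<le> b \<Longrightarrow> norm (x - x0) \<le> r \<Longrightarrow> norm (U \<tau> x) \<le> M \<and> norm (dt U \<tau> x) \<le> M"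
  and "\<And>\<tau> \<tau>' x. a \<le> \<tau> \<Longrightarrow> \<tau> \<le> \<tau>' \<Longrightarrow> \<tau>' \<le> b \<Longrightarrow> 0 \<le> r \<Longrightarrow> norm (x - x0) \<le> r \<Longrightarrow>
   norm (U \<tau> x - U \<tau>' x0) \<le> M * (\<tau>' - \<tau> + norm (x - x0))"
proof -
 define K where "K = {a..b} \<times> cball x0 r"
 have vU: "C1v L U" using CU vanishU by (auto simp: C1v_def)
 have Kc: "compact K" "convex K" by (auto simp: K_def intro: compact_Times convex_Times)
 have K0: "K \<subseteq> {z. 0 < fst z}" using t by (auto simp: K_def)
 have bd: "\<exists>M\<ge>0. \<forall>z\<in>K. norm (f z) \<le> M" if "continuous_on {z. 0 < fst z} f" for f :: "real \<times> vec3 \<Rightarrow> vec3"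
 proof -
  have "compact (f ` K)" by (rule compact_continuous_image[OF continuous_on_subset[OF that K0] Kc(1)])
  then obtain M where "\<forall>y\<in>f ` K. norm y \<le> M" using compact_imp_bounded bounded_iff by blast
  then show ?thesis by (intro exI[of _ "max M 0"]) force
 qed
 obtain M0 where M0: "0 \<le> M0" "\<forall>z\<in>K. norm (U (fst z) (snd z)) \<le> M0" using bd[OF C1v_continuous(1)[OF vU]] by blast
 obtain M1 where M1: "0 \<le> M1" "\<forall>z\<in>K. norm (dt U (fst z) (snd z)) \<le> M1" using bd[OF C1v_continuous(2)[OF vU]] by blast
 have "\<forall>i::3. \<exists>M. 0 \<le> M \<and> (\<forall>z\<in>K. norm (dx i U (fst z) (snd z)) \<le> M)"
  using bd[OF C1v_continuous(3)[OF vU]] by blast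
 from choice[OF this] obtain M2 where M2: "\<And>i::3. 0 \<le> M2 i \<and> (\<forall>z\<in>K. norm (dx i U (fst z) (snd z)) \<le> M2 i)" by blast
 define M where "M = M0 + M1 + (\<Sum>i\<in>UNIV. M2 i)"
 have M2s: "0 \<le> (\<Sum>i\<in>UNIV. M2 i)" using M2 by (intro sum_nonneg) auto
 have lip: "norm (U (fst z) (snd z) - U (fst y) (snd y)) \<le> M * norm (z - y)" if "z \<in> K" "y \<in> K" for z y
 proof (rule differentiable_bound[where f = "unc U"
    and f' = "\<lambda>z. tx_deriv U (fst z) (snd z)", OF Kc(2) _ _ that])
  fix z assume z: "z \<in> K"
  then have "0 < fst z" using K0 by auto
  from C1v_deriv[OF vU this, of "snd z"]
  show "(unc U has_derivative (tx_deriv U (fst z) (snd z))) (at z within K)"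
   unfolding prod.collapse by (rule has_derivative_at_withinI)
  show "onorm (tx_deriv U (fst z) (snd z)) \<le> M"
  proof (rule onorm_le)
   fix h :: "real \<times> vec3"
   have 1: "norm (fst h *\<^sub>R dt U (fst z) (snd z)) \<le> norm h * M1"
    unfolding norm_scaleR using M1 z norm_fst_snd_le(1)[of h] by (intro mult_mono) auto
   have "norm (\<Sum>i\<in>UNIV. (snd h $ i) *\<^sub>R dx i U (fst z) (snd z)) \<le> (\<Sum>i\<in>UNIV. norm h * M2 i)"
   proof (rule sum_norm_le)
    fix i :: 3
    have "\<bar>snd h $ i\<bar> \<le> norm h" using component_le_norm_cart[of "snd h" i] norm_fst_snd_le(2)[of h] by linarith
    then show "norm ((snd h $ i) *\<^sub>R dx i U (fst z) (snd z)) \<le> norm h * M2 i"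
     unfolding norm_scaleR using M2[of i] z by (intro mult_mono) auto
   qed
   also have "\<dots> = norm h * (\<Sum>i\<in>UNIV. M2 i)" by (rule sum_distrib_left[symmetric])
   finally have "norm (tx_deriv U (fst z) (snd z) h)
    \<le> norm h * M1 + norm h * (\<Sum>i\<in>UNIV. M2 i)" using 1 by (intro norm_triangle_le) linarith
   also have "\<dots> \<le> M * norm h" using M0(1) by (simp add: M_def algebra_simps)
   finally show "norm (tx_deriv U (fst z) (snd z) h) \<le> M * norm h" .
  qed
 qed
 show thesis
 proof (rule that[of M])
  fix \<tau> x assume h: "a \<le> \<tau>" "\<tau> \<le> b" "norm (x - x0) \<le> r"
  then have "(\<tau>, x) \<in> K" by (simp add: K_def dist_norm norm_minus_commute)
  then have "norm (U \<tau> x) \<le> M0" "norm (dt U \<tau> x) \<le> M1" using M0(2) M1(2) by auto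
  then show "norm (U \<tau> x) \<le> M \<and> norm (dt U \<tau> x) \<le> M" using M0(1) M1(1) M2s by (simp add: M_def)
 next
  fix \<tau> \<tau>' x assume h: "a \<le> \<tau>" "\<tau> \<le> \<tau>'" "\<tau>' \<le> b" "0 \<le> r" "norm (x - x0) \<le> r"
  then have k: "(\<tau>, x) \<in> K" "(\<tau>', x0) \<in> K" by (simp_all add: K_def dist_norm norm_minus_commute)
  have "norm (U \<tau> x - U \<tau>' x0) \<le> M * norm ((\<tau>, x) - (\<tau>', x0))" using lip[OF k] by simp
  also have "\<dots> \<le> M * (norm (\<tau> - \<tau>') + norm (x - x0))"
   using norm_Pair_le[of "\<tau> - \<tau>'" "x - x0"] M0(1) M1(1) M2s by (intro mult_left_mono) (simp_all add: M_def)
  finally show "norm (U \<tau> x - U \<tau>' x0) \<le> M * (\<tau>' - \<tau> + norm (x - x0))" using h by simp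
 qed
qed

text \<open>\<open>a\<close> is taken as the direction of the field, so that the component estimate
  bounds the norm. Division by 3/4 turns 480 into 640 and leaves 320 below it.\<close>

lemma field_estimate:
 assumes far: "norm x0 + L + 8 \<le> t0" and R: "R = (t0 + 2 + norm x0 + L) / 2"
  and j1: "\<And>\<tau> x. t0 - R - 2 \<le> \<tau> \<Longrightarrow> \<tau> \<le> t0 + 2 \<Longrightarrow> norm (j \<tau> x) \<le> B1 \<and> norm (k \<tau> x) \<le> B1 \<and> \<bar>\<rho> \<tau> x\<bar> \<le> B1"
  and j2: "\<And>\<tau> \<tau>' x. t0 - R - 2 \<le> \<tau> \<Longrightarrow> \<tau> \<le> \<tau>' \<Longrightarrow> \<tau>' \<le> t0 + 2 \<Longrightarrow>
   norm (j \<tau>' x - j \<tau> x) \<le> B2 * (\<tau>' - \<tau>) \<and> norm (k \<tau>' x - k \<tau> x) \<le> B2 * (\<tau>' - \<tau>) \<and> \<bar>\<rho> \<tau>' x - \<rho> \<tau> x\<bar> \<le> B2 * (\<tau>' - \<tau>)"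
 shows "norm (U t0 x0) \<le> 640 * (B1 * (R + 1) + B2 * (R + 1)^2)"
proof -
 have mp: "maxwell_point U V j k \<rho> L x0 t0 \<epsilon>" if "0 < \<epsilon>" "\<epsilon> \<le> 1" for \<epsilon>
  using that by (intro maxwell_point.intro maxwell_axioms cone_point.intro L far)
 have cp: "cone_point L x0 t0 1" by (intro cone_point.intro L far) auto
 have RR: "cone_point.R L x0 t0 = R" using cone_point.R_def[OF cp] R by simp
 have R1: "1 \<le> R" "0 < t0 - R - 2" using cone_point.R[OF cp] RR by auto
 obtain M where M: "\<And>\<tau> x. t0 - R - 2 \<le> \<tau> \<Longrightarrow> \<tau> \<le> t0 + 2 \<Longrightarrow> norm (x - x0) \<le> R \<Longrightarrow> norm (U \<tau> x) \<le> M \<and> norm (dt U \<tau> x) \<le> M"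
  "\<And>\<tau> \<tau>' x. t0 - R - 2 \<le> \<tau> \<Longrightarrow> \<tau> \<le> \<tau>' \<Longrightarrow> \<tau>' \<le> t0 + 2 \<Longrightarrow> 0 \<le> R \<Longrightarrow> norm (x - x0) \<le> R \<Longrightarrow>
   norm (U \<tau> x - U \<tau>' x0) \<le> M * (\<tau>' - \<tau> + norm (x - x0))"
  by (rule local_bounds[OF R1(2), of "t0 + 2" x0 R]) blast
 have M0: "0 \<le> M" using M(1)[of t0 x0] R1 norm_ge_zero[of "U t0 x0"] by (smt (verit) diff_self norm_zero)
 define a where "a = sgn (U t0 x0)"
 have a: "norm a \<le> 1" "a \<bullet> U t0 x0 = norm (U t0 x0)"
  by (cases "U t0 x0 = 0"; simp add: a_def sgn_div_norm power2_norm_eq_inner[symmetric] power2_eq_square)+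
 have "3 / 4 * norm (U t0 x0) \<le> 320 * B1 * (R + 1) + 480 * B2 * (R + 1)^2"
 proof (rule le_of_small_multiples)
  fix \<delta> :: real assume \<delta>: "0 < \<delta>" "\<delta> \<le> 1"
  have "0 < \<delta> ^ 4" "\<delta> ^ 4 \<le> 1" using \<delta> by (auto intro: power_le_one)
  from maxwell_point.cone_inequality[OF mp[OF this] a(1) \<delta> refl, unfolded RR, OF j1 j2 M(1) M(2)]
  have "3 / 4 * \<bar>a \<bullet> U t0 x0\<bar> \<le> 320 * B1 * (R + 1) + 480 * B2 * (R + 1)^2 + 4000 * (R + 1) * M * \<delta>"
   using R1(1) by simp
  then show "3 / 4 * norm (U t0 x0) \<le> 320 * B1 * (R + 1) + 480 * B2 * (R + 1)^2 + (4000 * (R + 1) * M) * \<delta>"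
   by (simp add: a(2))
 qed (use M0 R1 in simp)
 moreover have "0 \<le> B1 * (R + 1)"
  using j1[of t0 x0] R1 abs_ge_zero[of "\<rho> t0 x0"] by (intro mult_nonneg_nonneg) linarith+
 ultimately show ?thesis by (simp add: algebra_simps)
qed

end

section \<open>Decay of charge, current and fields\<close>

definition lp :: "nat \<Rightarrow> nat \<Rightarrow> real \<Rightarrow> real" where "lp n k t = ln t ^ n / t ^ k"

lemma lp_nonneg: "1 \<le> t \<Longrightarrow> 0 \<le> lp n k t" by (simp add: lp_def)

lemma lp_tendsto: "0 < k \<Longrightarrow> (lp n k \<longlongrightarrow> 0) at_top"
proof (rule Lim_null_comparison)
 assume k: "0 < k"
 show "((\<lambda>t::real. ln t ^ n / exp (ln t)) \<longlongrightarrow> 0) at_top"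
  using filterlim_compose[OF tendsto_power_div_exp_0[of n] ln_at_top] by simp
 show "eventually (\<lambda>t. norm (lp n k t) \<le> ln t ^ n / exp (ln t)) at_top"
  using eventually_ge_at_top[of 1]
 proof eventually_elim
  case (elim t)
  have "t \<le> t ^ k" using elim k self_le_power[of t k] by simp
  then have "ln t ^ n / t ^ k \<le> ln t ^ n / t" using elim by (intro divide_left_mono) auto
  then show ?case using elim lp_nonneg[of t n k] by (simp add: lp_def)
 qed
qed

text \<open>Once \<open>ln t\<close> is at least 2 n, differentiating the logarithm costs at most
  half of what the power of \<open>t\<close> loses. So \<open>- 2 * lp n k\<close> has derivative at
  least \<open>lp n (Suc k)\<close>, and this serves as a majorant in place of exact integrals of
  logarithmic powers.\<close>

lemma lp_deriv:
 assumes t: "exp (2 * real n) \<le> t" and k: "0 < k"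
 obtains d where "(lp n k has_real_derivative d) (at t)" "d \<le> - (lp n (Suc k) t / 2)"
proof -
 have t1: "1 \<le> t" using t one_le_exp_iff[of "2 * real n"] by linarith
 have l: "2 * real n \<le> ln t" using t t1 by (simp add: ln_ge_iff)
 define d where "d = (real n * ln t ^ (n - 1) - real k * ln t ^ n) / t ^ Suc k"
 have "(lp n k has_real_derivative ((real n * ln t ^ (n - 1) * (1 / t)) * t ^ k - ln t ^ n * (real k * t ^ (k - 1))) / (t ^ k * t ^ k)) (at t)"
  unfolding lp_def[abs_def] using t1 by (intro DERIV_divide derivative_eq_intros) auto
 moreover have "((real n * ln t ^ (n - 1) * (1 / t)) * t ^ k - ln t ^ n * (real k * t ^ (k - 1))) / (t ^ k * t ^ k) = d"
 proof -
  have "t ^ k = t * t ^ (k - 1)" using k by (cases k) auto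
  then show ?thesis using t1 by (simp add: d_def field_simps)
 qed
 ultimately have 1: "(lp n k has_real_derivative d) (at t)" by simp
 have "real n * ln t ^ (n - 1) \<le> ln t ^ n / 2"
 proof (cases n)
  case (Suc l')
  have "(2 * real n) * ln t ^ l' \<le> ln t * ln t ^ l'" using l t1 by (intro mult_right_mono) auto
  moreover have "ln t ^ n = ln t * ln t ^ l'" "n - 1 = l'" using Suc by auto
  ultimately show ?thesis by (simp only: mult.assoc)
 qed simp
 moreover have "1 * ln t ^ n \<le> real k * ln t ^ n" using k t1 by (intro mult_right_mono) auto
 ultimately have "real n * ln t ^ (n - 1) - real k * ln t ^ n \<le> - (ln t ^ n / 2)" by simp
 then have "d \<le> - (ln t ^ n / 2) / t ^ Suc k" unfolding d_def using t1 by (intro divide_right_mono) auto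
 then have "d \<le> - (lp n (Suc k) t / 2)" by (simp add: lp_def)
 with 1 show thesis by (rule that)
qed

lemma log_decay_increment:
 fixes f :: "real \<Rightarrow> 'a::real_normed_vector"
 assumes d: "\<And>t. T \<le> t \<Longrightarrow> (f has_vector_derivative f' t) (at t)"
  and b: "\<And>t. T \<le> t \<Longrightarrow> norm (f' t) \<le> K * lp n (Suc k) t"
  and T: "exp (2 * real n) \<le> T" and k: "0 < k" and ts: "T \<le> t" "t \<le> s"
  and K: "0 \<le> K"
 shows "norm (f s - f t) \<le> 2 * K * lp n k t"
proof -
 have T1: "1 \<le> T" using T one_le_exp_iff[of "2 * real n"] by linarith
 have fT: "0 \<le> K * lp n k u" if "T \<le> u" for u using K lp_nonneg[of u n k] that T1 by simp
 have "\<exists>d. (lp n k has_real_derivative d) (at u) \<and> d \<le> - (lp n (Suc k) u / 2)" if "T \<le> u" for u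
  using lp_deriv[of n u k] that T k by (metis order_trans)
 then obtain D where D: "\<And>u. T \<le> u \<Longrightarrow> (lp n k has_real_derivative D u) (at u)" "\<And>u. T \<le> u \<Longrightarrow> D u \<le> - (lp n (Suc k) u / 2)"
  by metis
 show ?thesis
 proof (cases "t = s")
  case False
  have "norm (f s - f t) \<le> (- (2 * K * lp n k s)) - (- (2 * K * lp n k t))"
  proof (rule differentiable_bound_general)
   show "t < s" using ts False by simp
   show "continuous_on {t..s} f"
    using has_vector_derivative_continuous[OF d] ts by (intro continuous_at_imp_continuous_on) auto
   have "isCont (lp n k) u" if "u \<in> {t..s}" for u using D(1)[of u] that ts DERIV_isCont by auto
   then show "continuous_on {t..s} (\<lambda>u. - (2 * K * lp n k u))"
    by (intro continuous_on_minus continuous_on_mult_left) (auto intro: continuous_at_imp_continuous_on)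
   fix u assume u: "t < u" "u < s"
   show "(f has_vector_derivative f' u) (at u)" using d u ts by simp
   have "((\<lambda>u. - (2 * K * lp n k u)) has_real_derivative - (2 * K * D u)) (at u)"
    using D(1)[of u] u ts by (intro DERIV_minus DERIV_cmult) auto
   then show "((\<lambda>u. - (2 * K * lp n k u)) has_vector_derivative - (2 * K * D u)) (at u)"
    by (simp add: has_real_derivative_iff_has_vector_derivative)
   have "2 * K * D u \<le> 2 * K * (- (lp n (Suc k) u / 2))" using D(2)[of u] K u ts by (intro mult_left_mono) auto
   then show "norm (f' u) \<le> - (2 * K * D u)" using b[of u] u ts by simp
  qed
  then show ?thesis using fT[of s] ts by simp
 qed (use fT[of t] ts in simp)
qed

text \<open>The increments are bounded by a quantity that tends to zero. The limit is produced along
  the sequence \<open>T + real i\<close>, and the bound then extends the convergence to all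
  times.\<close>

lemma log_decay:
 fixes f :: "real \<Rightarrow> 'a::banach"
 assumes d: "\<And>t. T \<le> t \<Longrightarrow> (f has_vector_derivative f' t) (at t)"
  and b: "\<And>t. T \<le> t \<Longrightarrow> norm (f' t) \<le> K * lp n (Suc k) t"
  and T: "exp (2 * real n) \<le> T" and k: "0 < k" and K: "0 \<le> K"
 obtains c where "(f \<longlongrightarrow> c) at_top" "\<And>t. T \<le> t \<Longrightarrow> norm (f t - c) \<le> 2 * K * lp n k t"
proof -
 have inc: "norm (f s - f t) \<le> 2 * K * lp n k t" if "T \<le> t" "t \<le> s" for s t
  by (rule log_decay_increment[where f' = f', OF d b T k that K])
 have lim: "((\<lambda>t. 2 * K * lp n k t) \<longlongrightarrow> 0) at_top" using tendsto_mult[OF tendsto_const[of "2 * K"] lp_tendsto[OF k, of n]] by simp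
 have seq: "filterlim (\<lambda>i. T + real i) at_top sequentially"
  by (rule filterlim_tendsto_add_at_top[OF tendsto_const filterlim_real_sequentially])
 have "Cauchy (\<lambda>i. f (T + real i))"
 proof (rule CauchyI)
  fix e :: real assume "0 < e"
  then have "eventually (\<lambda>i. 2 * K * lp n k (T + real i) < e) sequentially"
   using order_tendstoD(2)[OF filterlim_compose[OF lim seq]] by blast
  then obtain M where M: "\<And>i. M \<le> i \<Longrightarrow> 2 * K * lp n k (T + real i) < e" by (auto simp: eventually_sequentially)
  have "norm (f (T + real i) - f (T + real l)) < e" if "M \<le> i" "M \<le> l" for i l
  proof (cases "i \<le> l")
   case True
   then show ?thesis using inc[of "T + real i" "T + real l"] M[OF that(1)] by (simp add: norm_minus_commute)
  next
   case False
   then show ?thesis using inc[of "T + real l" "T + real i"] M[OF that(2)] by simp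
  qed
  then show "\<exists>M. \<forall>m\<ge>M. \<forall>n\<ge>M. norm (f (T + real m) - f (T + real n)) < e" by blast
 qed
 then obtain c where c: "(\<lambda>i. f (T + real i)) \<longlonglongrightarrow> c" using Cauchy_convergent_iff convergent_def by blast
 have le: "norm (f t - c) \<le> 2 * K * lp n k t" if t: "T \<le> t" for t
 proof (rule tendsto_upperbound)
  show "(\<lambda>i. norm (f t - f (T + real i))) \<longlonglongrightarrow> norm (f t - c)" by (intro tendsto_intros c)
  have "eventually (\<lambda>i. t \<le> T + real i) sequentially" using seq by (simp add: filterlim_at_top)
  then show "eventually (\<lambda>i. norm (f t - f (T + real i)) \<le> 2 * K * lp n k t) sequentially"
   by eventually_elim (use inc[OF t] in \<open>metis norm_minus_commute\<close>)
 qed simp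
 have "((\<lambda>t. f t - c) \<longlongrightarrow> 0) at_top"
 proof (rule Lim_null_comparison[OF _ lim])
  show "eventually (\<lambda>t. norm (f t - c) \<le> 2 * K * lp n k t) at_top"
   using eventually_ge_at_top[of T] by eventually_elim (rule le)
 qed
 then have "(f \<longlongrightarrow> c) at_top" by (simp add: LIM_zero_iff)
 from that[OF this le] show thesis .
qed

section \<open>Momenta along characteristics\<close>

context species begin

lemma char_sol:
 assumes c: "is_char m q E B \<tau> x p X P" and t: "0 \<le> \<tau>"
 shows "sol \<tau> t X P"
 unfolding sol_def force_def
proof
 fix s assume s: "s \<in> {\<tau>..t}"
 then have "{\<tau>..t} \<subseteq> {0..}" "0 \<le> s" using t by auto
 then show "(X has_vector_derivative vel m (P s)) (at s within {\<tau>..t}) \<and>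
  (P has_vector_derivative q *\<^sub>R (E s (X s) + cross3 (vel m (P s)) (B s (X s)))) (at s within {\<tau>..t})"
  using c unfolding is_char_def by (blast intro: has_vector_derivative_within_subset)
qed

text \<open>The support is a closure, so the density may vanish at \<open>(x, p)\<close> itself.
  Approximating points of nonzero density stay in the cone up to time \<open>t\<close>, and
  continuous dependence transfers this to the limit.\<close>

lemma char_support:
 assumes c: "is_char m q E B \<tau> x p X P" and t: "0 \<le> \<tau>" "\<tau> \<le> t" and z: "(x, p) \<in> supp_f g \<tau>"
 shows "norm (X t) \<le> L + \<gamma> * t"
proof -
 obtain zs where zs: "\<And>n::nat. zs n \<in> {z. g \<tau> (fst z) (snd z) \<noteq> 0}" "zs \<longlonglongrightarrow> (x, p)"
  using z unfolding supp_f_def closure_sequential by auto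
 obtain C where C: "\<And>X P X' P' s. sol \<tau> t X P \<and> sol \<tau> t X' P' \<and> s \<in> {\<tau>..t} \<and> 0 \<le> \<tau> \<Longrightarrow>
  norm ((X s, P s) - (X' s, P' s)) \<le> C * norm ((X \<tau>, P \<tau>) - (X' \<tau>, P' \<tau>))"
  using sol_close[of \<tau> t] by blast
 have "\<forall>n. \<exists>Y. sol \<tau> t (\<lambda>s. fst (Y s)) (\<lambda>s. snd (Y s)) \<and> Y \<tau> = zs n"
 proof
  fix n
  obtain X' P' where "sol \<tau> t X' P'" "X' \<tau> = fst (zs n)" "P' \<tau> = snd (zs n)" using sol_forward[OF t] by blast
  then show "\<exists>Y. sol \<tau> t (\<lambda>s. fst (Y s)) (\<lambda>s. snd (Y s)) \<and> Y \<tau> = zs n"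
   by (intro exI[of _ "\<lambda>s. (X' s, P' s)"]) simp
 qed
 from choice[OF this] obtain Y where Y: "\<And>n. sol \<tau> t (\<lambda>s. fst (Y n s)) (\<lambda>s. snd (Y n s))" "\<And>n. Y n \<tau> = zs n" by blast
 have xp: "X \<tau> = x" "P \<tau> = p" using c by (auto simp: is_char_def)
 have b: "norm (fst (Y n t)) \<le> L + \<gamma> * t" for n
 proof -
  have "g t (fst (Y n t)) (snd (Y n t)) \<noteq> 0"
   using g_const[OF Y(1)[of n], of t] t zs(1)[of n] by (simp add: Y(2))
  then show ?thesis using g_x_support[of t "fst (Y n t)" "snd (Y n t)"] t by fastforce
 qed
 have "(\<lambda>n. Y n t - (X t, P t)) \<longlonglongrightarrow> 0"
 proof (rule Lim_null_comparison)
  show "eventually (\<lambda>n. norm (Y n t - (X t, P t)) \<le> C * norm (zs n - (x, p))) sequentially"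
  proof (intro always_eventually allI)
   fix n
   show "norm (Y n t - (X t, P t)) \<le> C * norm (zs n - (x, p))"
    using C[of "\<lambda>s. fst (Y n s)" "\<lambda>s. snd (Y n s)" X P t] Y[of n] char_sol[OF c t(1), of t] t by (simp add: xp)
  qed
  have "(\<lambda>n. C * norm (zs n - (x, p))) \<longlonglongrightarrow> C * norm ((x, p) - (x, p))" by (intro tendsto_intros zs(2))
  then show "(\<lambda>n. C * norm (zs n - (x, p))) \<longlonglongrightarrow> 0" by simp
 qed
 then have l: "(\<lambda>n. Y n t) \<longlonglongrightarrow> (X t, P t)" by (simp add: LIM_zero_iff)
 have "(\<lambda>n. norm (fst (Y n t))) \<longlonglongrightarrow> norm (X t)" using tendsto_norm[OF tendsto_fst[OF l]] by simp
 then show "norm (X t) \<le> L + \<gamma> * t" by (rule tendsto_upperbound) (use b in auto)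
qed

lemma char_decay:
 assumes c: "is_char m q E B \<tau> x p X P" and \<tau>: "0 \<le> \<tau>" and z: "(x, p) \<in> supp_f g \<tau>"
  and b: "\<And>t x. T \<le> t \<Longrightarrow> norm x \<le> (1 + \<gamma>) / 2 * t \<Longrightarrow> norm (E t x) + norm (B t x) \<le> K * (ln t ^ 8 / t ^ 3)"
 shows "\<exists>Pinf. (P \<longlongrightarrow> Pinf) at_top \<and> (\<exists>K. \<forall>\<^sub>F t in at_top. norm (P t - Pinf) \<le> K * (ln t ^ 8 / t ^ 2))"
proof -
 \<comment> \<open>Past \<open>2 * L / (1 - \<gamma>)\<close> the bound L + \<gamma> t is below (1 +
   \<gamma>) t / 2, the cone where the field estimate is assumed. \<open>exp (2 * real 8)\<close> is
   the threshold of \<open>log_decay\<close> for n = 8.\<close>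
 define T' where "T' = Max {T, \<tau>, 2 * L / (1 - \<gamma>), exp (2 * real 8)}"
 have T': "T \<le> T'" "\<tau> \<le> T'" "2 * L / (1 - \<gamma>) \<le> T'" "exp (2 * real 8) \<le> T'" by (auto simp: T'_def)
 have T0: "1 < T'" "0 < T'" using T'(4) exp_ge_add_one_self[of "2 * real 8"] by auto
 have "0 \<le> K * (ln T' ^ 8 / T' ^ 3)" using b[of T' 0] T'(1) T0 \<gamma> by (smt (verit) norm_ge_zero norm_zero mult_nonneg_nonneg divide_nonneg_nonneg)
 moreover have "0 < ln T' ^ 8 / T' ^ 3" using T0 by simp
 ultimately have K: "0 \<le> K" by (metis mult_neg_pos not_le)
 have d: "(P has_vector_derivative force t (X t) (P t)) (at t)" if t: "T' \<le> t" for t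
 proof -
  have "(P has_vector_derivative force t (X t) (P t)) (at t within {0..})"
   using c t T0 by (simp add: is_char_def force_def)
  then have "(P has_vector_derivative force t (X t) (P t)) (at t within {0<..})"
   by (rule has_vector_derivative_within_subset) auto
  then show ?thesis using at_within_open[of t "{0<..}"] t T0 by simp
 qed
 have bd: "norm (force t (X t) (P t)) \<le> (\<bar>q\<bar> * K) * lp 8 (Suc 2) t" if t: "T' \<le> t" for t
 proof -
  have "2 * L / (1 - \<gamma>) \<le> t" using T'(3) t by linarith
  then have "2 * L \<le> (1 - \<gamma>) * t" using \<gamma>(2) by (simp add: pos_divide_le_eq mult.commute)
  then have "L + \<gamma> * t \<le> (1 + \<gamma>) / 2 * t" by (simp add: field_simps)
  then have "norm (X t) \<le> (1 + \<gamma>) / 2 * t" using char_support[OF c \<tau> _ z, of t] t T' by simp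
  then have f: "norm (E t (X t)) + norm (B t (X t)) \<le> K * (ln t ^ 8 / t ^ 3)" using b[of t] t T' by simp
  have "norm (cross3 (vel m (P t)) (B t (X t))) \<le> norm (vel m (P t)) * norm (B t (X t))" by (rule norm_cross3_le)
  also have "\<dots> \<le> 1 * norm (B t (X t))" using norm_vel_less_1[OF m, of "P t"] by (intro mult_right_mono) auto
  finally have "norm (E t (X t) + cross3 (vel m (P t)) (B t (X t))) \<le> K * (ln t ^ 8 / t ^ 3)"
   using f by (intro norm_triangle_le) simp
  then have "\<bar>q\<bar> * norm (E t (X t) + cross3 (vel m (P t)) (B t (X t))) \<le> \<bar>q\<bar> * (K * (ln t ^ 8 / t ^ 3))"
   by (intro mult_left_mono) auto
  then show ?thesis by (simp add: force_def lp_def eval_nat_numeral)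
 qed
 obtain Pinf where P: "(P \<longlongrightarrow> Pinf) at_top" "\<And>t. T' \<le> t \<Longrightarrow> norm (P t - Pinf) \<le> 2 * (\<bar>q\<bar> * K) * lp 8 2 t"
  by (rule log_decay[OF d bd T'(4)]) (use K in auto)
 have "\<forall>\<^sub>F t in at_top. norm (P t - Pinf) \<le> (2 * (\<bar>q\<bar> * K)) * (ln t ^ 8 / t ^ 2)"
  using eventually_ge_at_top[of T'] by eventually_elim (use P(2) in \<open>simp add: lp_def\<close>)
 with P(1) show ?thesis by blast
qed

end

lemma lp_mono: assumes "3 \<le> t" "n \<le> n'" "k' \<le> k" shows "lp n k t \<le> lp n' k' t"
proof -
 have "1 \<le> ln t" using exp_le assms(1) by (simp add: ln_ge_iff)
 then show ?thesis unfolding lp_def using assms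
  by (intro frac_le power_increasing) auto
qed

lemma lp_power: "0 < t \<Longrightarrow> (ln t / t) ^ n = lp n n t" "0 < t \<Longrightarrow> lp n k t * ln t ^ i = lp (n + i) k t" "0 < t \<Longrightarrow> lp n k t / t = lp n (Suc k) t"
 "0 < t \<Longrightarrow> lp n k t / t ^ i = lp n (k + i) t"
 by (simp_all add: lp_def power_divide power_add field_simps)

lemma abs_weighted_sum_le:
 fixes c a k :: "nat \<Rightarrow> real"
 assumes "\<And>\<alpha>. \<alpha> < N \<Longrightarrow> \<bar>a \<alpha>\<bar> \<le> k \<alpha> * b"
 shows "\<bar>\<Sum>\<alpha><N. c \<alpha> * a \<alpha>\<bar> \<le> (\<Sum>\<alpha><N. \<bar>c \<alpha>\<bar> * k \<alpha>) * b"
proof -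
 have "\<bar>\<Sum>\<alpha><N. c \<alpha> * a \<alpha>\<bar> \<le> (\<Sum>\<alpha><N. \<bar>c \<alpha> * a \<alpha>\<bar>)" by (rule sum_abs)
 also have "\<dots> \<le> (\<Sum>\<alpha><N. \<bar>c \<alpha>\<bar> * (k \<alpha> * b))"
  by (intro sum_mono) (use assms in \<open>auto simp: abs_mult intro: mult_left_mono\<close>)
 finally show ?thesis by (simp add: sum_distrib_right mult.assoc)
qed

section \<open>Totals over all species\<close>

locale plasma =
 fixes N :: nat and m e :: "nat \<Rightarrow> real" and L \<beta> K0 :: real and E B :: "real \<Rightarrow> vec3 \<Rightarrow> vec3"
  and f :: "nat \<Rightarrow> real \<Rightarrow> vec3 \<Rightarrow> vec3 \<Rightarrow> real" and f0 :: "nat \<Rightarrow> vec3 \<Rightarrow> vec3 \<Rightarrow> real" and Finf :: "nat \<Rightarrow> vec3 \<Rightarrow> real"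
 assumes sp: "\<And>\<alpha>. \<alpha> < N \<Longrightarrow> species (m \<alpha>) (e \<alpha>) L \<beta> K0 E B (f \<alpha>) (f0 \<alpha>)"
  and L: "0 < L"
  and lim: "\<And>\<alpha>. \<alpha> < N \<Longrightarrow> uniform_limit UNIV (\<lambda>t p. integral UNIV (\<lambda>x. f \<alpha> t x p)) (Finf \<alpha>) at_top"
  and rho_inf_zero: "\<And>y. rho_inf N m e Finf y = 0"
begin

definition tot :: "(nat \<Rightarrow> real) \<Rightarrow> real" where "tot a = (\<Sum>\<alpha><N. e \<alpha> * a \<alpha>)"

definition one :: "nat \<Rightarrow> vec3 \<Rightarrow> real" where "one \<alpha> = (\<lambda>_. 1)"
definition vv :: "3 \<Rightarrow> nat \<Rightarrow> vec3 \<Rightarrow> real" where "vv i \<alpha> = species.vc (m \<alpha>) i"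
definition vw :: "3 \<Rightarrow> 3 \<Rightarrow> nat \<Rightarrow> vec3 \<Rightarrow> real" where "vw i j \<alpha> = (\<lambda>p. species.vc (m \<alpha>) i p * species.vc (m \<alpha>) j p)"

definition TI :: "(nat \<Rightarrow> vec3 \<Rightarrow> real) \<Rightarrow> real \<Rightarrow> vec3 \<Rightarrow> real" where
 "TI \<eta> t x = tot (\<lambda>\<alpha>. species.Iw (f \<alpha>) (\<eta> \<alpha>) t x)"

definition dTI :: "(nat \<Rightarrow> vec3 \<Rightarrow> real) \<Rightarrow> real \<Rightarrow> vec3 \<Rightarrow> real \<times> vec3 \<Rightarrow> real" where
 "dTI \<eta> t x h = tot (\<lambda>\<alpha>. species.dIw (f \<alpha>) (\<eta> \<alpha>) t x h)"

lemma tot_add: "tot (\<lambda>\<alpha>. a \<alpha> + b \<alpha>) = tot a + tot b" and tot_diff: "tot (\<lambda>\<alpha>. a \<alpha> - b \<alpha>) = tot a - tot b"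
 and tot_mult: "tot (\<lambda>\<alpha>. c * a \<alpha>) = c * tot a" and tot_minus: "tot (\<lambda>\<alpha>. - a \<alpha>) = - tot a"
 and tot_sum: "tot (\<lambda>\<alpha>. \<Sum>i\<in>I. d i \<alpha>) = (\<Sum>i\<in>I. tot (d i))"
 and tot_cong: "(\<And>\<alpha>. \<alpha> < N \<Longrightarrow> a \<alpha> = b \<alpha>) \<Longrightarrow> tot a = tot b"
proof -
 show "tot (\<lambda>\<alpha>. \<Sum>i\<in>I. d i \<alpha>) = (\<Sum>i\<in>I. tot (d i))"
  unfolding tot_def by (simp only: sum_distrib_left) (rule sum.swap)
qed (simp_all add: tot_def sum.distrib sum_subtractf sum_distrib_left sum_negf algebra_simps)

lemma weights_cont:
 assumes "\<alpha> < N"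
 shows "continuous_on UNIV (one \<alpha>)" "continuous_on UNIV (vv i \<alpha>)" "continuous_on UNIV (vw i j \<alpha>)"
proof -
 interpret s: species "m \<alpha>" "e \<alpha>" L \<beta> K0 E B "f \<alpha>" "f0 \<alpha>" by (rule sp[OF assms])
 show "continuous_on UNIV (one \<alpha>)" "continuous_on UNIV (vv i \<alpha>)" "continuous_on UNIV (vw i j \<alpha>)"
  unfolding one_def vv_def vw_def by (intro continuous_intros s.vc_cont)+
qed

text \<open>The estimates that pass from one species to charge-weighted sums, each being a bound on
  a quantity that is summed linearly. The function arguments stand, in order, for the time
  derivative of t^3 times the density along a ray, the distance to the spatial average, the centred
  first moment, the gradients of the first and second centred moments, and the force term. Powers
  are rounded to those occurring in the result.\<close>

definition moment_decay where
 "moment_decay K h r v dv dw F \<longleftrightarrow> 0 \<le> K \<and> (\<forall>t\<ge>3. \<forall>(y::vec3) y' (k::vec3) (i::3) (j::3).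
  \<bar>h t y\<bar> \<le> K * lp 6 2 t \<and> \<bar>h t y - h t y'\<bar> \<le> K * (lp 8 2 t * norm (y - y')) \<and> \<bar>r t y\<bar> \<le> K * lp 6 1 t
  \<and> \<bar>v i t y\<bar> \<le> K * lp 6 4 t \<and> \<bar>dv i t y k\<bar> \<le> K * (lp 8 4 t * norm k) \<and> \<bar>dw i j t y k\<bar> \<le> K * (lp 8 4 t * norm k)
  \<and> \<bar>F i t y\<bar> \<le> K * lp 8 5 t)"

definition defect where "defect \<alpha> t y = t ^ 3 * species.Iw (f \<alpha>) (\<lambda>_. 1) t (t *\<^sub>R y) - species.dens (m \<alpha>) (f \<alpha>) t y"

definition thd where "thd t y = tot (\<lambda>\<alpha>. species.hd (f \<alpha>) t y)"
definition tV1 where "tV1 i t y = tot (\<lambda>\<alpha>. species.V1 (m \<alpha>) (f \<alpha>) i t y)"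
definition tdV1 where "tdV1 i t y k = tot (\<lambda>\<alpha>. species.dV1 (m \<alpha>) (f \<alpha>) i t y k)"
definition tdV2 where "tdV2 i j t y k = tot (\<lambda>\<alpha>. species.dV2 (m \<alpha>) (f \<alpha>) i j t y k)"
definition tfrc where "tfrc j t x = tot (\<lambda>\<alpha>. species.frc (m \<alpha>) (e \<alpha>) E B (f \<alpha>) j t x)"

lemma species_decay:
 assumes "\<alpha> < N"
 shows "\<exists>K. moment_decay K (species.hd (f \<alpha>)) (defect \<alpha>) (species.V1 (m \<alpha>) (f \<alpha>))
  (species.dV1 (m \<alpha>) (f \<alpha>)) (species.dV2 (m \<alpha>) (f \<alpha>)) (species.frc (m \<alpha>) (e \<alpha>) E B (f \<alpha>))"
proof -
 interpret s: species "m \<alpha>" "e \<alpha>" L \<beta> K0 E B "f \<alpha>" "f0 \<alpha>" by (rule sp[OF assms])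
 obtain K1 where K1: "0 \<le> K1" "\<And>t y i j k. 3 \<le> t \<Longrightarrow> \<bar>s.V1 i t y\<bar> \<le> K1 * (ln t / t) ^ 4 \<and>
  \<bar>s.dV1 i t y k\<bar> \<le> K1 * (ln t / t) ^ 4 * (ln t)^2 * norm k \<and> \<bar>s.dV2 i j t y k\<bar> \<le> K1 * (ln t / t) ^ 5 * (ln t)^2 * norm k"
  using s.moment_estimates by blast
 obtain K2 where K2: "0 \<le> K2" "\<And>t y y'. 3 \<le> t \<Longrightarrow> \<bar>s.hd t y\<bar> \<le> K2 * lp 6 2 t \<and> \<bar>s.hd t y - s.hd t y'\<bar> \<le> K2 * lp 8 2 t * norm (y - y')"
  using s.hd_estimates unfolding lp_def by blast
 obtain K3 where K3: "0 \<le> K3" "\<And>t y. 3 \<le> t \<Longrightarrow> \<bar>defect \<alpha> t y\<bar> \<le> K3 * lp 6 1 t"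
  using s.dens_limit unfolding lp_def defect_def power_one_right by blast
 obtain K4 where K4: "0 \<le> K4" "\<And>t x j. 3 \<le> t \<Longrightarrow> \<bar>s.frc j t x\<bar> \<le> K4 * (1 / t^2 * (ln t / t) ^ 3)"
  using s.frc_bound by blast
 define K where "K = K1 + K2 + K3 + K4"
 have up: "x \<le> K * c" if "x \<le> k * b" "b \<le> c" "0 \<le> c" "0 \<le> k" "k \<le> K" for x k b c :: real
  using mult_left_mono[OF that(2,4)] mult_right_mono[OF that(5,3)] that(1) by linarith
 have KK: "0 \<le> K" "K1 \<le> K" "K2 \<le> K" "K3 \<le> K" "K4 \<le> K" using K1(1) K2(1) K3(1) K4(1) by (auto simp: K_def)
 show ?thesis unfolding moment_decay_def
 proof (intro exI[of _ K] conjI allI impI KK(1))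
  fix t :: real and y y' k :: vec3 and i j :: 3
  assume t: "3 \<le> t"
  then have t0: "0 < t" by simp
  have l: "0 \<le> lp n k t" for n k using lp_nonneg[of t n k] t by simp
  have 1: "(ln t / t) ^ 4 \<le> lp 6 4 t" "(ln t / t) ^ 4 * (ln t)^2 \<le> lp 8 4 t" "(ln t / t) ^ 5 * (ln t)^2 \<le> lp 8 4 t" "1 / t^2 * (ln t / t) ^ 3 \<le> lp 8 5 t"
   using lp_mono[OF t, of 4 6 4 4] lp_mono[OF t, of 6 8 4 4] lp_mono[OF t, of 7 8 4 5] lp_mono[OF t, of 3 8 5 5] lp_power(4)[OF t0, of 3 3 2]
   by (simp_all add: lp_power[OF t0])
  have m: "a * norm k \<le> b * norm k" if "a \<le> b" for a b using that by (rule mult_right_mono) simp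
  show "\<bar>s.hd t y\<bar> \<le> K * lp 6 2 t" by (rule up[of _ K2]) (use K2 t l KK in auto)
  show "\<bar>s.hd t y - s.hd t y'\<bar> \<le> K * (lp 8 2 t * norm (y - y'))"
   by (rule up[of _ K2 "lp 8 2 t * norm (y - y')"]) (use K2 t l KK in \<open>auto simp: mult.assoc\<close>)
  show "\<bar>defect \<alpha> t y\<bar> \<le> K * lp 6 1 t" by (rule up[of _ K3]) (use K3 t l KK in auto)
  show "\<bar>s.V1 i t y\<bar> \<le> K * lp 6 4 t" by (rule up[of _ K1, OF _ 1(1)]) (use K1 t l KK in auto)
  show "\<bar>s.dV1 i t y k\<bar> \<le> K * (lp 8 4 t * norm k)" by (rule up[of _ K1, OF _ m[OF 1(2)]]) (use K1 t l KK in \<open>auto simp: mult.assoc\<close>)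
  show "\<bar>s.dV2 i j t y k\<bar> \<le> K * (lp 8 4 t * norm k)" by (rule up[of _ K1, OF _ m[OF 1(3)]]) (use K1 t l KK in \<open>auto simp: mult.assoc\<close>)
  show "\<bar>s.frc i t y\<bar> \<le> K * lp 8 5 t" by (rule up[of _ K4, OF _ 1(4)]) (use K4 t l KK in auto)
 qed
qed

lemma tot_decay: obtains K where "moment_decay K thd (\<lambda>t y. tot (\<lambda>\<alpha>. defect \<alpha> t y)) tV1 tdV1 tdV2 tfrc"
proof -
 have "\<forall>\<alpha>. \<exists>K. \<alpha> < N \<longrightarrow> moment_decay K (species.hd (f \<alpha>)) (defect \<alpha>) (species.V1 (m \<alpha>) (f \<alpha>))
  (species.dV1 (m \<alpha>) (f \<alpha>)) (species.dV2 (m \<alpha>) (f \<alpha>)) (species.frc (m \<alpha>) (e \<alpha>) E B (f \<alpha>))"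
  using species_decay by blast
 from choice[OF this] obtain K where K: "\<And>\<alpha>. \<alpha> < N \<Longrightarrow> moment_decay (K \<alpha>) (species.hd (f \<alpha>)) (defect \<alpha>) (species.V1 (m \<alpha>) (f \<alpha>))
  (species.dV1 (m \<alpha>) (f \<alpha>)) (species.dV2 (m \<alpha>) (f \<alpha>)) (species.frc (m \<alpha>) (e \<alpha>) E B (f \<alpha>))" by blast
 note b = K[unfolded moment_decay_def, THEN conjunct2, rule_format]
 show thesis
 proof (rule that[of "\<Sum>\<alpha><N. \<bar>e \<alpha>\<bar> * K \<alpha>"], unfold moment_decay_def, intro conjI allI impI)
  show "0 \<le> (\<Sum>\<alpha><N. \<bar>e \<alpha>\<bar> * K \<alpha>)" using K by (intro sum_nonneg mult_nonneg_nonneg) (auto simp: moment_decay_def)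
 qed ((unfold thd_def tV1_def tdV1_def tdV2_def tfrc_def)?; (unfold tot_diff[symmetric])?; unfold tot_def; rule abs_weighted_sum_le; use b in blast)+
qed

text \<open>The place where the vanishing of \<open>rho_inf\<close> enters: the charge-weighted
  spatial averages converge to it, and \<open>defect\<close> tends to zero.\<close>

lemma H_tendsto: "((\<lambda>t. t ^ 3 * TI one t (t *\<^sub>R y)) \<longlongrightarrow> 0) at_top"
proof -
 obtain K where K: "moment_decay K thd (\<lambda>t y. tot (\<lambda>\<alpha>. defect \<alpha> t y)) tV1 tdV1 tdV2 tfrc" by (rule tot_decay)
 have "((\<lambda>t. tot (\<lambda>\<alpha>. defect \<alpha> t y)) \<longlongrightarrow> 0) at_top"
 proof (rule Lim_null_comparison)
  show "eventually (\<lambda>t. norm (tot (\<lambda>\<alpha>. defect \<alpha> t y)) \<le> K * lp 6 1 t) at_top"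
   using eventually_ge_at_top[of 3] by eventually_elim (use K in \<open>simp add: moment_decay_def\<close>)
  show "((\<lambda>t. K * lp 6 1 t) \<longlongrightarrow> 0) at_top" using tendsto_mult[OF tendsto_const[of K] lp_tendsto[of 1 6]] by simp
 qed
 moreover have "((\<lambda>t. tot (\<lambda>\<alpha>. species.dens (m \<alpha>) (f \<alpha>) t y)) \<longlongrightarrow> rho_inf N m e Finf y) at_top"
 proof (cases "norm y < 1")
  case True
  have "((\<lambda>t. \<Sum>\<alpha><N. e \<alpha> * (Djac (m \<alpha>) (vel_inv (m \<alpha>) y) * integral UNIV (\<lambda>x. f \<alpha> t x (vel_inv (m \<alpha>) y)))) \<longlongrightarrow>
   (\<Sum>\<alpha><N. e \<alpha> * (Djac (m \<alpha>) (vel_inv (m \<alpha>) y) * Finf \<alpha> (vel_inv (m \<alpha>) y)))) at_top"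
   by (intro tendsto_sum tendsto_mult tendsto_const tendsto_uniform_limitI[OF lim]) auto
  moreover have "tot (\<lambda>\<alpha>. species.dens (m \<alpha>) (f \<alpha>) t y) = (\<Sum>\<alpha><N. e \<alpha> * (Djac (m \<alpha>) (vel_inv (m \<alpha>) y) * integral UNIV (\<lambda>x. f \<alpha> t x (vel_inv (m \<alpha>) y))))" for t
   unfolding tot_def by (intro sum.cong) (use True in \<open>auto simp: species.dens_def[OF sp]\<close>)
  ultimately show ?thesis using True by (simp add: rho_inf_def mult.assoc)
 next
  case False
  have "tot (\<lambda>\<alpha>. species.dens (m \<alpha>) (f \<alpha>) t y) = 0" for t
   unfolding tot_def by (intro sum.neutral) (use False in \<open>auto simp: species.dens_def[OF sp]\<close>)
  then show ?thesis using False by (simp add: rho_inf_def)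
 qed
 ultimately have "((\<lambda>t. tot (\<lambda>\<alpha>. defect \<alpha> t y) + tot (\<lambda>\<alpha>. species.dens (m \<alpha>) (f \<alpha>) t y)) \<longlongrightarrow> 0 + rho_inf N m e Finf y) at_top"
  by (rule tendsto_add)
 then show ?thesis by (simp add: defect_def tot_diff tot_mult rho_inf_zero TI_def one_def)
qed

lemma H_deriv: assumes "0 < t"
 shows "((\<lambda>t. t ^ 3 * TI one t (t *\<^sub>R y)) has_vector_derivative thd t y) (at t)"
proof -
 have "((\<lambda>t. \<Sum>\<alpha><N. e \<alpha> * (t ^ 3 * species.Iw (f \<alpha>) (\<lambda>_. 1) t (t *\<^sub>R y))) has_real_derivative (\<Sum>\<alpha><N. e \<alpha> * species.hd (f \<alpha>) t y)) (at t)"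
  by (intro DERIV_sum DERIV_cmult species.hd_deriv[OF sp assms]) auto
 moreover have "(\<Sum>\<alpha><N. e \<alpha> * (t ^ 3 * species.Iw (f \<alpha>) (\<lambda>_. 1) t (t *\<^sub>R y))) = t ^ 3 * TI one t (t *\<^sub>R y)" for t
  by (simp add: TI_def tot_def one_def sum_distrib_left algebra_simps)
 ultimately show ?thesis by (simp add: thd_def tot_def has_real_derivative_iff_has_vector_derivative)
qed

text \<open>The Lipschitz bound comes from applying the decay argument to the difference of two
  rays, whose time derivative is controlled by the Lipschitz estimate for \<open>thd\<close>; the
  limit is never differentiated. The threshold \<open>exp 16\<close> is exp (2 n) for n = 8.\<close>

lemma one_bounds:
 "\<exists>K\<ge>0. \<forall>t y y'. exp 16 \<le> t \<longrightarrow> \<bar>TI one t (t *\<^sub>R y)\<bar> \<le> K * lp 6 4 t \<and>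
  \<bar>TI one t (t *\<^sub>R y) - TI one t (t *\<^sub>R y')\<bar> \<le> K * (lp 8 4 t * norm (y - y'))"
proof -
 obtain K where "moment_decay K thd (\<lambda>t y. tot (\<lambda>\<alpha>. defect \<alpha> t y)) tV1 tdV1 tdV2 tfrc" by (rule tot_decay)
 then have K: "0 \<le> K" "\<And>t y y'. 3 \<le> t \<Longrightarrow> \<bar>thd t y\<bar> \<le> K * lp 6 2 t \<and> \<bar>thd t y - thd t y'\<bar> \<le> K * (lp 8 2 t * norm (y - y'))"
  by (auto simp: moment_decay_def)
 have e3: "3 \<le> exp (16::real)" using exp_ge_add_one_self[of 16] by simp
 have T: "3 \<le> t" "0 < t" if "exp 16 \<le> t" for t :: real using e3 that by linarith+
 have b1: "\<bar>TI one t (t *\<^sub>R y)\<bar> \<le> (2 * K) * lp 6 4 t" if t: "exp 16 \<le> t" for t y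
 proof -
  obtain c where c: "((\<lambda>t. t ^ 3 * TI one t (t *\<^sub>R y)) \<longlongrightarrow> c) at_top"
   "\<And>t. exp 16 \<le> t \<Longrightarrow> norm (t ^ 3 * TI one t (t *\<^sub>R y) - c) \<le> 2 * K * lp 6 1 t"
  proof (rule log_decay[where n = 6 and T = "exp 16" and K = K and k = 1])
   show "((\<lambda>t. t ^ 3 * TI one t (t *\<^sub>R y)) has_vector_derivative thd t y) (at t)" if "exp 16 \<le> t" for t
    by (rule H_deriv[OF T(2)[OF that]])
   show "norm (thd t y) \<le> K * lp 6 (Suc 1) t" if "exp 16 \<le> t" for t
    using K(2)[OF T(1)[OF that], of y] by (simp add: numeral_2_eq_2)
  qed (use K(1) in auto)
  have "c = 0" using tendsto_unique[OF _ c(1) H_tendsto] by simp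
  then have "t ^ 3 * \<bar>TI one t (t *\<^sub>R y)\<bar> \<le> 2 * K * lp 6 1 t" using c(2)[OF t] T(2)[OF t] by (simp add: abs_mult)
  then have "\<bar>TI one t (t *\<^sub>R y)\<bar> \<le> 2 * K * lp 6 1 t / t ^ 3" using T(2)[OF t] by (simp add: pos_le_divide_eq mult.commute)
  also have "\<dots> = 2 * K * lp 6 4 t" by (simp add: times_divide_eq_right[symmetric] lp_power(4)[OF T(2)[OF t]] del: times_divide_eq_right)
  finally show ?thesis .
 qed
 have b2: "\<bar>TI one t (t *\<^sub>R y) - TI one t (t *\<^sub>R y')\<bar> \<le> (2 * K) * (lp 8 4 t * norm (y - y'))" if t: "exp 16 \<le> t" for t y y'
 proof -
  obtain c where c: "((\<lambda>t. t ^ 3 * TI one t (t *\<^sub>R y) - t ^ 3 * TI one t (t *\<^sub>R y')) \<longlongrightarrow> c) at_top"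
   "\<And>t. exp 16 \<le> t \<Longrightarrow> norm (t ^ 3 * TI one t (t *\<^sub>R y) - t ^ 3 * TI one t (t *\<^sub>R y') - c) \<le> 2 * (K * norm (y - y')) * lp 8 1 t"
  proof (rule log_decay[where n = 8 and T = "exp 16" and K = "K * norm (y - y')" and k = 1])
   show "((\<lambda>t. t ^ 3 * TI one t (t *\<^sub>R y) - t ^ 3 * TI one t (t *\<^sub>R y')) has_vector_derivative thd t y - thd t y') (at t)" if "exp 16 \<le> t" for t
    by (intro has_vector_derivative_diff H_deriv[OF T(2)[OF that]])
   show "norm (thd t y - thd t y') \<le> (K * norm (y - y')) * lp 8 (Suc 1) t" if "exp 16 \<le> t" for t
    using K(2)[OF T(1)[OF that], of y y'] by (simp add: numeral_2_eq_2 ac_simps)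
  qed (use K(1) in auto)
  have "c = 0" using tendsto_unique[OF _ c(1) tendsto_diff[OF H_tendsto H_tendsto]] by simp
  then have "\<bar>t ^ 3 * (TI one t (t *\<^sub>R y) - TI one t (t *\<^sub>R y'))\<bar> \<le> 2 * (K * norm (y - y')) * lp 8 1 t"
   using c(2)[OF t] by (simp add: right_diff_distrib)
  then have "t ^ 3 * \<bar>TI one t (t *\<^sub>R y) - TI one t (t *\<^sub>R y')\<bar> \<le> 2 * (K * norm (y - y')) * lp 8 1 t" using T(2)[OF t] by (simp add: abs_mult)
  then have "\<bar>TI one t (t *\<^sub>R y) - TI one t (t *\<^sub>R y')\<bar> \<le> 2 * (K * norm (y - y')) * lp 8 1 t / t ^ 3" using T(2)[OF t] by (simp add: pos_le_divide_eq mult.commute)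
  also have "\<dots> = (2 * K) * (lp 8 4 t * norm (y - y'))" by (simp add: times_divide_eq_right[symmetric] lp_power(4)[OF T(2)[OF t]] del: times_divide_eq_right)
  finally show ?thesis .
 qed
 show ?thesis using b1 b2 K(1) by (intro exI[of _ "2 * K"] conjI allI impI) auto
qed

definition qT :: "(nat \<Rightarrow> vec3 \<Rightarrow> real) \<Rightarrow> real \<Rightarrow> vec3 \<Rightarrow> vec3 \<Rightarrow> real" where
 "qT \<eta> t y k = tot (\<lambda>\<alpha>. species.qI (f \<alpha>) (\<eta> \<alpha>) t y k)"

lemma TI_vv: "TI (vv i) t (t *\<^sub>R y) = y $ i * TI one t (t *\<^sub>R y) + tV1 i t y"
proof -
 have "tV1 i t y = tot (\<lambda>\<alpha>. species.Iw (f \<alpha>) (vv i \<alpha>) t (t *\<^sub>R y) - y $ i * species.Iw (f \<alpha>) (one \<alpha>) t (t *\<^sub>R y))"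
  unfolding tV1_def by (rule tot_cong) (simp add: species.V1_def[OF sp] vv_def one_def)
 then show ?thesis by (simp add: tot_diff tot_mult TI_def)
qed

lemma qT_vv: "qT (vv i) t y k = y $ i * qT one t y k + k $ i * TI one t (t *\<^sub>R y) + tdV1 i t y k"
proof -
 have "tdV1 i t y k = tot (\<lambda>\<alpha>. species.qI (f \<alpha>) (vv i \<alpha>) t y k - (y $ i * species.qI (f \<alpha>) (one \<alpha>) t y k + k $ i * species.Iw (f \<alpha>) (one \<alpha>) t (t *\<^sub>R y)))"
  unfolding tdV1_def by (rule tot_cong) (simp add: species.dV1_def[OF sp] vv_def one_def)
 then show ?thesis by (simp add: tot_diff tot_add tot_mult TI_def qT_def)
qed

lemma qT_vw: "qT (vw i j) t y k = y $ i * qT (vv j) t y k + k $ i * TI (vv j) t (t *\<^sub>R y) + (y $ j * qT (vv i) t y k + k $ j * TI (vv i) t (t *\<^sub>R y))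
  - (y $ i * (y $ j * qT one t y k + k $ j * TI one t (t *\<^sub>R y)) + k $ i * (y $ j * TI one t (t *\<^sub>R y))) + tdV2 i j t y k"
proof -
 have "tdV2 i j t y k = tot (\<lambda>\<alpha>. species.qI (f \<alpha>) (vw i j \<alpha>) t y k - (y $ i * species.qI (f \<alpha>) (vv j \<alpha>) t y k + k $ i * species.Iw (f \<alpha>) (vv j \<alpha>) t (t *\<^sub>R y))
  - (y $ j * species.qI (f \<alpha>) (vv i \<alpha>) t y k + k $ j * species.Iw (f \<alpha>) (vv i \<alpha>) t (t *\<^sub>R y))
  + (y $ i * (y $ j * species.qI (f \<alpha>) (one \<alpha>) t y k + k $ j * species.Iw (f \<alpha>) (one \<alpha>) t (t *\<^sub>R y)) + k $ i * (y $ j * species.Iw (f \<alpha>) (one \<alpha>) t (t *\<^sub>R y))))"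
  unfolding tdV2_def by (rule tot_cong) (simp add: species.dV2_def[OF sp] vv_def vw_def one_def)
 then show ?thesis by (simp add: tot_diff tot_add tot_mult TI_def qT_def)
qed

lemma qT_one_deriv: assumes "0 < t"
 shows "((\<lambda>y. TI one t (t *\<^sub>R y)) has_derivative qT one t y) (at y)"
 unfolding TI_def tot_def qT_def
 by (intro has_derivative_sum has_derivative_mult_right species.qI_deriv[OF sp _ assms] weights_cont) auto

lemma qT_one_bound:
 "\<exists>K\<ge>0. \<forall>t y k. exp 16 \<le> t \<longrightarrow> \<bar>TI one t (t *\<^sub>R y)\<bar> \<le> K * lp 6 4 t \<and> \<bar>qT one t y k\<bar> \<le> K * (lp 8 4 t * norm k)"
proof -
 obtain K where K: "0 \<le> K" "\<And>t y y'. exp 16 \<le> t \<Longrightarrow> \<bar>TI one t (t *\<^sub>R y)\<bar> \<le> K * lp 6 4 t"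
  "\<And>t y y'. exp 16 \<le> t \<Longrightarrow> \<bar>TI one t (t *\<^sub>R y) - TI one t (t *\<^sub>R y')\<bar> \<le> K * (lp 8 4 t * norm (y - y'))"
  using one_bounds by blast
 have "\<bar>qT one t y k\<bar> \<le> K * (lp 8 4 t * norm k)" if t: "exp 16 \<le> t" for t y k
 proof -
  have "0 < t" using t exp_gt_zero[of 16] by linarith
  from derivative_bound_of_lipschitz[OF qT_one_deriv[OF this, of y], of "K * lp 8 4 t" k]
  show ?thesis using K(3)[OF t] by (simp add: mult.assoc)
 qed
 then show ?thesis using K by blast
qed

text \<open>The components of \<open>y\<close> that multiply the charge are bounded because |y| <=
  2; for larger \<open>y\<close> the sources vanish at large times (\<open>TI_zero\<close>).\<close>

lemma moment_totals:
 "\<exists>K\<ge>0. \<forall>t y k i j. exp 16 \<le> t \<and> norm y \<le> 2 \<longrightarrow> \<bar>TI one t (t *\<^sub>R y)\<bar> \<le> K * lp 6 4 t \<and> \<bar>TI (vv i) t (t *\<^sub>R y)\<bar> \<le> K * lp 6 4 t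
  \<and> \<bar>qT one t y k\<bar> \<le> K * (lp 8 4 t * norm k) \<and> \<bar>qT (vv i) t y k\<bar> \<le> K * (lp 8 4 t * norm k) \<and> \<bar>qT (vw i j) t y k\<bar> \<le> K * (lp 8 4 t * norm k)"
proof -
 obtain K1 where "moment_decay K1 thd (\<lambda>t y. tot (\<lambda>\<alpha>. defect \<alpha> t y)) tV1 tdV1 tdV2 tfrc" by (rule tot_decay)
 then have K1: "0 \<le> K1" "\<And>t y i. 3 \<le> t \<Longrightarrow> \<bar>tV1 i t y\<bar> \<le> K1 * lp 6 4 t" "\<And>t y i k. 3 \<le> t \<Longrightarrow> \<bar>tdV1 i t y k\<bar> \<le> K1 * (lp 8 4 t * norm k)"
  "\<And>t y i j k. 3 \<le> t \<Longrightarrow> \<bar>tdV2 i j t y k\<bar> \<le> K1 * (lp 8 4 t * norm k)" by (auto simp: moment_decay_def)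
 obtain K4 where K4: "0 \<le> K4" "\<And>t y. exp 16 \<le> t \<Longrightarrow> \<bar>TI one t (t *\<^sub>R y)\<bar> \<le> K4 * lp 6 4 t" "\<And>t y k. exp 16 \<le> t \<Longrightarrow> \<bar>qT one t y k\<bar> \<le> K4 * (lp 8 4 t * norm k)"
  using qT_one_bound by blast
 define S where "S = K1 + K4"
 have S: "K1 \<le> S" "K4 \<le> S" "0 \<le> S" using K1(1) K4(1) by (auto simp: S_def)
 show ?thesis
 proof (intro exI[of _ "40 * S"] conjI allI impI)
   fix t :: real and y k :: vec3 and i j :: 3
   assume "exp 16 \<le> t \<and> norm y \<le> 2"
   then have t: "exp 16 \<le> t" and y: "norm y \<le> 2" by auto
   have t3: "3 \<le> t" using t exp_ge_add_one_self[of "16::real"] by linarith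
   define a where "a = S * lp 6 4 t"
   define b where "b = S * (lp 8 4 t * norm k)"
   have l: "0 \<le> lp 6 4 t" "0 \<le> lp 8 4 t" "lp 6 4 t \<le> lp 8 4 t" using t3 lp_nonneg lp_mono by auto
   have a0: "0 \<le> a" and b0: "0 \<le> b" using S l by (auto simp: a_def b_def)
   have yi: "\<bar>y $ i\<bar> \<le> 2" for i using component_le_norm_cart[of y i] y by linarith
   have ka: "\<bar>k $ i\<bar> * c \<le> n * b" if "c \<le> n * a" "0 \<le> c" "0 \<le> n" for i c n
   proof -
    have "\<bar>k $ i\<bar> * c \<le> norm k * (n * a)" using that component_le_norm_cart[of k i] a0 by (intro mult_mono) auto
    also have "\<dots> = n * (S * (lp 6 4 t * norm k))" by (simp add: a_def ac_simps)
    also have "\<dots> \<le> n * b" unfolding b_def using that l S by (intro mult_left_mono mult_right_mono) auto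
    finally show ?thesis .
   qed
   have up: "x \<le> K * c \<Longrightarrow> K \<le> S \<Longrightarrow> 0 \<le> c \<Longrightarrow> x \<le> S * c" for x K c :: real by (meson mult_right_mono order_trans)
   have 0: "\<bar>TI one t (t *\<^sub>R y)\<bar> \<le> a" unfolding a_def by (rule up[OF K4(2)[OF t] S(2) l(1)])
   have v: "\<bar>tV1 i t y\<bar> \<le> a" for i unfolding a_def by (rule up[OF K1(2)[OF t3] S(1) l(1)])
   have q: "\<bar>qT one t y k\<bar> \<le> b" unfolding b_def by (rule up[OF K4(3)[OF t] S(2)]) (use l in simp)
   have d: "\<bar>tdV1 i t y k\<bar> \<le> b" for i unfolding b_def by (rule up[OF K1(3)[OF t3] S(1)]) (use l in simp)
   have dd: "\<bar>tdV2 i j t y k\<bar> \<le> b" for i j unfolding b_def by (rule up[OF K1(4)[OF t3] S(1)]) (use l in simp)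
   have m2: "\<bar>y $ i * c\<bar> \<le> 2 * C" if "\<bar>c\<bar> \<le> C" for i c C
    unfolding abs_mult using yi that by (intro mult_mono) auto
   have J: "\<bar>TI (vv i) t (t *\<^sub>R y)\<bar> \<le> 3 * a" for i
    unfolding TI_vv using m2[OF 0, of i] v[of i] by linarith
   have k1: "\<bar>k $ i * TI one t (t *\<^sub>R y)\<bar> \<le> b" for i unfolding abs_mult using ka[of _ 1 i] 0 by simp
   have k3: "\<bar>k $ i * TI (vv j) t (t *\<^sub>R y)\<bar> \<le> 3 * b" for i j unfolding abs_mult using ka[of _ 3 i] J[of j] by simp
   have qv: "\<bar>qT (vv i) t y k\<bar> \<le> 4 * b" for i
    unfolding qT_vv using m2[OF q, of i] k1[of i] d[of i] by linarith
   have "\<bar>y $ j * qT one t y k + k $ j * TI one t (t *\<^sub>R y)\<bar> \<le> 3 * b" using m2[OF q, of j] k1[of j] by linarith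
   note e1 = m2[OF this, of i]
   have e2: "\<bar>k $ i * (y $ j * TI one t (t *\<^sub>R y))\<bar> \<le> 2 * b" unfolding abs_mult using ka[of _ 2 i] m2[OF 0, of j] by (simp add: abs_mult)
   \<comment> \<open>The contributions add up to 31 b: 16 from the gradients of the first moments, 6
     from their values, 8 from the terms with the charge, 1 from the centred part.\<close>
   have qw: "\<bar>qT (vw i j) t y k\<bar> \<le> 40 * b"
    unfolding qT_vw using m2[OF qv, of i j] m2[OF qv, of j i] k3[of i j] k3[of j i] e1 e2 dd[of i j] b0 by linarith
   show "\<bar>TI one t (t *\<^sub>R y)\<bar> \<le> 40 * S * lp 6 4 t" "\<bar>TI (vv i) t (t *\<^sub>R y)\<bar> \<le> 40 * S * lp 6 4 t"
    using 0 J[of i] a0 unfolding a_def by (simp_all only: mult.assoc)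
   show "\<bar>qT one t y k\<bar> \<le> 40 * S * (lp 8 4 t * norm k)" "\<bar>qT (vv i) t y k\<bar> \<le> 40 * S * (lp 8 4 t * norm k)" "\<bar>qT (vw i j) t y k\<bar> \<le> 40 * S * (lp 8 4 t * norm k)"
    using q qv[of i] qw b0 unfolding b_def by (simp_all only: mult.assoc)
 qed (use S in simp)
qed

end

text \<open>For |x| <= \<gamma> t the retarded times seen from \<open>(t, x)\<close> stay above a
  multiple of \<open>t\<close>. Sources of size t^(-4) and time derivatives of size t^(-5) then give
  t^(-4) * t + t^(-5) * t^2. In the Lipschitz hypothesis the logarithm is taken at the later and the
  power at the earlier time, which needs no monotonicity of \<open>lp\<close>.\<close>

lemma (in maxwell) field_decay:
 assumes T: "0 < T" and \<gamma>: "0 \<le> \<gamma>" "\<gamma> < 1" and K: "0 \<le> K"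
  and b: "\<And>t x. T \<le> t \<Longrightarrow> norm (j t x) \<le> K * lp 6 4 t \<and> norm (k t x) \<le> K * lp 6 4 t \<and> \<bar>\<rho> t x\<bar> \<le> K * lp 6 4 t"
  and l: "\<And>t t' x. T \<le> t \<Longrightarrow> t \<le> t' \<Longrightarrow> norm (j t' x - j t x) \<le> K * (ln t' ^ 8 / t ^ 5) * (t' - t)
   \<and> norm (k t' x - k t x) \<le> K * (ln t' ^ 8 / t ^ 5) * (t' - t) \<and> \<bar>\<rho> t' x - \<rho> t x\<bar> \<le> K * (ln t' ^ 8 / t ^ 5) * (t' - t)"
 shows "\<exists>K' T'. \<forall>t\<ge>T'. \<forall>x. norm x \<le> \<gamma> * t \<longrightarrow> norm (U t x) \<le> K' * (ln t ^ 8 / t ^ 3)"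
proof -
 \<comment> \<open>Here t - |x| >= 4 c t. One c t pays for the additive constants, and half of the
   remaining 3 c t, the half coming from \<open>R\<close>, still exceeds c t.\<close>
 define c where "c = (1 - \<gamma>) / 4"
 have c: "0 < c" using \<gamma> by (simp add: c_def)
 define T' where "T' = Max {3, T / c, 3 / c, (L + 8) / c}"
 have T': "3 \<le> T'" "T / c \<le> T'" "3 / c \<le> T'" "(L + 8) / c \<le> T'" by (auto simp: T'_def)
 \<comment> \<open>64 = 2^6 and 256 = 2^8 come from ln (t + 2) <= 2 ln t, the powers of
   \<open>c\<close> from the earliest retarded time, and 640 from
   \<open>field_estimate\<close>.\<close>
 define K' where "K' = 640 * K * (64 / c ^ 4 + 256 / c ^ 5)"
 have "norm (U t x) \<le> K' * (ln t ^ 8 / t ^ 3)" if t: "T' \<le> t" and x: "norm x \<le> \<gamma> * t" for t x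
 proof -
  define R where "R = (t + 2 + norm x + L) / 2"
  have "T / c \<le> t" "3 / c \<le> t" "(L + 8) / c \<le> t" using t T' by linarith+
  then have t3: "3 \<le> t" and ct: "T \<le> c * t" "3 \<le> c * t" "L + 8 \<le> c * t"
   using t T'(1) c by (auto simp: pos_divide_le_eq mult.commute)
  have \<gamma>t: "\<gamma> * t = t - 4 * (c * t)" by (simp add: c_def field_simps)
  have far: "norm x + L + 8 \<le> t" using x ct unfolding \<gamma>t by linarith
  have low: "c * t \<le> t - R - 2" using x ct L unfolding \<gamma>t R_def by (simp add: field_simps)
  have nx: "0 \<le> norm x" by simp
  have R1: "R + 1 \<le> t" "0 \<le> R + 1"
   using far unfolding R_def by (simp add: field_simps) (use nx L t3 in \<open>intro add_nonneg_nonneg divide_nonneg_nonneg, auto\<close>)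
  have "3 * t \<le> t * t" using t3 by (intro mult_right_mono) auto
  then have "t + 2 \<le> t * t" using t3 by linarith
  then have "ln (t + 2) \<le> ln (t * t)" using t3 by (intro iffD2[OF ln_le_cancel_iff]) auto
  also have "\<dots> = 2 * ln t" using t3 by (simp add: ln_mult)
  finally have ln2: "ln (t + 2) \<le> 2 * ln t" .
  have lnt: "1 \<le> ln t" using exp_le t3 by (simp add: ln_ge_iff)
  have lns: "0 \<le> ln s" "ln s \<le> 2 * ln t" if "c * t \<le> s" "s \<le> t + 2" for s
  proof -
   have "3 \<le> s" using that ct by linarith
   then have "ln s \<le> ln (t + 2)" using that by simp
   then show "0 \<le> ln s" "ln s \<le> 2 * ln t" using ln2 \<open>3 \<le> s\<close> by auto
  qed
  have p1: "lp 6 4 s \<le> (2 * ln t) ^ 6 / (c * t) ^ 4" if "c * t \<le> s" "s \<le> t + 2" for s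
   unfolding lp_def using that lns[OF that] ct by (intro frac_le power_mono) auto
  have p2: "ln s' ^ 8 / s ^ 5 \<le> (2 * ln t) ^ 8 / (c * t) ^ 5" if "c * t \<le> s" "s \<le> s'" "s' \<le> t + 2" for s s'
   using that lns[of s'] ct by (intro frac_le power_mono) auto
  define B1 where "B1 = K * ((2 * ln t) ^ 6 / (c * t) ^ 4)"
  define B2 where "B2 = K * ((2 * ln t) ^ 8 / (c * t) ^ 5)"
  have "norm (U t x) \<le> 640 * (B1 * (R + 1) + B2 * (R + 1)^2)"
  proof (rule field_estimate[OF far R_def])
   fix s y assume s: "t - R - 2 \<le> s" "s \<le> t + 2"
   have "T \<le> s" "c * t \<le> s" using s low ct by linarith+
   moreover have "K * lp 6 4 s \<le> B1" unfolding B1_def using p1[of s] s low K by (intro mult_left_mono) auto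
   ultimately show "norm (j s y) \<le> B1 \<and> norm (k s y) \<le> B1 \<and> \<bar>\<rho> s y\<bar> \<le> B1" using b[of s y] by linarith
  next
   fix s s' y assume s: "t - R - 2 \<le> s" "s \<le> s'" "s' \<le> t + 2"
   have Ts: "T \<le> s" "c * t \<le> s" using s low ct by linarith+
   have "K * (ln s' ^ 8 / s ^ 5) \<le> B2" unfolding B2_def using p2[of s s'] s Ts K by (intro mult_left_mono) auto
   then have "K * (ln s' ^ 8 / s ^ 5) * (s' - s) \<le> B2 * (s' - s)" using s by (intro mult_right_mono) auto
   then show "norm (j s' y - j s y) \<le> B2 * (s' - s) \<and> norm (k s' y - k s y) \<le> B2 * (s' - s) \<and> \<bar>\<rho> s' y - \<rho> s y\<bar> \<le> B2 * (s' - s)"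
    using l[OF Ts(1) s(2), of y] by linarith
  qed
  also have "\<dots> \<le> 640 * (B1 * t + B2 * t^2)"
  proof -
   have "0 \<le> B1" "0 \<le> B2" using K lnt ct by (auto simp: B1_def B2_def intro!: mult_nonneg_nonneg divide_nonneg_nonneg)
   then show ?thesis using R1 by (intro mult_left_mono add_mono power_mono) auto
  qed
  also have "\<dots> = 640 * K * (64 / c ^ 4 * (ln t ^ 6 / t ^ 3) + 256 / c ^ 5 * (ln t ^ 8 / t ^ 3))"
   using t3 c by (simp add: B1_def B2_def power_mult_distrib field_simps eval_nat_numeral)
  also have "\<dots> \<le> 640 * K * (64 / c ^ 4 * (ln t ^ 8 / t ^ 3) + 256 / c ^ 5 * (ln t ^ 8 / t ^ 3))"
   using t3 c K lnt by (intro mult_left_mono add_mono divide_right_mono power_increasing) auto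
  also have "\<dots> = K' * (ln t ^ 8 / t ^ 3)" by (simp add: K'_def algebra_simps)
  finally show ?thesis .
 qed
 then show ?thesis by blast
qed

context plasma begin

lemma TI_deriv: assumes t: "0 < t" and c: "\<And>\<alpha>. \<alpha> < N \<Longrightarrow> continuous_on UNIV (\<eta> \<alpha>)"
 shows "(TI \<eta> t has_derivative (\<lambda>h. dTI \<eta> t x (0, h))) (at x)"
  "((\<lambda>t. TI \<eta> t x) has_real_derivative dTI \<eta> t x (1, 0)) (at t)"
proof -
 show "(TI \<eta> t has_derivative (\<lambda>h. dTI \<eta> t x (0, h))) (at x)"
  unfolding TI_def[abs_def] dTI_def tot_def
  by (intro has_derivative_sum has_derivative_mult_right species.Iw_deriv_x[OF sp _ t] c) auto
 show "((\<lambda>t. TI \<eta> t x) has_real_derivative dTI \<eta> t x (1, 0)) (at t)"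
  unfolding TI_def[abs_def] dTI_def tot_def
  by (intro DERIV_sum DERIV_cmult species.Iw_deriv_t[OF sp _ t] c) auto
qed

lemma TI_zero: assumes t: "0 < t" "L \<le> t" and x: "2 * t < norm x"
 shows "TI \<eta> t x = 0" "(\<And>\<alpha>. \<alpha> < N \<Longrightarrow> continuous_on UNIV (\<eta> \<alpha>)) \<Longrightarrow> dTI \<eta> t x h = 0"
proof -
 have far: "L + species.\<gamma> (m \<alpha>) \<beta> * t < norm x" if "\<alpha> < N" for \<alpha>
 proof -
  have "species.\<gamma> (m \<alpha>) \<beta> * t \<le> 1 * t" using species.\<gamma>(2)[OF sp[OF that]] t by (intro mult_right_mono) auto
  then show ?thesis using t x by linarith
 qed
 show "TI \<eta> t x = 0"
  unfolding TI_def tot_def by (intro sum.neutral) (use far t in \<open>auto simp: species.Iw_zero[OF sp]\<close>)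
 assume "\<And>\<alpha>. \<alpha> < N \<Longrightarrow> continuous_on UNIV (\<eta> \<alpha>)"
 then show "dTI \<eta> t x h = 0"
  unfolding dTI_def tot_def by (intro sum.neutral) (use far t in \<open>auto simp: species.dIw_zero[OF sp]\<close>)
qed

text \<open>Conservation of charge, and the balance of the current. They convert time derivatives of
  the sources into spatial derivatives of moments one degree higher, plus the force term.\<close>

lemma dTI_time: assumes t: "0 < t"
 shows "dTI one t x (1, 0) = - (\<Sum>i\<in>UNIV. dTI (vv i) t x (0, axis i 1))"
  "dTI (vv j) t x (1, 0) = - (\<Sum>i\<in>UNIV. dTI (vw j i) t x (0, axis i 1)) + tfrc j t x"
proof -
 have "dTI one t x (1, 0) = tot (\<lambda>\<alpha>. - (\<Sum>i\<in>UNIV. species.dIw (f \<alpha>) (vv i \<alpha>) t x (0, axis i 1)))"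
  unfolding dTI_def
 proof (rule tot_cong)
  fix \<alpha> assume \<alpha>: "\<alpha> < N"
  interpret s: species "m \<alpha>" "e \<alpha>" L \<beta> K0 E B "f \<alpha>" "f0 \<alpha>" by (rule sp[OF \<alpha>])
  have "s.dIw (\<lambda>_. 1) t x (1, 0) = - (\<Sum>i\<in>UNIV. s.dIw (\<lambda>p. 1 * (vel (m \<alpha>) p $ i)) t x (0, axis i 1)) + integral UNIV (\<lambda>p. 0 * f \<alpha> t x p)"
   by (rule s.dIw_time[where \<eta>' = "\<lambda>_ _. 0"]) (use t C1_on_const in auto)
  then show "s.dIw (one \<alpha>) t x (1, 0) = - (\<Sum>i\<in>UNIV. s.dIw (vv i \<alpha>) t x (0, axis i 1))"
   by (simp add: one_def vv_def s.vc_def[abs_def])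
 qed
 then show "dTI one t x (1, 0) = - (\<Sum>i\<in>UNIV. dTI (vv i) t x (0, axis i 1))" by (simp add: tot_minus tot_sum dTI_def)
 have "dTI (vv j) t x (1, 0) = tot (\<lambda>\<alpha>. - (\<Sum>i\<in>UNIV. species.dIw (f \<alpha>) (vw j i \<alpha>) t x (0, axis i 1)) + species.frc (m \<alpha>) (e \<alpha>) E B (f \<alpha>) j t x)"
  unfolding dTI_def by (rule tot_cong) (use species.dIw_time_vc[OF sp _] t in \<open>simp add: vv_def vw_def\<close>)
 then show "dTI (vv j) t x (1, 0) = - (\<Sum>i\<in>UNIV. dTI (vw j i) t x (0, axis i 1)) + tfrc j t x"
  by (simp add: tot_minus tot_sum tot_add tot_diff dTI_def tfrc_def)
qed

text \<open>A gradient in x is a gradient in y = x / t divided by t, which turns t^(-4) into t^(-5).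
  Time derivatives follow from the balance equations: three divergence terms and the force give
  \<open>3 * K + K2\<close>. Beyond |x| = 2 t everything vanishes.\<close>

lemma source_bounds:
 "\<exists>K\<ge>0. \<forall>t x h i j. exp 16 \<le> t \<and> L \<le> t \<longrightarrow> \<bar>TI one t x\<bar> \<le> K * lp 6 4 t \<and> \<bar>TI (vv i) t x\<bar> \<le> K * lp 6 4 t
  \<and> \<bar>dTI one t x (0, h)\<bar> \<le> K * lp 8 5 t * norm h \<and> \<bar>dTI (vv i) t x (0, h)\<bar> \<le> K * lp 8 5 t * norm h
  \<and> \<bar>dTI one t x (1, 0)\<bar> \<le> K * lp 8 5 t \<and> \<bar>dTI (vv j) t x (1, 0)\<bar> \<le> K * lp 8 5 t"
proof -
 obtain K where K: "0 \<le> K" and Kb: "\<And>t y k i j. exp 16 \<le> t \<and> norm y \<le> 2 \<longrightarrow> \<bar>TI one t (t *\<^sub>R y)\<bar> \<le> K * lp 6 4 t \<and> \<bar>TI (vv i) t (t *\<^sub>R y)\<bar> \<le> K * lp 6 4 t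
  \<and> \<bar>qT one t y k\<bar> \<le> K * (lp 8 4 t * norm k) \<and> \<bar>qT (vv i) t y k\<bar> \<le> K * (lp 8 4 t * norm k) \<and> \<bar>qT (vw i j) t y k\<bar> \<le> K * (lp 8 4 t * norm k)"
  using moment_totals by metis
 obtain K2 where "moment_decay K2 thd (\<lambda>t y. tot (\<lambda>\<alpha>. defect \<alpha> t y)) tV1 tdV1 tdV2 tfrc" by (rule tot_decay)
 then have K2: "0 \<le> K2" "\<And>t x j. 3 \<le> t \<Longrightarrow> \<bar>tfrc j t x\<bar> \<le> K2 * lp 8 5 t" by (auto simp: moment_decay_def)
 have base: "\<bar>TI one t x\<bar> \<le> K * lp 6 4 t \<and> \<bar>TI (vv i) t x\<bar> \<le> K * lp 6 4 t
  \<and> \<bar>dTI one t x (0, h)\<bar> \<le> K * lp 8 5 t * norm h \<and> \<bar>dTI (vv i) t x (0, h)\<bar> \<le> K * lp 8 5 t * norm h \<and> \<bar>dTI (vw i j) t x (0, h)\<bar> \<le> K * lp 8 5 t * norm h"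
  if t: "exp 16 \<le> t" "L \<le> t" for t x h i j
 proof -
  have t3: "3 \<le> t" using t exp_ge_add_one_self[of "16::real"] by linarith
  then have t0: "0 < t" by simp
  show ?thesis
  proof (cases "norm x \<le> 2 * t")
   case True
   define y where "y = x /\<^sub>R t"
   define k where "k = h /\<^sub>R t"
   have y: "norm y \<le> 2" "t *\<^sub>R y = x" "t *\<^sub>R k = h" using True t0 by (auto simp: y_def k_def field_simps)
   have q: "qT \<eta> t y k = dTI \<eta> t x (0, h)" for \<eta>
    unfolding qT_def dTI_def by (rule tot_cong) (simp add: species.qI_def[OF sp] y(2,3))
   have "lp 8 4 t * norm k = lp 8 5 t * norm h" using t0 lp_power(3)[OF t0, of 8 4] by (simp add: k_def field_simps)
   then show ?thesis using Kb[of t y i k j] y(1,2) t by (simp add: q mult.assoc)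
  next
   case False
   then have "2 * t < norm x" by simp
   note z = TI_zero[OF t0 t(2) this]
   have "0 \<le> K * lp 6 4 t" "0 \<le> K * lp 8 5 t * norm h" using K lp_nonneg[of t] t3 by simp_all
   then show ?thesis by (simp add: z weights_cont)
  qed
 qed
 show ?thesis
 proof (intro exI[of _ "3 * K + K2"] conjI allI impI)
  fix t :: real and x h :: vec3 and i j :: 3
  assume "exp 16 \<le> t \<and> L \<le> t"
  then have t: "exp 16 \<le> t" "L \<le> t" by auto
  have t3: "3 \<le> t" using t exp_ge_add_one_self[of "16::real"] by linarith
  then have t0: "0 < t" by simp
  have l: "0 \<le> lp n k t" for n k using lp_nonneg[of t n k] t3 by simp
  have up: "x \<le> K * c \<Longrightarrow> 0 \<le> c \<Longrightarrow> x \<le> (3 * K + K2) * c" for x c :: real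
   using K K2(1) mult_right_mono[of K "3 * K + K2" c] by linarith
  note b = base[OF t, of x i h j]
  show "\<bar>TI one t x\<bar> \<le> (3 * K + K2) * lp 6 4 t" "\<bar>TI (vv i) t x\<bar> \<le> (3 * K + K2) * lp 6 4 t"
   using b l by (auto intro: up)
  show "\<bar>dTI one t x (0, h)\<bar> \<le> (3 * K + K2) * lp 8 5 t * norm h" "\<bar>dTI (vv i) t x (0, h)\<bar> \<le> (3 * K + K2) * lp 8 5 t * norm h"
   using b l unfolding mult.assoc by (auto intro: up)
  have s: "\<bar>\<Sum>i\<in>(UNIV::3 set). a i\<bar> \<le> 3 * (K * lp 8 5 t)" if "\<And>i. \<bar>a i\<bar> \<le> K * lp 8 5 t" for a
   using that[of 1] that[of 2] that[of 3] unfolding sum_3 by linarith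
  have "\<bar>\<Sum>i\<in>UNIV. dTI (vv i) t x (0, axis i 1)\<bar> \<le> 3 * (K * lp 8 5 t)"
   by (rule s) (use base[OF t, of x _ "axis _ 1"] in \<open>metis mult.right_neutral norm_axis_1\<close>)
  then have "\<bar>dTI one t x (1, 0)\<bar> \<le> 3 * (K * lp 8 5 t)" unfolding dTI_time(1)[OF t0] by simp
  moreover have "0 \<le> K2 * lp 8 5 t" using K2(1) l by simp
  ultimately show "\<bar>dTI one t x (1, 0)\<bar> \<le> (3 * K + K2) * lp 8 5 t" by (simp only: distrib_right mult.assoc)
  have "\<bar>\<Sum>i\<in>UNIV. dTI (vw j i) t x (0, axis i 1)\<bar> \<le> 3 * (K * lp 8 5 t)"
   by (rule s) (use base[OF t, of x _ "axis _ 1"] in \<open>metis mult.right_neutral norm_axis_1\<close>)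
  then show "\<bar>dTI (vv j) t x (1, 0)\<bar> \<le> (3 * K + K2) * lp 8 5 t"
   unfolding dTI_time(2)[OF t0] distrib_right using K2(2)[OF t3, of j x] by (simp only: mult.assoc)
 qed (use K K2 in simp)
qed

end

lemma (in species) integral_vel_nth:
 assumes "0 \<le> t"
 shows "integral UNIV (\<lambda>p. g t x p *\<^sub>R vel m p) $ i = Iw (vc i) t x"
proof -
 have "cs \<beta> (\<lambda>p. g t x p *\<^sub>R vel m p)"
  unfolding cs_def using g_supp[OF assms] assms
  by (auto intro!: continuous_on_scaleR continuous_g continuous_vel continuous_intros)
 from integral_linear[OF cs_integrable[OF this] bounded_linear_vec_nth[of i]]
 show ?thesis by (simp add: o_def Iw_def vc_def mult.commute)
qed

lemma vec3_basis_combination_norm: "norm (\<Sum>i\<in>(UNIV::3 set). c i *\<^sub>R (axis i 1 :: vec3)) \<le> 3 * A" if "\<And>i. \<bar>c i\<bar> \<le> A"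
proof -
 have "norm (\<Sum>i\<in>(UNIV::3 set). c i *\<^sub>R (axis i 1 :: vec3)) \<le> (\<Sum>i\<in>(UNIV::3 set). A)"
  by (rule sum_norm_le) (simp add: that)
 then show ?thesis by simp
qed

lemma lipschitz_of_log_decay:
 fixes F :: "real \<Rightarrow> 'a::real_normed_vector"
 assumes F: "\<And>s. 0 < s \<Longrightarrow> (F has_vector_derivative F' s) (at s)" and F': "\<And>s. T \<le> s \<Longrightarrow> norm (F' s) \<le> K * lp n k s"
  and t: "max 1 T \<le> t" "t \<le> t'" and K: "0 \<le> K"
 shows "norm (F t' - F t) \<le> K * (ln t' ^ n / t ^ k) * (t' - t)"
proof -
 have "norm (F t' - F t) \<le> K * (ln t' ^ n / t ^ k) * norm (t' - t)"
 proof (rule differentiable_bound[where f' = "\<lambda>s h. h *\<^sub>R F' s" and S = "{t..t'}"])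
  fix s assume s: "s \<in> {t..t'}"
  show "(F has_derivative (\<lambda>h. h *\<^sub>R F' s)) (at s within {t..t'})"
   using F[of s] s t has_derivative_at_withinI unfolding has_vector_derivative_def by auto
  have "lp n k s \<le> ln t' ^ n / t ^ k" unfolding lp_def using s t by (intro frac_le power_mono) auto
  then have "K * lp n k s \<le> K * (ln t' ^ n / t ^ k)" using K by (intro mult_left_mono) auto
  then have n: "norm (F' s) \<le> K * (ln t' ^ n / t ^ k)" using F'[of s] s t by simp
  show "onorm (\<lambda>h. h *\<^sub>R F' s) \<le> K * (ln t' ^ n / t ^ k)"
  proof (rule onorm_le)
   fix h :: real
   have "\<bar>h\<bar> * norm (F' s) \<le> \<bar>h\<bar> * (K * (ln t' ^ n / t ^ k))" using n by (intro mult_left_mono) auto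
   then show "norm (h *\<^sub>R F' s) \<le> K * (ln t' ^ n / t ^ k) * norm h" by (simp add: mult.commute)
  qed
 qed (use t in auto)
 then show ?thesis using t by simp
qed

context plasma begin

lemma rho_eq: "rho N e f t x = 4 * pi * TI one t x"
 unfolding rho_def TI_def tot_def
 by (intro arg_cong2[where f = "(*)"] sum.cong refl) (simp add: species.Iw_def[OF sp] one_def)

lemma cur_eq: assumes "0 \<le> t"
 shows "cur N m e f t x = (\<Sum>i\<in>UNIV. (4 * pi * TI (vv i) t x) *\<^sub>R axis i 1)"
proof -
 have "cur N m e f t x $ i = 4 * pi * TI (vv i) t x" for i
  unfolding cur_def TI_def tot_def vector_scaleR_component sum_component real_scaleR_def
  by (intro arg_cong2[where f = "(*)"] sum.cong refl) (use assms in \<open>simp add: species.integral_vel_nth[OF sp] vv_def\<close>)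
 then show ?thesis using vec3_basis_expansion[of "cur N m e f t x"] by simp
qed

definition dcur :: "real \<Rightarrow> vec3 \<Rightarrow> real \<times> vec3 \<Rightarrow> vec3" where
 "dcur t x h = (\<Sum>i\<in>UNIV. (4 * pi * dTI (vv i) t x h) *\<^sub>R axis i 1)"

lemma source_deriv: assumes t: "0 < t"
 shows "(rho N e f t has_derivative (\<lambda>h. 4 * pi * dTI one t x (0, h))) (at x)"
  "((\<lambda>s. rho N e f s x) has_real_derivative 4 * pi * dTI one t x (1, 0)) (at t)"
  "(cur N m e f t has_derivative (\<lambda>h. dcur t x (0, h))) (at x)"
  "((\<lambda>s. cur N m e f s x) has_vector_derivative dcur t x (1, 0)) (at t)"
proof -
 have "rho N e f t = (\<lambda>x. 4 * pi * TI one t x)" by (simp add: rho_eq fun_eq_iff)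
 then show "(rho N e f t has_derivative (\<lambda>h. 4 * pi * dTI one t x (0, h))) (at x)"
  by (simp only:) (intro has_derivative_mult_right TI_deriv(1)[OF t weights_cont(1)])
 show "((\<lambda>s. rho N e f s x) has_real_derivative 4 * pi * dTI one t x (1, 0)) (at t)"
  unfolding rho_eq by (rule DERIV_cmult[OF TI_deriv(2)[OF t weights_cont(1)]])
 have "cur N m e f t = (\<lambda>x. \<Sum>i\<in>UNIV. (4 * pi * TI (vv i) t x) *\<^sub>R axis i 1)" using t by (simp add: cur_eq fun_eq_iff)
 moreover have "((\<lambda>x. \<Sum>i\<in>UNIV. (4 * pi * TI (vv i) t x) *\<^sub>R axis i 1) has_derivative (\<lambda>h. dcur t x (0, h))) (at x)"
  unfolding dcur_def
  by (intro has_derivative_sum has_derivative_scaleR_left has_derivative_mult_right TI_deriv(1)[OF t weights_cont(2)])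
 ultimately show "(cur N m e f t has_derivative (\<lambda>h. dcur t x (0, h))) (at x)" by simp
 have "((\<lambda>s. \<Sum>i\<in>UNIV. (4 * pi * TI (vv i) s x) *\<^sub>R axis i 1) has_vector_derivative dcur t x (1, 0)) (at t)"
  unfolding dcur_def
 proof (rule has_vector_derivative_sum)
  fix i :: 3
  show "((\<lambda>s. (4 * pi * TI (vv i) s x) *\<^sub>R axis i 1) has_vector_derivative (4 * pi * dTI (vv i) t x (1, 0)) *\<^sub>R (axis i 1 :: vec3)) (at t)"
   using has_vector_derivative_scaleR[OF DERIV_cmult[OF TI_deriv(2)[OF t weights_cont(2)]] has_vector_derivative_const[of "axis i 1 :: vec3"]] by simp
 qed
 then show "((\<lambda>s. cur N m e f s x) has_vector_derivative dcur t x (1, 0)) (at t)"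
  by (rule has_vector_derivative_transform_within_open[where S = "{0<..}"]) (use t cur_eq in auto)
qed

lemma charge_bounds:
 "\<exists>K\<ge>0. \<exists>T>0. \<forall>t\<ge>T. \<forall>x h. \<bar>rho N e f t x\<bar> \<le> K * lp 6 4 t \<and> norm (cur N m e f t x) \<le> K * lp 6 4 t
  \<and> \<bar>4 * pi * dTI one t x (0, h)\<bar> \<le> K * lp 8 5 t * norm h \<and> norm (dcur t x (0, h)) \<le> K * lp 8 5 t * norm h
  \<and> \<bar>4 * pi * dTI one t x (1, 0)\<bar> \<le> K * lp 8 5 t \<and> norm (dcur t x (1, 0)) \<le> K * lp 8 5 t"
proof -
 obtain K where K: "0 \<le> K" and b: "\<And>t x h i j. exp 16 \<le> t \<and> L \<le> t \<longrightarrow> \<bar>TI one t x\<bar> \<le> K * lp 6 4 t \<and> \<bar>TI (vv i) t x\<bar> \<le> K * lp 6 4 t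
  \<and> \<bar>dTI one t x (0, h)\<bar> \<le> K * lp 8 5 t * norm h \<and> \<bar>dTI (vv i) t x (0, h)\<bar> \<le> K * lp 8 5 t * norm h
  \<and> \<bar>dTI one t x (1, 0)\<bar> \<le> K * lp 8 5 t \<and> \<bar>dTI (vv j) t x (1, 0)\<bar> \<le> K * lp 8 5 t"
  using source_bounds by metis
 define T where "T = max (exp 16) L"
 have T: "0 < T" unfolding T_def using L by simp
 have p: "\<bar>4 * pi * a\<bar> \<le> 12 * pi * A" "\<bar>4 * pi * a\<bar> \<le> 4 * pi * A" if "\<bar>a\<bar> \<le> A" for a A :: real
 proof -
  have "0 \<le> A" using that by linarith
  have "4 * pi * \<bar>a\<bar> \<le> 4 * pi * A" using that by (intro mult_left_mono) auto
  then show "\<bar>4 * pi * a\<bar> \<le> 4 * pi * A" by (simp add: abs_mult)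
  moreover have "4 * pi * A \<le> 12 * pi * A" using \<open>0 \<le> A\<close> by (intro mult_right_mono) auto
  ultimately show "\<bar>4 * pi * a\<bar> \<le> 12 * pi * A" by linarith
 qed
 have v: "norm (\<Sum>i\<in>UNIV. (4 * pi * c i) *\<^sub>R (axis i 1 :: vec3)) \<le> 12 * pi * A" if "\<And>i. \<bar>c i\<bar> \<le> A" for c A
  using vec3_basis_combination_norm[of "\<lambda>i. 4 * pi * c i" "4 * pi * A"] p(2)[OF that] by simp
 show ?thesis
 \<comment> \<open>4 pi is the normalisation of the sources, and 3 counts the components of the
   current.\<close>
 proof (rule exI[of _ "12 * pi * K"], (rule conjI[OF _ exI[of _ T]]; (intro conjI allI impI)?))
  fix t :: real and x h :: vec3
  assume "T \<le> t"
  then have t: "exp 16 \<le> t \<and> L \<le> t" "0 \<le> t" using T by (auto simp: T_def)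
  note b' = b[rule_format, OF t(1)]
  show "\<bar>rho N e f t x\<bar> \<le> 12 * pi * K * lp 6 4 t" unfolding rho_eq using p(1)[of "TI one t x" "K * lp 6 4 t"] b' by (simp add: mult.assoc)
  show "norm (cur N m e f t x) \<le> 12 * pi * K * lp 6 4 t" unfolding cur_eq[OF t(2)] using v[of "\<lambda>i. TI (vv i) t x" "K * lp 6 4 t"] b' by (simp add: mult.assoc)
  show "\<bar>4 * pi * dTI one t x (0, h)\<bar> \<le> 12 * pi * K * lp 8 5 t * norm h"
   using p(1)[of "dTI one t x (0, h)" "K * lp 8 5 t * norm h"] b' by (simp add: mult.assoc)
  show "norm (dcur t x (0, h)) \<le> 12 * pi * K * lp 8 5 t * norm h"
   unfolding dcur_def using v[of "\<lambda>i. dTI (vv i) t x (0, h)" "K * lp 8 5 t * norm h"] b' by (simp add: mult.assoc)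
  show "\<bar>4 * pi * dTI one t x (1, 0)\<bar> \<le> 12 * pi * K * lp 8 5 t"
   using p(1)[of "dTI one t x (1, 0)" "K * lp 8 5 t"] b' by (simp add: mult.assoc)
  show "norm (dcur t x (1, 0)) \<le> 12 * pi * K * lp 8 5 t"
   unfolding dcur_def using v[of "\<lambda>i. dTI (vv i) t x (1, 0)" "K * lp 8 5 t"] b' by (simp add: mult.assoc)
 qed (use K T in auto)
qed

lemma charge_current_decay:
 "\<exists>K. \<forall>\<^sub>F t in at_top. \<forall>x. \<bar>rho N e f t x\<bar> + norm (cur N m e f t x) \<le> K * (ln t ^ 6 / t ^ 4)"
proof -
 obtain K T where b: "\<And>t x. T \<le> t \<Longrightarrow> \<bar>rho N e f t x\<bar> \<le> K * lp 6 4 t \<and> norm (cur N m e f t x) \<le> K * lp 6 4 t"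
  using charge_bounds by blast
 have "\<bar>rho N e f t x\<bar> + norm (cur N m e f t x) \<le> (2 * K) * (ln t ^ 6 / t ^ 4)" if "T \<le> t" for t x
  using b[OF that, of x] unfolding lp_def by linarith
 then show ?thesis by (intro exI[of _ "2 * K"] eventually_mono[OF eventually_ge_at_top[of T]]) blast
qed

lemma charge_current_derivative_decay:
 "\<exists>K. \<forall>\<^sub>F t in at_top. \<forall>x. \<exists>D1 D2 d.
    (rho N e f t has_derivative D1) (at x) \<and> (cur N m e f t has_derivative D2) (at x) \<and>
    ((\<lambda>s. cur N m e f s x) has_vector_derivative d) (at t) \<and>
    onorm D1 + onorm D2 + norm d \<le> K * (ln t ^ 8 / t ^ 5)"
proof -
 obtain K T where K: "0 \<le> K" and b: "\<And>t x h. T \<le> t \<Longrightarrow> \<bar>4 * pi * dTI one t x (0, h)\<bar> \<le> K * lp 8 5 t * norm h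
  \<and> norm (dcur t x (0, h)) \<le> K * lp 8 5 t * norm h \<and> norm (dcur t x (1, 0)) \<le> K * lp 8 5 t"
  using charge_bounds by blast
 show ?thesis
 proof (rule exI[of _ "3 * K"], rule eventually_mono[OF eventually_ge_at_top[of "max 1 T"]], intro allI exI conjI)
  fix t x assume "max 1 T \<le> t"
  then have t: "T \<le> t" "0 < t" "1 \<le> t" by auto
  show "(rho N e f t has_derivative (\<lambda>h. 4 * pi * dTI one t x (0, h))) (at x)"
   "(cur N m e f t has_derivative (\<lambda>h. dcur t x (0, h))) (at x)"
   "((\<lambda>s. cur N m e f s x) has_vector_derivative dcur t x (1, 0)) (at t)" by (rule source_deriv[OF t(2)])+
  have k: "0 \<le> K * lp 8 5 t" using K lp_nonneg[OF t(3)] by simp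
  have "onorm (\<lambda>h. 4 * pi * dTI one t x (0, h)) \<le> K * lp 8 5 t" "onorm (\<lambda>h. dcur t x (0, h)) \<le> K * lp 8 5 t"
   by (rule onorm_bound[OF k]; use b[OF t(1)] in simp)+
  moreover have "norm (dcur t x (1, 0)) \<le> K * lp 8 5 t" using b[OF t(1)] by blast
  ultimately show "onorm (\<lambda>h. 4 * pi * dTI one t x (0, h)) + onorm (\<lambda>h. dcur t x (0, h)) + norm (dcur t x (1, 0)) \<le> (3 * K) * (ln t ^ 8 / t ^ 5)"
   unfolding lp_def by linarith
 qed
qed

end

section \<open>Electric and magnetic field\<close>

locale plasma_maxwell = plasma +
 assumes pdeE: "\<And>t x. 0 < t \<Longrightarrow> dt E t x - curl B t x = - cur N m e f t x"
  and divE: "\<And>t x. 0 < t \<Longrightarrow> div3 E t x = rho N e f t x"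
  and pdeB: "\<And>t x. 0 < t \<Longrightarrow> dt B t x + curl E t x = 0"
  and divB: "\<And>t x. 0 < t \<Longrightarrow> div3 B t x = 0"
  and N: "1 \<le> N"
begin

lemma fields:
 shows "C1_on {z. 0 < fst z} (unc E)" "C1_on {z. 0 < fst z} (unc B)"
  "0 < t \<Longrightarrow> t + L < norm x \<Longrightarrow> E t x = 0" "0 < t \<Longrightarrow> t + L < norm x \<Longrightarrow> B t x = 0"
proof -
 \<comment> \<open>Every species carries the same field hypotheses; species 0 exists because
   \<open>N\<close> is at least 1.\<close>
 interpret s: species "m 0" "e 0" L \<beta> K0 E B "f 0" "f0 0" by (rule sp) (use N in simp)
 show "C1_on {z. 0 < fst z} (unc E)" "C1_on {z. 0 < fst z} (unc B)"
  by (rule C1_on_subset[OF s.C1E], auto) (rule C1_on_subset[OF s.C1B], auto)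
 show "0 < t \<Longrightarrow> t + L < norm x \<Longrightarrow> E t x = 0" "0 < t \<Longrightarrow> t + L < norm x \<Longrightarrow> B t x = 0" using s.vanish[of t x] by auto
qed

lemma deriv_minus:
 assumes "C1_on {z. 0 < fst z} (unc W)" "0 < t"
 shows "dt (\<lambda>t x. - W t x :: vec3) t x = - dt W t x" "curl (\<lambda>t x. - W t x) t x = - curl W t x"
proof -
 have "(unc W) differentiable at (t, x)"
 proof -
  have op: "open {z::real \<times> vec3. 0 < fst z}" by (intro open_Collect_less continuous_intros)
  obtain D where D: "\<And>z. z \<in> {z. 0 < fst z} \<Longrightarrow> (unc W has_derivative blinfun_apply (D z)) (at z within {z. 0 < fst z})"
   using assms(1) unfolding C1_on_def by blast
  have "(unc W has_derivative blinfun_apply (D (t, x))) (at (t, x))"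
   using D[of "(t, x)"] assms(2) at_within_open[OF _ op, of "(t, x)"] by simp
  then show ?thesis unfolding differentiable_def by blast
 qed
 then have "(unc W has_derivative frechet_derivative (unc W) (at (t, x))) (at (t, x))"
  by (simp add: frechet_derivative_works)
 from has_derivative_minus[OF this]
 have "frechet_derivative (\<lambda>z. - W (fst z) (snd z)) (at (t, x)) = (\<lambda>h. - frechet_derivative (unc W) (at (t, x)) h)"
  by (rule frechet_derivative_at[symmetric])
 then show "dt (\<lambda>t x. - W t x) t x = - dt W t x" "curl (\<lambda>t x. - W t x) t x = - curl W t x"
  by (simp_all add: dt_def dx_def curl_def vec_eq_iff forall_3)
qed

lemma C1_on_minus: "C1_on S W \<Longrightarrow> C1_on S (\<lambda>z::real \<times> vec3. - W z :: vec3)"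
 using C1_on_diff[OF C1_on_const[of S 0], of W] by simp

sublocale elec: maxwell E B "cur N m e f" "\<lambda>_ _. 0" "rho N e f" L
proof
 fix t :: real and x :: vec3 assume t: "0 < t"
 show "dt E t x = curl B t x - cur N m e f t x" using pdeE[OF t, of x] by (simp add: algebra_simps)
 show "dt B t x = - curl E t x - 0" using pdeB[OF t, of x] by (simp add: eq_neg_iff_add_eq_0)
qed (use L fields divE in auto)

sublocale mag: maxwell B "\<lambda>t x. - E t x" "\<lambda>_ _. 0" "\<lambda>t x. - cur N m e f t x" "\<lambda>_ _. 0" L
proof
 fix t :: real and x :: vec3 assume t: "0 < t"
 show "dt B t x = curl (\<lambda>t x. - E t x) t x - 0" using pdeB[OF t, of x] by (simp add: deriv_minus[OF fields(1) t] eq_neg_iff_add_eq_0)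
 show "dt (\<lambda>t x. - E t x) t x = - curl B t x - - cur N m e f t x" using pdeE[OF t, of x] by (simp add: deriv_minus[OF fields(1) t] algebra_simps)
qed (use L fields divB C1_on_minus in auto)

lemma electromagnetic_decay:
 assumes \<gamma>: "0 \<le> \<gamma>" "\<gamma> < 1"
 shows "\<exists>K T. \<forall>t\<ge>T. \<forall>x. norm x \<le> \<gamma> * t \<longrightarrow> norm (E t x) + norm (B t x) \<le> K * (ln t ^ 8 / t ^ 3)"
proof -
 obtain K T0 where K: "0 \<le> K" "0 < T0" and c: "\<And>t x h. T0 \<le> t \<Longrightarrow> \<bar>rho N e f t x\<bar> \<le> K * lp 6 4 t \<and> norm (cur N m e f t x) \<le> K * lp 6 4 t
  \<and> \<bar>4 * pi * dTI one t x (1, 0)\<bar> \<le> K * lp 8 5 t \<and> norm (dcur t x (1, 0)) \<le> K * lp 8 5 t"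
  using charge_bounds by blast
 define T where "T = max 1 T0"
 have T: "0 < T" by (simp add: T_def)
 have b: "\<bar>rho N e f t x\<bar> \<le> K * lp 6 4 t" "norm (cur N m e f t x) \<le> K * lp 6 4 t" "0 \<le> K * lp 6 4 t" if "T \<le> t" for t x
  using c[of t x] that K lp_nonneg[of t 6 4] by (auto simp: T_def)
 have l: "norm (cur N m e f t' x - cur N m e f t x) \<le> K * (ln t' ^ 8 / t ^ 5) * (t' - t)"
  "\<bar>rho N e f t' x - rho N e f t x\<bar> \<le> K * (ln t' ^ 8 / t ^ 5) * (t' - t)" "0 \<le> K * (ln t' ^ 8 / t ^ 5) * (t' - t)" if t: "T \<le> t" "t \<le> t'" for t t' x
 proof -
  show "norm (cur N m e f t' x - cur N m e f t x) \<le> K * (ln t' ^ 8 / t ^ 5) * (t' - t)"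
   by (rule lipschitz_of_log_decay[of "\<lambda>t. cur N m e f t x" "\<lambda>t. dcur t x (1, 0)" T0]) (use source_deriv(4) c t K in \<open>auto simp: T_def\<close>)
  have "norm (rho N e f t' x - rho N e f t x) \<le> K * (ln t' ^ 8 / t ^ 5) * (t' - t)"
   by (rule lipschitz_of_log_decay[of "\<lambda>t. rho N e f t x" "\<lambda>t. 4 * pi * dTI one t x (1, 0)" T0])
    (use source_deriv(2) c t K in \<open>auto simp: T_def has_real_derivative_iff_has_vector_derivative\<close>)
  then show "\<bar>rho N e f t' x - rho N e f t x\<bar> \<le> K * (ln t' ^ 8 / t ^ 5) * (t' - t)" by simp
  then show "0 \<le> K * (ln t' ^ 8 / t ^ 5) * (t' - t)" by linarith
 qed
 have "\<exists>K' T'. \<forall>t\<ge>T'. \<forall>x. norm x \<le> \<gamma> * t \<longrightarrow> norm (E t x) \<le> K' * (ln t ^ 8 / t ^ 3)"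
  by (rule elec.field_decay[OF T \<gamma> K(1)]) (use b l in simp_all)
 then obtain A S where A: "\<And>t x. S \<le> t \<Longrightarrow> norm x \<le> \<gamma> * t \<Longrightarrow> norm (E t x) \<le> A * (ln t ^ 8 / t ^ 3)" by blast
 have "\<exists>K' T'. \<forall>t\<ge>T'. \<forall>x. norm x \<le> \<gamma> * t \<longrightarrow> norm (B t x) \<le> K' * (ln t ^ 8 / t ^ 3)"
  by (rule mag.field_decay[OF T \<gamma> K(1)]) (use b l in \<open>simp_all add: norm_minus_commute\<close>)
 then obtain A' S' where A': "\<And>t x. S' \<le> t \<Longrightarrow> norm x \<le> \<gamma> * t \<Longrightarrow> norm (B t x) \<le> A' * (ln t ^ 8 / t ^ 3)" by blast
 have "norm (E t x) + norm (B t x) \<le> (A + A') * (ln t ^ 8 / t ^ 3)" if "max S S' \<le> t" "norm x \<le> \<gamma> * t" for t x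
  unfolding distrib_right using A[of t x] A'[of t x] that by (intro add_mono) auto
 then show ?thesis by blast
qed

end

theorem theorem1p3:
  fixes N :: nat and m e :: "nat \<Rightarrow> real" and L :: real
  assumes "N \<ge> 1" and "\<forall>\<alpha><N. m \<alpha> > 0" and "L > 0"
  shows "\<exists>\<epsilon>0>0. \<forall>\<beta>>0. \<forall>(f0 :: nat \<Rightarrow> vec3 \<Rightarrow> vec3 \<Rightarrow> real) (E0 :: vec3 \<Rightarrow> vec3) (B0 :: vec3 \<Rightarrow> vec3)
      (f :: nat \<Rightarrow> real \<Rightarrow> vec3 \<Rightarrow> vec3 \<Rightarrow> real) (E :: real \<Rightarrow> vec3 \<Rightarrow> vec3) (B :: real \<Rightarrow> vec3 \<Rightarrow> vec3)
      (C :: real) (Finf :: nat \<Rightarrow> vec3 \<Rightarrow> real).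
    \<comment> \<open>initial data\<close>
    (\<forall>\<alpha><N. Ck 2 (\<lambda>z::vec3 \<times> vec3. f0 \<alpha> (fst z) (snd z))) \<and>
    (\<forall>\<alpha><N. \<forall>x p. f0 \<alpha> x p \<ge> 0) \<and>
    (\<forall>\<alpha><N. \<forall>x p. f0 \<alpha> x p \<noteq> 0 \<longrightarrow> norm x \<le> L \<and> norm p \<le> L) \<and>
    Ck 3 E0 \<and> Ck 3 B0 \<and>
    (\<forall>x. norm x > L \<longrightarrow> E0 x = 0 \<and> B0 x = 0) \<and>
    (\<forall>x. div0 E0 x = rho N e f 0 x) \<and> (\<forall>x. div0 B0 x = 0) \<and>
    integral UNIV (\<lambda>x. rho N e f 0 x) = 0 \<and>
    (\<Sum>\<alpha><N. Ck_norm 2 (\<lambda>z::vec3 \<times> vec3. f0 \<alpha> (fst z) (snd z))) + Ck_norm 3 E0 + Ck_norm 3 B0 \<le> \<epsilon>0 \<and>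
    \<comment> \<open>the global classical solution and its properties\<close>
    RVM_solution N m e f E B f0 E0 B0 \<and>
    (\<forall>t\<ge>0. Ck 2 (E t) \<and> Ck 2 (B t)) \<and>
    (\<forall>\<alpha><N. \<forall>t\<ge>0. \<forall>x p. norm p \<ge> \<beta> \<longrightarrow> f \<alpha> t x p = 0) \<and>
    (\<forall>t\<ge>0. \<forall>x. norm x > t + L \<longrightarrow> E t x = 0 \<and> B t x = 0) \<and>
    (\<forall>t\<ge>0. \<forall>x. norm x \<le> t + L \<longrightarrow>
        norm (E t x) + norm (B t x) \<le> C * \<epsilon>0 / ((t + 1) * (t - norm x + 2 * L)) \<and>
        Dk_abs 1 (E t) x + Dk_abs 1 (B t) x \<le> C * \<epsilon>0 * ln (t + 2) / ((t + 1) * (t - norm x + 2 * L) ^ 2) \<and>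
        Dk_abs 2 (E t) x + Dk_abs 2 (B t) x \<le> C * \<epsilon>0 * ln (t + 2) / ((t + 1) * (t - norm x + 2 * L) ^ 3)) \<and>
    \<comment> \<open>F_oo as uniform limit of the spatial averages, and rho_oo = 0\<close>
    (\<forall>\<alpha><N. uniform_limit UNIV (\<lambda>t p. integral UNIV (\<lambda>x. f \<alpha> t x p)) (Finf \<alpha>) at_top) \<and>
    (\<forall>q. rho_inf N m e Finf q = 0)
    \<longrightarrow>
    \<comment> \<open>(a) momentum characteristics converge at rate t^-2 ln^8 t\<close>
    (\<forall>\<alpha><N. \<forall>\<tau>\<ge>0. \<forall>z\<in>supp_f (f \<alpha>) \<tau>. \<forall>X P. is_char (m \<alpha>) (e \<alpha>) E B \<tau> (fst z) (snd z) X P \<longrightarrow>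
        (\<exists>Pinf. (P \<longlongrightarrow> Pinf) at_top \<and>
           (\<exists>K. \<forall>\<^sub>F t in at_top. norm (P t - Pinf) \<le> K * (ln t ^ 8 / t ^ 2)))) \<and>
    \<comment> \<open>(b) decay of charge, current and fields\<close>
    (\<exists>K. \<forall>\<^sub>F t in at_top. \<forall>x. \<bar>rho N e f t x\<bar> + norm (cur N m e f t x) \<le> K * (ln t ^ 6 / t ^ 4)) \<and>
    (\<exists>K. \<forall>\<^sub>F t in at_top. \<forall>x. \<exists>D1 D2 d.
        (rho N e f t has_derivative D1) (at x) \<and> (cur N m e f t has_derivative D2) (at x) \<and>
        ((\<lambda>s. cur N m e f s x) has_vector_derivative d) (at t) \<and>
        onorm D1 + onorm D2 + norm d \<le> K * (ln t ^ 8 / t ^ 5)) \<and>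
    (\<exists>K. \<forall>\<^sub>F t in at_top. \<forall>x. norm x \<le> max (1/2) (2 * \<beta> / sqrt (1 + 4 * \<beta>^2)) * t \<longrightarrow>
        norm (E t x) + norm (B t x) \<le> K * (ln t ^ 8 / t ^ 3))"
proof (intro exI[of _ 1] conjI[OF zero_less_one] allI impI, elim conjE, goal_cases)
 case (1 \<beta> f0 E0 B0 f E B C Finf)
 \<comment> \<open>With the witness \<open>\<epsilon>0 = 1\<close> the product
   \<open>C * \<epsilon>0\<close> in the assumed field bounds is \<open>C\<close>, which takes the
   place of \<open>K0\<close>.\<close>
 have sp: "species (m \<alpha>) (e \<alpha>) L \<beta> C E B (f \<alpha>) (f0 \<alpha>)" if "\<alpha> < N" for \<alpha>
  using that assms(2,3) 1 unfolding RVM_solution_def by unfold_locales auto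
 interpret P: plasma_maxwell N m e L \<beta> C E B f f0 Finf
  by (intro plasma_maxwell.intro plasma.intro plasma_maxwell_axioms.intro sp;
   use assms(1,3) 1 in \<open>simp add: RVM_solution_def\<close>)
 have a: "\<exists>Pinf. (P \<longlongrightarrow> Pinf) at_top \<and> (\<exists>K. \<forall>\<^sub>F t in at_top. norm (P t - Pinf) \<le> K * (ln t ^ 8 / t ^ 2))"
  if \<alpha>: "\<alpha> < N" and \<tau>: "0 \<le> \<tau>" and z: "z \<in> supp_f (f \<alpha>) \<tau>" and c: "is_char (m \<alpha>) (e \<alpha>) E B \<tau> (fst z) (snd z) X P" for \<alpha> \<tau> z X P
 proof -
  interpret s: species "m \<alpha>" "e \<alpha>" L \<beta> C E B "f \<alpha>" "f0 \<alpha>" by (rule P.sp[OF \<alpha>])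
  \<comment> \<open>A cone between the region reached by this species and the light cone; it varies
    with the mass.\<close>
  have "0 \<le> (1 + s.\<gamma>) / 2" "(1 + s.\<gamma>) / 2 < 1" using s.\<gamma> by auto
  from P.electromagnetic_decay[OF this] obtain K T where b: "\<And>t x. T \<le> t \<Longrightarrow> norm x \<le> (1 + s.\<gamma>) / 2 * t \<Longrightarrow> norm (E t x) + norm (B t x) \<le> K * (ln t ^ 8 / t ^ 3)"
   by blast
  show ?thesis by (rule s.char_decay[OF c \<tau> _ b]) (use z in simp)
 qed
 have "2 * \<beta> < sqrt (1 + 4 * \<beta>^2)"
  by (rule real_less_rsqrt) (simp add: power_mult_distrib)
 then have "2 * \<beta> / sqrt (1 + 4 * \<beta>^2) < 1" using 1(1) by (subst divide_less_eq_1_pos) (auto intro: add_pos_nonneg)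
 then have "max (1/2) (2 * \<beta> / sqrt (1 + 4 * \<beta>^2)) < 1" "0 \<le> max (1/2) (2 * \<beta> / sqrt (1 + 4 * \<beta>^2))" by auto
 from P.electromagnetic_decay[OF this(2,1)] obtain K T where
  KT: "\<And>t x. T \<le> t \<Longrightarrow> norm x \<le> max (1/2) (2 * \<beta> / sqrt (1 + 4 * \<beta>^2)) * t \<Longrightarrow> norm (E t x) + norm (B t x) \<le> K * (ln t ^ 8 / t ^ 3)"
  by blast
 have d: "\<exists>K. \<forall>\<^sub>F t in at_top. \<forall>x. norm x \<le> max (1/2) (2 * \<beta> / sqrt (1 + 4 * \<beta>^2)) * t \<longrightarrow>
    norm (E t x) + norm (B t x) \<le> K * (ln t ^ 8 / t ^ 3)"
  by (rule exI[of _ K], rule eventually_mono[OF eventually_ge_at_top[of T]]) (use KT in blast)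
 show ?case
  by (intro conjI P.charge_current_decay P.charge_current_derivative_decay d allI ballI impI a)
qed

end
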